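(* Let $\nu$ be a partition and let $n\geq 1$. Then \[ \omega\,\Delta'_{s_\nu} e_n\big|_{t=0} \;=\; \sum_{k=\ell(\nu)+1}^{|\nu|+1} P_{\nu,k-1}(q)\sum_{\substack{\mu\vdash n\\ \ell(\mu)=k}} q^{\overline{b}(\mu)} {k \brack m(\mu)}_q\, Q'_\mu, \] where \[ P_{\nu,k-1}(q) = q^{|\nu|-\binom{k}{2}} \sum_{\substack{|\rho|=|\nu|\\ \ell(\rho)=k-1}} q^{b(\rho)} {k-1\brack m(\rho)}_q K_{\nu,\rho}(q), \] the sum being over partitions $\rho$ (inner sums over an empty set of partitions are $0$).
   Context: Symmetric functions are over $\mathbb{Q}(q,t)$ in variables $\mathbf{x}=(x_1,x_2,\dots)$; $s_\lambda, e_n, h_n$ are Schur, elementary and complete homogeneous functions, and $\omega$ is the involution with $\omega e_n=h_n$. $K_{\lambda,\mu}(q)$ is the Kostka–Foulkes polynomial and $Q'_\mu=Q'_\mu(\mathbf{x};q)=\sum_\lambda K_{\lambda,\mu}(q)s_\lambda$ is the dual Hall–Littlewood function. For a partition $\lambda=(\lambda_1,\dots,\lambda_\ell)$: $\ell(\lambda)$ is its number of parts, $m_i(\lambda)$ the multiplicity of $i$ as a part, $b(\lambda)=\sum_i(i-1)\lambda_i$, $\overline{b}(\lambda)=b(\lambda)-\binom{\ell(\lambda)}{2}=\sum_i(\lambda_i-1)(i-1)$, and ${\ell(\lambda)\brack m(\lambda)}_q=[\ell(\lambda)]_q!/\prod_i [m_i(\lambda)]_q!$, with $[n]_q=1+q+\dots+q^{n-1}$,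 $[n]_q!=[n]_q\cdots[1]_q$. Let $\widetilde H_\mu(\mathbf{x};q,t)$ denote the modified Macdonald polynomials, indexed so that $\widetilde H_\mu|_{t=0}=\mathrm{rev}_q(Q'_\mu)$ (this is the transpose of the indexing in Haglund's book); in this indexing, the cell of $\mu$ in row $i$ ($1\le i\le \ell(\mu)$) and column $j$ ($1\le j\le\mu_i$) has weight $q^{i-1}t^{j-1}$. For a symmetric function $f$, the primed delta operator $\Delta'_f$ is the linear operator on symmetric functions with $\Delta'_f\widetilde H_\mu = f(\dots,q^{i-1}t^{j-1},\dots)\,\widetilde H_\mu$, where $(i,j)$ ranges over all cells of $\mu$ other than $(1,1)$ and all other variables of $f$ are set to $0$. Here $\mathrm{rev}_q$ reverses the coefficient sequence of a polynomial in $q$: if $f$ has $q$-degree $d$, $\mathrm{rev}_q f = q^d f|_{q\to q^{-1}}$. *)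

theory Defs
  imports Main "HOL-Library.FuncSet" "HOL-Computational_Algebra.Polynomial"
    "HOL-Computational_Algebra.Fraction_Field"
begin

definition partition :: "nat list \<Rightarrow> bool" where
  "partition lam \<longleftrightarrow> sorted_wrt (\<ge>) lam \<and> 0 \<notin> set lam"

definition partitions :: "nat \<Rightarrow> nat list set" where
  "partitions n = {lam. partition lam \<and> sum_list lam = n}"

definition cells :: "nat list \<Rightarrow> (nat \<times> nat) set" where
  "cells lam = {(i, j). i < length lam \<and> j < lam ! i}"

definition conj :: "nat list \<Rightarrow> nat list" where
  "conj lam = map (\<lambda>i. length (filter (\<lambda>x. x > i) lam)) [0..<(if lam = [] then 0 else hd lam)]"

definition dom_le :: "nat list \<Rightarrow> nat list \<Rightarrow> bool" where
  "dom_le mu lam \<longleftrightarrow> sum_list mu = sum_list lam \<and>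
     (\<forall>k. sum_list (take k mu) \<le> sum_list (take k lam))"

definition bstat :: "nat list \<Rightarrow> nat" where
  "bstat lam = (\<Sum>i<length lam. i * lam ! i)"

definition bbar :: "nat list \<Rightarrow> nat" where
  "bbar lam = (\<Sum>i<length lam. i * (lam ! i - 1))"

definition ssyt :: "nat list \<Rightarrow> nat \<Rightarrow> (nat \<times> nat \<Rightarrow> nat) set" where
  "ssyt lam N = {T \<in> cells lam \<rightarrow>\<^sub>E {..<N}.
      (\<forall>i j. (i, j + 1) \<in> cells lam \<longrightarrow> T (i, j) \<le> T (i, j + 1)) \<and>
      (\<forall>i j. (i + 1, j) \<in> cells lam \<longrightarrow> T (i, j) < T (i + 1, j))}"

text \<open>Kostka number: coefficient of m_mu in s_lam.\<close>
definition kostka :: "nat list \<Rightarrow> nat list \<Rightarrow> nat" where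
  "kostka lam mu = card {T \<in> ssyt lam (length mu).
      \<forall>k < length mu. card {c \<in> cells lam. T c = k} = mu ! k}"

text \<open>Coefficient of m_mu in the power sum p_rho.\<close>
definition psum_mono :: "nat list \<Rightarrow> nat list \<Rightarrow> nat" where
  "psum_mono rho mu = card {f \<in> {..<length rho} \<rightarrow>\<^sub>E {..<length mu}.
      \<forall>j < length mu. (\<Sum>i \<in> {i. i < length rho \<and> f i = j}. rho ! i) = mu ! j}"

text \<open>Evaluation of the Schur function s_nu at the finite list of values zs
  (all other variables set to 0).\<close>
definition schur_eval :: "nat list \<Rightarrow> 'a::comm_ring_1 list \<Rightarrow> 'a" where
  "schur_eval nu zs = (\<Sum>T \<in> ssyt nu (length zs). \<Prod>c \<in> cells nu. zs ! (T c))"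

text \<open>A symmetric function (homogeneous of degree n) is represented by its
  coefficient function in the Schur basis, indexed by partitions of n and zero elsewhere.\<close>

definition supp_on :: "nat \<Rightarrow> (nat list \<Rightarrow> 'a::zero) \<Rightarrow> bool" where
  "supp_on n f \<longleftrightarrow> (\<forall>lam. f lam \<noteq> 0 \<longrightarrow> lam \<in> partitions n)"

definition psum_coeffs :: "nat \<Rightarrow> (nat list \<Rightarrow> 'a::field) \<Rightarrow> nat list \<Rightarrow> 'a" where
  "psum_coeffs n f = (THE c. supp_on n c \<and>
      (\<forall>mu \<in> partitions n. (\<Sum>lam \<in> partitions n. f lam * of_nat (kostka lam mu))
          = (\<Sum>rho \<in> partitions n. c rho * of_nat (psum_mono rho mu))))"

text \<open>Plethystic substitution f |-> f[X(1-u)], i.e. p_k |-> (1 - u^k) p_k.\<close>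
definition pleth :: "nat \<Rightarrow> 'a::field \<Rightarrow> (nat list \<Rightarrow> 'a) \<Rightarrow> nat list \<Rightarrow> 'a" where
  "pleth n u f = (THE g. supp_on n g \<and>
      (\<forall>mu \<in> partitions n. (\<Sum>lam \<in> partitions n. g lam * of_nat (kostka lam mu))
          = (\<Sum>rho \<in> partitions n. psum_coeffs n f rho * (\<Prod>x\<leftarrow>rho. 1 - u ^ x)
                 * of_nat (psum_mono rho mu))))"

definition omega :: "(nat list \<Rightarrow> 'a::zero) \<Rightarrow> nat list \<Rightarrow> 'a" where
  "omega f lam = (if partition lam then f (conj lam) else 0)"

definition e_sf :: "nat \<Rightarrow> nat list \<Rightarrow> 'a::{zero,one}" where
  "e_sf n lam = (if lam = replicate n 1 then 1 else 0)"

text \<open>Q(q,t) = fractions of Q[q][t]: the inner polynomial variable is q, the outer is t.\<close>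
type_synonym qt = "rat poly poly fract"
type_synonym qq = "rat poly fract"

definition qF :: qt where "qF = Fract [:[:0, 1:]:] 1"
definition tF :: qt where "tF = Fract [:0, 1:] 1"
definition qG :: qq where "qG = Fract [:0, 1:] 1"

text \<open>Specialization t = 0 of a rational function in q,t that is regular at t = 0.\<close>
definition spec0 :: "qt \<Rightarrow> qq" where
  "spec0 x = (THE v. \<exists>a b. x = Fract a b \<and> coeff b 0 \<noteq> 0 \<and>
                      v = Fract (coeff a 0) (coeff b 0))"

text \<open>Q'_mu is characterized by: Q'_mu in span{s_lam : lam \<ge> mu} with coefficient 1 at s_mu,
  and Q'_mu[X(1-q)] = Q_mu in span{s_lam : lam \<le> mu}.\<close>
definition Qp :: "nat list \<Rightarrow> nat list \<Rightarrow> qq" where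
  "Qp mu = (THE h. supp_on (sum_list mu) h \<and>
      (\<forall>lam. h lam \<noteq> 0 \<longrightarrow> dom_le mu lam) \<and> h mu = 1 \<and>
      (\<forall>lam. pleth (sum_list mu) qG h lam \<noteq> 0 \<longrightarrow> dom_le lam mu))"

definition KF :: "nat list \<Rightarrow> nat list \<Rightarrow> qq" where
  "KF lam mu = Qp mu lam"

text \<open>Indexing as in the paper (transpose of Haglund's book):
  Ht mu [X(1-q)] in span{s_lam : lam \<ge> mu'}, Ht mu [X(1-t)] in span{s_lam : lam \<ge> mu},
  and the coefficient of s_(n) is 1.\<close>
definition Ht :: "nat list \<Rightarrow> nat list \<Rightarrow> qt" where
  "Ht mu = (THE h. supp_on (sum_list mu) h \<and>
      (\<forall>lam. pleth (sum_list mu) qF h lam \<noteq> 0 \<longrightarrow> dom_le (conj mu) lam) \<and>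
      (\<forall>lam. pleth (sum_list mu) tF h lam \<noteq> 0 \<longrightarrow> dom_le mu lam) \<and>
      h [sum_list mu] = 1)"

text \<open>Weights q^(i-1) t^(j-1) of the cells of mu other than (1,1) (here 0-based).\<close>
definition wts :: "nat list \<Rightarrow> qt list" where
  "wts mu = concat (map (\<lambda>i. map (\<lambda>j. qF ^ i * tF ^ j) (if i = 0 then [1..<mu ! i] else [0..<mu ! i]))
                       [0..<length mu])"

definition delta' :: "nat list \<Rightarrow> nat \<Rightarrow> (nat list \<Rightarrow> qt) \<Rightarrow> nat list \<Rightarrow> qt" where
  "delta' nu n g = (let c = (THE c. supp_on n c \<and>
                        g = (\<lambda>lam. \<Sum>mu \<in> partitions n. c mu * Ht mu lam))
      in (\<lambda>lam. \<Sum>mu \<in> partitions n. c mu * schur_eval nu (wts mu) * Ht mu lam))"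

definition qint :: "nat \<Rightarrow> qq" where "qint n = (\<Sum>i<n. qG ^ i)"
definition qfact :: "nat \<Rightarrow> qq" where "qfact n = (\<Prod>i\<in>{1..n}. qint i)"
definition qmultinom :: "nat \<Rightarrow> nat list \<Rightarrow> qq" where
  "qmultinom k lam = qfact k / (\<Prod>i \<in> set lam. qfact (count_list lam i))"

definition Pnu :: "nat list \<Rightarrow> nat \<Rightarrow> qq" where
  "Pnu nu j = qG powi (int (sum_list nu) - int ((j + 1) choose 2)) *
     (\<Sum>rho \<in> {rho \<in> partitions (sum_list nu). length rho = j}.
        qG ^ bstat rho * qmultinom j rho * KF nu rho)"

end

theory Submission
  imports Defs "HOL-Library.Poly_Mapping" "HOL-Library.Multiset" "HOL-Combinatorics.Permutations"
    "HOL-Computational_Algebra.Formal_Power_Series"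
begin

section \<open>Ring homomorphisms, plethysm and Newton series on the power sum generators\<close>

section \<open>The ring of symmetric functions as polynomials in the power sums\<close>

text \<open>At t = 0 the modified Macdonald polynomials become, up to scalars, Hall-Littlewood
  functions \<open>HL qG mu\<close>, and the eigenvalue of the delta operator depends on mu only
  through l = \<open>length mu\<close>: the weights that survive are q, ..., q^(l-1), so it equals
  q^|nu| s_nu[(1-q^(l-1))/(1-q)]. Everything then follows from expanding h_n[X(1-u)/(1-q)]
  (\<open>AA\<close>) in Hall-Littlewood functions: the coefficient at mu is a constant times a
  polynomial in u that depends only on n and l.

  Write (v;x)_l for the product of 1 - x^i v over i < l. For parameter 1/q the Hall-Littlewood
  function is Q'_mu (\<open>Qp_HL\<close>), and \<open>AA_dual\<close> gives the coefficient
  \<open>aa mu\<close> (v;1/q)_l. Pairing with s_nu at v = q^(l-1) writes the eigenvalue as q^|nu|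
  times a sum over j of (q^(l-1);1/q)_j \<open>dual_sum |nu| j nu\<close>, and this
  \<open>dual_sum\<close> is P_{nu,j} up to an explicit factor (\<open>Pnu_dual_sum\<close>). For
  parameter q the choice u = 1/q expands e_n (\<open>e_expansion\<close>). Applying omega to the
  expansion for q reproduces, up to sign, the one for 1/q (\<open>Om_expansion\<close>). Grouped by
  length, this equates a combination of the (v;q)_l with a combination of the (v;1/q)_k, so the
  connection coefficients \<open>conn\<close> express the sums of Q'_mu of length k through the sums
  of omega \<open>HL qG mu\<close> of length l (\<open>dual_sum_omega_sum\<close>). The theorem then
  holds separately for each j = k - 1 (\<open>summand_identity\<close>), because the connection
  coefficient is itself a shifted factorial of the kind that occurs in the eigenvalue
  (\<open>conn_shf\<close>). The constants \<open>HLq.CC\<close> stay implicit and are never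
  evaluated.

  The expansions of \<open>AA\<close> come from Macdonald's operator at t = 0. It has the
  Hall-Littlewood functions as eigenvectors with eigenvalue q^l (\<open>EE_R\<close>) and acts on
  \<open>AA\<close> by a q-difference equation in u (\<open>EE_AA\<close>), whose polynomial
  solutions form a line (\<open>functional_equation_unique\<close>). The constants satisfy a
  recursion because e_k^perp removes a first column of length k (\<open>ek_JJ\<close>,
  \<open>CC_recursion\<close>).

  Macdonald polynomials exist because the operator is triangular on Schur functions with distinct
  eigenvalues (\<open>EE_sN\<close>, \<open>ip_EE_sch\<close>), and because its two conjugates give
  both triangularity conditions at once (\<open>macdonald_exists\<close>). They are unique because
  the form <F[X(1-t)], G[X(1-1/q)]> has no isotropic vectors (\<open>macdonald_unique\<close>). The
  same uniqueness at t = 0 guarantees a limit with leading coefficient 1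
  (\<open>macdonald_specialize\<close>).

  Symmetric functions are modelled as polynomials in power sums and Schur functions as Jacobi-Trudi
  determinants; the tableau counts in the definitions are recovered as Hall pairings with products
  of h_n.\<close>

definition rhom :: "('x::comm_ring_1 \<Rightarrow> 'y::comm_ring_1) \<Rightarrow> bool" where
  "rhom f \<longleftrightarrow> f 1 = 1 \<and> (\<forall>x y. f (x + y) = f x + f y) \<and> (\<forall>x y. f (x * y) = f x * f y)"

lemma rhom_1: "rhom f \<Longrightarrow> f 1 = 1"
  and rhom_add: "rhom f \<Longrightarrow> f (x + y) = f x + f y"
  and rhom_mult: "rhom f \<Longrightarrow> f (x * y) = f x * f y"
  by (auto simp: rhom_def)

lemma rhom_0: "rhom f \<Longrightarrow> f 0 = 0"
  using rhom_add[of f 0 0] by simp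

lemma rhom_uminus: "rhom f \<Longrightarrow> f (- x) = - f x"
  using rhom_add[of f x "- x"] rhom_0[of f] by (simp add: eq_neg_iff_add_eq_0 add.commute)

lemma rhom_diff: "rhom f \<Longrightarrow> f (x - y) = f x - f y"
  using rhom_add[of f x "- y"] rhom_uminus[of f y] by simp

lemma rhom_sum: "rhom f \<Longrightarrow> f (sum g A) = (\<Sum>a\<in>A. f (g a))"
  by (induction A rule: infinite_finite_induct) (auto simp: rhom_0 rhom_add)

lemma rhom_prod: "rhom f \<Longrightarrow> f (prod g A) = (\<Prod>a\<in>A. f (g a))"
  by (induction A rule: infinite_finite_induct) (auto simp: rhom_1 rhom_mult)

lemma rhom_of_nat: "rhom f \<Longrightarrow> f (of_nat n) = of_nat n"
  by (induction n) (auto simp: rhom_0 rhom_1 rhom_add)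

lemma rhom_of_int: "rhom f \<Longrightarrow> f (of_int n) = of_int n"
  by (cases n rule: int_diff_cases) (simp add: rhom_diff rhom_of_nat)

lemma rhom_comp: "rhom f \<Longrightarrow> rhom g \<Longrightarrow> rhom (\<lambda>x. f (g x))"
  by (auto simp: rhom_def)

text \<open>A monomial in the power sums is the multiset of its indices. The index 0 is formally
  allowed and gives a spurious variable p_0; \<open>homog\<close> excludes it.\<close>

type_synonym 'a sym = "nat multiset \<Rightarrow>\<^sub>0 'a"

abbreviation lookup :: "('k \<Rightarrow>\<^sub>0 'b::zero) \<Rightarrow> 'k \<Rightarrow> 'b" where "lookup \<equiv> Poly_Mapping.lookup"
abbreviation keys :: "('k \<Rightarrow>\<^sub>0 'b::zero) \<Rightarrow> 'k set" where "keys \<equiv> Poly_Mapping.keys"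

definition Co :: "'a::comm_ring_1 \<Rightarrow> 'a sym" where "Co c = Poly_Mapping.single {#} c"
definition pp :: "nat \<Rightarrow> 'a::comm_ring_1 sym" where "pp k = Poly_Mapping.single {#k#} 1"
definition mon :: "nat multiset \<Rightarrow> 'a::comm_ring_1 sym" where "mon m = Poly_Mapping.single m 1"

lemma rhom_Co: "rhom Co"
  unfolding rhom_def Co_def by (simp add: single_add mult_single)

lemmas Co_add = rhom_add[OF rhom_Co] and Co_mult = rhom_mult[OF rhom_Co]
  and Co_0 [simp] = rhom_0[OF rhom_Co] and Co_1 [simp] = rhom_1[OF rhom_Co]
  and Co_uminus = rhom_uminus[OF rhom_Co] and Co_diff = rhom_diff[OF rhom_Co]
  and Co_sum = rhom_sum[OF rhom_Co] and Co_prod = rhom_prod[OF rhom_Co]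
  and Co_of_nat = rhom_of_nat[OF rhom_Co] and Co_of_int = rhom_of_int[OF rhom_Co]

lemma mon_empty [simp]: "mon {#} = 1"
  by (simp add: mon_def)

lemma mon_add_mset: "mon (add_mset k m) = pp k * mon m"
  by (simp add: mon_def pp_def mult_single)

lemma single_eq_Co_mon: "Poly_Mapping.single m c = Co c * mon m"
  by (simp add: mon_def Co_def mult_single)

lemma sym_sum_single: "F = (\<Sum>m\<in>keys F. Poly_Mapping.single m (lookup F m))"
  by (rule poly_mapping_eqI)
     (simp add: lookup_sum lookup_single when_def in_keys_iff sum.delta')

lemma sym_induct_single [case_names single add]:
  assumes s: "\<And>m c. P (Poly_Mapping.single m c)" and a: "\<And>F G. P F \<Longrightarrow> P G \<Longrightarrow> P (F + G)"
  shows "P (F :: 'a::comm_ring_1 sym)"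
proof -
  have 0: "P 0" using s[of "{#}" 0] by simp
  have "P (\<Sum>m\<in>S. Poly_Mapping.single m (lookup F m))" for S
    by (induction S rule: infinite_finite_induct) (auto simp: 0 intro: s a)
  then show ?thesis by (subst sym_sum_single)
qed

lemma sym_induct [case_names const pp add]:
  assumes c: "\<And>c. P (Co c)" and p: "\<And>k F. P F \<Longrightarrow> P (pp k * F)"
    and a: "\<And>F G. P F \<Longrightarrow> P G \<Longrightarrow> P (F + G)"
  shows "P (F :: 'a::comm_ring_1 sym)"
proof (induction F rule: sym_induct_single)
  case (single m c)
  have "P (Co c * mon m)"
  proof (induction m)
    case empty then show ?case by (simp add: c)
  next
    case (add k m)
    then show ?case using p[of "Co c * mon m" k] by (simp add: mon_add_mset ac_simps)
  qed
  then show ?case by (simp add: single_eq_Co_mon)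
qed (rule a)

lemma rhom_ext:
  assumes "rhom f" "rhom g" "\<And>c. f (Co c) = g (Co c)" "\<And>k. f (pp k) = g (pp k)"
  shows "f F = g (F :: 'a::comm_ring_1 sym)"
  by (induction F rule: sym_induct) (use assms in \<open>auto simp: rhom_def\<close>)

lemma lookup_Co: "lookup (Co c) m = (if m = {#} then c else 0)"
  by (simp add: Co_def lookup_single when_def)

lemma lookup_single_mult: "lookup (Poly_Mapping.single m c * F) (m + m') = c * lookup F m'"
  for F :: "'a::comm_ring_1 sym"
  by (induction F rule: sym_induct_single)
     (auto simp: mult_single lookup_single when_def lookup_add distrib_left)

lemma lookup_single_mult':
  "lookup (Poly_Mapping.single m c * F) m' = (if m \<subseteq># m' then c * lookup F (m' - m) else 0)"
  for F :: "'a::comm_ring_1 sym"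
proof (cases "m \<subseteq># m'")
  case True
  then show ?thesis using lookup_single_mult[of m c F "m' - m"] by simp
next
  case False
  then show ?thesis
    by (induction F rule: sym_induct_single)
       (auto simp: mult_single lookup_single when_def lookup_add distrib_left)
qed

lemma lookup_Co_mult [simp]: "lookup (Co c * F) m = c * lookup F m"
  for F :: "'a::comm_ring_1 sym"
  by (simp add: Co_def lookup_single_mult')

lemma lookup_pp_mult: "lookup (pp k * F) m = (if k \<in># m then lookup F (m - {#k#}) else 0)"
  for F :: "'a::comm_ring_1 sym"
  by (simp add: pp_def lookup_single_mult')

text \<open>The universal property of a polynomial ring: the extension of the coefficient map
  \<open>i\<close> that sends p_k to \<open>\<phi> k\<close>.\<close>

definition evg :: "('a::comm_ring_1 \<Rightarrow> 'r::comm_ring_1) \<Rightarrow> (nat \<Rightarrow> 'r) \<Rightarrow> 'a sym \<Rightarrow> 'r" where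
  "evg i \<phi> F = (\<Sum>m\<in>keys F. i (lookup F m) * (\<Prod>k\<in>#m. \<phi> k))"

lemma evg_single:
  assumes "rhom i" shows "evg i \<phi> (Poly_Mapping.single m c) = i c * (\<Prod>k\<in>#m. \<phi> k)"
  by (simp add: evg_def rhom_0[OF assms])

lemma evg_add:
  assumes "rhom i" shows "evg i \<phi> (F + G) = evg i \<phi> F + evg i \<phi> G"
  unfolding evg_def
  by (rule setsum_keys_plus_distrib) (auto simp: rhom_0[OF assms] rhom_add[OF assms] distrib_right)

lemma rhom_evg:
  assumes i: "rhom i" shows "rhom (evg i \<phi>)"
proof -
  have 1: "evg i \<phi> (Poly_Mapping.single m c * G) = evg i \<phi> (Poly_Mapping.single m c) * evg i \<phi> G" for m c G
    by (induction G rule: sym_induct_single)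
       (auto simp: mult_single evg_single[OF i] rhom_mult[OF i] evg_add[OF i] distrib_left mult.assoc
          mult.left_commute)
  have "evg i \<phi> (F * G) = evg i \<phi> F * evg i \<phi> G" for F G
    by (induction F rule: sym_induct_single) (auto simp: 1 evg_add[OF i] distrib_right)
  moreover have "evg i \<phi> 1 = 1"
    using evg_single[OF i, of \<phi> "{#}" 1] by (simp add: rhom_1[OF i])
  ultimately show ?thesis by (auto simp: rhom_def evg_add[OF i])
qed

lemma evg_Co: "rhom i \<Longrightarrow> evg i \<phi> (Co c) = i c"
  by (simp add: Co_def evg_single)

lemma evg_pp: "rhom i \<Longrightarrow> evg i \<phi> (pp k) = \<phi> k"
  by (simp add: pp_def evg_single rhom_1)

text \<open>Covers every plethysm of the form p_k -> c_k p_k: X(1-u), X/(1-q), omega, -X and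
  rescaling by degree. Such maps are diagonal on monomials, hence commute with each other and are
  self-adjoint for the Hall product.\<close>

definition diag :: "(nat \<Rightarrow> 'a) \<Rightarrow> 'a::comm_ring_1 sym \<Rightarrow> 'a sym" where
  "diag c = evg Co (\<lambda>k. Co (c k) * pp k)"

lemma rhom_diag: "rhom (diag c)"
  unfolding diag_def by (rule rhom_evg[OF rhom_Co])

lemma diag_Co [simp]: "diag c (Co a) = Co a"
  and diag_pp [simp]: "diag c (pp k) = Co (c k) * pp k"
  by (simp_all add: diag_def evg_Co[OF rhom_Co] evg_pp[OF rhom_Co])

lemma diag_mult: "diag c (F * G) = diag c F * diag c G"
  and diag_add: "diag c (F + G) = diag c F + diag c G"
  and diag_1 [simp]: "diag c 1 = 1" and diag_0 [simp]: "diag c 0 = 0"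
  using rhom_diag[of c] rhom_0[OF rhom_diag, of c] by (auto simp: rhom_def)

lemma lookup_diag: "lookup (diag c F) m = (\<Prod>k\<in>#m. c k) * lookup F m"
  for F :: "'a::comm_ring_1 sym"
proof (induction F arbitrary: m rule: sym_induct)
  case (const a) then show ?case by (simp add: lookup_Co)
next
  case (pp k F)
  have "lookup (diag c (Submission.pp k * F)) m = c k * lookup (Submission.pp k * diag c F) m"
    by (simp add: diag_mult mult.assoc)
  also have "\<dots> = (if k \<in># m then (\<Prod>k\<in>#m. c k) * lookup F (m - {#k#}) else 0)"
    by (auto simp: lookup_pp_mult pp dest!: multi_member_split)
  finally show ?case by (simp add: lookup_pp_mult)
next
  case (add F G) then show ?case by (simp add: diag_add lookup_add distrib_left)
qed

lemma diag_diag: "diag c (diag d F) = diag (\<lambda>k. c k * d k) F"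
  for F :: "'a::comm_ring_1 sym"
  by (rule poly_mapping_eqI) (simp add: lookup_diag prod_mset.distrib ac_simps)

lemma diag_one_id: "diag (\<lambda>_. 1) F = F" for F :: "'a::comm_ring_1 sym"
  by (rule poly_mapping_eqI) (simp add: lookup_diag)

text \<open>Plethystic translation p_k -> p_k + a_k x^k, with x the polynomial variable. The
  spurious p_0 is left fixed.\<close>

definition transl :: "(nat \<Rightarrow> 'a) \<Rightarrow> 'a::comm_ring_1 sym \<Rightarrow> 'a sym poly" where
  "transl a = evg (\<lambda>c. [:Co c:]) (\<lambda>k. [:pp k:] + (if k = 0 then 0 else monom (Co (a k)) k))"

lemma rhom_pCons_Co: "rhom (\<lambda>c. [:Co c:])"
  unfolding rhom_def by (simp add: Co_add Co_mult one_pCons)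

lemma rhom_transl: "rhom (transl a)"
  unfolding transl_def by (rule rhom_evg[OF rhom_pCons_Co])

lemma trans_Co [simp]: "transl a (Co c) = [:Co c:]"
  and transl_pp: "transl a (pp k) = [:pp k:] + (if k = 0 then 0 else monom (Co (a k)) k)"
  by (simp_all add: transl_def evg_Co[OF rhom_pCons_Co] evg_pp[OF rhom_pCons_Co])

definition evl :: "(nat \<Rightarrow> 'a) \<Rightarrow> 'a::comm_ring_1 sym \<Rightarrow> 'a" where
  "evl z = evg (\<lambda>x. x) z"

lemma rhom_id: "rhom (\<lambda>x. x)" by (simp add: rhom_def)

lemma rhom_evl: "rhom (evl z)"
  unfolding evl_def by (rule rhom_evg[OF rhom_id])

lemma evl_Co [simp]: "evl z (Co c) = c" and evl_pp [simp]: "evl z (pp k) = z k"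
  by (simp_all add: evl_def evg_Co[OF rhom_id] evg_pp[OF rhom_id])

lemma coeff_transl_pp_mult:
  "coeff (transl a (pp k * F)) r =
     pp k * coeff (transl a F) r + (if 1 \<le> k \<and> k \<le> r then Co (a k) * coeff (transl a F) (r - k) else 0)"
proof -
  have "transl a (pp k * F) = smult (pp k) (transl a F) + (if k = 0 then 0 else monom (Co (a k)) k * transl a F)"
    by (simp add: rhom_mult[OF rhom_transl] transl_pp distrib_right)
  then show ?thesis by (auto simp: coeff_monom_mult)
qed

subsection \<open>Power series with prescribed logarithmic derivative\<close>

text \<open>\<open>newt a A\<close> encodes \<open>A = exp (\<Sum>\<^sub>k a\<^sub>k x^k / k)\<close>, so that plethystic exponentials
  are multiplied by adding the sequences \<open>a\<close>.\<close>

definition newt :: "(nat \<Rightarrow> 'r::comm_ring_1) \<Rightarrow> (nat \<Rightarrow> 'r) \<Rightarrow> bool" where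
  "newt a A \<longleftrightarrow> A 0 = 1 \<and> (\<forall>n. of_nat n * A n = (\<Sum>k=1..n. a k * A (n - k)))"

lemma newt_fps: "newt a A \<longleftrightarrow> A 0 = 1 \<and>
   fps_X * fps_deriv (Abs_fps A) = Abs_fps (\<lambda>k. if k = 0 then 0 else a k) * Abs_fps A"
proof -
  have "fps_nth (fps_X * fps_deriv (Abs_fps A)) n = of_nat n * A n" for n
    by (cases n) auto
  moreover have "fps_nth (Abs_fps (\<lambda>k. if k = 0 then 0 else a k) * Abs_fps A) n = (\<Sum>k=1..n. a k * A (n - k))" for n
  proof -
    have "fps_nth (Abs_fps (\<lambda>k. if k = 0 then 0 else a k) * Abs_fps A) n
        = (\<Sum>k\<in>{0..n}. (if k = 0 then 0 else a k) * A (n - k))"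
      by (simp add: fps_mult_nth)
    also have "\<dots> = (\<Sum>k=1..n. a k * A (n - k))"
      by (rule sum.mono_neutral_cong_right) auto
    finally show ?thesis .
  qed
  ultimately show ?thesis by (simp add: newt_def fps_eq_iff)
qed

lemma newt_mult:
  assumes "newt a A" "newt b B"
  shows "newt (\<lambda>k. a k + b k) (\<lambda>n. \<Sum>j\<le>n. A j * B (n - j))"
proof -
  let ?f = "\<lambda>a. Abs_fps (\<lambda>k. if k = (0::nat) then 0 else a k)"
  have e: "Abs_fps (\<lambda>n. \<Sum>j\<le>n. A j * B (n - j)) = Abs_fps A * Abs_fps B"
    by (simp add: fps_eq_iff fps_mult_nth atLeast0AtMost)
  have s: "?f (\<lambda>k. a k + b k) = ?f a + ?f b" by (simp add: fps_eq_iff)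
  have "fps_X * fps_deriv (Abs_fps A * Abs_fps B)
    = (fps_X * fps_deriv (Abs_fps A)) * Abs_fps B + Abs_fps A * (fps_X * fps_deriv (Abs_fps B))"
    by (simp add: algebra_simps)
  also have "\<dots> = (?f a + ?f b) * (Abs_fps A * Abs_fps B)"
    using assms by (simp add: newt_fps algebra_simps)
  finally show ?thesis using assms by (simp add: newt_fps e s)
qed

text \<open>The recursion determines A from a as soon as positive integers can be cancelled.
  Identities between generating functions are proved below by comparing logarithmic derivatives
  through this lemma.\<close>

lemma newt_unique:
  fixes A B :: "nat \<Rightarrow> 'r::comm_ring_1"
  assumes tf: "\<And>n (x::'r). n > 0 \<Longrightarrow> of_nat n * x = 0 \<Longrightarrow> x = 0"
    and "newt a A" "newt b B" and ab: "\<And>k. k \<ge> 1 \<Longrightarrow> a k = b k"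
  shows "A n = B n"
proof (induction n rule: less_induct)
  case (less n)
  show ?case
  proof (cases "n = 0")
    case True then show ?thesis using assms by (simp add: newt_def)
  next
    case False
    have "of_nat n * A n = (\<Sum>k=1..n. a k * A (n - k))" using assms(2) by (simp add: newt_def)
    also have "\<dots> = (\<Sum>k=1..n. b k * B (n - k))" by (intro sum.cong) (auto simp: less ab)
    also have "\<dots> = of_nat n * B n" using assms(3) by (simp add: newt_def)
    finally have "of_nat n * (A n - B n) = 0" by (simp add: algebra_simps)
    then show ?thesis using tf[of n "A n - B n"] False by simp
  qed
qed

lemma sym_tf: "n > 0 \<Longrightarrow> of_nat n * (x :: 'a::field_char_0 sym) = 0 \<Longrightarrow> x = 0"
proof -
  assume n: "n > 0" and "of_nat n * x = 0"
  then have "lookup (Co (of_nat n) * x) m = 0" for m by (simp add: Co_of_nat)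
  then show "x = 0" using n by (intro poly_mapping_eqI) simp
qed

lemma poly_sym_tf: "n > 0 \<Longrightarrow> of_nat n * (x :: 'a::field_char_0 sym poly) = 0 \<Longrightarrow> x = 0"
proof (rule poly_eqI)
  fix i assume n: "n > 0" and "of_nat n * x = 0"
  then have "coeff (smult (of_nat n) x) i = 0" by (simp add: of_nat_poly)
  then show "coeff x i = coeff 0 i" using sym_tf[OF n] by simp
qed

lemma newt_unique_sym:
  "newt a A \<Longrightarrow> newt b B \<Longrightarrow> (\<And>k. k \<ge> 1 \<Longrightarrow> a k = b k) \<Longrightarrow> A n = (B n :: 'a::field_char_0 sym)"
  by (rule newt_unique[of a A b B]) (auto intro: sym_tf)

lemma newt_unique_poly:
  "newt a A \<Longrightarrow> newt b B \<Longrightarrow> (\<And>k. k \<ge> 1 \<Longrightarrow> a k = b k) \<Longrightarrow> A n = (B n :: 'a::field_char_0 sym poly)"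
  by (rule newt_unique[of a A b B]) (auto intro: poly_sym_tf)

lemma newt_geometric: "newt (\<lambda>k. c ^ k) (\<lambda>n. c ^ n)"
proof -
  have "(\<Sum>k=1..n. c ^ k * c ^ (n - k)) = of_nat n * c ^ n" for n
  proof -
    have "(\<Sum>k=1..n. c ^ k * c ^ (n - k)) = (\<Sum>k=1..n. c ^ n)"
      by (intro sum.cong) (auto simp flip: power_add)
    then show ?thesis by simp
  qed
  then show ?thesis by (simp add: newt_def)
qed

text \<open>The series 1 - c x, reciprocal to the geometric series of
  \<open>newt_geometric\<close>.\<close>

lemma newt_linear: "newt (\<lambda>k. - (c ^ k)) (\<lambda>n. if n = 0 then 1 else if n = 1 then - c else 0)"
proof -
  let ?A = "\<lambda>n::nat. if n = 0 then 1 else if n = 1 then - c else 0"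
  have "of_nat n * ?A n = (\<Sum>k=1..n. - (c ^ k) * ?A (n - k))" for n
  proof (cases "n \<le> 1")
    case True then show ?thesis by (cases n) auto
  next
    case False
    then have m: "n = Suc (Suc (n - 2))" by simp
    define m where "m = n - 2"
    note m = m[folded m_def]
    have "(\<Sum>k=1..n. - (c ^ k) * ?A (n - k)) = (\<Sum>k\<in>{Suc m, Suc (Suc m)}. - (c ^ k) * ?A (n - k))"
      by (rule sum.mono_neutral_right) (auto simp: m)
    then show ?thesis by (simp add: m)
  qed
  then show ?thesis by (simp add: newt_def)
qed

lemma newt_hom: "rhom f \<Longrightarrow> newt a A \<Longrightarrow> newt (\<lambda>k. f (a k)) (\<lambda>n. f (A n))"
proof -
  assume f: "rhom f" and A: "newt a A"
  have "of_nat n * f (A n) = (\<Sum>k=1..n. f (a k) * f (A (n - k)))" for n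
  proof -
    have "of_nat n * f (A n) = f (of_nat n * A n)" by (simp only: rhom_mult[OF f] rhom_of_nat[OF f])
    also have "of_nat n * A n = (\<Sum>k=1..n. a k * A (n - k))" using A by (simp only: newt_def)
    finally show ?thesis by (simp only: rhom_sum[OF f] rhom_mult[OF f])
  qed
  with A show ?thesis by (simp add: newt_def rhom_1[OF f])
qed

lemma newt_scale:
  assumes "newt a A" shows "newt (\<lambda>k. c ^ k * a k) (\<lambda>n. c ^ n * A n)"
proof -
  have "of_nat n * (c ^ n * A n) = (\<Sum>k=1..n. c ^ k * a k * (c ^ (n - k) * A (n - k)))" for n
  proof -
    have "of_nat n * (c ^ n * A n) = c ^ n * (of_nat n * A n)" by (simp only: mult.left_commute)
    also have "of_nat n * A n = (\<Sum>k=1..n. a k * A (n - k))" using assms by (simp only: newt_def)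
    also have "c ^ n * \<dots> = (\<Sum>k=1..n. c ^ k * a k * (c ^ (n - k) * A (n - k)))"
      unfolding sum_distrib_left
    proof (intro sum.cong refl)
      fix k assume "k \<in> {1..n}"
      then have "c ^ n = c ^ k * c ^ (n - k)" by (simp flip: power_add)
      then show "c ^ n * (a k * A (n - k)) = c ^ k * a k * (c ^ (n - k) * A (n - k))" by (simp add: ac_simps)
    qed
    finally show ?thesis .
  qed
  then show ?thesis using assms by (simp add: newt_def)
qed

subsection \<open>Complete homogeneous functions\<close>

fun hh :: "nat \<Rightarrow> 'a::field_char_0 sym" where
  "hh n = (if n = 0 then 1 else Co (1 / of_nat n) * (\<Sum>k<n. pp (Suc k) * hh (n - Suc k)))"

declare hh.simps [simp del]

lemma hh_0 [simp]: "hh 0 = 1" by (simp add: hh.simps)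

lemma newt_hh: "newt pp (hh :: nat \<Rightarrow> 'a::field_char_0 sym)"
proof -
  have "of_nat n * hh n = (\<Sum>k=1..n. pp k * (hh (n - k) :: 'a sym))" for n
  proof (cases "n = 0")
    case False
    have "(of_nat n :: 'a sym) * hh n = Co (of_nat n) * Co (1 / of_nat n) * (\<Sum>k<n. pp (Suc k) * hh (n - Suc k))"
      using False by (subst hh.simps) (simp add: Co_of_nat ac_simps)
    also have "\<dots> = (\<Sum>k<n. pp (Suc k) * hh (n - Suc k))"
      using False by (simp flip: Co_mult)
    also have "\<dots> = (\<Sum>k=1..n. pp k * hh (n - k))"
      by (rule sum.reindex_bij_witness[of _ "\<lambda>k. k - 1" Suc]) auto
    finally show ?thesis .
  qed simp
  then show ?thesis by (simp add: newt_def)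
qed

text \<open>The classical z_lambda. It vanishes on multisets containing 0.\<close>

definition zz :: "nat multiset \<Rightarrow> 'a::field_char_0" where
  "zz m = (\<Prod>k\<in>set_mset m. of_nat k ^ count m k * fact (count m k))"

lemma zz_add_mset: "zz (add_mset k m) = of_nat (k * (count m k + 1)) * zz m"
proof -
  let ?f = "\<lambda>m k. of_nat k ^ count m k * fact (count m k) :: 'a"
  have "zz (add_mset k m) = (\<Prod>j\<in>insert k (set_mset m). ?f (add_mset k m) j)" by (simp add: zz_def)
  also have "\<dots> = ?f (add_mset k m) k * (\<Prod>j\<in>set_mset m - {k}. ?f (add_mset k m) j)"
    by (rule prod.insert_remove) simp
  also have "(\<Prod>j\<in>set_mset m - {k}. ?f (add_mset k m) j) = (\<Prod>j\<in>set_mset m - {k}. ?f m j)"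
    by (rule prod.cong) auto
  also have "?f (add_mset k m) k = of_nat (k * (count m k + 1)) * ?f m k"
    by (simp add: algebra_simps)
  also have "of_nat (k * (count m k + 1)) * ?f m k * (\<Prod>j\<in>set_mset m - {k}. ?f m j)
     = of_nat (k * (count m k + 1)) * (\<Prod>j\<in>insert k (set_mset m). ?f m j)"
    by (subst prod.insert_remove) (auto simp: ac_simps)
  also have "(\<Prod>j\<in>insert k (set_mset m). ?f m j) = zz m"
    unfolding zz_def by (cases "k \<in># m") (auto simp: insert_absorb not_in_iff)
  finally show ?thesis .
qed

lemma zz_nonzero: "0 \<notin># m \<Longrightarrow> zz m \<noteq> 0"
  by (auto simp: zz_def intro!: Nat.gr0I)

lemma of_nat_mult_Suc_nonzero:
  "k \<ge> 1 \<Longrightarrow> of_nat k + of_nat k * of_nat c \<noteq> (0 :: 'a::field_char_0)"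
proof -
  assume "k \<ge> 1"
  then have "of_nat (k * (c + 1)) \<noteq> (0 :: 'a)" unfolding of_nat_eq_0_iff by simp
  then show ?thesis by (simp add: algebra_simps)
qed

lemma sum_mult_count: "finite A \<Longrightarrow> set_mset m \<subseteq> A \<Longrightarrow> (\<Sum>k\<in>A. k * count m k) = sum_mset m"
proof (induction m)
  case (add x m)
  have "(\<Sum>k\<in>A. k * count (add_mset x m) k) = (\<Sum>k\<in>A. (if k = x then x else 0) + k * count m k)"
    by (rule sum.cong) auto
  also have "\<dots> = x + sum_mset m" using add by (simp add: sum.distrib)
  finally show ?case by simp
qed simp

text \<open>The expansion of h_n as the sum of p_lambda / z_lambda. In Newton's recursion, removing
  one k from m contributes k times its multiplicity over z_m, and these weights add up to n.\<close>

lemma lookup_hh: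
  "lookup (hh n :: 'a::field_char_0 sym) m = (if 0 \<notin># m \<and> sum_mset m = n then 1 / zz m else 0)"
proof (induction n arbitrary: m rule: less_induct)
  case (less n)
  show ?case
  proof (cases "n = 0")
    case True
    then show ?thesis by (auto simp: lookup_one when_def zz_def)
  next
    case False
    have "of_nat n * lookup (hh n :: 'a sym) m = lookup (of_nat n * hh n) m"
      by (metis Co_of_nat lookup_Co_mult)
    also have "\<dots> = lookup (\<Sum>k=1..n. pp k * hh (n - k) :: 'a sym) m"
      using newt_hh[where 'a='a] unfolding newt_def by metis
    also have "\<dots> = (\<Sum>k=1..n. if k \<in># m then lookup (hh (n - k) :: 'a sym) (m - {#k#}) else 0)"
      by (simp add: lookup_sum lookup_pp_mult)
    also have "\<dots> = (\<Sum>k=1..n. if 0 \<notin># m \<and> sum_mset m = n then of_nat (k * count m k) / zz m else 0)"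
    proof (intro sum.cong refl)
      fix k assume k: "k \<in> {1..n}"
      show "(if k \<in># m then lookup (hh (n - k) :: 'a sym) (m - {#k#}) else 0) =
         (if 0 \<notin># m \<and> sum_mset m = n then of_nat (k * count m k) / zz m else 0)"
      proof (cases "k \<in># m")
        case True
        then obtain m' where m: "m = add_mset k m'" by (blast dest: multi_member_split)
        have "of_nat (k * count m k) / zz m = (1 / zz m' :: 'a)"
          using k of_nat_mult_Suc_nonzero[of k "count m' k", where 'a='a]
          unfolding m zz_add_mset by (auto simp: distrib_left)
        then show ?thesis using k less[of "n - k" "m'"] by (auto simp: m)
      next
        case False
        then have "count m k = 0" by (simp add: not_in_iff)
        then show ?thesis using False by simp
      qed
    qed
    also have "\<dots> = (if 0 \<notin># m \<and> sum_mset m = n then of_nat n / zz m else 0)"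
    proof (cases "0 \<notin># m \<and> sum_mset m = n")
      case True
      have "(\<Sum>k=1..n. k * count m k) = n"
      proof (subst sum_mult_count)
        show "set_mset m \<subseteq> {1..n}"
          using True by (auto simp: Suc_le_eq dest!: multi_member_split intro!: Nat.gr0I)
      qed (use True in auto)
      then have "(\<Sum>k=1..n. of_nat (k * count m k)) = (of_nat n :: 'a)" by (metis of_nat_sum)
      then show ?thesis using True by (simp flip: sum_divide_distrib of_nat_mult)
    qed auto
    finally have e: "of_nat n * lookup (hh n :: 'a sym) m =
      (if 0 \<notin># m \<and> sum_mset m = n then of_nat n / zz m else 0)" .
    have "lookup (hh n :: 'a sym) m = of_nat n * lookup (hh n) m / of_nat n" using False by simp
    then show ?thesis using False unfolding e by (auto simp del: of_nat_sum_mset)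
  qed
qed

subsection \<open>Homogeneous elements\<close>

text \<open>Excluding the index 0 removes the spurious p_0; on such monomials z_m is nonzero, so the
  Hall product is nondegenerate there.\<close>

definition homog :: "nat \<Rightarrow> 'a::comm_ring_1 sym \<Rightarrow> bool" where
  "homog n F \<longleftrightarrow> (\<forall>m. lookup F m \<noteq> 0 \<longrightarrow> 0 \<notin># m \<and> sum_mset m = n)"

lemma homog_0 [simp]: "homog n 0" by (simp add: homog_def)

lemma homog_add: "homog n F \<Longrightarrow> homog n G \<Longrightarrow> homog n (F + G)"
  unfolding homog_def by (metis add.right_neutral lookup_add)

lemma homog_sum: "(\<And>i. i \<in> A \<Longrightarrow> homog n (f i)) \<Longrightarrow> homog n (sum f A)"
  by (induction A rule: infinite_finite_induct) (auto intro: homog_add)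

lemma homog_Co: "homog n F \<Longrightarrow> homog n (Co c * F)"
  unfolding homog_def lookup_Co_mult by (metis mult_zero_right)

lemma homog_of_int: "homog n F \<Longrightarrow> homog n (of_int c * F)"
  using homog_Co[of n F "of_int c"] by (simp add: Co_of_int)

lemma homog_diff: "homog n F \<Longrightarrow> homog n G \<Longrightarrow> homog n (F - G)"
  unfolding homog_def by (metis diff_zero lookup_minus diff_0_right)

lemma homog_1 [simp]: "homog 0 1"
  by (auto simp: homog_def lookup_one when_def split: if_splits)

lemma homog_mult:
  assumes "homog n F" "homog k (G :: 'a::comm_ring_1 sym)" shows "homog (n + k) (F * G)"
proof -
  have 1: "homog (n + k) (Poly_Mapping.single m c * G)" if "c \<noteq> 0 \<longrightarrow> 0 \<notin># m \<and> sum_mset m = n" for m c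
    unfolding homog_def lookup_single_mult'
  proof (intro allI impI)
    fix m' assume "(if m \<subseteq># m' then c * lookup G (m' - m) else 0) \<noteq> 0"
    then have m: "m \<subseteq># m'" and c: "c \<noteq> 0" "lookup G (m' - m) \<noteq> 0" by (auto split: if_splits)
    then obtain u where u: "m' = m + u" by (metis subset_mset.le_iff_add)
    with c that assms(2) have "0 \<notin># m" "sum_mset m = n" "0 \<notin># u" "sum_mset u = k" by (auto simp: homog_def)
    with u show "0 \<notin># m' \<and> sum_mset m' = n + k" by simp
  qed
  have "F * G = (\<Sum>m\<in>keys F. Poly_Mapping.single m (lookup F m) * G)"
    by (subst sym_sum_single[of F]) (simp add: sum_distrib_right)
  moreover have "homog (n + k) \<dots>"
    using assms(1) by (intro homog_sum 1) (auto simp: homog_def)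
  ultimately show ?thesis by simp
qed

lemma homog_prod: "(\<And>i. i \<in> A \<Longrightarrow> homog (d i) (f i)) \<Longrightarrow> homog (sum d A) (prod f A)"
  by (induction A rule: infinite_finite_induct) (auto intro: homog_mult)

lemma homog_diag: "homog n F \<Longrightarrow> homog n (diag c F)"
  unfolding homog_def lookup_diag by (metis mult_zero_right)

lemma homog_hh: "homog n (hh n)"
  by (auto simp: homog_def lookup_hh)

lemma homog_mon: "0 \<notin># m \<Longrightarrow> homog (sum_mset m) (mon m)"
  by (auto simp: homog_def mon_def lookup_single when_def)

subsection \<open>The Hall inner product\<close>

text \<open>The Hall inner product in its power sum form; bilinear, with the monomials orthogonal of
  norm z_m.\<close>

definition ip :: "'a::field_char_0 sym \<Rightarrow> 'a sym \<Rightarrow> 'a" where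
  "ip F G = (\<Sum>m\<in>keys F. zz m * lookup F m * lookup G m)"

lemma ip_superset: "finite S \<Longrightarrow> keys F \<subseteq> S \<Longrightarrow> ip F G = (\<Sum>m\<in>S. zz m * lookup F m * lookup G m)"
  unfolding ip_def by (rule sum.mono_neutral_left) (auto simp: in_keys_iff)

lemma ip_commute: "ip F G = ip G F"
  using ip_superset[of "keys F \<union> keys G" F G] ip_superset[of "keys F \<union> keys G" G F]
  by (simp add: ac_simps)

lemma ip_add_right: "ip F (G + H) = ip F G + ip F H"
  by (simp add: ip_def lookup_add distrib_left sum.distrib)

lemma ip_add_left: "ip (G + H) F = ip G F + ip H F"
  using ip_add_right ip_commute by metis

lemma ip_Co_right: "ip F (Co c * G) = c * ip F G"
  by (simp add: ip_def sum_distrib_left mult.assoc mult.left_commute)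

lemma ip_Co_left: "ip (Co c * F) G = c * ip F G"
  using ip_Co_right ip_commute by metis

lemma ip_0 [simp]: "ip F 0 = 0" "ip 0 F = 0"
  by (simp_all add: ip_def)

lemma ip_sum_right: "ip F (sum g A) = (\<Sum>a\<in>A. ip F (g a))"
  by (induction A rule: infinite_finite_induct) (auto simp: ip_add_right)

lemma ip_sum_left: "ip (sum g A) F = (\<Sum>a\<in>A. ip (g a) F)"
  by (induction A rule: infinite_finite_induct) (auto simp: ip_add_left)

lemma ip_of_int_left: "ip (of_int c * F) G = of_int c * ip F G"
  by (metis Co_of_int ip_Co_left)

lemma ip_of_int_right: "ip F (of_int c * G) = of_int c * ip F G"
  by (metis Co_of_int ip_Co_right)

lemma ip_diff_right: "ip F (G - H) = ip F G - ip F H"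
  using ip_add_right[of F "G - H" H] by simp

lemma ip_diff_left: "ip (G - H) F = ip G F - ip H F"
  using ip_diff_right ip_commute by metis

lemma ip_diag: "ip (diag c F) G = ip F (diag c G)"
  using ip_superset[of "keys F \<union> keys (diag c F)" "diag c F" G]
    ip_superset[of "keys F \<union> keys (diag c F)" F "diag c G"]
  by (simp add: lookup_diag ac_simps)

lemma ip_single: "ip (Poly_Mapping.single m c) G = zz m * c * lookup G m"
  by (simp add: ip_superset[of "{m}"])

text \<open>The reproducing property of the Cauchy kernel: since h_n has coefficients 1/z_m, the
  norms cancel and pairing becomes evaluation at p_k = z_k.\<close>

lemma ip_hh_diag:
  assumes "homog n F" shows "ip (diag z (hh n)) F = evl z F"
proof -
  have "ip (diag z (hh n)) F = (\<Sum>m\<in>keys F. zz m * lookup F m * lookup (diag z (hh n)) m)"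
    by (subst ip_commute) (simp add: ip_def)
  also have "\<dots> = (\<Sum>m\<in>keys F. lookup F m * (\<Prod>k\<in>#m. z k))"
    using assms by (intro sum.cong refl) (auto simp: lookup_diag lookup_hh homog_def zz_nonzero in_keys_iff)
  finally show ?thesis by (simp add: evl_def evg_def)
qed

text \<open>The derivation k d/dp_k, adjoint to multiplication by p_k.\<close>

definition der :: "nat \<Rightarrow> 'a::field_char_0 sym \<Rightarrow> 'a sym" where
  "der k F = (\<Sum>m\<in>keys F. Poly_Mapping.single (m - {#k#}) (of_nat (k * count m k) * lookup F m))"

lemma lookup_der: "lookup (der k F) m = of_nat (k * (count m k + 1)) * lookup F (add_mset k m)"
proof -
  have "lookup (der k F) m = (\<Sum>m'\<in>keys F. if m' = add_mset k m then of_nat (k * count m' k) * lookup F m' else 0)"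
    unfolding der_def lookup_sum
  proof (intro sum.cong refl)
    fix m'
    show "lookup (Poly_Mapping.single (m' - {#k#}) (of_nat (k * count m' k) * lookup F m')) m =
         (if m' = add_mset k m then of_nat (k * count m' k) * lookup F m' else 0)"
    proof (cases "k \<in># m'")
      case True
      then obtain u where "m' = add_mset k u" by (blast dest: multi_member_split)
      then show ?thesis by (auto simp: lookup_single when_def)
    next
      case False
      then have "m' \<noteq> add_mset k m" "count m' k = 0" by (auto simp: not_in_iff)
      then show ?thesis by simp
    qed
  qed
  also have "\<dots> = of_nat (k * (count m k + 1)) * lookup F (add_mset k m)"
    by (auto simp: sum.delta in_keys_iff)
  finally show ?thesis .
qed

lemma ip_pp: "ip (pp k * F) G = ip F (der k G)"
proof (induction F rule: sym_induct_single)
  case (single m c)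
  have "pp k * Poly_Mapping.single m c = Poly_Mapping.single (add_mset k m) c"
    by (simp add: pp_def mult_single)
  then show ?case by (simp add: ip_single lookup_der zz_add_mset ac_simps)
qed (simp add: distrib_left ip_add_left)

lemma der_add: "der k (F + G) = der k F + der k G"
  by (rule poly_mapping_eqI) (simp add: lookup_der lookup_add distrib_left)

lemma der_Co: "der k (Co c) = 0"
  by (rule poly_mapping_eqI) (simp add: lookup_der lookup_Co)

lemma der_pp_mult: "der k (pp j * F) = (if j = k then of_nat k * F else 0) + pp j * der k F"
proof (rule poly_mapping_eqI)
  fix m
  show "lookup (der k (pp j * F)) m = lookup ((if j = k then of_nat k * F else 0) + pp j * der k F) m"
  proof (cases "j = k")
    case True
    have 1: "lookup (der k (pp k * F)) m = of_nat (k * (count m k + 1)) * lookup F m"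
      by (simp add: lookup_der lookup_pp_mult)
    have 2: "lookup (pp k * der k F) m = of_nat (k * count m k) * lookup F m"
      by (auto simp: lookup_der lookup_pp_mult not_in_iff dest!: multi_member_split)
    have 3: "lookup (of_nat k * F) m = of_nat k * lookup F m"
      by (metis Co_of_nat lookup_Co_mult)
    show ?thesis unfolding True lookup_add if_True simp_thms 1 2 3 by (simp add: algebra_simps)
  next
    case False
    then show ?thesis
      by (auto simp: lookup_der lookup_pp_mult dest!: multi_member_split)
  qed
qed

lemma der_mult: "der k (F * G) = der k F * G + F * der k G"
proof (induction F rule: sym_induct)
  case (const c)
  have "der k (Co c * G) = Co c * der k G" by (rule poly_mapping_eqI) (simp add: lookup_der)
  then show ?case by (simp add: der_Co)
next
  case (pp j F)
  have "der k (Submission.pp j * F * G) = (if j = k then of_nat k * (F * G) else 0) + Submission.pp j * der k (F * G)"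
    by (simp add: der_pp_mult mult.assoc)
  then show ?case unfolding pp der_pp_mult[of k j F] by (auto simp: algebra_simps)
qed (simp add: distrib_right der_add)

lemma der_hh:
  assumes k: "k \<ge> 1"
  shows "der k (hh n :: 'a::field_char_0 sym) = (if k \<le> n then hh (n - k) else 0)"
proof (rule poly_mapping_eqI)
  fix m
  show "lookup (der k (hh n :: 'a sym)) m = lookup (if k \<le> n then hh (n - k) else 0) m"
    using k of_nat_mult_Suc_nonzero[OF k, of "count m k", where 'a='a]
    by (auto simp: lookup_der lookup_hh zz_add_mset zz_nonzero distrib_left)
qed

abbreviation tau :: "'a::field_char_0 sym \<Rightarrow> 'a sym poly" where "tau \<equiv> transl (\<lambda>_. 1)"

text \<open>Translation by one letter x is the exponential of the sum of x^k/k \<open>der k\<close>;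
  applying x d/dx gives this recursion for its coefficients.\<close>

lemma coeff_tau_der: "of_nat r * coeff (tau G) r = (\<Sum>k=1..r. coeff (tau (der k G)) (r - k))"
proof (induction G arbitrary: r rule: sym_induct)
  case (const c)
  have "of_nat r * coeff [:Co c:] r = 0" by (cases r) auto
  then show ?case by (simp add: der_Co rhom_0[OF rhom_transl])
next
  case (add F G)
  then show ?case by (simp add: rhom_add[OF rhom_transl] der_add distrib_left sum.distrib)
next
  case (pp j F)
  let ?c = "coeff (tau F)"
  have of: "coeff (tau (of_nat k * F)) i = of_nat k * ?c i" for k i
    by (simp add: rhom_mult[OF rhom_transl] rhom_of_nat[OF rhom_transl] of_nat_poly)
  have "coeff (tau (der k (Submission.pp j * F))) (r - k) =
      (if j = k then of_nat j * ?c (r - j) else 0) + Submission.pp j * coeff (tau (der k F)) (r - k)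
       + (if 1 \<le> j \<and> j \<le> r - k then coeff (tau (der k F)) (r - j - k) else 0)" if "k \<in> {1..r}" for k
    by (simp add: der_pp_mult rhom_add[OF rhom_transl] coeff_transl_pp_mult rhom_0[OF rhom_transl] of
      add.commute[of k j])
  then have "(\<Sum>k=1..r. coeff (tau (der k (Submission.pp j * F))) (r - k)) =
      (\<Sum>k=1..r. if j = k then of_nat j * ?c (r - j) else 0)
     + Submission.pp j * (\<Sum>k=1..r. coeff (tau (der k F)) (r - k))
     + (\<Sum>k=1..r. if 1 \<le> j \<and> j \<le> r - k then coeff (tau (der k F)) (r - j - k) else 0)"
    by (simp add: sum.distrib sum_distrib_left)
  also have "(\<Sum>k=1..r. if j = k then of_nat j * ?c (r - j) else 0) =
      (if 1 \<le> j \<and> j \<le> r then of_nat j * ?c (r - j) else 0)"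
    by (auto simp: sum.delta)
  also have "(\<Sum>k=1..r. coeff (tau (der k F)) (r - k)) = of_nat r * ?c r" using pp by simp
  also have "(\<Sum>k=1..r. if 1 \<le> j \<and> j \<le> r - k then coeff (tau (der k F)) (r - j - k) else 0)
     = (if 1 \<le> j \<and> j \<le> r then of_nat (r - j) * ?c (r - j) else 0)"
  proof (cases "1 \<le> j \<and> j \<le> r")
    case True
    have "(\<Sum>k=1..r. if 1 \<le> j \<and> j \<le> r - k then coeff (tau (der k F)) (r - j - k) else 0)
      = (\<Sum>k=1..r-j. coeff (tau (der k F)) (r - j - k))"
      using True by (intro sum.mono_neutral_cong_right) auto
    then show ?thesis using pp[of "r - j"] True by simp
  qed (auto intro!: sum.neutral)
  finally show ?case
    unfolding coeff_transl_pp_mult by (auto simp: algebra_simps of_nat_diff)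
qed

text \<open>Skewing by h_r reads off the coefficient of x^r in G[X + x]. Both sides obey the same
  recursion: Newton's for h_r on the left, \<open>coeff_tau_der\<close> on the right.\<close>

lemma ip_hh_mult: "ip (hh r * F) G = ip F (coeff (tau G) r)"
proof (induction r arbitrary: F G rule: less_induct)
  case (less r)
  have lin: "coeff (tau G) 0 = G" for G :: "'a sym"
  proof (induction G rule: sym_induct)
    case (pp k F) then show ?case
      by (auto simp: coeff_transl_pp_mult)
  qed (auto simp: rhom_add[OF rhom_transl])
  show ?case
  proof (cases "r = 0")
    case True then show ?thesis by (simp add: lin)
  next
    case False
    have "of_nat r * ip (hh r * F) G = ip (of_nat r * hh r * F) G"
      using ip_Co_left[of "of_nat r" "hh r * F" G] by (simp add: Co_of_nat mult.assoc)
    also have "of_nat r * hh r = (\<Sum>k=1..r. pp k * (hh (r - k) :: 'a sym))"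
      using newt_hh[where 'a='a] unfolding newt_def by metis
    also have "ip (\<dots> * F) G = (\<Sum>k=1..r. ip (hh (r - k) * F) (der k G))"
      by (simp add: sum_distrib_right ip_sum_left mult.assoc ip_pp)
    also have "\<dots> = (\<Sum>k=1..r. ip F (coeff (tau (der k G)) (r - k)))"
      using less by (intro sum.cong) auto
    also have "\<dots> = ip F (of_nat r * coeff (tau G) r)"
      by (simp add: coeff_tau_der ip_sum_right)
    also have "\<dots> = of_nat r * ip F (coeff (tau G) r)"
      by (metis Co_of_nat ip_Co_right)
    finally show ?thesis using False by simp
  qed
qed

section \<open>Leibniz determinants and the row operations needed for Jacobi-Trudi matrices\<close>

section \<open>Determinants indexed by natural numbers\<close>

text \<open>Matrices are plain functions, so a row is replaced by function update and the size N may
  vary freely.\<close>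

definition dt :: "nat \<Rightarrow> (nat \<Rightarrow> nat \<Rightarrow> 'r::comm_ring_1) \<Rightarrow> 'r" where
  "dt N f = (\<Sum>p | p permutes {..<N}. of_int (sign p) * (\<Prod>i<N. f i (p i)))"

lemma finite_perms: "finite {p. p permutes {..<N::nat}}"
  by (rule finite_permutations) simp

lemma dt_cong: "(\<And>i j. i < N \<Longrightarrow> j < N \<Longrightarrow> f i j = g i j) \<Longrightarrow> dt N f = dt N g"
  unfolding dt_def by (intro sum.cong refl arg_cong2[where f="(*)"] prod.cong)
    (auto dest: permutes_in_image)

lemma dt_hom: "rhom h \<Longrightarrow> h (dt N f) = dt N (\<lambda>i j. h (f i j))"
  by (simp add: dt_def rhom_sum rhom_mult rhom_of_int rhom_prod)

lemma dt_transpose: "dt N (\<lambda>i j. f j i) = dt N f"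
proof -
  have "dt N (\<lambda>i j. f j i) = (\<Sum>p | p permutes {..<N}. of_int (sign (inv p)) * (\<Prod>i<N. f (inv p i) i))"
    unfolding dt_def by (rule sum_permutations_inverse)
  also have "\<dots> = dt N f"
    unfolding dt_def
  proof (rule sum.cong[OF refl])
    fix p assume "p \<in> {p. p permutes {..<N}}"
    then have p: "p permutes {..<N}" by simp
    have "(\<Prod>i<N. f (inv p i) i) = prod ((\<lambda>i. f (inv p i) i) \<circ> p) {..<N}"
      by (rule prod.permute[OF p])
    also have "\<dots> = (\<Prod>i<N. f i (p i))"
      by (rule prod.cong) (simp_all add: permutes_inverses(2)[OF p])
    finally show "of_int (sign (inv p)) * (\<Prod>i<N. f (inv p i) i) = of_int (sign p) * (\<Prod>i<N. f i (p i))"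
      using permutation_permutes p by (subst sign_inverse) auto
  qed
  finally show ?thesis .
qed

lemma dt_identical_rows:
  assumes "a < N" "b < N" "a \<noteq> b" and eq: "\<And>j. j < N \<Longrightarrow> f a j = f b j"
  shows "dt N f = 0"
proof -
  let ?P = "{p. p permutes {..<N}}"
  let ?t = "transpose a b"
  let ?T = "\<lambda>p. of_int (sign p) * (\<Prod>i<N. f i (p i))"
  have tp: "?t permutes {..<N}" using assms by (intro permutes_swap_id) auto
  have sg: "sign (p \<circ> ?t) = - sign p" if "p permutes {..<N}" for p
    using that tp assms(3) by (subst sign_compose) (auto simp: permutation_permutes sign_swap_id intro!: exI[of _ "{..<N}"])
  have T: "?T (p \<circ> ?t) = - ?T p" if p: "p permutes {..<N}" for p
  proof -
    have "(\<Prod>i<N. f i (p (?t i))) = prod ((\<lambda>i. f i (p (?t i))) \<circ> ?t) {..<N}"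
      by (rule prod.permute[OF tp])
    also have "\<dots> = (\<Prod>i<N. f i (p i))"
      using permutes_in_image[OF p] assms by (intro prod.cong) (auto simp: transpose_def eq)
    finally show ?thesis using sg[OF p] by simp
  qed
  have fin: "finite ?P" by (rule finite_perms)
  have "bij_betw (\<lambda>p. p \<circ> ?t) {p\<in>?P. sign p = 1} {p\<in>?P. sign p \<noteq> 1}"
  proof (rule bij_betw_byWitness[where f'="\<lambda>p. p \<circ> ?t"])
    show "\<forall>p\<in>{p \<in> ?P. sign p = 1}. p \<circ> ?t \<circ> ?t = p" "\<forall>p\<in>{p \<in> ?P. sign p \<noteq> 1}. p \<circ> ?t \<circ> ?t = p"
      by (auto simp: fun_eq_iff)
    show "(\<lambda>p. p \<circ> ?t) ` {p \<in> ?P. sign p = 1} \<subseteq> {p \<in> ?P. sign p \<noteq> 1}"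
      using sg permutes_compose[OF tp] by auto
    show "(\<lambda>p. p \<circ> ?t) ` {p \<in> ?P. sign p \<noteq> 1} \<subseteq> {p \<in> ?P. sign p = 1}"
    proof clarsimp
      fix p assume p: "p permutes {..<N}" "sign p \<noteq> 1"
      then have "sign p = -1" by (metis sign_cases)
      then show "p \<circ> ?t permutes {..<N} \<and> sign (p \<circ> ?t) = 1" using sg[OF p(1)] permutes_compose[OF tp p(1)] by simp
    qed
  qed
  then have "(\<Sum>p\<in>{p\<in>?P. sign p \<noteq> 1}. ?T p) = (\<Sum>p\<in>{p\<in>?P. sign p = 1}. ?T (p \<circ> ?t))"
    by (rule sum.reindex_bij_betw[symmetric])
  also have "\<dots> = (\<Sum>p\<in>{p\<in>?P. sign p = 1}. - ?T p)"
    by (rule sum.cong[OF refl]) (use T in auto)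
  finally have 1: "(\<Sum>p\<in>{p\<in>?P. sign p \<noteq> 1}. ?T p) = - (\<Sum>p\<in>{p\<in>?P. sign p = 1}. ?T p)"
    by (simp add: sum_negf)
  have "dt N f = (\<Sum>p\<in>{p\<in>?P. sign p = 1} \<union> {p\<in>?P. sign p \<noteq> 1}. ?T p)"
    unfolding dt_def by (rule sum.cong) auto
  also have "\<dots> = (\<Sum>p\<in>{p\<in>?P. sign p = 1}. ?T p) + (\<Sum>p\<in>{p\<in>?P. sign p \<noteq> 1}. ?T p)"
    by (rule sum.union_disjoint) (use fin in auto)
  finally show ?thesis using 1 by simp
qed

lemma dt_zero_row: "a < N \<Longrightarrow> (\<And>j. j < N \<Longrightarrow> f a j = 0) \<Longrightarrow> dt N f = 0"
  unfolding dt_def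
proof (rule sum.neutral, clarify)
  fix p assume a: "a < N" "\<And>j. j < N \<Longrightarrow> f a j = 0" and p: "p permutes {..<N}"
  then have "f a (p a) = 0" using permutes_in_image[OF p, of a] by auto
  then have "(\<Prod>i<N. f i (p i)) = 0" using a by (intro prod_zero) auto
  then show "of_int (sign p) * (\<Prod>i<N. f i (p i)) = 0" by simp
qed

lemma dt_rows_expand:
  assumes "\<And>i j. i < N \<Longrightarrow> j < N \<Longrightarrow> f i j = (\<Sum>k\<in>S i. c i k * v i k j)" "\<And>i. i < N \<Longrightarrow> finite (S i)"
  shows "dt N f = (\<Sum>\<kappa>\<in>PiE {..<N} S. (\<Prod>i<N. c i (\<kappa> i)) * dt N (\<lambda>i j. v i (\<kappa> i) j))"
proof -
  have "dt N f = (\<Sum>p | p permutes {..<N}. of_int (sign p) * (\<Prod>i<N. \<Sum>k\<in>S i. c i k * v i k (p i)))"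
    unfolding dt_def
    by (intro sum.cong refl arg_cong2[where f="(*)"] prod.cong) (auto intro!: assms dest: permutes_in_image)
  also have "\<dots> = (\<Sum>p | p permutes {..<N}. of_int (sign p) *
       (\<Sum>\<kappa>\<in>PiE {..<N} S. \<Prod>i<N. c i (\<kappa> i) * v i (\<kappa> i) (p i)))"
    by (subst prod_sum_PiE) (auto simp: assms(2))
  also have "\<dots> = (\<Sum>p | p permutes {..<N}. \<Sum>\<kappa>\<in>PiE {..<N} S. (\<Prod>i<N. c i (\<kappa> i)) *
       (of_int (sign p) * (\<Prod>i<N. v i (\<kappa> i) (p i))))"
    by (simp add: sum_distrib_left prod.distrib mult.left_commute)
  also have "\<dots> = (\<Sum>\<kappa>\<in>PiE {..<N} S. (\<Prod>i<N. c i (\<kappa> i)) * dt N (\<lambda>i j. v i (\<kappa> i) j))"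
    by (subst sum.swap) (simp add: dt_def sum_distrib_left)
  finally show ?thesis .
qed

lemma dt_row_add:
  assumes "r < N"
  shows "dt N (f(r := \<lambda>j. a j + b j)) = dt N (f(r := a)) + dt N (f(r := b))"
proof -
  have *: "(\<Prod>i<N. (f(r := g)) i (p i)) = g (p r) * (\<Prod>i\<in>{..<N} - {r}. f i (p i))" for g p
    using assms by (subst prod.remove[of _ r]) auto
  show ?thesis
    unfolding dt_def * by (simp add: distrib_left distrib_right sum.distrib)
qed

lemma dt_row_mult:
  assumes "r < N" shows "dt N (f(r := \<lambda>j. c * a j)) = c * dt N (f(r := a))"
proof -
  have *: "(\<Prod>i<N. (f(r := g)) i (p i)) = g (p r) * (\<Prod>i\<in>{..<N} - {r}. f i (p i))" for g p
    using assms by (subst prod.remove[of _ r]) auto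
  show ?thesis
    unfolding dt_def * by (simp add: sum_distrib_left mult.assoc mult.left_commute)
qed

lemma dt_row_add_other:
  assumes "r < N" "s < N" "r \<noteq> s"
  shows "dt N (f(r := \<lambda>j. a j + c * f s j)) = dt N (f(r := a))"
proof -
  have "dt N (f(r := f s)) = 0"
    by (rule dt_identical_rows[of r N s]) (use assms in auto)
  then show ?thesis
    using dt_row_add[OF assms(1), of f a "\<lambda>j. c * f s j"] dt_row_mult[OF assms(1), of f c "f s"] by simp
qed

lemma dt_row_sum_others:
  assumes "r < N" "finite S" "S \<subseteq> {..<N} - {r}"
  shows "dt N (f(r := \<lambda>j. a j + (\<Sum>s\<in>S. c s * f s j))) = dt N (f(r := a))"
  using assms(2,3)
proof (induction S rule: finite_induct)
  case (insert s S)
  have "dt N (f(r := \<lambda>j. a j + (\<Sum>s\<in>insert s S. c s * f s j))) =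
     dt N (f(r := \<lambda>j. (a j + (\<Sum>s\<in>S. c s * f s j)) + c s * f s j))"
    using insert(1,2) by (simp add: add.assoc add.commute add.left_commute)
  also have "\<dots> = dt N (f(r := \<lambda>j. a j + (\<Sum>s\<in>S. c s * f s j)))"
    by (rule dt_row_add_other) (use insert assms in auto)
  also have "\<dots> = dt N (f(r := a))" using insert by blast
  finally show ?case .
qed simp

text \<open>The rows are simplified from the top down; each step uses only the next row, which is
  still in its original form at that moment.\<close>

lemma dt_next_row:
  assumes "\<And>i j. Suc i < N \<Longrightarrow> j < N \<Longrightarrow> f i j = g i j + c i * f (Suc i) j"
    and "\<And>i j. Suc i = N \<Longrightarrow> j < N \<Longrightarrow> f i j = g i j"
  shows "dt N f = dt N g"
proof -
  have "dt N (\<lambda>i. if i < m then g i else f i) = dt N f" if "m \<le> N" for m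
    using that
  proof (induction m)
    case (Suc m)
    let ?F = "\<lambda>i. if i < m then g i else f i"
    have "dt N ?F = dt N (?F(m := g m))"
    proof (cases "Suc m < N")
      case True
      have "dt N ?F = dt N (?F(m := \<lambda>j. g m j + c m * ?F (Suc m) j))"
        by (rule dt_cong) (use assms(1)[of m] True in auto)
      also have "\<dots> = dt N (?F(m := g m))"
        by (rule dt_row_add_other) (use True in auto)
      finally show ?thesis .
    next
      case False
      then have "Suc m = N" using Suc by simp
      then show ?thesis by (intro dt_cong) (use assms(2)[of m] in auto)
    qed
    moreover have "?F(m := g m) = (\<lambda>i. if i < Suc m then g i else f i)" by (auto simp: fun_eq_iff)
    ultimately show ?case using Suc by simp
  qed simp
  from this[of N] have "dt N (\<lambda>i. if i < N then g i else f i) = dt N f" by simp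
  moreover have "dt N (\<lambda>i. if i < N then g i else f i) = dt N g" by (rule dt_cong) auto
  ultimately show ?thesis by simp
qed

lemma dt_last_row:
  assumes "\<And>j. j < N \<Longrightarrow> f N j = 0" "f N N = 1"
  shows "dt (Suc N) f = dt N f"
proof -
  have sub: "{p. p permutes {..<N}} \<subseteq> {p. p permutes {..<Suc N}}"
    by (auto intro: permutes_subset)
  have z: "of_int (sign p) * (\<Prod>i<Suc N. f i (p i)) = 0"
    if p: "p \<in> {p. p permutes {..<Suc N}} - {p. p permutes {..<N}}" for p
  proof -
    have p1: "p permutes {..<Suc N}" using p by simp
    have "p N \<noteq> N"
    proof
      assume "p N = N"
      then have "p permutes {..<N}"
        by (intro permutes_superset[OF p1]) (auto simp: less_Suc_eq)
      with p show False by simp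
    qed
    moreover have "p N < Suc N" using permutes_in_image[OF p1, of N] by auto
    ultimately have "f N (p N) = 0" using assms by (simp add: less_Suc_eq)
    then show ?thesis by simp
  qed
  have "dt (Suc N) f = (\<Sum>p | p permutes {..<N}. of_int (sign p) * (\<Prod>i<Suc N. f i (p i)))"
    unfolding dt_def by (rule sum.mono_neutral_right[OF finite_perms sub]) (use z in blast)
  also have "\<dots> = dt N f"
    unfolding dt_def
  proof (rule sum.cong[OF refl])
    fix p assume "p \<in> {p. p permutes {..<N}}"
    then have "p N = N" by (auto simp: permutes_not_in)
    then show "of_int (sign p) * (\<Prod>i<Suc N. f i (p i)) = of_int (sign p) * (\<Prod>i<N. f i (p i))"
      using assms by simp
  qed
  finally show ?thesis .
qed

section \<open>Jacobi-Trudi functions, branching by strips, and dominance\<close>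

section \<open>Schur functions by the Jacobi--Trudi formula\<close>

definition hi :: "int \<Rightarrow> 'a::field_char_0 sym" where
  "hi m = (if m < 0 then 0 else hh (nat m))"

lemma hi_neg [simp]: "m < 0 \<Longrightarrow> hi m = 0" and hi_0 [simp]: "hi 0 = 1"
  and hi_nonneg: "m \<ge> 0 \<Longrightarrow> hi m = hh (nat m)"
  by (auto simp: hi_def)

text \<open>Jacobi-Trudi determinants of arbitrary integer sequences, so that row operations and
  index shifts may leave the set of partitions. By \<open>sch_sN\<close>, padding a partition with
  zeros does not change the value.\<close>

definition sN :: "nat \<Rightarrow> (nat \<Rightarrow> int) \<Rightarrow> 'a::field_char_0 sym" where
  "sN N \<alpha> = dt N (\<lambda>i j. hi (\<alpha> i - int i + int j))"

definition nth0 :: "nat list \<Rightarrow> nat \<Rightarrow> nat" where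
  "nth0 l i = (if i < length l then l ! i else 0)"

definition sch :: "nat list \<Rightarrow> 'a::field_char_0 sym" where
  "sch l = sN (length l) (\<lambda>i. int (nth0 l i))"

lemma sN_cong: "(\<And>i. i < N \<Longrightarrow> \<alpha> i = \<beta> i) \<Longrightarrow> sN N \<alpha> = sN N \<beta>"
  unfolding sN_def by (rule dt_cong) simp

lemma sN_Suc: "\<alpha> N = 0 \<Longrightarrow> sN (Suc N) \<alpha> = sN N \<alpha>"
  unfolding sN_def by (rule dt_last_row) auto

lemma sch_sN: "length l \<le> N \<Longrightarrow> sch l = sN N (\<lambda>i. int (nth0 l i))"
proof (induction N rule: dec_induct)
  case base then show ?case by (simp add: sch_def)
next
  case (step n) then show ?case by (simp add: sN_Suc nth0_def)
qed

lemma homog_hi: "m \<ge> 0 \<Longrightarrow> homog (nat m) (hi m)"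
  by (simp add: hi_nonneg homog_hh)

lemma homog_prod_hi:
  assumes "(\<Sum>i\<in>A. \<beta> i) = int n" "finite A"
  shows "homog n (\<Prod>i\<in>A. hi (\<beta> i) :: 'a::field_char_0 sym)"
proof (cases "\<forall>i\<in>A. \<beta> i \<ge> 0")
  case True
  have "homog (\<Sum>i\<in>A. nat (\<beta> i)) (\<Prod>i\<in>A. hi (\<beta> i) :: 'a sym)"
    by (rule homog_prod) (use True in \<open>auto intro: homog_hi\<close>)
  moreover have "int (\<Sum>i\<in>A. nat (\<beta> i)) = int n" using True assms by simp
  ultimately show ?thesis by (simp only: of_nat_eq_iff)
next
  case False
  then have "(\<Prod>i\<in>A. hi (\<beta> i) :: 'a sym) = 0" using assms(2) by (intro prod_zero) (auto simp: not_le intro: hi_neg)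
  then show ?thesis by simp
qed

lemma perm_shift_sum:
  assumes "p permutes {..<N}" shows "(\<Sum>i<N. \<alpha> i - int i + int (p i)) = (\<Sum>i<N. \<alpha> i)"
proof -
  have "(\<Sum>i<N. int (p i)) = (\<Sum>i<N. int i)"
    using sum.permute[OF assms, of int] by (simp add: comp_def)
  then show ?thesis by (simp add: sum.distrib sum_subtractf)
qed

lemma homog_sN:
  assumes "(\<Sum>i<N. \<alpha> i) = int n" shows "homog n (sN N \<alpha> :: 'a::field_char_0 sym)"
  unfolding sN_def dt_def
  by (intro homog_sum homog_of_int homog_prod_hi) (auto simp: perm_shift_sum assms)

lemma sum_nth0: "length l \<le> N \<Longrightarrow> (\<Sum>i<N. nth0 l i) = sum_list l"
proof -
  assume "length l \<le> N"
  then have "(\<Sum>i<N. nth0 l i) = (\<Sum>i<length l. nth0 l i)"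
    by (intro sum.mono_neutral_right) (auto simp: nth0_def)
  also have "\<dots> = sum_list l" by (simp add: sum_list_sum_nth nth0_def atLeast0LessThan)
  finally show ?thesis .
qed

lemma homog_sch: "homog (sum_list l) (sch l)"
  unfolding sch_def by (rule homog_sN) (simp flip: of_nat_sum add: sum_nth0)

subsection \<open>Partitions as weakly decreasing sequences\<close>

lemma partition_Nil [simp]: "partition []" by (simp add: partition_def)

lemma partition_nth0_mono: "partition l \<Longrightarrow> i \<le> j \<Longrightarrow> nth0 l j \<le> nth0 l i"
  unfolding partition_def nth0_def
  by (cases "i = j") (auto simp: sorted_wrt_iff_nth_less)

lemma partition_nth0_pos: "partition l \<Longrightarrow> 0 < nth0 l i \<longleftrightarrow> i < length l"
  unfolding partition_def nth0_def by (metis gr0I less_irrefl nth_mem)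

lemma nth0_eqI:
  assumes "partition k" "partition l" "\<And>i. nth0 k i = nth0 l i" shows "k = l"
proof -
  have len: "length k = length l"
  proof -
    have "i < length k \<longleftrightarrow> i < length l" for i
      using partition_nth0_pos[OF assms(1), of i] partition_nth0_pos[OF assms(2), of i] assms(3)[of i]
      by simp
    then show ?thesis by (metis linorder_neqE_nat less_irrefl)
  qed
  then show ?thesis using assms(3) by (intro nth_equalityI) (auto simp: nth0_def, metis)
qed

definition list_of :: "nat \<Rightarrow> (nat \<Rightarrow> nat) \<Rightarrow> nat list" where
  "list_of N \<alpha> = filter (\<lambda>x. x > 0) (map \<alpha> [0..<N])"

lemma list_of_props:
  assumes "\<And>i j. i \<le> j \<Longrightarrow> j < N \<Longrightarrow> \<alpha> j \<le> \<alpha> i"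
  shows "partition (list_of N \<alpha>)" "length (list_of N \<alpha>) \<le> N"
    "nth0 (list_of N \<alpha>) i = (if i < N then \<alpha> i else 0)"
proof -
  have "sorted_wrt (\<ge>) (map \<alpha> [0..<N])"
    using assms by (auto simp: sorted_wrt_map sorted_wrt_iff_nth_less)
  then show p: "partition (list_of N \<alpha>)"
    by (auto simp: partition_def list_of_def sorted_wrt_filter)
  show l: "length (list_of N \<alpha>) \<le> N"
    unfolding list_of_def by (rule order_trans[OF length_filter_le]) simp
  have "\<exists>m\<le>N. (\<forall>i<m. \<alpha> i > 0) \<and> (\<forall>i. m \<le> i \<and> i < N \<longrightarrow> \<alpha> i = 0)" using assms
  proof (induction N)
    case (Suc N)
    then obtain m where m: "m \<le> N" "\<forall>i<m. \<alpha> i > 0" "\<forall>i. m \<le> i \<and> i < N \<longrightarrow> \<alpha> i = 0"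
      using less_SucI by metis
    show ?case
    proof (cases "\<alpha> N = 0")
      case True then show ?thesis using m by (intro exI[of _ m]) (auto simp: less_Suc_eq)
    next
      case False
      then have "\<alpha> i > 0" if "i < Suc N" for i using Suc.prems[of i N] that by simp
      then show ?thesis by (intro exI[of _ "Suc N"]) auto
    qed
  qed simp
  then obtain m where m: "m \<le> N" "\<forall>i<m. \<alpha> i > 0" "\<forall>i. m \<le> i \<and> i < N \<longrightarrow> \<alpha> i = 0" by blast
  have "[0..<N] = [0..<m] @ [m..<N]" using m(1) by (metis le0 upt_add_eq_append le_add_diff_inverse)
  moreover have "filter (\<lambda>x. x > 0) (map \<alpha> [0..<m]) = map \<alpha> [0..<m]" using m by (auto simp: filter_id_conv)
  moreover have "filter (\<lambda>x. x > 0) (map \<alpha> [m..<N]) = []" using m by (auto simp: filter_empty_conv)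
  ultimately have "list_of N \<alpha> = map \<alpha> [0..<m]" unfolding list_of_def by simp
  then show "nth0 (list_of N \<alpha>) i = (if i < N then \<alpha> i else 0)"
    using m by (auto simp: nth0_def)
qed

lemma sN_list_of:
  assumes "\<And>i j. i \<le> j \<Longrightarrow> j < N \<Longrightarrow> \<alpha> j \<le> \<alpha> i"
  shows "sN N (\<lambda>i. int (\<alpha> i)) = (sch (list_of N \<alpha>) :: 'a::field_char_0 sym)"
proof -
  have "(sch (list_of N \<alpha>) :: 'a sym) = sN N (\<lambda>i. int (nth0 (list_of N \<alpha>) i))"
    by (rule sch_sN[OF list_of_props(2)[OF assms]])
  also have "\<dots> = sN N (\<lambda>i. int (\<alpha> i))"
    by (rule sN_cong) (simp add: list_of_props(3)[OF assms])
  finally show ?thesis by simp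
qed

lemma finite_partitions: "finite (partitions n)"
proof -
  have "partitions n \<subseteq> {xs. set xs \<subseteq> {..n} \<and> length xs \<le> n}"
  proof
    fix l assume "l \<in> partitions n"
    then have l: "partition l" "sum_list l = n" by (auto simp: partitions_def)
    have "length l \<le> sum_list l" using l(1) unfolding partition_def
      by (induction l) (auto simp: Suc_le_eq)
    moreover have "x \<le> sum_list l" if "x \<in> set l" for x using that by (simp add: member_le_sum_list)
    ultimately show "l \<in> {xs. set xs \<subseteq> {..n} \<and> length xs \<le> n}" using l by auto
  qed
  then show ?thesis by (rule finite_subset) (rule finite_lists_length_le, simp)
qed

text \<open>In \<open>hs l\<close> the skew shape l / k is a horizontal strip (k interlaces l); in
  \<open>vs l\<close> below it is a vertical strip.\<close>

definition hs :: "nat list \<Rightarrow> nat list set" where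
  "hs l = {k. partition k \<and> (\<forall>i. nth0 l (Suc i) \<le> nth0 k i \<and> nth0 k i \<le> nth0 l i)}"

definition vs :: "nat list \<Rightarrow> nat list set" where
  "vs l = {k. partition k \<and> (\<forall>i. nth0 k i \<le> nth0 l i \<and> nth0 l i \<le> Suc (nth0 k i))}"

lemma sub_props:
  assumes "partition k" "partition l" "\<And>i. nth0 k i \<le> nth0 l i"
  shows "length k \<le> length l" "sum_list k \<le> sum_list l"
proof -
  show len: "length k \<le> length l"
  proof (rule ccontr)
    assume "\<not> ?thesis"
    then have "length l < length k" by simp
    then show False using assms(3)[of "length l"] partition_nth0_pos[OF assms(1), of "length l"]
      by (simp add: nth0_def)
  qed
  show "sum_list k \<le> sum_list l"
    using sum_mono[of "{..<length l}" "nth0 k" "nth0 l"] sum_nth0[OF len] sum_nth0[of l "length l"] assms(3)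
    by simp
qed

lemma finite_hs: "partition l \<Longrightarrow> finite (hs l)" and finite_vs: "partition l \<Longrightarrow> finite (vs l)"
proof -
  assume l: "partition l"
  have "hs l \<subseteq> (\<Union>n\<le>sum_list l. partitions n)" "vs l \<subseteq> (\<Union>n\<le>sum_list l. partitions n)"
    using sub_props[OF _ l] by (auto simp: hs_def vs_def partitions_def)
  moreover have "finite (\<Union>n\<le>sum_list l. partitions n)" by (simp add: finite_partitions)
  ultimately show "finite (hs l)" "finite (vs l)" by (auto intro: finite_subset)
qed

subsection \<open>Branching rules\<close>

lemma tau_hi: "tau (hi m) = (\<Sum>k\<le>nat m. monom (hi (m - int k)) k)"
proof (cases "m < 0")
  case True then show ?thesis by (simp add: rhom_0[OF rhom_transl])
next
  case False
  let ?x = "monom 1 1 :: 'a sym poly"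
  have lift: "newt (\<lambda>k. [:pp k:]) (\<lambda>n. [:hh n :: 'a sym:])"
    by (rule newt_hom[OF _ newt_hh]) (simp add: rhom_def one_pCons)
  have "newt (\<lambda>k. [:pp k:] + ?x ^ k) (\<lambda>n. \<Sum>j\<le>n. [:hh j :: 'a sym:] * ?x ^ (n - j))"
    by (rule newt_mult[OF lift newt_geometric])
  moreover have "newt (\<lambda>k. tau (pp k)) (\<lambda>n. tau (hh n :: 'a sym))"
    by (rule newt_hom[OF rhom_transl newt_hh])
  ultimately have "(\<Sum>j\<le>nat m. [:hh j :: 'a sym:] * ?x ^ (nat m - j)) = tau (hh (nat m))"
    by (rule newt_unique_poly) (auto simp: transl_pp monom_power)
  then have "tau (hh (nat m)) = (\<Sum>j\<le>nat m. [:hh j :: 'a sym:] * ?x ^ (nat m - j))" by simp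
  also have "\<dots> = (\<Sum>k\<le>nat m. [:hh (nat m - k):] * ?x ^ k)"
    by (rule sum.reindex_bij_witness[of _ "\<lambda>k. nat m - k" "\<lambda>k. nat m - k"]) auto
  also have "\<dots> = (\<Sum>k\<le>nat m. monom (hi (m - int k)) k)"
    using False by (intro sum.cong refl) (auto simp: hi_def monom_power smult_monom nat_diff_distrib)
  finally show ?thesis using False by (simp add: hi_nonneg)
qed

lemma tau_hi_ge: "nat m \<le> K \<Longrightarrow> tau (hi m) = (\<Sum>k\<le>K. monom (hi (m - int k)) k)"
  unfolding tau_hi by (rule sum.mono_neutral_left) (auto simp: not_le intro!: hi_neg)

text \<open>After the first d terms the rest of h_m[X + x] is x^d h_(m-d)[X + x]. With d = \<alpha>
  i - \<alpha> (i+1) + 1 that remainder is x^d times the entry of the next Jacobi-Trudi row.\<close>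

lemma tau_hi_step:
  assumes "m' = m - int d"
  shows "tau (hi m) = (\<Sum>k<d. monom (hi (m - int k)) k) + monom 1 d * tau (hi m')"
proof -
  define K where "K = nat m + d"
  have "tau (hi m) = (\<Sum>k\<le>K + d. monom (hi (m - int k)) k)"
    by (rule tau_hi_ge) (simp add: K_def)
  also have "{..K + d} = {..<d} \<union> {d..K + d}" by auto
  also have "(\<Sum>k\<in>{..<d} \<union> {d..K + d}. monom (hi (m - int k)) k)
     = (\<Sum>k<d. monom (hi (m - int k)) k) + (\<Sum>k\<in>{d..K + d}. monom (hi (m - int k)) k)"
    by (rule sum.union_disjoint) auto
  also have "(\<Sum>k\<in>{d..K + d}. monom (hi (m - int k)) k) = (\<Sum>k\<le>K. monom (hi (m' - int k)) (d + k))"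
    by (rule sum.reindex_bij_witness[of _ "\<lambda>k. d + k" "\<lambda>k. k - d"]) (auto simp: assms algebra_simps of_nat_diff)
  also have "\<dots> = monom 1 d * tau (hi m')"
    by (subst tau_hi_ge[of m' K]) (auto simp: K_def assms sum_distrib_left mult_monom)
  finally show ?thesis .
qed

text \<open>Subtracting a multiple of the next row truncates the entries of row i to the exponents
  from \<alpha> (i+1) to \<alpha> i. Multilinearity then yields precisely the horizontal strips,
  without cancellation.\<close>

lemma tau_sN:
  fixes \<alpha> :: "nat \<Rightarrow> nat"
  assumes dec: "\<And>i. \<alpha> (Suc i) \<le> \<alpha> i" and z: "\<alpha> N = 0"
  shows "tau (sN N (\<lambda>i. int (\<alpha> i))) =
    (\<Sum>\<kappa>\<in>PiE {..<N} (\<lambda>i. {\<alpha> (Suc i)..\<alpha> i}). monom (sN N (\<lambda>i. int (\<kappa> i))) (\<Sum>i<N. \<alpha> i - \<kappa> i))"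
proof -
  let ?e = "\<lambda>i j. int (\<alpha> i) - int i + int j"
  let ?d = "\<lambda>i. \<alpha> i - \<alpha> (Suc i) + 1"
  let ?g = "\<lambda>i j. \<Sum>k<?d i. monom (hi (?e i j - int k)) k :: 'a sym poly"
  have "tau (sN N (\<lambda>i. int (\<alpha> i))) = dt N (\<lambda>i j. tau (hi (?e i j)))"
    unfolding sN_def by (rule dt_hom[OF rhom_transl])
  also have "\<dots> = dt N ?g"
  proof (rule dt_next_row[where c="\<lambda>i. monom 1 (?d i)"])
    fix i j show "tau (hi (?e i j)) = ?g i j + monom 1 (?d i) * tau (hi (?e (Suc i) j))"
      by (rule tau_hi_step) (use dec[of i] in auto)
  next
    \<comment> \<open>In the last row the remainder has index j - N < 0 because \<alpha> N = 0, so
      it vanishes by itself.\<close>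
    fix i j assume "Suc i = N" "j < N"
    then show "tau (hi (?e i j)) = ?g i j"
      using tau_hi_step[of "?e i j - int (?d i)" "?e i j" "?d i"] z by (simp add: rhom_0[OF rhom_transl])
  qed
  also have "\<dots> = (\<Sum>\<kappa>\<in>PiE {..<N} (\<lambda>i. {\<alpha> (Suc i)..\<alpha> i}).
      (\<Prod>i<N. monom 1 (\<alpha> i - \<kappa> i)) * dt N (\<lambda>i j. [:hi (int (\<kappa> i) - int i + int j):]))"
  proof (rule dt_rows_expand)
    fix i j
    have "?g i j = (\<Sum>k\<in>{\<alpha> (Suc i)..\<alpha> i}. monom (hi (int k - int i + int j)) (\<alpha> i - k))"
      by (rule sum.reindex_bij_witness[of _ "\<lambda>k. \<alpha> i - k" "\<lambda>k. \<alpha> i - k"])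
         (use dec[of i] in \<open>auto simp: of_nat_diff algebra_simps\<close>)
    then show "?g i j = (\<Sum>k\<in>{\<alpha> (Suc i)..\<alpha> i}. monom 1 (\<alpha> i - k) * [:hi (int k - int i + int j):])"
      by (simp add: smult_monom)
  qed auto
  also have "\<dots> = (\<Sum>\<kappa>\<in>PiE {..<N} (\<lambda>i. {\<alpha> (Suc i)..\<alpha> i}). monom (sN N (\<lambda>i. int (\<kappa> i))) (\<Sum>i<N. \<alpha> i - \<kappa> i))"
  proof (rule sum.cong[OF refl])
    fix \<kappa>
    have "dt N (\<lambda>i j. [:hi (int (\<kappa> i) - int i + int j) :: 'a sym:]) = [:sN N (\<lambda>i. int (\<kappa> i)):]"
      unfolding sN_def by (rule dt_hom[symmetric]) (simp add: rhom_def one_pCons)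
    moreover have "(\<Prod>i<M. monom (1::'a sym) (\<alpha> i - \<kappa> i)) = monom 1 (\<Sum>i<M. \<alpha> i - \<kappa> i)" for M
      by (induction M) (auto simp: mult_monom)
    ultimately show "(\<Prod>i<N. monom 1 (\<alpha> i - \<kappa> i)) * dt N (\<lambda>i j. [:hi (int (\<kappa> i) - int i + int j):]) =
        monom (sN N (\<lambda>i. int (\<kappa> i)) :: 'a sym) (\<Sum>i<N. \<alpha> i - \<kappa> i)"
      by (simp add: smult_monom)
  qed
  finally show ?thesis .
qed

lemma tau_sch:
  assumes l: "partition l"
  shows "tau (sch l :: 'a::field_char_0 sym) = (\<Sum>k\<in>hs l. monom (sch k) (sum_list l - sum_list k))"
proof -
  let ?N = "length l"
  let ?P = "PiE {..<?N} (\<lambda>i. {nth0 l (Suc i)..nth0 l i})"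
  have "tau (sch l :: 'a sym) = (\<Sum>\<kappa>\<in>?P. monom (sN ?N (\<lambda>i. int (\<kappa> i))) (\<Sum>i<?N. nth0 l i - \<kappa> i))"
    unfolding sch_def
    by (rule tau_sN) (auto intro: partition_nth0_mono[OF l] simp: nth0_def[of l "length l"])
  also have "\<dots> = (\<Sum>k\<in>hs l. monom (sch k) (sum_list l - sum_list k))"
  proof (rule sum.reindex_bij_witness[of _ "\<lambda>k. restrict (nth0 k) {..<?N}" "\<lambda>\<kappa>. list_of ?N \<kappa>"])
    fix \<kappa> assume \<kappa>: "\<kappa> \<in> ?P"
    have b: "nth0 l (Suc i) \<le> \<kappa> i" "\<kappa> i \<le> nth0 l i" if "i < ?N" for i
      using \<kappa> that by (auto simp: PiE_def Pi_def)
    have dec: "\<kappa> j \<le> \<kappa> i" if "i \<le> j" "j < ?N" for i j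
    proof (cases "i = j")
      case False
      then have "nth0 l j \<le> nth0 l (Suc i)" using that by (intro partition_nth0_mono[OF l]) auto
      then show ?thesis using b[of i] b[of j] that by linarith
    qed simp
    note lp = list_of_props[of ?N \<kappa>, OF dec]
    show "restrict (nth0 (list_of ?N \<kappa>)) {..<?N} = \<kappa>"
      using \<kappa> lp(3) by (intro ext) (auto simp: PiE_def extensional_def)
    show in_hs: "list_of ?N \<kappa> \<in> hs l"
      using lp b by (auto simp: hs_def nth0_def[of l])
    have "sum_list l = (\<Sum>i<?N. nth0 l i)" "sum_list (list_of ?N \<kappa>) = (\<Sum>i<?N. \<kappa> i)"
      using sum_nth0[OF lp(2)] sum_nth0[of l ?N] lp(3) by auto
    then have "sum_list l - sum_list (list_of ?N \<kappa>) = (\<Sum>i<?N. nth0 l i - \<kappa> i)"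
      using sum_subtractf_nat[of "{..<?N}" \<kappa> "nth0 l"] b by simp
    then show "monom (sch (list_of ?N \<kappa>)) (sum_list l - sum_list (list_of ?N \<kappa>)) =
       monom (sN ?N (\<lambda>i. int (\<kappa> i)) :: 'a sym) (\<Sum>i<?N. nth0 l i - \<kappa> i)"
      by (simp add: sN_list_of[OF dec])
  next
    fix k assume k: "k \<in> hs l"
    then have kp: "partition k" and b: "\<And>i. nth0 l (Suc i) \<le> nth0 k i" "\<And>i. nth0 k i \<le> nth0 l i"
      by (auto simp: hs_def)
    show "restrict (nth0 k) {..<?N} \<in> ?P" using b by auto
    have dec: "restrict (nth0 k) {..<?N} j \<le> restrict (nth0 k) {..<?N} i" if "i \<le> j" "j < ?N" for i j
      using that partition_nth0_mono[OF kp] by auto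
    note lp = list_of_props[of ?N "restrict (nth0 k) {..<?N}", OF dec]
    have "length k \<le> ?N" using sub_props[OF kp l b(2)] by simp
    then show "list_of ?N (restrict (nth0 k) {..<?N}) = k"
      using lp(3) by (intro nth0_eqI[OF lp(1) kp]) (auto simp: nth0_def[of k])
  qed
  finally show ?thesis .
qed

lemma coeff_tau_sch:
  "partition l \<Longrightarrow> coeff (tau (sch l)) r = (\<Sum>k\<in>{k\<in>hs l. sum_list k + r = sum_list l}. sch k)"
proof -
  assume l: "partition l"
  have "coeff (tau (sch l)) r = (\<Sum>k\<in>hs l. if sum_list l - sum_list k = r then sch k else 0)"
    by (simp add: tau_sch[OF l] coeff_sum)
  also have "\<dots> = (\<Sum>k\<in>{k\<in>hs l. sum_list k + r = sum_list l}. sch k)"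
  proof (rule sum.mono_neutral_cong_right)
    show "(if sum_list l - sum_list k = r then sch k else 0) = sch k"
      if "k \<in> {k \<in> hs l. sum_list k + r = sum_list l}" for k
      using that by auto
    show "\<forall>i\<in>hs l - {k \<in> hs l. sum_list k + r = sum_list l}. (if sum_list l - sum_list i = r then sch i else 0) = 0"
    proof
      fix k assume k: "k \<in> hs l - {k \<in> hs l. sum_list k + r = sum_list l}"
      then have "sum_list k \<le> sum_list l" by (intro sub_props[OF _ l]) (auto simp: hs_def)
      then show "(if sum_list l - sum_list k = r then sch k else 0) = 0" using k by auto
    qed
  qed (auto simp: finite_hs[OF l])
  finally show ?thesis .
qed

text \<open>Translation p_k -> p_k - (-x)^k, the omega-conjugate of \<open>tau\<close>: its
  coefficient of x^r is skewing by e_r.\<close>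

abbreviation tau' :: "'a::field_char_0 sym \<Rightarrow> 'a sym poly" where
  "tau' \<equiv> transl (\<lambda>k. - ((- 1) ^ k))"

lemma tau'_hi: "tau' (hi m) = [:hi m:] + monom (hi (m - 1)) 1"
proof (cases "m < 0")
  case True then show ?thesis by (simp add: rhom_0[OF rhom_transl])
next
  case False
  let ?x = "monom 1 1 :: 'a sym poly"
  let ?L = "\<lambda>n. if n = 0 then 1 else if n = 1 then - (- ?x) else (0 :: 'a sym poly)"
  have lift: "newt (\<lambda>k. [:pp k:]) (\<lambda>n. [:hh n :: 'a sym:])"
    by (rule newt_hom[OF _ newt_hh]) (simp add: rhom_def one_pCons)
  have 1: "newt (\<lambda>k. [:pp k:] + - ((- ?x) ^ k)) (\<lambda>n. \<Sum>j\<le>n. [:hh j :: 'a sym:] * ?L (n - j))"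
    by (rule newt_mult[OF lift newt_linear])
  have mx: "(- ?x) ^ k = monom ((- 1) ^ k) k" for k
    by (simp add: minus_monom monom_power)
  have 2: "newt (\<lambda>k. tau' (pp k)) (\<lambda>n. tau' (hh n :: 'a sym))"
    by (rule newt_hom[OF rhom_transl newt_hh])
  have "(\<Sum>j\<le>nat m. [:hh j :: 'a sym:] * ?L (nat m - j)) = tau' (hh (nat m))"
  proof (rule newt_unique_poly[OF 1 2])
    fix k :: nat assume "k \<ge> 1"
    moreover have "Co (- ((- 1) ^ k)) = (- ((- 1) ^ k) :: 'a sym)"
      by (cases "even k") (auto simp: Co_uminus)
    moreover have "- ((- ?x) ^ k) = monom (- ((- 1) ^ k)) k" unfolding mx by (simp only: minus_monom)
    ultimately show "[:pp k:] + - ((- ?x) ^ k) = tau' (pp k)"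
      by (simp add: transl_pp)
  qed
  also have "(\<Sum>j\<le>nat m. [:hh j :: 'a sym:] * ?L (nat m - j)) = [:hi m:] + monom (hi (m - 1)) 1"
  proof (cases "m = 0")
    case False
    with \<open>\<not> m < 0\<close> have m: "m \<ge> 1" by simp
    have "(\<Sum>j\<le>nat m. [:hh j :: 'a sym:] * ?L (nat m - j))
       = (\<Sum>j\<in>{nat m, nat m - 1}. [:hh j :: 'a sym:] * ?L (nat m - j))"
      by (rule sum.mono_neutral_right) (use m in auto)
    also have "\<dots> = [:hh (nat m):] + smult (hh (nat m - 1)) ?x" using m by (auto simp: not_le)
    finally show ?thesis using m by (simp add: hi_nonneg smult_monom nat_diff_distrib)
  qed (simp add: one_pCons)
  finally show ?thesis using False by (simp add: hi_nonneg)
qed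

lemma sN_eq_0:
  assumes "i < N" "j < N" "i \<noteq> j" "\<alpha> i - int i = \<alpha> j - int j" shows "sN N \<alpha> = 0"
  unfolding sN_def by (rule dt_identical_rows[OF assms(1-3)]) (simp add: assms(4))

lemma sN_neg_last:
  assumes "N > 0" "\<alpha> (N - 1) < 0" shows "sN N \<alpha> = 0"
  unfolding sN_def by (rule dt_zero_row[of "N - 1"]) (use assms in \<open>auto intro!: hi_neg\<close>)

lemma tau'_sN:
  "tau' (sN N \<alpha>) =
    (\<Sum>\<kappa>\<in>PiE {..<N} (\<lambda>_. {0, 1}). monom (sN N (\<lambda>i. \<alpha> i - int (\<kappa> i))) (\<Sum>i<N. \<kappa> i))"
proof -
  have "tau' (sN N \<alpha> :: 'a sym) = dt N (\<lambda>i j. tau' (hi (\<alpha> i - int i + int j)))"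
    unfolding sN_def by (rule dt_hom[OF rhom_transl])
  also have "\<dots> = (\<Sum>\<kappa>\<in>PiE {..<N} (\<lambda>_. {0, 1}).
      (\<Prod>i<N. monom 1 (\<kappa> i)) * dt N (\<lambda>i j. [:hi (\<alpha> i - int (\<kappa> i) - int i + int j):]))"
    by (rule dt_rows_expand) (auto simp: tau'_hi smult_monom monom_0 algebra_simps)
  also have "\<dots> = (\<Sum>\<kappa>\<in>PiE {..<N} (\<lambda>_. {0, 1}). monom (sN N (\<lambda>i. \<alpha> i - int (\<kappa> i))) (\<Sum>i<N. \<kappa> i))"
  proof (rule sum.cong[OF refl])
    fix \<kappa> :: "nat \<Rightarrow> nat"
    have "dt N (\<lambda>i j. [:hi (\<alpha> i - int (\<kappa> i) - int i + int j) :: 'a sym:]) = [:sN N (\<lambda>i. \<alpha> i - int (\<kappa> i)):]"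
      unfolding sN_def by (rule dt_hom[symmetric]) (simp add: rhom_def one_pCons)
    moreover have "(\<Prod>i<M. monom (1::'a sym) (\<kappa> i)) = monom 1 (\<Sum>i<M. \<kappa> i)" for M
      by (induction M) (auto simp: mult_monom)
    ultimately show "(\<Prod>i<N. monom 1 (\<kappa> i)) * dt N (\<lambda>i j. [:hi (\<alpha> i - int (\<kappa> i) - int i + int j):]) =
        monom (sN N (\<lambda>i. \<alpha> i - int (\<kappa> i)) :: 'a sym) (\<Sum>i<N. \<kappa> i)"
      by (simp add: smult_monom)
  qed
  finally show ?thesis .
qed

text \<open>The entries are linear in x, so the determinant expands over all 0/1 vectors subtracted
  from l. If the result is not a partition, two adjacent rows of its determinant coincide; the other
  vectors are the vertical strips.\<close>

lemma tau'_sch: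
  assumes l: "partition l"
  shows "tau' (sch l :: 'a::field_char_0 sym) = (\<Sum>k\<in>vs l. monom (sch k) (sum_list l - sum_list k))"
proof -
  let ?N = "length l"
  let ?P = "PiE {..<?N} (\<lambda>_. {0, 1::nat})"
  let ?b = "\<lambda>\<kappa> i. nth0 l i - \<kappa> i"
  define good where "good \<kappa> \<longleftrightarrow> (\<forall>i j. i \<le> j \<longrightarrow> j < ?N \<longrightarrow> ?b \<kappa> j \<le> ?b \<kappa> i)" for \<kappa>
  have le: "\<kappa> i \<le> nth0 l i" "\<kappa> i \<le> 1" if "\<kappa> \<in> ?P" "i < ?N" for \<kappa> i
  proof -
    have "\<kappa> i \<in> {0, 1}" using that by (auto simp: PiE_def Pi_def)
    then show "\<kappa> i \<le> nth0 l i" "\<kappa> i \<le> 1" using partition_nth0_pos[OF l, of i] that(2) by auto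
  qed
  have "tau' (sch l :: 'a sym) = (\<Sum>\<kappa>\<in>?P. monom (sN ?N (\<lambda>i. int (nth0 l i) - int (\<kappa> i))) (\<Sum>i<?N. \<kappa> i))"
    unfolding sch_def by (rule tau'_sN)
  also have "\<dots> = (\<Sum>\<kappa>\<in>?P. monom (sN ?N (\<lambda>i. int (?b \<kappa> i))) (\<Sum>i<?N. \<kappa> i))"
    by (intro sum.cong refl arg_cong2[where f=monom] sN_cong) (use le in \<open>auto simp: of_nat_diff\<close>)
  also have "\<dots> = (\<Sum>\<kappa>\<in>{\<kappa>\<in>?P. good \<kappa>}. monom (sN ?N (\<lambda>i. int (?b \<kappa> i))) (\<Sum>i<?N. \<kappa> i))"
  proof (rule sum.mono_neutral_right)
    show "finite ?P" by (intro finite_PiE) auto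
    show "\<forall>\<kappa>\<in>?P - {\<kappa>\<in>?P. good \<kappa>}. monom (sN ?N (\<lambda>i. int (?b \<kappa> i)) :: 'a sym) (\<Sum>i<?N. \<kappa> i) = 0"
    proof
      fix \<kappa> assume \<kappa>: "\<kappa> \<in> ?P - {\<kappa>\<in>?P. good \<kappa>}"
      have "\<exists>i. Suc i < ?N \<and> ?b \<kappa> i < ?b \<kappa> (Suc i)"
      proof (rule ccontr)
        assume "\<not> ?thesis"
        then have s: "?b \<kappa> (Suc i) \<le> ?b \<kappa> i" if "Suc i < ?N" for i using that by (meson not_le)
        have "?b \<kappa> j \<le> ?b \<kappa> i" if "i \<le> j" "j < ?N" for i j
          using that
        proof (induction j rule: dec_induct)
          case (step n) then show ?case using s[of n] by (metis Suc_lessD le_trans)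
        qed simp
        then show False using \<kappa> by (auto simp: good_def)
      qed
      then obtain i where i: "Suc i < ?N" "?b \<kappa> i < ?b \<kappa> (Suc i)" by blast
      have "nth0 l (Suc i) \<le> nth0 l i" by (rule partition_nth0_mono[OF l]) simp
      then have "int (?b \<kappa> i) - int i = int (?b \<kappa> (Suc i)) - int (Suc i)"
        using i le(2)[of \<kappa> i] \<kappa> by auto
      then have "sN ?N (\<lambda>i. int (?b \<kappa> i)) = (0 :: 'a sym)"
        by (intro sN_eq_0[of i _ "Suc i"]) (use i in auto)
      then show "monom (sN ?N (\<lambda>i. int (?b \<kappa> i)) :: 'a sym) (\<Sum>i<?N. \<kappa> i) = 0" by simp
    qed
  qed auto
  also have "\<dots> = (\<Sum>k\<in>vs l. monom (sch k) (sum_list l - sum_list k))"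
  proof (rule sum.reindex_bij_witness[of _ "\<lambda>k. restrict (\<lambda>i. nth0 l i - nth0 k i) {..<?N}" "\<lambda>\<kappa>. list_of ?N (?b \<kappa>)"])
    fix \<kappa> assume k: "\<kappa> \<in> {\<kappa>\<in>?P. good \<kappa>}"
    then have \<kappa>: "\<kappa> \<in> ?P" and dec: "\<And>i j. i \<le> j \<Longrightarrow> j < ?N \<Longrightarrow> ?b \<kappa> j \<le> ?b \<kappa> i" by (auto simp: good_def)
    note lp = list_of_props[of ?N "?b \<kappa>", OF dec]
    show "restrict (\<lambda>i. nth0 l i - nth0 (list_of ?N (?b \<kappa>)) i) {..<?N} = \<kappa>"
      using \<kappa> lp(3) le[OF \<kappa>] by (intro ext) (auto simp: PiE_def extensional_def)
    show "list_of ?N (?b \<kappa>) \<in> vs l"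
      unfolding vs_def mem_Collect_eq
    proof (intro conjI allI)
      fix i
      show "nth0 (list_of ?N (?b \<kappa>)) i \<le> nth0 l i" by (simp add: lp(3))
      show "nth0 l i \<le> Suc (nth0 (list_of ?N (?b \<kappa>)) i)"
      proof (cases "i < ?N")
        case True then show ?thesis using le[OF \<kappa>, of i] by (simp add: lp(3))
      next
        case False then show ?thesis by (simp add: nth0_def)
      qed
    qed (rule lp(1))
    have "sum_list l = (\<Sum>i<?N. nth0 l i)" "sum_list (list_of ?N (?b \<kappa>)) = (\<Sum>i<?N. ?b \<kappa> i)"
      using sum_nth0[OF lp(2)] sum_nth0[of l ?N] lp(3) by auto
    moreover have "(\<Sum>i<?N. ?b \<kappa> i) = (\<Sum>i<?N. nth0 l i) - (\<Sum>i<?N. \<kappa> i)"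
      by (rule sum_subtractf_nat) (use le[OF \<kappa>] in auto)
    moreover have "(\<Sum>i<?N. \<kappa> i) \<le> (\<Sum>i<?N. nth0 l i)" by (rule sum_mono) (use le[OF \<kappa>] in auto)
    ultimately have "sum_list l - sum_list (list_of ?N (?b \<kappa>)) = (\<Sum>i<?N. \<kappa> i)" by simp
    then show "monom (sch (list_of ?N (?b \<kappa>))) (sum_list l - sum_list (list_of ?N (?b \<kappa>))) =
       monom (sN ?N (\<lambda>i. int (?b \<kappa> i)) :: 'a sym) (\<Sum>i<?N. \<kappa> i)"
      by (simp add: sN_list_of[OF dec])
  next
    fix k assume k: "k \<in> vs l"
    then have kp: "partition k" and b: "\<And>i. nth0 k i \<le> nth0 l i" "\<And>i. nth0 l i \<le> Suc (nth0 k i)"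
      by (auto simp: vs_def)
    let ?\<kappa> = "restrict (\<lambda>i. nth0 l i - nth0 k i) {..<?N}"
    have bk: "?b ?\<kappa> i = nth0 k i" if "i < ?N" for i using b(1)[of i] that by simp
    have dec: "?b ?\<kappa> j \<le> ?b ?\<kappa> i" if "i \<le> j" "j < ?N" for i j
      using that bk[of i] bk[of j] partition_nth0_mono[OF kp, of i j] by auto
    have "nth0 l i - nth0 k i \<in> {0, 1}" for i using b(2)[of i] by auto
    then have "?\<kappa> \<in> ?P" by auto
    moreover have "good ?\<kappa>" unfolding good_def using dec by blast
    ultimately show "?\<kappa> \<in> {\<kappa>\<in>?P. good \<kappa>}" by simp
    note lp = list_of_props[of ?N "?b ?\<kappa>", OF dec]
    have "length k \<le> ?N" using sub_props[OF kp l b(1)] by simp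
    have "nth0 (list_of ?N (?b ?\<kappa>)) i = nth0 k i" for i
    proof (cases "i < ?N")
      case True
      then show ?thesis using lp(3)[of i] bk[OF True] by (simp only: if_True True)
    next
      case False
      then have "nth0 k i = 0" using \<open>length k \<le> ?N\<close> by (simp add: nth0_def)
      then show ?thesis using lp(3)[of i] False by (simp only: if_False)
    qed
    then show "list_of ?N (?b ?\<kappa>) = k" by (intro nth0_eqI[OF lp(1) kp])
  qed
  finally show ?thesis .
qed

lemma coeff_tau'_sch:
  "partition l \<Longrightarrow> coeff (tau' (sch l)) r = (\<Sum>k\<in>{k\<in>vs l. sum_list k + r = sum_list l}. sch k)"
proof -
  assume l: "partition l"
  have "coeff (tau' (sch l :: 'a sym)) r = (\<Sum>k\<in>vs l. if sum_list l - sum_list k = r then sch k else 0)"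
    by (simp add: tau'_sch[OF l] coeff_sum)
  also have "\<dots> = (\<Sum>k\<in>{k\<in>vs l. sum_list k + r = sum_list l}. sch k)"
  proof (rule sum.mono_neutral_cong_right)
    show "(if sum_list l - sum_list k = r then sch k else 0) = (sch k :: 'a sym)"
      if "k \<in> {k \<in> vs l. sum_list k + r = sum_list l}" for k
      using that by auto
    show "\<forall>i\<in>vs l - {k \<in> vs l. sum_list k + r = sum_list l}.
       (if sum_list l - sum_list i = r then sch i else 0) = (0 :: 'a sym)"
    proof
      fix k assume k: "k \<in> vs l - {k \<in> vs l. sum_list k + r = sum_list l}"
      then have "sum_list k \<le> sum_list l" by (intro sub_props[OF _ l]) (auto simp: vs_def)
      then show "(if sum_list l - sum_list k = r then sch k else 0) = (0 :: 'a sym)" using k by auto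
    qed
  qed (auto simp: finite_vs[OF l])
  finally show ?thesis .
qed

subsection \<open>Dominance\<close>

text \<open>The number of cells of l to the right of column c. For a partition, the sum of the first
  k parts is the minimum over c of \<open>excess l c + k * c\<close>, a discrete Legendre
  duality.\<close>

definition excess :: "nat list \<Rightarrow> nat \<Rightarrow> nat" where
  "excess l c = (\<Sum>x\<leftarrow>l. x - c)"

lemma sum_take_le_excess: "sum_list (take k l) \<le> excess l c + k * c"
proof (induction l arbitrary: k)
  case (Cons x l)
  show ?case
  proof (cases k)
    case (Suc k')
    then show ?thesis using Cons[of k'] by (simp add: excess_def)
  qed simp
qed (simp add: excess_def)

lemma sum_take_nth0: "sum_list (take k l) = (\<Sum>i<k. nth0 l i)"
proof -
  have "sum_list (take k l) = (\<Sum>i<length (take k l). nth0 l i)"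
    by (simp add: sum_list_sum_nth nth0_def atLeast0LessThan)
  also have "\<dots> = (\<Sum>i<k. nth0 l i)"
    by (rule sum.mono_neutral_left) (auto simp: nth0_def)
  finally show ?thesis .
qed

lemma excess_nth0: "length l \<le> N \<Longrightarrow> excess l c = (\<Sum>i<N. nth0 l i - c)"
proof -
  assume "length l \<le> N"
  then have "(\<Sum>i<N. nth0 l i - c) = (\<Sum>i<length l. nth0 l i - c)"
    by (intro sum.mono_neutral_right) (auto simp: nth0_def)
  also have "\<dots> = excess l c" by (simp add: excess_def sum_list_sum_nth nth0_def atLeast0LessThan)
  finally show ?thesis by simp
qed

lemma excess_attained:
  assumes l: "partition l"
  shows "\<exists>k. excess l c + k * c = sum_list (take k l)"
proof -
  define k where "k = length (filter (\<lambda>x. x > c) l)"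
  have "excess l c + length (filter (\<lambda>x. x > c) l) * c = sum_list (take (length (filter (\<lambda>x. x > c) l)) l)"
    using l
  proof (induction l)
    case (Cons x l)
    then have IH: "excess l c + length (filter (\<lambda>x. x > c) l) * c = sum_list (take (length (filter (\<lambda>x. x > c) l)) l)"
      by (auto simp: partition_def)
    show ?case
    proof (cases "x > c")
      case True then show ?thesis using IH by (simp add: excess_def)
    next
      case False
      then have "\<forall>y\<in>set l. y \<le> c" using Cons.prems by (force simp: partition_def)
      then have "filter (\<lambda>x. x > c) l = []" "excess l c = 0" by (auto simp: filter_empty_conv excess_def)
      then show ?thesis using False by (simp add: excess_def)
    qed
  qed (simp add: excess_def)
  then show ?thesis by blast
qed

lemma sum_take_attained:
  assumes l: "partition l"
  shows "\<exists>c. sum_list (take k l) = excess l c + k * c"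
proof (cases "k = 0")
  case True
  have "x - sum_list l = 0" if "x \<in> set l" for x using member_le_sum_list[OF that] by simp
  then have "excess l (sum_list l) = 0" unfolding excess_def by (simp add: sum_list_nonneg_eq_0_iff)
  then show ?thesis using True by (metis add.right_neutral mult_0 sum_list.Nil take_0)
next
  case False
  define c where "c = nth0 l (k - 1)"
  have "(\<Sum>i<max k (length l). nth0 l i - c) = (\<Sum>i<k. nth0 l i - c)"
  proof (rule sum.mono_neutral_right)
    have "nth0 l i \<le> c" if "k \<le> i" for i
      unfolding c_def using that by (intro partition_nth0_mono[OF l]) simp
    then show "\<forall>i\<in>{..<max k (length l)} - {..<k}. nth0 l i - c = 0" by auto
  qed auto
  also have "\<dots> + k * c = (\<Sum>i<k. (nth0 l i - c) + c)" by (simp add: sum.distrib)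
  also have "\<dots> = (\<Sum>i<k. nth0 l i)"
    by (rule sum.cong) (use False in \<open>auto simp: c_def intro!: le_add_diff_inverse2 partition_nth0_mono[OF l]\<close>)
  finally show ?thesis using excess_nth0[of l "max k (length l)" c] by (intro exI[of _ c]) (simp add: sum_take_nth0)
qed

text \<open>Dominance order in terms of excesses: \<open>\<lambda>\<close> dominates \<open>\<mu>\<close> iff \<open>excess \<mu> \<le> excess \<lambda>\<close>; the latter
  only depends on the parts as a multiset.\<close>

lemma dom_le_excess:
  assumes l: "partition l" "sum_list m = sum_list l"
    and ex: "\<And>c. excess m c \<le> excess l c"
  shows "dom_le m l"
  unfolding dom_le_def
proof (intro conjI allI)
  fix k
  obtain c where "sum_list (take k l) = excess l c + k * c" using sum_take_attained[OF l(1)] by blast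
  then show "sum_list (take k m) \<le> sum_list (take k l)" using sum_take_le_excess[of k m c] ex[of c] by linarith
qed (rule l(2))

lemma excess_dom_le:
  assumes "partition m" "dom_le m l" shows "excess m c \<le> excess l c"
proof -
  obtain k where "excess m c + k * c = sum_list (take k m)" using excess_attained[OF assms(1)] by blast
  moreover have "sum_list (take k m) \<le> sum_list (take k l)" using assms(2) by (simp add: dom_le_def)
  ultimately show ?thesis using sum_take_le_excess[of k l c] by linarith
qed

lemma dom_le_refl [simp]: "dom_le l l" by (simp add: dom_le_def)

lemma dom_le_trans: "dom_le a b \<Longrightarrow> dom_le b c \<Longrightarrow> dom_le a c"
  unfolding dom_le_def by (metis le_trans)

lemma dom_le_antisym:
  assumes "partition a" "partition b" "dom_le a b" "dom_le b a" shows "a = b"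
proof (rule nth0_eqI[OF assms(1,2)])
  fix i
  have e: "(\<Sum>j<k. nth0 a j) = (\<Sum>j<k. nth0 b j)" for k
    using assms(3,4) by (auto simp: dom_le_def sum_take_nth0 intro: antisym)
  show "nth0 a i = nth0 b i" using e[of i] e[of "Suc i"] by simp
qed

subsection \<open>Triangularity between Schur and complete functions\<close>

definition hmu :: "nat list \<Rightarrow> 'a::field_char_0 sym" where
  "hmu l = (\<Prod>x\<leftarrow>l. hh x)"

lemma homog_hmu: "homog (sum_list l) (hmu l)"
  by (induction l) (auto simp: hmu_def intro: homog_mult homog_hh)

lemma hmu_mset: "hmu l = (\<Prod>x\<in>#mset l. hh x)"
  by (simp add: hmu_def flip: prod_mset_prod_list)

lemma hmu_Cons: "hmu (x # b) = hh x * hmu b" by (simp add: hmu_def)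

lemma hmu_nth0: "length l \<le> N \<Longrightarrow> hmu l = (\<Prod>i<N. hi (int (nth0 l i)))"
proof -
  assume "length l \<le> N"
  then have "(\<Prod>i<N. hi (int (nth0 l i)) :: 'a sym) = (\<Prod>i<length l. hi (int (nth0 l i)))"
    by (intro prod.mono_neutral_right) (auto simp: nth0_def)
  also have "\<dots> = hmu l"
    unfolding hmu_def by (induction l rule: rev_induct) (auto simp: nth0_def hi_nonneg nth_append)
  finally show ?thesis by simp
qed

lemma inj_sum_ge:
  assumes "inj_on p {..<k}" shows "(\<Sum>i<k. i) \<le> (\<Sum>i<k. p i :: nat)"
proof -
  define S where "S = p ` {..<k}"
  have S: "finite S" "card S = k" using assms by (auto simp: S_def card_image)
  have c: "card (S - {..<k}) = card ({..<k} - S)"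
    using S card_Diff_subset_Int[of S "{..<k}"] card_Diff_subset_Int[of "{..<k}" S] by (simp add: Int_commute)
  have "(\<Sum>i<k. i) = sum id ({..<k} \<inter> S) + sum id ({..<k} - S)"
    by (subst sum.Int_Diff[of _ _ S]) auto
  also have "sum id ({..<k} - S) \<le> card ({..<k} - S) * k"
    using sum_bounded_above[of "{..<k} - S" id k] by auto
  also have "\<dots> \<le> sum id (S - {..<k})"
    unfolding c[symmetric] using sum_bounded_below[of "S - {..<k}" k id] by auto
  also have "sum id ({..<k} \<inter> S) + sum id (S - {..<k}) = sum id S"
    by (subst sum.Int_Diff[of S id "{..<k}"]) (use S in \<open>auto simp: Int_commute\<close>)
  also have "\<dots> = (\<Sum>i<k. p i)" unfolding S_def using assms by (subst sum.reindex) auto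
  finally show ?thesis by simp
qed

lemma perm_eq_id:
  assumes p: "p permutes {..<N::nat}" and le: "\<And>k. k \<le> N \<Longrightarrow> (\<Sum>i<k. p i) \<le> (\<Sum>i<k. i)"
  shows "p = id"
proof -
  have "p k = k" if "k < N" for k
    using that
  proof (induction k rule: less_induct)
    case (less k)
    then have eq: "p i = i" if "i < k" for i using that by simp
    have "\<not> p k < k"
    proof
      assume "p k < k"
      then have "p (p k) = p k" by (rule eq)
      then have "p k = k" using permutes_inj[OF p] by (simp add: inj_eq)
      then show False using \<open>p k < k\<close> by simp
    qed
    moreover have "(\<Sum>i<k. p i) + p k \<le> (\<Sum>i<k. i) + k" using le[of "Suc k"] less by simp
    moreover have "(\<Sum>i<k. p i) = (\<Sum>i<k. i)" by (rule sum.cong) (auto simp: eq)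
    ultimately show ?case by simp
  qed
  then show ?thesis using permutes_not_in[OF p] by (auto simp: fun_eq_iff)
qed

text \<open>A Jacobi-Trudi term either contains an index below 0 or is h_k for a partition k
  dominating l: p takes distinct values, so partial sums of the shifted exponents are at least those
  of l, and sorting only raises them. If k = l, all partial sums of p are minimal, which forces p =
  id.\<close>

lemma prod_hi_cases:
  assumes l: "partition l" and p: "p permutes {..<N}" and N: "length l \<le> N"
  defines "\<beta> \<equiv> (\<lambda>i. int (nth0 l i) - int i + int (p i))"
  shows "(\<exists>i<N. \<beta> i < 0) \<or> (\<exists>k. k \<in> partitions (sum_list l) \<and> dom_le l k \<and> (k = l \<longrightarrow> p = id) \<and>
       (\<Prod>i<N. hi (\<beta> i)) = (hmu k :: 'a::field_char_0 sym))"
proof (cases "\<exists>i<N. \<beta> i < 0")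
  case False
  then have nn: "\<beta> i \<ge> 0" if "i < N" for i using that by (meson not_le)
  let ?b = "\<lambda>i. nat (\<beta> i)"
  let ?xs = "map ?b [0..<N]"
  define k where "k = rev (sort (filter (\<lambda>x. x > 0) ?xs))"
  have k: "partition k" unfolding k_def partition_def
    by (auto simp: sorted_wrt_rev)
  have exk: "excess k c = excess ?xs c" for c
  proof -
    have "excess k c = (\<Sum>x\<in>#filter_mset (\<lambda>x. x > 0) (mset ?xs). x - c)"
      unfolding excess_def k_def by (simp flip: sum_mset_sum_list)
    also have "\<dots> = excess ?xs c" unfolding excess_def
      by (induction N) (auto simp flip: sum_mset_sum_list)
    finally show ?thesis .
  qed
  have sb: "(\<Sum>i<j. int (?b i)) = (\<Sum>i<j. int (nth0 l i)) + (\<Sum>i<j. int (p i)) - (\<Sum>i<j. int i)" if "j \<le> N" for j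
    using that nn by (simp add: \<beta>_def sum.distrib sum_subtractf)
  have sl: "(\<Sum>i<N. int (p i)) = (\<Sum>i<N. int i)"
    using sum.permute[OF p, of int] by (simp add: comp_def)
  have ex0: "excess m 0 = sum_list m" for m by (simp add: excess_def)
  have "int (sum_list k) = (\<Sum>i<N. int (?b i))"
    using exk[of 0] by (simp add: ex0 sum_list_sum_nth atLeast0LessThan)
  also have "\<dots> = int (sum_list l)" using sb[of N] sl sum_nth0[OF N] by (simp flip: of_nat_sum)
  finally have sumk: "sum_list k = sum_list l" by simp
  have tk: "(\<Sum>i<j. ?b i) \<le> sum_list (take j k)" if "j \<le> N" for j
  proof -
    obtain c where c: "sum_list (take j k) = excess k c + j * c" using sum_take_attained[OF k] by blast
    have "sum_list (take j ?xs) = (\<Sum>i<j. ?b i)"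
      using that by (simp add: take_map sum_list_sum_nth atLeast0LessThan min_def)
    then show ?thesis using sum_take_le_excess[of j ?xs c] c exk[of c] by simp
  qed
  have inj: "inj_on p {..<j}" for j using permutes_inj[OF p] by (rule inj_on_subset) auto
  have low: "(\<Sum>i<j. nth0 l i) \<le> (\<Sum>i<j. ?b i)" if "j \<le> N" for j
  proof -
    have "(\<Sum>i<j. int i) \<le> (\<Sum>i<j. int (p i))" using inj_sum_ge[OF inj, of j] by (simp flip: of_nat_sum)
    then have "int (\<Sum>i<j. nth0 l i) \<le> int (\<Sum>i<j. ?b i)" using sb[OF that] unfolding of_nat_sum by linarith
    then show ?thesis by (simp only: of_nat_le_iff)
  qed
  have "dom_le l k"
    unfolding dom_le_def
  proof (intro conjI allI)
    fix j
    show "sum_list (take j l) \<le> sum_list (take j k)"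
    proof (cases "j \<le> N")
      case True then show ?thesis using low[OF True] tk[OF True] by (simp add: sum_take_nth0)
    next
      case False
      have "length k \<le> length (filter (\<lambda>x. x > 0) ?xs)" by (simp add: k_def)
      also have "\<dots> \<le> N" by (rule order_trans[OF length_filter_le]) simp
      finally show ?thesis using False N sumk by simp
    qed
  qed (rule sumk[symmetric])
  moreover have "p = id" if "k = l"
  proof (rule perm_eq_id[OF p])
    fix j assume "j \<le> N"
    then have "(\<Sum>i<j. ?b i) \<le> (\<Sum>i<j. nth0 l i)" using tk[of j] that by (simp add: sum_take_nth0)
    then have "int (\<Sum>i<j. ?b i) \<le> int (\<Sum>i<j. nth0 l i)" by (simp only: of_nat_le_iff)
    then have "(\<Sum>i<j. int (?b i)) \<le> (\<Sum>i<j. int (nth0 l i))" unfolding of_nat_sum .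
    then have "(\<Sum>i<j. int (p i)) \<le> (\<Sum>i<j. int i)" using sb[OF \<open>j \<le> N\<close>] by linarith
    then show "(\<Sum>i<j. p i) \<le> (\<Sum>i<j. i)" by (simp flip: of_nat_sum)
  qed
  moreover have "(\<Prod>i<N. hi (\<beta> i)) = (hmu k :: 'a sym)"
  proof -
    have "(\<Prod>i<N. hi (\<beta> i) :: 'a sym) = (\<Prod>i<N. hh (?b i))"
      by (rule prod.cong) (use nn in \<open>auto simp: hi_nonneg\<close>)
    also have "\<dots> = (\<Prod>x\<leftarrow>?xs. hh x)" by (simp add: prod.list_conv_set_nth atLeast0LessThan)
    also have "\<dots> = (\<Prod>x\<in>#filter_mset (\<lambda>x. x > 0) (mset ?xs). hh x)"
      by (induction N) (auto simp flip: prod_mset_prod_list simp: ac_simps)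
    also have "\<dots> = hmu k" by (simp add: hmu_mset k_def)
    finally show ?thesis .
  qed
  ultimately show ?thesis using k sumk by (auto simp: partitions_def)
qed simp

section \<open>The tableau counts of the definitions as Hall pairings; orthonormality of Schur
  functions\<close>

section \<open>Tableaux, Kostka numbers and evaluations\<close>

lemma mem_cells: "partition l \<Longrightarrow> (i, j) \<in> cells l \<longleftrightarrow> j < nth0 l i"
  by (auto simp: cells_def nth0_def)

lemma cells_Sigma: "cells l = Sigma {..<length l} (\<lambda>i. {..<l ! i})"
  by (auto simp: cells_def)

lemma finite_cells [simp]: "finite (cells l)"
  by (simp add: cells_Sigma)

lemma card_cells: "card (cells l) = sum_list l"
  by (simp add: cells_Sigma sum_list_sum_nth atLeast0LessThan)

lemma finite_ssyt [simp]: "finite (ssyt l N)"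
  unfolding ssyt_def by (rule finite_subset[of _ "cells l \<rightarrow>\<^sub>E {..<N}"]) (auto intro!: finite_PiE)

lemma ssyt_less: "T \<in> ssyt l N \<Longrightarrow> c \<in> cells l \<Longrightarrow> T c < N"
  and ssyt_undefined: "T \<in> ssyt l N \<Longrightarrow> c \<notin> cells l \<Longrightarrow> T c = undefined"
  and ssyt_row: "T \<in> ssyt l N \<Longrightarrow> (i, j + 1) \<in> cells l \<Longrightarrow> T (i, j) \<le> T (i, j + 1)"
  and ssyt_col: "T \<in> ssyt l N \<Longrightarrow> (i + 1, j) \<in> cells l \<Longrightarrow> T (i, j) < T (i + 1, j)"
  unfolding ssyt_def by (blast dest: PiE_mem PiE_arb)+

definition add_letter :: "nat list \<Rightarrow> nat \<Rightarrow> nat list \<Rightarrow> (nat \<times> nat \<Rightarrow> nat) \<Rightarrow> nat \<times> nat \<Rightarrow> nat" where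
  "add_letter l N k S c = (if c \<in> cells k then S c else if c \<in> cells l then N else undefined)"

lemma initial_segment:
  fixes P :: "nat \<Rightarrow> bool"
  assumes "\<And>i j. i \<le> j \<Longrightarrow> P j \<Longrightarrow> P i" "\<not> P b"
  shows "j < (LEAST j. \<not> P j) \<longleftrightarrow> P j"
  using assms LeastI[of "\<lambda>j. \<not> P j", OF assms(2)] not_less_Least[of j "\<lambda>j. \<not> P j"]
  by (meson not_le)

text \<open>The cells holding letters below N form a partition k, and the cells holding N form the
  horizontal strip l / k. Summing an arbitrary \<Phi> lets one bijection serve both Schur
  evaluations and Kostka numbers.\<close>

lemma sum_ssyt_Suc:
  assumes l: "partition l"
  shows "(\<Sum>T\<in>ssyt l (Suc N). \<Phi> T) = (\<Sum>k\<in>hs l. \<Sum>S\<in>ssyt k N. \<Phi> (add_letter l N k S))"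
proof -
  let ?P = "\<lambda>T i j. j < nth0 l i \<and> T (i, j) < N"
  \<comment> \<open>Rows increase weakly, so the least column violating \<open>?P\<close> equals the
    number of letters below N in that row.\<close>
  define kap where "kap T = list_of (length l) (\<lambda>i. LEAST j. \<not> ?P T i j)" for T
  have row: "T (i, j) \<le> T (i, j')" if T: "T \<in> ssyt l M" and "j \<le> j'" "j' < nth0 l i" for T M i j j'
    using that(2,3)
  proof (induction j' rule: dec_induct)
    case (step n)
    then have "T (i, n) \<le> T (i, n + 1)" using ssyt_row[OF T, of i n] mem_cells[OF l, of i "n + 1"] by simp
    then show ?case using step by simp
  qed simp
  have key: "partition (kap T) \<and> (\<forall>i j. j < nth0 (kap T) i \<longleftrightarrow> ?P T i j) \<and> kap T \<in> hs l"
    if T: "T \<in> ssyt l (Suc N)" for T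
  proof -
    let ?a = "\<lambda>i. LEAST j. \<not> ?P T i j"
    have a: "j < ?a i \<longleftrightarrow> ?P T i j" for i j
    proof (rule initial_segment)
      show "?P T i j" if "j \<le> j'" "?P T i j'" for j j'
        using row[OF T that(1), of i] that by auto
      show "\<not> ?P T i (nth0 l i)" by simp
    qed
    have col: "T (i, j) < T (Suc i, j)" if "j < nth0 l (Suc i)" for i j
      using ssyt_col[OF T, of i j] that mem_cells[OF l, of "Suc i" j] by simp
    have le: "T (i, j) \<le> N" if "j < nth0 l i" for i j
      using ssyt_less[OF T, of "(i, j)"] that mem_cells[OF l, of i j] by simp
    have mono1: "nth0 l (Suc i) \<le> nth0 l i" for i by (rule partition_nth0_mono[OF l]) simp
    have mono_a: "?a (Suc i) \<le> ?a i" for i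
    proof (rule ccontr)
      assume "\<not> ?thesis"
      then have "?a i < ?a (Suc i)" by simp
      then have "?P T (Suc i) (?a i)" using a by blast
      then have "?P T i (?a i)" using col[of "?a i" i] mono1[of i] by auto
      then show False using a by blast
    qed
    have dec: "?a j \<le> ?a i" if "i \<le> j" for i j
      using that
    proof (induction j rule: dec_induct)
      case (step n) then show ?case using mono_a[of n] by linarith
    qed simp
    note lp = list_of_props[of "length l" ?a, OF dec]
    have n: "nth0 (kap T) i = ?a i" for i
    proof (cases "i < length l")
      case False
      then have "nth0 l i = 0" by (simp add: nth0_def)
      then have "\<not> 0 < ?a i" unfolding a by simp
      then show ?thesis using lp(3) False by (simp add: kap_def)
    next
      case True
      then show ?thesis using lp(3)[of i] by (simp add: kap_def)
    qed
    have "nth0 l (Suc i) \<le> ?a i" for i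
    proof (rule ccontr)
      assume "\<not> ?thesis"
      then have "?a i < nth0 l (Suc i)" by simp
      then have "?P T i (?a i)" using col[of "?a i" i] le[of "?a i" "Suc i"] mono1[of i] by auto
      then show False using a by blast
    qed
    moreover have "?a i \<le> nth0 l i" for i using a[of "nth0 l i" i] by simp
    moreover have "partition (kap T)" unfolding kap_def by (rule lp(1))
    ultimately show ?thesis using a n by (simp add: hs_def)
  qed
  have "(\<Sum>T\<in>ssyt l (Suc N). \<Phi> T) = (\<Sum>(k, S)\<in>Sigma (hs l) (\<lambda>k. ssyt k N). \<Phi> (add_letter l N k S))"
  proof (rule sum.reindex_bij_witness[of _ "\<lambda>(k, S). add_letter l N k S" "\<lambda>T. (kap T, restrict T (cells (kap T)))"])
    fix T assume T: "T \<in> ssyt l (Suc N)"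
    have kp: "partition (kap T)" and kn: "\<And>i j. j < nth0 (kap T) i \<longleftrightarrow> ?P T i j" and kh: "kap T \<in> hs l"
      using key[OF T] by auto
    have mk: "(i, j) \<in> cells (kap T) \<longleftrightarrow> (i, j) \<in> cells l \<and> T (i, j) < N" for i j
      by (simp add: mem_cells[OF kp] mem_cells[OF l] kn)
    have ran: "T c < Suc N" if "c \<in> cells l" for c using ssyt_less[OF T that] .
    have ext: "T c = undefined" if "c \<notin> cells l" for c using ssyt_undefined[OF T that] .
    have e: "add_letter l N (kap T) (restrict T (cells (kap T))) = T"
    proof
      fix c :: "nat \<times> nat"
      obtain i j where c: "c = (i, j)" by (cases c)
      show "add_letter l N (kap T) (restrict T (cells (kap T))) c = T c"
        using ran[of c] ext[of c] by (auto simp: add_letter_def c mk)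
    qed
    then show "(case (kap T, restrict T (cells (kap T))) of (k, S) \<Rightarrow> add_letter l N k S) = T" by simp
    show "(case (kap T, restrict T (cells (kap T))) of (k, S) \<Rightarrow> \<Phi> (add_letter l N k S)) = \<Phi> T"
      by (simp add: e)
    have "restrict T (cells (kap T)) \<in> ssyt (kap T) N"
      unfolding ssyt_def mem_Collect_eq
    proof (intro conjI allI impI)
      show "restrict T (cells (kap T)) \<in> cells (kap T) \<rightarrow>\<^sub>E {..<N}" using mk by auto
    next
      fix i j assume "(i, j + 1) \<in> cells (kap T)"
      moreover from this have "(i, j) \<in> cells (kap T)" by (simp add: mem_cells[OF kp])
      ultimately show "restrict T (cells (kap T)) (i, j) \<le> restrict T (cells (kap T)) (i, j + 1)"
        using ssyt_row[OF T, of i j] mk by simp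
    next
      fix i j assume *: "(i + 1, j) \<in> cells (kap T)"
      moreover have "nth0 (kap T) (i + 1) \<le> nth0 (kap T) i" by (rule partition_nth0_mono[OF kp]) simp
      moreover from calculation have "(i, j) \<in> cells (kap T)" by (simp add: mem_cells[OF kp])
      ultimately show "restrict T (cells (kap T)) (i, j) < restrict T (cells (kap T)) (i + 1, j)"
        using ssyt_col[OF T, of i j] mk by simp
    qed
    with kh show "(kap T, restrict T (cells (kap T))) \<in> Sigma (hs l) (\<lambda>k. ssyt k N)" by simp
  next
    fix kS assume "kS \<in> Sigma (hs l) (\<lambda>k. ssyt k N)"
    then obtain k S where kS: "kS = (k, S)" and k: "k \<in> hs l" and S: "S \<in> ssyt k N" by auto
    then have kp: "partition k" and b: "\<And>i. nth0 l (Suc i) \<le> nth0 k i" "\<And>i. nth0 k i \<le> nth0 l i"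
      by (auto simp: hs_def)
    let ?T = "add_letter l N k S"
    have sub: "c \<in> cells l" if "c \<in> cells k" for c
      using that b(2)[of "fst c"] by (cases c) (auto simp: mem_cells[OF kp] mem_cells[OF l])
    have ran: "S c < N" if "c \<in> cells k" for c using ssyt_less[OF S that] .
    have T: "?T \<in> ssyt l (Suc N)"
      unfolding ssyt_def mem_Collect_eq
    proof (intro conjI allI impI)
      show "?T \<in> cells l \<rightarrow>\<^sub>E {..<Suc N}" using ran sub
        by (auto simp: add_letter_def less_Suc_eq)
    next
      fix i j assume *: "(i, j + 1) \<in> cells l"
      show "?T (i, j) \<le> ?T (i, j + 1)"
      proof (cases "(i, j + 1) \<in> cells k")
        case True
        moreover from this have "(i, j) \<in> cells k" by (simp add: mem_cells[OF kp])
        ultimately show ?thesis using ssyt_row[OF S, of i j] by (simp add: add_letter_def)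
      next
        case False
        moreover have "(i, j) \<in> cells l" using * by (simp add: mem_cells[OF l])
        ultimately show ?thesis using * ran[of "(i, j)"] by (auto simp: add_letter_def)
      qed
    next
      fix i j assume *: "(i + 1, j) \<in> cells l"
      then have kij: "(i, j) \<in> cells k" using b(1)[of i] by (simp add: mem_cells[OF kp] mem_cells[OF l])
      show "?T (i, j) < ?T (i + 1, j)"
      proof (cases "(i + 1, j) \<in> cells k")
        case True
        then show ?thesis using ssyt_col[OF S, of i j] kij by (simp add: add_letter_def)
      next
        case False
        then show ?thesis using * kij ran[of "(i, j)"] by (auto simp: add_letter_def)
      qed
    qed
    then show "(case kS of (k, S) \<Rightarrow> add_letter l N k S) \<in> ssyt l (Suc N)" by (simp add: kS)
    have "j < nth0 (kap ?T) i \<longleftrightarrow> j < nth0 k i" for i j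
      using key[OF T] ran[of "(i, j)"] sub[of "(i, j)"]
      by (auto simp: add_letter_def mem_cells[OF kp] mem_cells[OF l])
    then have "nth0 (kap ?T) i = nth0 k i" for i by (metis linorder_neqE_nat less_irrefl)
    then have e: "kap ?T = k" using key[OF T] by (intro nth0_eqI[OF _ kp]) auto
    have "restrict ?T (cells k) = S"
      using ssyt_undefined[OF S] by (intro ext) (auto simp: add_letter_def)
    with e show "(kap (case kS of (k, S) \<Rightarrow> add_letter l N k S),
         restrict (case kS of (k, S) \<Rightarrow> add_letter l N k S) (cells (kap (case kS of (k, S) \<Rightarrow> add_letter l N k S)))) = kS"
      by (simp add: kS)
  qed
  also have "\<dots> = (\<Sum>k\<in>hs l. \<Sum>S\<in>ssyt k N. \<Phi> (add_letter l N k S))"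
    by (rule sum.Sigma[symmetric]) (auto simp: finite_hs[OF l])
  finally show ?thesis .
qed

lemma cells_hs:
  assumes "partition l" "k \<in> hs l" shows "cells k \<subseteq> cells l"
proof (rule subrelI)
  fix i j assume "(i, j) \<in> cells k"
  moreover have "partition k" "nth0 k i \<le> nth0 l i" using assms(2) by (auto simp: hs_def)
  ultimately show "(i, j) \<in> cells l" by (simp add: mem_cells assms(1))
qed

lemma card_filter_eq_sum: "finite A \<Longrightarrow> card {x\<in>A. P x} = (\<Sum>x\<in>A. if P x then 1 else 0)"
  unfolding card_eq_sum by (rule sum.inter_filter)

lemma ssyt_0: "partition l \<Longrightarrow> ssyt l 0 = (if l = [] then {\<lambda>_. undefined} else {})"
proof -
  assume l: "partition l"
  show ?thesis
  proof (cases "l = []")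
    case True then show ?thesis by (auto simp: ssyt_def cells_def)
  next
    case False
    then have "(0, 0) \<in> cells l" using partition_nth0_pos[OF l, of 0] by (simp add: mem_cells[OF l])
    then show ?thesis using False by (auto simp: ssyt_def PiE_def Pi_def)
  qed
qed

lemma ip_1: "ip F 1 = lookup F {#}"
  using ip_single[of "{#}" 1 F] ip_commute[of F 1] by (simp add: zz_def)

lemma lookup_homog_empty: "homog n F \<Longrightarrow> n \<noteq> 0 \<Longrightarrow> lookup F {#} = 0"
  by (auto simp: homog_def)

lemma sum_list_partition_eq_0: "partition l \<Longrightarrow> sum_list l = 0 \<longleftrightarrow> l = []"
  by (cases l) (auto simp: partition_def)

lemma sch_Nil [simp]: "sch [] = 1"
  by (simp add: sch_def sN_def dt_def sign_id)

lemma lookup_sch_empty: "partition l \<Longrightarrow> lookup (sch l) {#} = (if l = [] then 1 else 0)"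
  using lookup_homog_empty[OF homog_sch, of l] sum_list_partition_eq_0[of l]
  by (cases "l = []") (auto simp: lookup_one)

text \<open>The value 0 at k = 0 matches \<open>transl\<close>, which leaves p_0 alone; otherwise
  \<open>evl_psv_snoc\<close> would fail on p_0.\<close>

definition psv :: "'a::comm_ring_1 list \<Rightarrow> nat \<Rightarrow> 'a" where
  "psv zs k = (if k = 0 then 0 else (\<Sum>z\<leftarrow>zs. z ^ k))"

lemma rhom_poly: "rhom (\<lambda>P. poly P x)" by (simp add: rhom_def)

lemma evl_psv_snoc: "evl (psv (zs @ [z])) F = evl (psv zs) (poly (tau F) (Co z))"
  for F :: "'a::field_char_0 sym"
proof (rule rhom_ext[OF rhom_evl])
  show "rhom (\<lambda>F. evl (psv zs) (poly (tau F) (Co z)))"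
    using rhom_comp[OF rhom_comp[OF rhom_evl rhom_poly] rhom_transl] .
  have "Co z ^ k = Co (z ^ k)" for k by (induction k) (auto simp: Co_mult)
  then show "evl (psv (zs @ [z])) (pp k) = evl (psv zs) (poly (tau (pp k)) (Co z))" for k
    by (simp add: transl_pp psv_def poly_monom rhom_add[OF rhom_evl] rhom_0[OF rhom_evl])
qed simp

lemma evl_zero: "evl (\<lambda>_. 0) F = lookup F {#}" for F :: "'a::comm_ring_1 sym"
proof (induction F rule: sym_induct)
  case (pp k F) then show ?case by (simp add: rhom_mult[OF rhom_evl] lookup_pp_mult)
qed (auto simp: lookup_Co rhom_add[OF rhom_evl] lookup_add)

text \<open>Appending a variable z splits tableaux according to their largest letter and splits the
  determinant through \<open>tau_sch\<close> at x = z; the two recursions agree.\<close>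

lemma schur_eval_sch:
  "partition l \<Longrightarrow> schur_eval l zs = evl (psv zs) (sch l :: 'a::field_char_0 sym)"
proof (induction zs arbitrary: l rule: rev_induct)
  case Nil
  have "psv [] = (\<lambda>_. 0 :: 'a)" by (auto simp: psv_def fun_eq_iff)
  then have "evl (psv []) (sch l :: 'a sym) = (if l = [] then 1 else 0)"
    by (simp add: evl_zero lookup_sch_empty[OF Nil])
  then show ?case by (simp add: schur_eval_def ssyt_0[OF Nil] cells_def)
next
  case (snoc z zs)
  note l = snoc(2)
  let ?N = "length zs"
  have "schur_eval l (zs @ [z]) = (\<Sum>T\<in>ssyt l (Suc ?N). \<Prod>c\<in>cells l. (zs @ [z]) ! T c)"
    by (simp add: schur_eval_def)
  also have "\<dots> = (\<Sum>k\<in>hs l. \<Sum>S\<in>ssyt k ?N. \<Prod>c\<in>cells l. (zs @ [z]) ! add_letter l ?N k S c)"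
    by (rule sum_ssyt_Suc[OF l])
  also have "\<dots> = (\<Sum>k\<in>hs l. \<Sum>S\<in>ssyt k ?N. z ^ (sum_list l - sum_list k) * (\<Prod>c\<in>cells k. zs ! S c))"
  proof (intro sum.cong refl)
    fix k S assume k: "k \<in> hs l" and S: "S \<in> ssyt k ?N"
    note sub = cells_hs[OF l k]
    have "(\<Prod>c\<in>cells l. (zs @ [z]) ! add_letter l ?N k S c)
      = (\<Prod>c\<in>cells l - cells k. (zs @ [z]) ! add_letter l ?N k S c) * (\<Prod>c\<in>cells k. (zs @ [z]) ! add_letter l ?N k S c)"
      by (rule prod.subset_diff[OF sub]) simp
    also have "(\<Prod>c\<in>cells l - cells k. (zs @ [z]) ! add_letter l ?N k S c) = (\<Prod>c\<in>cells l - cells k. z)"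
      by (rule prod.cong) (auto simp: add_letter_def)
    also have "\<dots> = z ^ (sum_list l - sum_list k)"
      using card_Diff_subset[OF _ sub] by (simp add: card_cells)
    also have "(\<Prod>c\<in>cells k. (zs @ [z]) ! add_letter l ?N k S c) = (\<Prod>c\<in>cells k. zs ! S c)"
      by (rule prod.cong) (use ssyt_less[OF S] in \<open>auto simp: add_letter_def nth_append\<close>)
    finally show "(\<Prod>c\<in>cells l. (zs @ [z]) ! add_letter l ?N k S c)
      = z ^ (sum_list l - sum_list k) * (\<Prod>c\<in>cells k. zs ! S c)" .
  qed
  also have "\<dots> = (\<Sum>k\<in>hs l. z ^ (sum_list l - sum_list k) * schur_eval k zs)"
    by (simp add: schur_eval_def sum_distrib_left)
  also have "\<dots> = (\<Sum>k\<in>hs l. z ^ (sum_list l - sum_list k) * evl (psv zs) (sch k))"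
    by (intro sum.cong refl arg_cong2[where f="(*)"] snoc(1)) (auto simp: hs_def)
  also have "\<dots> = evl (psv zs) (poly (tau (sch l)) (Co z))"
  proof -
    have "Co z ^ k = Co (z ^ k)" for k by (induction k) (auto simp: Co_mult)
    then show ?thesis
      by (simp add: tau_sch[OF l] poly_sum poly_monom rhom_sum[OF rhom_evl] rhom_mult[OF rhom_evl]
          mult.commute[of "z ^ _"])
  qed
  finally show ?case by (simp add: evl_psv_snoc)
qed

lemma ip_sch_hh_mult:
  assumes l: "partition l"
  shows "ip (sch l) (hh r * G) = (\<Sum>k\<in>{k\<in>hs l. sum_list k + r = sum_list l}. ip (sch k) G)"
  using ip_hh_mult[of r G "sch l"] ip_commute[of "sch l" "hh r * G"]
    ip_commute[of G "coeff (tau (sch l)) r"]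
  by (simp add: coeff_tau_sch[OF l] ip_sum_left)

lemma hmu_snoc: "hmu (mu @ [r]) = hh r * hmu mu"
  by (simp add: hmu_def mult.commute)

text \<open>Induction on the last entry r of the content: the cells with the largest letter form a
  horizontal strip of size r, which is also what skewing by h_r removes.\<close>

lemma kostka_ip: "partition l \<Longrightarrow> of_nat (kostka l mu) = ip (sch l) (hmu mu :: 'a::field_char_0 sym)"
proof (induction mu arbitrary: l rule: rev_induct)
  case Nil
  then show ?case by (simp add: kostka_def ssyt_0 hmu_def ip_1 lookup_sch_empty)
next
  case (snoc r mu)
  note l = snoc(2)
  let ?N = "length mu"
  let ?Q = "\<lambda>k mu S. \<forall>a<length mu. card {c\<in>cells k. S c = a} = mu ! a"
  have "kostka l (mu @ [r]) = (\<Sum>T\<in>ssyt l (Suc ?N). if ?Q l (mu @ [r]) T then 1 else 0)"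
    unfolding kostka_def by (subst card_filter_eq_sum) auto
  also have "\<dots> = (\<Sum>k\<in>hs l. \<Sum>S\<in>ssyt k ?N. if ?Q l (mu @ [r]) (add_letter l ?N k S) then 1 else 0)"
    by (rule sum_ssyt_Suc[OF l])
  also have "\<dots> = (\<Sum>k\<in>hs l. \<Sum>S\<in>ssyt k ?N. if sum_list k + r = sum_list l \<and> ?Q k mu S then 1 else 0)"
  proof (intro sum.cong refl if_cong)
    fix k S assume k: "k \<in> hs l" and S: "S \<in> ssyt k ?N"
    note sub = cells_hs[OF l k]
    have ran: "S c < ?N" if "c \<in> cells k" for c using ssyt_less[OF S that] .
    have "{c\<in>cells l. add_letter l ?N k S c = ?N} = cells l - cells k"
      using sub by (auto simp: add_letter_def dest: ran)
    then have 1: "card {c\<in>cells l. add_letter l ?N k S c = ?N} = sum_list l - sum_list k"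
      using card_Diff_subset[OF _ sub] by (simp add: card_cells)
    have 2: "{c\<in>cells l. add_letter l ?N k S c = a} = {c\<in>cells k. S c = a}" if "a < ?N" for a
      using that sub by (auto simp: add_letter_def split: if_splits)
    have le: "sum_list k \<le> sum_list l" using card_mono[OF _ sub] by (simp add: card_cells)
    have "?Q l (mu @ [r]) (add_letter l ?N k S) \<longleftrightarrow>
       (\<forall>a<?N. card {c\<in>cells l. add_letter l ?N k S c = a} = mu ! a) \<and>
       card {c\<in>cells l. add_letter l ?N k S c = ?N} = r"
      by (auto simp: nth_append less_Suc_eq)
    also have "\<dots> \<longleftrightarrow> sum_list k + r = sum_list l \<and> ?Q k mu S"
      unfolding 1 using le by (auto simp: 2)
    finally show "?Q l (mu @ [r]) (add_letter l ?N k S) = (sum_list k + r = sum_list l \<and> ?Q k mu S)" .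
  qed
  also have "\<dots> = (\<Sum>k\<in>hs l. if sum_list k + r = sum_list l then kostka k mu else 0)"
    unfolding kostka_def by (intro sum.cong refl) (auto simp: card_filter_eq_sum)
  also have "\<dots> = (\<Sum>k\<in>{k\<in>hs l. sum_list k + r = sum_list l}. kostka k mu)"
    by (simp add: sum.inter_filter finite_hs[OF l])
  finally have "of_nat (kostka l (mu @ [r])) = (\<Sum>k\<in>{k\<in>hs l. sum_list k + r = sum_list l}. of_nat (kostka k mu) :: 'a)"
    by simp
  also have "\<dots> = (\<Sum>k\<in>{k\<in>hs l. sum_list k + r = sum_list l}. ip (sch k) (hmu mu :: 'a sym))"
    by (rule sum.cong[OF refl]) (auto simp: hs_def intro!: snoc(1))
  finally show ?case by (simp add: hmu_snoc ip_sch_hh_mult[OF l])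
qed

lemma dom_le_length:
  assumes "partition k" "dom_le mu k" shows "length k \<le> length mu"
proof (rule ccontr)
  assume "\<not> ?thesis"
  then have "nth0 k (length mu) > 0" using partition_nth0_pos[OF assms(1)] by simp
  moreover have "sum_list (take (length mu) k) + nth0 k (length mu) = sum_list (take (Suc (length mu)) k)"
    by (simp add: sum_take_nth0)
  moreover have "sum_list (take (Suc (length mu)) k) \<le> sum_list k"
    by (metis append_take_drop_id le_add1 sum_list_append)
  moreover have "sum_list (take (length mu) mu) \<le> sum_list (take (length mu) k)" "sum_list mu = sum_list k"
    using assms(2) unfolding dom_le_def by blast+
  moreover have "sum_list (take (length mu) mu) = sum_list mu" by simp
  ultimately show False by linarith
qed

text \<open>Removing the last entry of mu strips a horizontal strip from l and leaves some k
  dominating the shorter mu. Rows only shrink, which settles the early partial sums; l has at most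
  one row more than k, which settles the others.\<close>

lemma ip_sch_hmu_nonzero: "partition l \<Longrightarrow> ip (sch l) (hmu mu) \<noteq> (0 :: 'a::field_char_0) \<Longrightarrow> dom_le mu l"
proof (induction mu arbitrary: l rule: rev_induct)
  case Nil
  then show ?case by (simp add: hmu_def ip_1 lookup_sch_empty split: if_splits)
next
  case (snoc r mu)
  then have "(\<Sum>k\<in>{k\<in>hs l. sum_list k + r = sum_list l}. ip (sch k) (hmu mu :: 'a sym)) \<noteq> 0"
    by (simp add: hmu_snoc ip_sch_hh_mult)
  then obtain k where "k \<in> {k\<in>hs l. sum_list k + r = sum_list l}" "ip (sch k) (hmu mu :: 'a sym) \<noteq> 0"
    by (rule sum.not_neutral_contains_not_neutral)
  then have k: "k \<in> hs l" "sum_list k + r = sum_list l" "ip (sch k) (hmu mu :: 'a sym) \<noteq> 0" by auto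
  then have d: "dom_le mu k" and kp: "partition k" using snoc(1)[of k] by (auto simp: hs_def)
  have "sum_list (take j (mu @ [r])) \<le> sum_list (take j l)" for j
  proof (cases "j \<le> length mu")
    case True
    then have "sum_list (take j (mu @ [r])) \<le> sum_list (take j k)" using d by (simp add: dom_le_def)
    also have "\<dots> \<le> sum_list (take j l)" using k(1) by (auto simp: sum_take_nth0 hs_def intro: sum_mono)
    finally show ?thesis .
  next
    case False
    have len: "length k \<le> length mu" by (rule dom_le_length[OF kp d])
    have "length l \<le> Suc (length k)"
    proof (rule ccontr)
      assume "\<not> ?thesis"
      then have "nth0 l (Suc (length k)) > 0" using partition_nth0_pos[OF snoc(2)] by simp
      moreover have "nth0 l (Suc (length k)) \<le> nth0 k (length k)" using k(1) by (auto simp: hs_def)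
      ultimately show False by (simp add: nth0_def)
    qed
    then have "length l \<le> j" using len False by simp
    then show ?thesis using k(2) d False by (simp add: dom_le_def)
  qed
  moreover have "sum_list (mu @ [r]) = sum_list l" using d k(2) by (simp add: dom_le_def)
  ultimately show ?case by (simp add: dom_le_def)
qed

lemma partition_butlast: "partition (l @ [r]) \<Longrightarrow> partition l"
  by (auto simp: partition_def sorted_wrt_append)

lemma ip_sch_hmu_self: "partition l \<Longrightarrow> ip (sch l) (hmu l) = (1 :: 'a::field_char_0)"
proof (induction l rule: rev_induct)
  case Nil then show ?case by (simp add: hmu_def ip_1)
next
  case (snoc r l)
  note lr = snoc(2)
  have l: "partition l" by (rule partition_butlast[OF lr])
  have nl: "nth0 (l @ [r]) i = (if i = length l then r else nth0 l i)" for i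
    by (auto simp: nth0_def nth_append)
  have "(\<Sum>k\<in>{k\<in>hs (l @ [r]). sum_list k + r = sum_list (l @ [r])}. ip (sch k) (hmu l :: 'a sym))
     = (\<Sum>k\<in>{l}. ip (sch k) (hmu l))"
  proof (rule sum.mono_neutral_right)
    show "finite {k \<in> hs (l @ [r]). sum_list k + r = sum_list (l @ [r])}" using finite_hs[OF lr] by simp
    have "nth0 (l @ [r]) (Suc i) \<le> nth0 l i \<and> nth0 l i \<le> nth0 (l @ [r]) i" for i
    proof
      have a: "nth0 (l @ [r]) (Suc i) \<le> nth0 (l @ [r]) i" by (rule partition_nth0_mono[OF lr]) simp
      show "nth0 (l @ [r]) (Suc i) \<le> nth0 l i"
      proof (cases "i = length l")
        case True then show ?thesis by (simp add: nth0_def)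
      next
        case False then show ?thesis using a nl[of i] by simp
      qed
      show "nth0 l i \<le> nth0 (l @ [r]) i" by (auto simp: nth0_def nth_append)
    qed
    then show "{l} \<subseteq> {k \<in> hs (l @ [r]). sum_list k + r = sum_list (l @ [r])}" using l by (simp add: hs_def)
    show "\<forall>k\<in>{k \<in> hs (l @ [r]). sum_list k + r = sum_list (l @ [r])} - {l}. ip (sch k) (hmu l) = (0::'a)"
    proof (rule ballI, rule ccontr)
      fix k assume k: "k \<in> {k \<in> hs (l @ [r]). sum_list k + r = sum_list (l @ [r])} - {l}"
        and nz: "ip (sch k) (hmu l) \<noteq> (0::'a)"
      have kp: "partition k" using k by (auto simp: hs_def)
      have d: "dom_le l k" by (rule ip_sch_hmu_nonzero[OF kp nz])
      have len: "length k \<le> length l" by (rule dom_le_length[OF kp d])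
      have le: "nth0 k i \<le> nth0 l i" for i
      proof (cases "i < length l")
        case True
        have "nth0 k i \<le> nth0 (l @ [r]) i" using k by (auto simp: hs_def)
        then show ?thesis using nl[of i] True by simp
      next
        case False then show ?thesis using len by (simp add: nth0_def)
      qed
      have "dom_le k l" using le d by (auto simp: dom_le_def sum_take_nth0 intro: sum_mono)
      then show False using dom_le_antisym[OF kp l _ d] k by simp
    qed
  qed
  then show ?case using snoc l by (simp add: hmu_snoc ip_sch_hh_mult[OF lr])
qed

lemma sch_expand:
  assumes l: "partition l" and N: "length l \<le> N"
  shows "sch l = (\<Sum>p | p permutes {..<N}. of_int (sign p) * (\<Prod>i<N. hi (int (nth0 l i) - int i + int (p i))))"
  by (simp add: sch_sN[OF N] sN_def dt_def)

lemma ip_prod_hi_nonzero: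
  assumes l: "partition l" and p: "p permutes {..<N}" and N: "length l \<le> N" and m: "partition m"
    and nz: "ip (sch m) (\<Prod>i<N. hi (int (nth0 l i) - int i + int (p i))) \<noteq> (0 :: 'a::field_char_0)"
  shows "dom_le l m" "m = l \<Longrightarrow> p = id"
proof -
  have "\<not> (\<exists>i<N. int (nth0 l i) - int i + int (p i) < 0)"
  proof
    assume "\<exists>i<N. int (nth0 l i) - int i + int (p i) < 0"
    then have "(\<Prod>i<N. hi (int (nth0 l i) - int i + int (p i)) :: 'a sym) = 0"
      by (intro prod_zero) (auto intro: hi_neg)
    with nz show False by simp
  qed
  then obtain k where k: "k \<in> partitions (sum_list l)" "dom_le l k" "k = l \<longrightarrow> p = id"
      "(\<Prod>i<N. hi (int (nth0 l i) - int i + int (p i))) = (hmu k :: 'a sym)"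
    using prod_hi_cases[OF l p N, where 'a='a] by blast
  have km: "dom_le k m" by (rule ip_sch_hmu_nonzero[OF m]) (use nz k(4) in simp)
  show "dom_le l m" by (rule dom_le_trans[OF k(2) km])
  show "p = id" if "m = l"
    using dom_le_antisym[of k l] k km that l by (auto simp: partitions_def)
qed

lemma ip_sch_sch_dom:
  assumes "partition l" "partition m" "ip (sch m) (sch l) \<noteq> (0 :: 'a::field_char_0)"
  shows "dom_le l m"
proof -
  have "(\<Sum>p | p permutes {..<length l}. of_int (sign p) *
     ip (sch m) (\<Prod>i<length l. hi (int (nth0 l i) - int i + int (p i)) :: 'a sym)) \<noteq> 0"
    using assms(3) by (simp add: sch_expand[OF assms(1) order_refl] ip_sum_right ip_of_int_right)
  then obtain p where "p \<in> {p. p permutes {..<length l}}" "of_int (sign p) *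
    ip (sch m) (\<Prod>i<length l. hi (int (nth0 l i) - int i + int (p i)) :: 'a sym) \<noteq> 0"
    by (rule sum.not_neutral_contains_not_neutral)
  then have "p permutes {..<length l}"
    "ip (sch m) (\<Prod>i<length l. hi (int (nth0 l i) - int i + int (p i)) :: 'a sym) \<noteq> 0" by auto
  then show ?thesis by (intro ip_prod_hi_nonzero(1)[OF assms(1) _ order_refl assms(2)])
qed

lemma id_permutes: "id permutes S" by (rule permutes_id)

text \<open>Expanding one factor by Jacobi-Trudi forces dominance in one direction, symmetry of the
  pairing forces the other. On the diagonal only the identity permutation contributes, through <s_l,
  h_l> = 1.\<close>

lemma ip_sch_sch:
  assumes l: "partition l" and m: "partition m"
  shows "ip (sch l) (sch m) = (if l = m then 1 else 0 :: 'a::field_char_0)"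
proof (cases "l = m")
  case False
  have "ip (sch l) (sch m) = (0::'a)"
  proof (rule ccontr)
    assume nz: "\<not> ?thesis"
    then have "dom_le m l" by (intro ip_sch_sch_dom[OF m l])
    moreover have "dom_le l m" using nz by (intro ip_sch_sch_dom[OF l m]) (simp add: ip_commute)
    ultimately show False using dom_le_antisym[OF l m] False by simp
  qed
  then show ?thesis using False by simp
next
  case True
  let ?h = "\<lambda>p. \<Prod>i<length l. hi (int (nth0 l i) - int i + int (p i)) :: 'a sym"
  have "ip (sch l) (sch l) = (\<Sum>p | p permutes {..<length l}. of_int (sign p) * ip (sch l) (?h p))"
    by (subst (2) sch_expand[OF l order_refl]) (simp add: ip_sum_right ip_of_int_right)
  also have "\<dots> = (\<Sum>p\<in>{id}. of_int (sign p) * ip (sch l) (?h p))"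
  proof (rule sum.mono_neutral_right[OF finite_perms])
    show "\<forall>p\<in>{p. p permutes {..<length l}} - {id}. of_int (sign p) * ip (sch l) (?h p) = 0"
    proof
      fix p assume p: "p \<in> {p. p permutes {..<length l}} - {id}"
      then have "ip (sch l) (?h p) = 0" using ip_prod_hi_nonzero(2)[OF l _ order_refl l, of p, where 'a='a] by auto
      then show "of_int (sign p) * ip (sch l) (?h p) = 0" by simp
    qed
  qed (auto simp: id_permutes)
  also have "\<dots> = 1"
    using ip_sch_hmu_self[OF l, where 'a='a] by (simp add: sign_id hmu_nth0[OF order_refl])
  finally show ?thesis using True by simp
qed

section \<open>Passage between Schur coefficient functions and elements of the ring\<close>

section \<open>Schur coordinates\<close>

lemma partitions_iff: "l \<in> partitions n \<longleftrightarrow> partition l \<and> sum_list l = n"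
  by (simp add: partitions_def)

text \<open>Products of the h_n span: Newton's identity trades p_k for k h_k and products p_j
  h_(k-j) with j < k, which lowers the degree of the power sum part until only complete functions
  remain.\<close>

lemma ip_hmu_complete:
  fixes F :: "'a::field_char_0 sym"
  assumes F: "homog n F" and z: "\<And>l. l \<in> partitions n \<Longrightarrow> ip F (hmu l) = 0"
  shows "F = 0"
proof -
  have z': "ip F (hmu l) = 0" if "sum_list l = n" for l
  proof -
    let ?k = "rev (sort (filter (\<lambda>x. x > 0) l))"
    have "hmu (filter (\<lambda>x. x > 0) l) = (hmu l :: 'a sym)" for l
      by (induction l) (auto simp: hmu_def)
    moreover have "hmu ?k = (hmu (filter (\<lambda>x. x > 0) l) :: 'a sym)" by (simp add: hmu_mset)
    moreover have "sum_list ?k = n"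
    proof -
      have "sum_list ?k = sum_list (filter (\<lambda>x. x > 0) l)" by (simp flip: sum_mset_sum_list)
      also have "sum_list (filter (\<lambda>x. x > 0) l) = sum_list l" for l :: "nat list" by (induction l) auto
      finally show ?thesis using that by simp
    qed
    moreover have "partition ?k" by (auto simp: partition_def sorted_wrt_rev)
    ultimately show ?thesis using z[of ?k] by (simp add: partitions_iff)
  qed
  have main: "ip F (mon (mset rho) * hmu l) = 0" if "sum_list rho + sum_list l = n" "0 \<notin> set rho" for rho l
    using that
  proof (induction "sum_list rho" arbitrary: rho l rule: less_induct)
    case less
    show ?case
    proof (cases rho)
      case Nil
      then show ?thesis using z'[of l] less by simp
    next
      case (Cons k rho')
      then have k: "k \<ge> 1" using less.prems by (auto simp: Suc_le_eq)
      let ?G = "mon (mset rho') * hmu l :: 'a sym"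
      have "{1..k} = insert k {1..<k}" using k by auto
      then have "of_nat k * hh k = pp k + (\<Sum>j\<in>{1..<k}. pp j * hh (k - j) :: 'a sym)"
        using newt_hh[where 'a='a] unfolding newt_def by simp
      then have pk: "pp k = of_nat k * hh k - (\<Sum>j\<in>{1..<k}. pp j * hh (k - j) :: 'a sym)" by simp
      have "pp k * ?G = Co (of_nat k) * (mon (mset rho') * (hh k * hmu l))
         - (\<Sum>j\<in>{1..<k}. mon (mset (j # rho')) * (hh (k - j) * hmu l))"
        unfolding pk left_diff_distrib sum_distrib_right
        by (simp add: Co_of_nat mon_add_mset ac_simps)
      then have "ip F (pp k * ?G) = of_nat k * ip F (mon (mset rho') * hmu (k # l))
         - (\<Sum>j\<in>{1..<k}. ip F (mon (mset (j # rho')) * hmu ((k - j) # l)))"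
        by (simp add: ip_diff_right ip_sum_right ip_Co_right hmu_Cons)
      also have "ip F (mon (mset rho') * hmu (k # l)) = 0"
        using less.prems k Cons by (intro less.hyps) auto
      also have "(\<Sum>j\<in>{1..<k}. ip F (mon (mset (j # rho')) * hmu ((k - j) # l))) = 0"
        using less.prems k Cons by (intro sum.neutral ballI less.hyps) auto
      finally show ?thesis using Cons by (simp add: mon_add_mset mult.assoc)
    qed
  qed
  show ?thesis
  proof (rule poly_mapping_eqI)
    fix m
    show "lookup F m = lookup 0 m"
    proof (rule ccontr)
      assume nz: "lookup F m \<noteq> lookup 0 m"
      then have m: "0 \<notin># m" "sum_mset m = n" using F by (auto simp: homog_def)
      obtain rho where rho: "mset rho = m" using ex_mset by blast
      then have "ip F (mon m) = 0" using main[of rho "[]"] m by (auto simp: hmu_def simp flip: sum_mset_sum_list)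
      then have "zz m * lookup F m = 0" using ip_single[of m 1 F] ip_commute[of F "mon m"] by (simp add: mon_def)
      then show False using nz zz_nonzero[OF m(1), where 'a='a] by simp
    qed
  qed
qed

text \<open>By Jacobi-Trudi, s_l is h_l plus signed h_k with k strictly above l in dominance.
  Induction from the top of the order reduces the claim to \<open>ip_hmu_complete\<close>.\<close>

lemma ip_sch_complete:
  fixes F :: "'a::field_char_0 sym"
  assumes F: "homog n F" and z: "\<And>l. l \<in> partitions n \<Longrightarrow> ip F (sch l) = 0"
  shows "F = 0"
proof (rule ip_hmu_complete[OF F])
  fix l assume "l \<in> partitions n"
  then show "ip F (hmu l) = 0"
  proof (induction "card {k \<in> partitions n. dom_le l k}" arbitrary: l rule: less_induct)
    case less
    have l: "partition l" "sum_list l = n" using less.prems by (auto simp: partitions_iff)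
    let ?h = "\<lambda>p. \<Prod>i<length l. hi (int (nth0 l i) - int i + int (p i)) :: 'a sym"
    have hz: "ip F (?h p) = 0" if p: "p permutes {..<length l}" "p \<noteq> id" for p
    proof (cases "\<exists>i<length l. int (nth0 l i) - int i + int (p i) < 0")
      case True
      then have "?h p = 0" by (intro prod_zero) (auto intro: hi_neg)
      then show ?thesis by simp
    next
      case False
      then obtain k where k: "k \<in> partitions n" "dom_le l k" "k \<noteq> l" "?h p = hmu k"
        using prod_hi_cases[OF l(1) p(1) order_refl, where 'a='a] p(2) l(2) by blast
      then have kp: "partition k" by (simp add: partitions_iff)
      have "{k' \<in> partitions n. dom_le k k'} \<subset> {k' \<in> partitions n. dom_le l k'}"
      proof (rule psubsetI)
        show "{k' \<in> partitions n. dom_le k k'} \<subseteq> {k' \<in> partitions n. dom_le l k'}"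
          using dom_le_trans[OF k(2)] by auto
        have "l \<in> {k' \<in> partitions n. dom_le l k'}" "l \<notin> {k' \<in> partitions n. dom_le k k'}"
          using less.prems dom_le_antisym[OF kp l(1) _ k(2)] k(3) by auto
        then show "{k' \<in> partitions n. dom_le k k'} \<noteq> {k' \<in> partitions n. dom_le l k'}" by blast
      qed
      then have "card {k' \<in> partitions n. dom_le k k'} < card {k' \<in> partitions n. dom_le l k'}"
        by (intro psubset_card_mono) (auto simp: finite_partitions)
      then show ?thesis using less.hyps[of k] k by simp
    qed
    have "0 = ip F (sch l)" using z[OF less.prems] by simp
    also have "\<dots> = (\<Sum>p | p permutes {..<length l}. of_int (sign p) * ip F (?h p))"
      by (simp add: sch_expand[OF l(1) order_refl] ip_sum_right ip_of_int_right)
    also have "\<dots> = (\<Sum>p\<in>{id}. of_int (sign p) * ip F (?h p))"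
      by (rule sum.mono_neutral_right[OF finite_perms]) (auto simp: id_permutes hz)
    also have "\<dots> = ip F (hmu l)" by (simp add: sign_id hmu_nth0[OF order_refl])
    finally show ?case by simp
  qed
qed

text \<open>\<open>mk\<close> and \<open>sc\<close> are mutually inverse dictionaries between the
  Schur coefficient functions of the statement and homogeneous ring elements; by orthonormality
  \<open>sc\<close> can be read off as a pairing.\<close>

definition mk :: "nat \<Rightarrow> (nat list \<Rightarrow> 'a) \<Rightarrow> 'a::field_char_0 sym" where
  "mk n f = (\<Sum>l\<in>partitions n. Co (f l) * sch l)"

definition sc :: "nat \<Rightarrow> 'a::field_char_0 sym \<Rightarrow> nat list \<Rightarrow> 'a" where
  "sc n F l = (if l \<in> partitions n then ip F (sch l) else 0)"

lemma homog_mk: "homog n (mk n f)"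
  unfolding mk_def by (intro homog_sum homog_Co) (use homog_sch in \<open>auto simp: partitions_iff\<close>)

lemma ip_mk_sch: "l \<in> partitions n \<Longrightarrow> ip (mk n f) (sch l) = f l"
proof -
  assume l: "l \<in> partitions n"
  have "ip (mk n f) (sch l) = (\<Sum>k\<in>partitions n. if k = l then f k else 0)"
    unfolding mk_def ip_sum_left
    by (rule sum.cong) (use l in \<open>auto simp: ip_Co_left ip_sch_sch partitions_iff\<close>)
  then show ?thesis using l by (simp add: finite_partitions)
qed

lemma sc_mk: "supp_on n f \<Longrightarrow> sc n (mk n f) = f"
  by (auto simp: sc_def ip_mk_sch supp_on_def fun_eq_iff)

lemma mk_sc:
  assumes "homog n F" shows "mk n (sc n F) = F"
proof -
  have "F - mk n (sc n F) = 0"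
    by (rule ip_sch_complete[of n]) (auto simp: homog_diff assms homog_mk ip_diff_left ip_mk_sch sc_def)
  then show ?thesis by simp
qed

lemma supp_on_sc: "supp_on n (sc n F)" by (auto simp: supp_on_def sc_def)

lemma sc_inj: "homog n F \<Longrightarrow> homog n G \<Longrightarrow> sc n F = sc n G \<Longrightarrow> F = G"
  by (metis mk_sc)

lemma ip_mk_hmu: "ip (mk n f) (hmu mu) = (\<Sum>l\<in>partitions n. f l * of_nat (kostka l mu))"
  unfolding mk_def ip_sum_left by (rule sum.cong) (auto simp: ip_Co_left kostka_ip partitions_iff)

lemma der_hmu:
  assumes k: "k \<ge> 1"
  shows "der k (hmu mu :: 'a::field_char_0 sym) =
    (\<Sum>j\<in>{j. j < length mu \<and> k \<le> mu ! j}. hmu (mu[j := mu ! j - k]))"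
proof (induction mu)
  case Nil
  have "der k (Co 1) = (0 :: 'a sym)" by (rule der_Co)
  then show ?case by (simp add: hmu_def)
next
  case (Cons x mu)
  let ?J = "{j. j < length mu \<and> k \<le> mu ! j}"
  have J: "{j. j < length (x # mu) \<and> k \<le> (x # mu) ! j} = (if k \<le> x then {0} else {}) \<union> Suc ` ?J"
    by (auto simp: less_Suc_eq_0_disj nth_Cons' image_iff split: if_splits)
  have "der k (hmu (x # mu) :: 'a sym) = der k (hh x) * hmu mu + hh x * (\<Sum>j\<in>?J. hmu (mu[j := mu ! j - k]))"
    by (simp add: hmu_Cons der_mult Cons)
  also have "\<dots> = (\<Sum>j\<in>(if k \<le> x then {0} else {}). hmu ((x # mu)[j := (x # mu) ! j - k]))
     + (\<Sum>j\<in>Suc ` ?J. hmu ((x # mu)[j := (x # mu) ! j - k]))"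
    by (auto simp: der_hh[OF k] hmu_Cons sum.reindex sum_distrib_left)
  also have "\<dots> = (\<Sum>j\<in>(if k \<le> x then {0} else {}) \<union> Suc ` ?J. hmu ((x # mu)[j := (x # mu) ! j - k]))"
    by (rule sum.union_disjoint[symmetric]) auto
  finally show ?case unfolding J .
qed

lemma psum_mono_snoc:
  "psum_mono (rho @ [k]) mu = (\<Sum>j\<in>{j. j < length mu \<and> k \<le> mu ! j}. psum_mono rho (mu[j := mu ! j - k]))"
proof -
  let ?n = "length rho" and ?M = "length mu"
  let ?Q = "\<lambda>rho mu f. \<forall>j<length mu. (\<Sum>i\<in>{i. i < length rho \<and> f i = j}. rho ! i) = mu ! j"
  have fin: "finite ({..<a} \<rightarrow>\<^sub>E {..<b::nat})" for a b :: nat by (auto intro!: finite_PiE)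
  have sm: "(\<Sum>i\<in>{i. i < length (rho @ [k]) \<and> (f(?n := y)) i = j}. (rho @ [k]) ! i)
     = (\<Sum>i\<in>{i. i < ?n \<and> f i = j}. rho ! i) + (if y = j then k else 0)" for f y j
  proof -
    have "{i. i < length (rho @ [k]) \<and> (f(?n := y)) i = j} = {i. i < ?n \<and> f i = j} \<union> (if y = j then {?n} else {})"
      by (auto simp: less_Suc_eq)
    then have "(\<Sum>i\<in>{i. i < length (rho @ [k]) \<and> (f(?n := y)) i = j}. (rho @ [k]) ! i)
      = (\<Sum>i\<in>{i. i < ?n \<and> f i = j}. (rho @ [k]) ! i) + (\<Sum>i\<in>(if y = j then {?n} else {}). (rho @ [k]) ! i)"
      by (simp only:) (rule sum.union_disjoint, auto)
    then show ?thesis by (simp add: nth_append)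
  qed
  have Q: "?Q (rho @ [k]) mu (f(?n := y)) \<longleftrightarrow> k \<le> mu ! y \<and> ?Q rho (mu[y := mu ! y - k]) f" if "y < ?M" for f y
    unfolding sm using that by (auto simp: nth_list_update)
  have "psum_mono (rho @ [k]) mu = (\<Sum>f\<in>{..<Suc ?n} \<rightarrow>\<^sub>E {..<?M}. if ?Q (rho @ [k]) mu f then 1 else 0)"
    unfolding psum_mono_def by (subst card_filter_eq_sum) (auto simp: fin)
  also have "{..<Suc ?n} \<rightarrow>\<^sub>E {..<?M} = (\<lambda>(y, f). f(?n := y)) ` ({..<?M} \<times> ({..<?n} \<rightarrow>\<^sub>E {..<?M}))"
    by (simp add: lessThan_Suc PiE_insert_eq)
  also have "(\<Sum>f\<in>\<dots>. if ?Q (rho @ [k]) mu f then 1 else 0)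
     = (\<Sum>(y, f)\<in>{..<?M} \<times> ({..<?n} \<rightarrow>\<^sub>E {..<?M}). if ?Q (rho @ [k]) mu (f(?n := y)) then 1 else 0 :: nat)"
  proof -
    have "inj_on (\<lambda>(y, f). f(?n := y)) ({..<?M} \<times> ({..<?n} \<rightarrow>\<^sub>E {..<?M}))"
      by (rule inj_combinator) simp
    then show ?thesis by (subst sum.reindex) (simp_all only: comp_def case_prod_unfold)
  qed
  also have "\<dots> = (\<Sum>y<?M. \<Sum>f\<in>{..<?n} \<rightarrow>\<^sub>E {..<?M}. if ?Q (rho @ [k]) mu (f(?n := y)) then 1 else 0)"
    by (simp add: sum.cartesian_product)
  also have "\<dots> = (\<Sum>y<?M. if k \<le> mu ! y then psum_mono rho (mu[y := mu ! y - k]) else 0)"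
  proof (rule sum.cong[OF refl])
    fix y assume "y \<in> {..<?M}"
    then have y: "y < ?M" by simp
    show "(\<Sum>f\<in>{..<?n} \<rightarrow>\<^sub>E {..<?M}. if ?Q (rho @ [k]) mu (f(?n := y)) then 1 else 0)
      = (if k \<le> mu ! y then psum_mono rho (mu[y := mu ! y - k]) else 0)"
      unfolding Q[OF y] psum_mono_def by (subst card_filter_eq_sum) (auto simp: fin)
  qed
  also have "\<dots> = (\<Sum>j\<in>{y\<in>{..<?M}. k \<le> mu ! y}. psum_mono rho (mu[j := mu ! j - k]))"
    by (rule sum.inter_filter[symmetric]) simp
  finally show ?thesis by simp
qed

text \<open>Monomial coefficients are pairings with h_mu. Deciding which entry of mu receives the
  last part k is what the derivation k d/dp_k does to the product h_mu.\<close>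

lemma psum_mono_ip:
  "0 \<notin> set rho \<Longrightarrow> of_nat (psum_mono rho mu) = ip (mon (mset rho)) (hmu mu :: 'a::field_char_0 sym)"
proof (induction rho arbitrary: mu rule: rev_induct)
  case Nil
  have 1: "ip 1 (hmu mu :: 'a sym) = lookup (hmu mu) {#}"
    using ip_1[of "hmu mu :: 'a sym"] by (simp add: ip_commute)
  have "{f \<in> {..<length ([]::nat list)} \<rightarrow>\<^sub>E {..<length mu}. \<forall>j<length mu.
       (\<Sum>i\<in>{i. i < length ([]::nat list) \<and> f i = j}. [] ! i) = mu ! j} =
     (if \<forall>j<length mu. mu ! j = 0 then {\<lambda>_. undefined} else {})"
    by auto
  then have "psum_mono [] mu = (if \<forall>j<length mu. mu ! j = 0 then 1 else 0)"
    unfolding psum_mono_def by simp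
  also have "(\<forall>j<length mu. mu ! j = 0) \<longleftrightarrow> sum_list mu = 0" by (simp add: all_set_conv_all_nth)
  finally have 2: "psum_mono [] mu = (if sum_list mu = 0 then 1 else 0)" .
  have "sum_list mu = 0 \<Longrightarrow> hmu mu = (1 :: 'a sym)" by (induction mu) (auto simp: hmu_def)
  then show ?case using lookup_homog_empty[OF homog_hmu[of mu]] 1 2 by auto
next
  case (snoc k rho)
  then have k: "k \<ge> 1" by (auto simp: Suc_le_eq)
  have "ip (mon (mset (rho @ [k]))) (hmu mu :: 'a sym) = ip (mon (mset rho)) (der k (hmu mu))"
    by (simp add: mon_add_mset ip_pp)
  then show ?case using snoc by (simp add: der_hmu[OF k] ip_sum_right psum_mono_snoc)
qed

lemma inj_on_mset_partitions: "inj_on mset (partitions n)"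
proof (rule inj_onI)
  fix a b assume "a \<in> partitions n" "b \<in> partitions n" and m: "mset a = mset b"
  then have "sorted (rev a)" "sorted (rev b)" by (auto simp: partitions_iff partition_def sorted_wrt_rev)
  with m have "rev a = rev b" by (metis mset_rev properties_for_sort)
  then show "a = b" by simp
qed

lemma mset_partitions: "mset ` partitions n = {m. 0 \<notin># m \<and> sum_mset m = n}"
proof (intro set_eqI iffI)
  fix m assume "m \<in> mset ` partitions n"
  then show "m \<in> {m. 0 \<notin># m \<and> sum_mset m = n}" by (auto simp: partitions_iff partition_def sum_mset_sum_list)
next
  fix m assume m: "m \<in> {m. 0 \<notin># m \<and> sum_mset m = n}"
  let ?l = "rev (sorted_list_of_multiset m)"
  have ms: "mset ?l = m" by simp
  have "partition ?l" using m by (auto simp: partition_def sorted_wrt_rev sorted_sorted_list_of_multiset)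
  moreover have "sum_list ?l = n" using m ms by (metis (mono_tags) mem_Collect_eq sum_mset_sum_list)
  ultimately show "m \<in> mset ` partitions n" using ms by (metis imageI partitions_iff)
qed

definition pmk :: "nat \<Rightarrow> (nat list \<Rightarrow> 'a) \<Rightarrow> 'a::field_char_0 sym" where
  "pmk n c = (\<Sum>rho\<in>partitions n. Co (c rho) * mon (mset rho))"

lemma lookup_pmk: "lookup (pmk n c) m = (\<Sum>rho\<in>partitions n. if mset rho = m then c rho else 0)"
  unfolding pmk_def lookup_sum by (rule sum.cong) (auto simp: mon_def lookup_single when_def)

lemma lookup_pmk_mset: "rho \<in> partitions n \<Longrightarrow> lookup (pmk n c) (mset rho) = c rho"
proof -
  assume rho: "rho \<in> partitions n"
  have "lookup (pmk n c) (mset rho) = (\<Sum>r\<in>partitions n. if r = rho then c r else 0)"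
    unfolding lookup_pmk
  proof (rule sum.cong[OF refl])
    fix r assume "r \<in> partitions n"
    then have "mset r = mset rho \<longleftrightarrow> r = rho" using inj_onD[OF inj_on_mset_partitions _ _ rho, of r] by auto
    then show "(if mset r = mset rho then c r else 0) = (if r = rho then c r else 0)" by simp
  qed
  then show ?thesis using rho by (simp add: finite_partitions)
qed

lemma homog_pmk: "homog n (pmk n c)"
  unfolding pmk_def
proof (intro homog_sum homog_Co)
  fix rho assume "rho \<in> partitions n"
  then show "homog n (mon (mset rho) :: 'a sym)"
    using homog_mon[of "mset rho"] by (simp add: partitions_iff partition_def sum_mset_sum_list)
qed

lemma pmk_lookup:
  assumes F: "homog n F" shows "pmk n (\<lambda>rho. lookup F (mset rho)) = F"
proof (rule poly_mapping_eqI)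
  fix m
  show "lookup (pmk n (\<lambda>rho. lookup F (mset rho))) m = lookup F m"
  proof (cases "m \<in> mset ` partitions n")
    case True then show ?thesis by (auto simp: lookup_pmk_mset)
  next
    case False
    then have "lookup F m = 0" using F by (auto simp: mset_partitions homog_def)
    moreover have "lookup (pmk n (\<lambda>rho. lookup F (mset rho))) m = 0"
      unfolding lookup_pmk by (rule sum.neutral) (use False in auto)
    ultimately show ?thesis by simp
  qed
qed

lemma ip_pmk_hmu: "ip (pmk n c) (hmu mu) = (\<Sum>rho\<in>partitions n. c rho * of_nat (psum_mono rho mu))"
  unfolding pmk_def ip_sum_left
  by (rule sum.cong) (auto simp: ip_Co_left psum_mono_ip partitions_iff partition_def)

lemma homog_eqI_hmu:
  "homog n F \<Longrightarrow> homog n G \<Longrightarrow> (\<forall>mu\<in>partitions n. ip F (hmu mu) = ip G (hmu mu)) \<longleftrightarrow> F = G"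
  using ip_hmu_complete[of n "F - G"] by (auto simp: homog_diff ip_diff_left)

text \<open>Both sides of the defining system are pairings with h_mu, and these pairings separate
  homogeneous elements; so the system says that two ring elements agree, and power sum coefficients
  are unique. \<open>pleth_eq\<close> uses the same device.\<close>

lemma psum_coeffs_eq:
  "psum_coeffs n f = (\<lambda>rho. if rho \<in> partitions n then lookup (mk n f) (mset rho) else 0)" (is "_ = ?c")
proof -
  have iff: "(\<forall>mu \<in> partitions n. (\<Sum>lam \<in> partitions n. f lam * of_nat (kostka lam mu))
          = (\<Sum>rho \<in> partitions n. c rho * of_nat (psum_mono rho mu))) \<longleftrightarrow> mk n f = pmk n c" for c
    unfolding ip_mk_hmu[symmetric] ip_pmk_hmu[symmetric] by (rule homog_eqI_hmu[OF homog_mk homog_pmk])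
  show ?thesis
    unfolding psum_coeffs_def iff
  proof (rule the_equality)
    have "pmk n ?c = pmk n (\<lambda>rho. lookup (mk n f) (mset rho))" unfolding pmk_def by (rule sum.cong) auto
    then show "supp_on n ?c \<and> mk n f = pmk n ?c"
      using pmk_lookup[OF homog_mk, of n f] by (auto simp: supp_on_def)
  next
    fix c assume "supp_on n c \<and> mk n f = pmk n c"
    then show "c = ?c" by (auto simp: fun_eq_iff lookup_pmk_mset supp_on_def)
  qed
qed

abbreviation pi1 :: "'a::field_char_0 \<Rightarrow> 'a sym \<Rightarrow> 'a sym" where
  "pi1 u \<equiv> diag (\<lambda>k. 1 - u ^ k)"

lemma pleth_eq: "pleth n u f = sc n (pi1 u (mk n f))"
proof -
  have S: "(\<Sum>rho \<in> partitions n. psum_coeffs n f rho * (\<Prod>x\<leftarrow>rho. 1 - u ^ x) * of_nat (psum_mono rho mu))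
     = ip (pi1 u (mk n f)) (hmu mu)" for mu
  proof -
    have "pi1 u (mk n f) = pmk n (\<lambda>rho. lookup (pi1 u (mk n f)) (mset rho))"
      by (rule pmk_lookup[OF homog_diag[OF homog_mk], symmetric])
    also have "\<dots> = pmk n (\<lambda>rho. psum_coeffs n f rho * (\<Prod>x\<leftarrow>rho. 1 - u ^ x))"
      unfolding pmk_def
    proof (rule sum.cong[OF refl])
      fix rho assume "rho \<in> partitions n"
      moreover have "(\<Prod>k\<in>#mset rho. 1 - u ^ k) = (\<Prod>x\<leftarrow>rho. 1 - u ^ x)" by (induction rho) auto
      ultimately show "Co (lookup (pi1 u (mk n f)) (mset rho)) * mon (mset rho) =
         Co (psum_coeffs n f rho * (\<Prod>x\<leftarrow>rho. 1 - u ^ x)) * mon (mset rho)"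
        by (simp add: psum_coeffs_eq lookup_diag mult.commute[of "prod_list _"])
    qed
    finally show ?thesis by (simp add: ip_pmk_hmu)
  qed
  have iff: "(\<forall>mu \<in> partitions n. (\<Sum>lam \<in> partitions n. g lam * of_nat (kostka lam mu))
          = (\<Sum>rho \<in> partitions n. psum_coeffs n f rho * (\<Prod>x\<leftarrow>rho. 1 - u ^ x)
                 * of_nat (psum_mono rho mu))) \<longleftrightarrow> mk n g = pi1 u (mk n f)" for g
    unfolding ip_mk_hmu[symmetric] S by (rule homog_eqI_hmu[OF homog_mk homog_diag[OF homog_mk]])
  show ?thesis
    unfolding pleth_def iff
  proof (rule the_equality)
    show "supp_on n (sc n (pi1 u (mk n f))) \<and> mk n (sc n (pi1 u (mk n f))) = pi1 u (mk n f)"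
      by (simp add: supp_on_sc mk_sc homog_diag homog_mk)
    show "g = sc n (pi1 u (mk n f))" if "supp_on n g \<and> mk n g = pi1 u (mk n f)" for g
    proof -
      have e: "mk n g = pi1 u (mk n f)" using that by blast
      have "g = sc n (mk n g)" using that by (intro sc_mk[symmetric]) blast
      then show ?thesis unfolding e .
    qed
  qed
qed

section \<open>Conjugate partitions and the involution omega\<close>

section \<open>Conjugation\<close>

lemma nth0_conj: "partition l \<Longrightarrow> nth0 (conj l) j = length (filter (\<lambda>x. x > j) l)"
proof -
  assume l: "partition l"
  show ?thesis
  proof (cases "l = [] \<or> j < hd l")
    case True then show ?thesis by (cases l) (auto simp: conj_def nth0_def)
  next
    case False
    have "x \<le> hd l" if "x \<in> set l" for x using that l by (cases l) (auto simp: partition_def)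
    then have "filter (\<lambda>x. x > j) l = []" using False unfolding filter_empty_conv by (meson not_less le_trans)
    then show ?thesis using False by (auto simp: conj_def nth0_def)
  qed
qed

lemma less_length_filter:
  "partition l \<Longrightarrow> i < length (filter (\<lambda>x. x > j) l) \<longleftrightarrow> j < nth0 l i"
proof (induction l arbitrary: i)
  case (Cons x l)
  then have p: "partition l" and xl: "\<forall>y\<in>set l. y \<le> x" by (auto simp: partition_def)
  show ?case
  proof (cases "x > j")
    case True
    then show ?thesis using Cons.IH[OF p, of "i - 1"] by (cases i) (auto simp: nth0_def)
  next
    case False
    then have "filter (\<lambda>x. x > j) (x # l) = []" using xl by (force simp: filter_empty_conv)
    moreover have "nth0 (x # l) i \<le> j" using partition_nth0_mono[OF Cons.prems, of 0 i] False by (simp add: nth0_def)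
    ultimately show ?thesis by simp
  qed
qed (simp add: nth0_def)

lemma less_nth0_conj: "partition l \<Longrightarrow> i < nth0 (conj l) j \<longleftrightarrow> j < nth0 l i"
  by (simp add: nth0_conj less_length_filter)

lemma partition_conj: "partition l \<Longrightarrow> partition (conj l)"
proof -
  assume l: "partition l"
  have "nth0 (conj l) j \<le> nth0 (conj l) i" if "i \<le> j" for i j
  proof (rule ccontr)
    assume "\<not> ?thesis"
    then have "nth0 (conj l) i < nth0 (conj l) j" by simp
    then have "j < nth0 l (nth0 (conj l) i)" by (simp add: less_nth0_conj[OF l])
    then have "i < nth0 l (nth0 (conj l) i)" using that by simp
    then show False by (simp flip: less_nth0_conj[OF l])
  qed
  then have "sorted_wrt (\<ge>) (conj l)"
    by (force simp: sorted_wrt_iff_nth_less nth0_def dest: order.strict_implies_order)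
  moreover have "0 \<notin> set (conj l)"
    by (cases l) (auto simp: conj_def)
  ultimately show ?thesis by (simp add: partition_def)
qed

lemma conj_conj: "partition l \<Longrightarrow> conj (conj l) = l"
proof (rule nth0_eqI[OF partition_conj[OF partition_conj]])
  fix i assume l: "partition l"
  have "j < nth0 (conj (conj l)) i \<longleftrightarrow> j < nth0 l i" for j
    by (simp add: less_nth0_conj l partition_conj)
  then show "nth0 (conj (conj l)) i = nth0 l i" by (metis linorder_neqE_nat less_irrefl)
qed auto

lemma cells_conj: "partition l \<Longrightarrow> cells (conj l) = prod.swap ` cells l"
  by (auto simp: mem_cells partition_conj less_nth0_conj)

lemma sum_list_conj: "partition l \<Longrightarrow> sum_list (conj l) = sum_list l"
  by (simp add: cells_conj card_image flip: card_cells)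

lemma conj_partitions: "l \<in> partitions n \<Longrightarrow> conj l \<in> partitions n"
  by (simp add: partitions_iff partition_conj sum_list_conj)

text \<open>The first k columns and the cells to their right exhaust the diagram. With the
  description of dominance by excesses this is why conjugation reverses dominance.\<close>

lemma sum_take_conj: "partition l \<Longrightarrow> sum_list (take k (conj l)) + excess l k = sum_list l"
proof -
  assume l: "partition l"
  have "(\<Sum>j<k. length (filter (\<lambda>x. x > j) l)) + excess l k = sum_list l" for l
  proof (induction l)
    case (Cons x l)
    have "(\<Sum>j<k. length (filter (\<lambda>x. x > j) (x # l))) = (\<Sum>j<k. (if j < x then 1 else 0) + length (filter (\<lambda>x. x > j) l))"
      by (rule sum.cong) auto
    also have "\<dots> = card {j\<in>{..<k}. j < x} + (\<Sum>j<k. length (filter (\<lambda>x. x > j) l))"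
      unfolding sum.distrib by (subst card_filter_eq_sum) auto
    also have "{j\<in>{..<k}. j < x} = {..<min k x}" by auto
    finally show ?case using Cons by (simp add: excess_def)
  qed (simp add: excess_def)
  then show ?thesis by (simp add: sum_take_nth0 nth0_conj[OF l])
qed

lemma dom_le_conj:
  assumes "partition m" "partition l" "dom_le m l" shows "dom_le (conj l) (conj m)"
  unfolding dom_le_def
proof (intro conjI allI)
  have "sum_list m = sum_list l" using assms(3) by (simp add: dom_le_def)
  then show "sum_list (conj l) = sum_list (conj m)" by (simp add: sum_list_conj assms)
  fix k
  show "sum_list (take k (conj l)) \<le> sum_list (take k (conj m))"
    using sum_take_conj[OF assms(1), of k] sum_take_conj[OF assms(2), of k] excess_dom_le[OF assms(1,3), of k]
      \<open>sum_list m = sum_list l\<close> by linarith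
qed

lemma conj_hs:
  assumes l: "partition l" shows "bij_betw conj (vs l) (hs (conj l))"
proof (rule bij_betw_byWitness[where f'=conj])
  show "\<forall>k\<in>vs l. conj (conj k) = k" "\<forall>k\<in>hs (conj l). conj (conj k) = k"
    by (auto simp: vs_def hs_def conj_conj)
  have le: "a \<le> b \<longleftrightarrow> (\<forall>j. j < a \<longrightarrow> j < b)" for a b :: nat
  proof
    show "\<forall>j. j < a \<longrightarrow> j < b" if "a \<le> b" using that by auto
    show "a \<le> b" if "\<forall>j. j < a \<longrightarrow> j < b" using that[rule_format, of b] by (cases "a \<le> b") auto
  qed
  have le': "a \<le> Suc b \<longleftrightarrow> (\<forall>j. Suc j < a \<longrightarrow> j < b)" for a b :: nat
  proof
    show "\<forall>j. Suc j < a \<longrightarrow> j < b" if "a \<le> Suc b" using that by auto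
    show "a \<le> Suc b" if "\<forall>j. Suc j < a \<longrightarrow> j < b" using that[rule_format, of b] by (cases "a \<le> Suc b") auto
  qed
  have key: "k \<in> vs l \<longleftrightarrow> conj k \<in> hs (conj l)" if k: "partition k" for k
  proof -
    have "k \<in> vs l \<longleftrightarrow> (\<forall>i j. j < nth0 k i \<longrightarrow> j < nth0 l i) \<and> (\<forall>i j. Suc j < nth0 l i \<longrightarrow> j < nth0 k i)"
      unfolding vs_def mem_Collect_eq le' unfolding le using k by blast
    also have "\<dots> \<longleftrightarrow> conj k \<in> hs (conj l)"
      unfolding hs_def mem_Collect_eq le less_nth0_conj[OF k] less_nth0_conj[OF l]
      using partition_conj[OF k] by blast
    finally show ?thesis .
  qed
  show "conj ` vs l \<subseteq> hs (conj l)" using key by (auto simp: vs_def)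
  show "conj ` hs (conj l) \<subseteq> vs l"
  proof clarify
    fix k assume k: "k \<in> hs (conj l)"
    then have "partition k" by (simp add: hs_def)
    then show "conj k \<in> vs l" using key[OF partition_conj] k by (simp add: conj_conj)
  qed
qed

abbreviation om :: "nat \<Rightarrow> 'a::comm_ring_1" where "om k \<equiv> - ((- 1) ^ k)"
abbreviation Om :: "'a::field_char_0 sym \<Rightarrow> 'a sym" where "Om \<equiv> diag om"

text \<open>Moving p_k -> c_k p_k past a translation multiplies the translation by c_k. This turns
  \<open>tau\<close> into \<open>tau'\<close> under omega, and links \<open>DD\<close> with its
  conjugates \<open>EE\<close>.\<close>

lemma transl_diag: "coeff (transl a (diag c F)) r = diag c (coeff (transl (\<lambda>k. c k * a k) F) r)"
proof (induction F arbitrary: r rule: sym_induct)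
  case (const b) then show ?case by (cases r) (auto simp: coeff_pCons split: nat.splits)
next
  case (pp k F)
  have "transl a (diag c (Submission.pp k * F)) = smult (Co (c k)) (transl a (Submission.pp k * diag c F))"
    by (simp add: diag_mult rhom_mult[OF rhom_transl] mult.assoc)
  then have "coeff (transl a (diag c (Submission.pp k * F))) r = Co (c k) * (Submission.pp k * coeff (transl a (diag c F)) r +
      (if 1 \<le> k \<and> k \<le> r then Co (a k) * coeff (transl a (diag c F)) (r - k) else 0))"
    by (simp add: coeff_transl_pp_mult)
  then show ?case unfolding pp coeff_transl_pp_mult
    by (auto simp: diag_add diag_mult Co_mult distrib_left mult.assoc mult.left_commute)
next
  case (add F G) then show ?case by (simp add: diag_add rhom_add[OF rhom_transl])
qed

text \<open>Tested against products of h: skewing by h_r after omega is skewing by e_r before it,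
  and the vertical strips of l conjugate to the horizontal strips of \<open>conj l\<close>.\<close>

lemma Om_sch:
  assumes "partition l" shows "Om (sch l) = (sch (conj l) :: 'a::field_char_0 sym)"
proof -
  have "ip (Om (sch l)) (hmu mu) = ip (sch (conj l)) (hmu mu :: 'a sym)" if "partition l" for mu l
    using that
  proof (induction mu arbitrary: l)
    case Nil
    have "conj l = [] \<longleftrightarrow> l = []"
      using sum_list_conj[OF Nil] sum_list_partition_eq_0[OF Nil] sum_list_partition_eq_0[OF partition_conj[OF Nil]] by simp
    then show ?case by (simp add: hmu_def ip_1 lookup_diag lookup_sch_empty Nil partition_conj)
  next
    case (Cons r mu)
    note l = Cons.prems
    have "ip (Om (sch l)) (hmu (r # mu)) = ip (coeff (tau (Om (sch l))) r) (hmu mu :: 'a sym)"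
      using ip_hh_mult[of r "hmu mu" "Om (sch l) :: 'a sym"] by (simp add: hmu_Cons ip_commute)
    also have "coeff (tau (Om (sch l) :: 'a sym)) r = Om (coeff (tau' (sch l)) r)"
      by (simp add: transl_diag)
    also have "ip \<dots> (hmu mu) = (\<Sum>k\<in>{k\<in>vs l. sum_list k + r = sum_list l}. ip (Om (sch k)) (hmu mu))"
      by (simp add: coeff_tau'_sch[OF l] rhom_sum[OF rhom_diag] ip_sum_left)
    also have "\<dots> = (\<Sum>k\<in>{k\<in>vs l. sum_list k + r = sum_list l}. ip (sch (conj k)) (hmu mu))"
      by (rule sum.cong[OF refl]) (auto simp: vs_def intro!: Cons.IH)
    also have "\<dots> = (\<Sum>k\<in>{k\<in>hs (conj l). sum_list k + r = sum_list (conj l)}. ip (sch k) (hmu mu))"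
    proof (rule sum.reindex_bij_betw)
      have "bij_betw conj {k\<in>vs l. sum_list k + r = sum_list l} (conj ` {k\<in>vs l. sum_list k + r = sum_list l})"
        using conj_hs[OF l] by (rule bij_betw_subset) auto
      moreover have "conj ` {k\<in>vs l. sum_list k + r = sum_list l} = {k\<in>hs (conj l). sum_list k + r = sum_list (conj l)}"
      proof -
        have "sum_list (conj k) = sum_list k" if "k \<in> vs l" for k
          using that by (auto simp: vs_def sum_list_conj)
        then show ?thesis
          using conj_hs[OF l] by (auto simp: bij_betw_def sum_list_conj[OF l] image_iff) (metis image_iff)
      qed
      ultimately show "bij_betw conj {k\<in>vs l. sum_list k + r = sum_list l} {k\<in>hs (conj l). sum_list k + r = sum_list (conj l)}"
        by simp
    qed
    also have "\<dots> = ip (sch (conj l)) (hmu (r # mu))"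
      by (simp add: hmu_Cons ip_sch_hh_mult[OF partition_conj[OF l]])
    finally show ?case .
  qed
  note A = this
  show ?thesis
  proof (rule homog_eqI_hmu[THEN iffD1, of "sum_list l"])
    show "homog (sum_list l) (Om (sch l))" by (intro homog_diag homog_sch)
    show "homog (sum_list l) (sch (conj l))" using homog_sch[of "conj l"] assms by (simp add: sum_list_conj)
  qed (use A assms in blast)
qed

lemma omega_sc:
  assumes F: "homog n F" shows "omega (sc n F) = sc n (Om F)"
proof
  fix l
  show "omega (sc n F) l = sc n (Om F) l"
  proof (cases "l \<in> partitions n")
    case True
    then have l: "partition l" by (simp add: partitions_iff)
    then show ?thesis using True conj_partitions[OF True] by (simp add: omega_def sc_def ip_diag Om_sch)
  next
    case False
    have "conj l \<notin> partitions n" if "partition l"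
      using False that conj_partitions[of "conj l" n] conj_conj[OF that] by auto
    then show ?thesis using False by (simp add: omega_def sc_def)
  qed
qed

section \<open>Macdonald's constant term operator and its triangularity on Schur functions\<close>

section \<open>Macdonald's operator\<close>

text \<open>This is h_j[-X], that is (-1)^j e_j.\<close>

definition gneg :: "nat \<Rightarrow> 'a::field_char_0 sym" where
  "gneg j = diag (\<lambda>_. - 1) (hh j)"

lemma gneg_0 [simp]: "gneg 0 = 1" by (simp add: gneg_def)

lemma newt_gneg: "newt (\<lambda>k. - pp k) (gneg :: nat \<Rightarrow> 'a::field_char_0 sym)"
proof -
  have "newt (\<lambda>k. diag (\<lambda>_. - 1) (pp k)) (\<lambda>n. diag (\<lambda>_. - 1) (hh n :: 'a sym))"
    by (rule newt_hom[OF rhom_diag newt_hh])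
  then show ?thesis by (simp add: gneg_def[abs_def] Co_uminus)
qed

text \<open>A constant term: the coefficient of z^0 in P(1/z) times the series with coefficients
  g_j. By \<open>LL_ge\<close> any degree bound may replace the degree.\<close>

definition LL :: "(nat \<Rightarrow> 'a::field_char_0 sym) \<Rightarrow> 'a sym poly \<Rightarrow> 'a sym" where
  "LL g P = (\<Sum>j\<le>degree P. g j * coeff P j)"

lemma LL_ge: "degree P \<le> M \<Longrightarrow> LL g P = (\<Sum>j\<le>M. g j * coeff P j)"
  unfolding LL_def by (rule sum.mono_neutral_left) (auto simp: coeff_eq_0)

lemma LL_add: "LL g (P + Q) = LL g P + LL g Q"
proof -
  define M where "M = max (degree P) (degree Q)"
  have "degree (P + Q) \<le> M" "degree P \<le> M" "degree Q \<le> M" unfolding M_def by (auto simp: degree_add_le_max)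
  then show ?thesis by (simp add: LL_ge sum.distrib distrib_left)
qed

lemma LL_smult: "LL g (smult a P) = a * LL g P"
proof -
  have d: "degree (smult a P) \<le> degree P" by (rule degree_smult_le)
  show ?thesis by (simp add: LL_ge[OF d] LL_ge[of P "degree P"] sum_distrib_left mult.left_commute)
qed

lemma LL_0 [simp]: "LL g 0 = 0" by (simp add: LL_def)

lemma LL_sum: "LL g (sum f A) = (\<Sum>a\<in>A. LL g (f a))"
  by (induction A rule: infinite_finite_induct) (auto simp: LL_add)

lemma LL_monom: "LL g (monom a k) = g k * a"
proof -
  have "LL g (monom a k) = (\<Sum>j\<le>k. g j * coeff (monom a k) j)" by (rule LL_ge) (rule degree_monom_le)
  also have "\<dots> = (\<Sum>j\<le>k. if j = k then g j * a else 0)" by (rule sum.cong) auto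
  finally show ?thesis by simp
qed

lemma LL_pCons0: "g 0 = 1 \<Longrightarrow> LL g [:a:] = a"
  by (simp add: LL_def)

text \<open>\<open>DD\<close> below is the operator whose value at F is the constant term in z of
  F[X + (1-q)(1-t)/z] times the sum of (-z)^j e_j; modified Macdonald polynomials are its
  eigenvectors. \<open>EE\<close> is its conjugate under X -> X(1-t), the version that is triangular
  on Schur functions.\<close>

definition EE :: "'a::field_char_0 \<Rightarrow> 'a \<Rightarrow> 'a sym \<Rightarrow> 'a sym" where
  "EE q t F = LL (\<lambda>j. pi1 t (gneg j)) (transl (\<lambda>k. 1 - q ^ k) F)"

definition DD :: "'a::field_char_0 \<Rightarrow> 'a \<Rightarrow> 'a sym \<Rightarrow> 'a sym" where
  "DD q t F = LL gneg (transl (\<lambda>k. (1 - q ^ k) * (1 - t ^ k)) F)"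

lemma EE_add: "EE q t (F + G) = EE q t F + EE q t G"
  by (simp add: EE_def rhom_add[OF rhom_transl] LL_add)

lemma EE_Co: "EE q t (Co c * F) = Co c * EE q t F"
  by (simp add: EE_def rhom_mult[OF rhom_transl] LL_smult)

lemma EE_0 [simp]: "EE q t 0 = 0"
  using EE_Co[of q t 0 0] by simp

lemma EE_sum: "EE q t (sum f A) = (\<Sum>a\<in>A. EE q t (f a))"
  by (induction A rule: infinite_finite_induct) (auto simp: EE_add)

text \<open>\<open>DD\<close> is symmetric in q and t, so one eigenvector of \<open>DD\<close>
  yields eigenvectors of both \<open>EE q t\<close> and \<open>EE t q\<close>. The two triangularity
  conditions on Macdonald polynomials come from here.\<close>

lemma pi1_DD: "pi1 t (DD q t F) = EE q t (pi1 t F)" (is ?A)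
  and pi1_DD': "pi1 q (DD q t F) = EE t q (pi1 q F)" (is ?B)
proof -
  define P where "P = transl (\<lambda>k. (1 - q ^ k) * (1 - t ^ k)) F"
  have P2: "transl (\<lambda>k. (1 - t ^ k) * (1 - q ^ k)) F = P" by (simp add: P_def mult.commute)
  define M where "M = Max {degree P, degree (transl (\<lambda>k. 1 - q ^ k) (pi1 t F)), degree (transl (\<lambda>k. 1 - t ^ k) (pi1 q F))}"
  have M: "degree P \<le> M" "degree (transl (\<lambda>k. 1 - q ^ k) (pi1 t F)) \<le> M"
    "degree (transl (\<lambda>k. 1 - t ^ k) (pi1 q F)) \<le> M"
    unfolding M_def by auto
  have D: "DD q t F = (\<Sum>j\<le>M. gneg j * coeff P j)" unfolding DD_def P_def[symmetric] by (rule LL_ge[OF M(1)])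
  show ?A unfolding EE_def LL_ge[OF M(2)] D transl_diag P2 by (simp add: rhom_sum[OF rhom_diag] diag_mult)
  show ?B unfolding EE_def LL_ge[OF M(3)] D transl_diag P_def[symmetric] by (simp add: rhom_sum[OF rhom_diag] diag_mult)
qed

subsection \<open>Homogeneity\<close>

lemma homog_coeff_transl:
  assumes "homog n F"
  shows "(j \<le> n \<longrightarrow> homog (n - j) (coeff (transl a F) j)) \<and> (n < j \<longrightarrow> coeff (transl a F) j = 0)"
proof -
  have m: "(j \<le> sum_mset m \<longrightarrow> homog (sum_mset m - j) (coeff (transl a (mon m)) j)) \<and>
      (sum_mset m < j \<longrightarrow> coeff (transl a (mon m)) j = 0)" if "0 \<notin># m" for m j
    using that
  proof (induction m arbitrary: j)
    case empty
    then show ?case by (cases j) (auto simp: rhom_1[OF rhom_transl] one_pCons)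
  next
    case (add k m)
    let ?n = "sum_mset m"
    have IH: "j \<le> ?n \<Longrightarrow> homog (?n - j) (coeff (transl a (mon m)) j)" "?n < j \<Longrightarrow> coeff (transl a (mon m)) j = 0" for j
      using add.IH[of j] add.prems by auto
    have pk: "homog k (pp k :: 'a sym)" using homog_mon[of "{#k#}", where 'a='a] add.prems by (simp add: mon_def pp_def)
    have 1: "homog (k + ?n - j) (pp k * coeff (transl a (mon m)) j)" if "j \<le> k + ?n"
    proof (cases "j \<le> ?n")
      case True
      then show ?thesis using homog_mult[OF pk IH(1)[OF True]] by simp
    qed (simp add: IH(2))
    have 2: "homog (k + ?n - j) (Co (a k) * coeff (transl a (mon m)) (j - k))" if "j \<le> k + ?n" "k \<le> j"
    proof -
      have "j - k \<le> ?n" "?n - (j - k) = k + ?n - j" using that by auto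
      then show ?thesis using homog_Co[OF IH(1), of "j - k"] by simp
    qed
    show ?case
      using 1 2 IH(2)[of j] IH(2)[of "j - k"] by (auto simp: mon_add_mset coeff_transl_pp_mult intro!: homog_add)
  qed
  have F: "transl a F = (\<Sum>m\<in>keys F. smult (Co (lookup F m)) (transl a (mon m)))"
  proof -
    have "transl a F = transl a (\<Sum>m\<in>keys F. Co (lookup F m) * mon m)"
      by (subst sym_sum_single[of F]) (simp add: single_eq_Co_mon)
    then show ?thesis by (simp add: rhom_sum[OF rhom_transl] rhom_mult[OF rhom_transl])
  qed
  have k: "0 \<notin># u" "sum_mset u = n" if "u \<in> keys F" for u using assms that by (auto simp: homog_def in_keys_iff)
  show ?thesis
  proof (intro conjI impI)
    assume "j \<le> n"
    then show "homog (n - j) (coeff (transl a F) j)"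
      unfolding F coeff_sum coeff_smult using m[OF k(1), of _ j] k(2) by (intro homog_sum homog_Co) auto
  next
    assume "n < j"
    then show "coeff (transl a F) j = 0"
      unfolding F coeff_sum coeff_smult using m[OF k(1), of _ j] k(2) by (intro sum.neutral) auto
  qed
qed

lemma homog_EE:
  assumes F: "homog n F" shows "homog n (EE q t F)"
  unfolding EE_def LL_def
proof (rule homog_sum)
  fix j
  have g: "homog j (pi1 t (gneg j))" unfolding gneg_def by (intro homog_diag homog_hh)
  show "homog n (pi1 t (gneg j) * coeff (transl (\<lambda>k. 1 - q ^ k) F) j)"
  proof (cases "j \<le> n")
    case True
    then show ?thesis using homog_mult[OF g, of "n - j" "coeff (transl (\<lambda>k. 1 - q ^ k) F) j"]
      homog_coeff_transl[OF F, of j] by simp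
  next
    case False
    then show ?thesis using homog_coeff_transl[OF F, of j] by simp
  qed
qed

subsection \<open>Action on Schur functions\<close>

text \<open>With y marking the degree, the translation multiplies the series of the h_m by (1 - q x
  y)/(1 - x y) = q + (1 - q)/(1 - x y).\<close>

lemma trans_q_hi:
  "transl (\<lambda>k. 1 - q ^ k) (hi m) = [:Co q:] * [:hi m:] + [:Co (1 - q):] * tau (hi m :: 'a::field_char_0 sym)"
proof (cases "m < 0")
  case True then show ?thesis by (simp add: rhom_0[OF rhom_transl])
next
  case False
  let ?x = "monom (Co q) 1 :: 'a sym poly"
  let ?L = "\<lambda>n. if n = 0 then 1 else if n = 1 then - ?x else (0 :: 'a sym poly)"
  have 1: "newt (\<lambda>k. tau (pp k) + - (?x ^ k)) (\<lambda>n. \<Sum>j\<le>n. tau (hh j :: 'a sym) * ?L (n - j))"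
    by (rule newt_mult[OF newt_hom[OF rhom_transl newt_hh] newt_linear])
  have 2: "newt (\<lambda>k. transl (\<lambda>k. 1 - q ^ k) (pp k)) (\<lambda>n. transl (\<lambda>k. 1 - q ^ k) (hh n :: 'a sym))"
    by (rule newt_hom[OF rhom_transl newt_hh])
  have "Co q ^ k = Co (q ^ k)" for k by (induction k) (auto simp: Co_mult)
  then have mx: "?x ^ k = monom (Co (q ^ k)) k" for k by (simp add: monom_power)
  have "(\<Sum>j\<le>nat m. tau (hh j :: 'a sym) * ?L (nat m - j)) = transl (\<lambda>k. 1 - q ^ k) (hh (nat m))"
  proof (rule newt_unique_poly[OF 1 2])
    fix k :: nat assume "k \<ge> 1"
    then show "tau (pp k) + - (?x ^ k) = transl (\<lambda>k. 1 - q ^ k) (pp k)"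
      unfolding mx by (simp add: transl_pp Co_diff diff_monom)
  qed
  also have "(\<Sum>j\<le>nat m. tau (hh j :: 'a sym) * ?L (nat m - j)) = tau (hi m) - ?x * tau (hi (m - 1))"
  proof (cases "m = 0")
    case True then show ?thesis by (simp add: rhom_0[OF rhom_transl])
  next
    case F: False
    with False have m: "m \<ge> 1" by simp
    have "(\<Sum>j\<le>nat m. tau (hh j :: 'a sym) * ?L (nat m - j))
       = (\<Sum>j\<in>{nat m, nat m - 1}. tau (hh j :: 'a sym) * ?L (nat m - j))"
      by (rule sum.mono_neutral_right) (use m in auto)
    also have "\<dots> = tau (hh (nat m)) - ?x * tau (hh (nat m - 1))" using m by (auto simp: not_le)
    finally show ?thesis using m by (simp add: hi_nonneg nat_diff_distrib)
  qed
  also have "?x * tau (hi (m - 1)) = [:Co q:] * (tau (hi m) - [:hi m:])"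
  proof -
    have s: "tau (hi m :: 'a sym) = [:hi m:] + monom 1 1 * tau (hi (m - 1))"
      using tau_hi_step[of "m - 1" m 1, where 'a='a] by (simp add: monom_0)
    have "?x = [:Co q:] * monom 1 1" by (simp add: smult_monom)
    then have "?x * tau (hi (m - 1)) = [:Co q:] * (monom 1 1 * tau (hi (m - 1)))" by (simp only: mult.assoc)
    also have "monom 1 1 * tau (hi (m - 1) :: 'a sym) = tau (hi m) - [:hi m:]" using s by simp
    finally show ?thesis .
  qed
  finally have e: "tau (hi m) - [:Co q:] * (tau (hi m) - [:hi m:]) = transl (\<lambda>k. 1 - q ^ k) (hi m :: 'a sym)"
    using False by (simp add: hi_nonneg)
  have s: "[:Co (1 - q):] * tau (hi m :: 'a sym) = tau (hi m) - smult (Co q) (tau (hi m))"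
    by (simp add: Co_diff smult_diff_left)
  show ?thesis unfolding e[symmetric] s by (simp add: smult_diff_right)
qed

text \<open>The constant term sums h_j[-X(1-t)] h_(m-j)[X] over j, which is h_m[X - X(1-t)] =
  h_m[tX].\<close>

lemma LL_tau_hi: "LL (\<lambda>j. pi1 t (gneg j)) (tau (hi m)) = Co (t ^ nat m) * hi m"
proof (cases "m < 0")
  case True then show ?thesis by (simp add: rhom_0[OF rhom_transl])
next
  case False
  have Cp: "Co c ^ k = Co (c ^ k)" for c :: 'a and k by (induction k) (auto simp: Co_mult)
  have 1: "newt (\<lambda>k. pi1 t (- pp k) + pp k) (\<lambda>n. \<Sum>j\<le>n. pi1 t (gneg j) * (hh (n - j) :: 'a sym))"
    by (rule newt_mult[OF newt_hom[OF rhom_diag newt_gneg] newt_hh])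
  have 2: "newt (\<lambda>k. Co t ^ k * pp k) (\<lambda>n. Co t ^ n * (hh n :: 'a sym))"
    by (rule newt_scale[OF newt_hh])
  have "(\<Sum>j\<le>nat m. pi1 t (gneg j) * (hh (nat m - j) :: 'a sym)) = Co t ^ nat m * hh (nat m)"
    by (rule newt_unique_sym[OF 1 2]) (simp add: rhom_uminus[OF rhom_diag] Co_diff Cp algebra_simps)
  moreover have "LL (\<lambda>j. pi1 t (gneg j)) (tau (hi m :: 'a sym)) = (\<Sum>j\<le>nat m. pi1 t (gneg j) * hi (m - int j))"
    by (simp add: tau_hi LL_sum LL_monom)
  moreover have "\<dots> = (\<Sum>j\<le>nat m. pi1 t (gneg j) * hh (nat m - j))"
    by (rule sum.cong) (use False in \<open>auto simp: hi_nonneg nat_diff_distrib\<close>)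
  ultimately show ?thesis using False by (simp add: hi_nonneg Cp)
qed

text \<open>The determinant of \<open>B\<^sub>r = q H\<^sub>r + (1-q) W\<^sub>r\<close> with \<open>W\<^sub>r = H\<^sub>r + x H\<^sub>r\<^sub>-\<^sub>1 + \<dots>\<close>: modulo the other rows
  only the topmost row of type \<open>W\<close> survives.\<close>

lemma dt_mixed_rows:
  fixes H W B :: "nat \<Rightarrow> nat \<Rightarrow> 'r::comm_ring_1"
  assumes B: "\<And>r i. B r i = Q * H r i + (1 - Q) * W r i"
    and W: "\<And>m r i. m < r \<Longrightarrow> W r i = H r i + (\<Sum>s\<in>{m..<r}. x ^ (r - s) * (if s = m then W m i else H s i))"
  shows "dt N B = dt N H + (1 - Q) * (\<Sum>r<N. Q ^ r * (dt N (H(r := W r)) - dt N H))"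
proof -
  \<comment> \<open>\<open>X m\<close> is an interpolation: rows with index below m are of type B,
    the others of type H; in \<open>Y m r\<close> row r is replaced by its W version.\<close>
  define X where "X m = dt N (\<lambda>r. if r < m then B r else H r)" for m
  define Y where "Y m r = dt N ((\<lambda>r. if r < m then B r else H r)(r := W r))" for m r
  have row: "dt N (f(m := B m)) = Q * dt N (f(m := H m)) + (1 - Q) * dt N (f(m := W m))" if "m < N" for f m
  proof -
    have "B m = (\<lambda>i. Q * H m i + (1 - Q) * W m i)" by (rule ext) (rule B)
    then show ?thesis using dt_row_add[OF that, of f "\<lambda>i. Q * H m i" "\<lambda>i. (1 - Q) * W m i"]
      by (simp add: dt_row_mult[OF that])
  qed
  have XS: "X (Suc m) = Q * X m + (1 - Q) * Y m m" if "m < N" for m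
  proof -
    let ?f = "\<lambda>r. if r < m then B r else H r"
    have "(\<lambda>r. if r < Suc m then B r else H r) = ?f(m := B m)" by (auto simp: fun_eq_iff less_Suc_eq)
    moreover have "?f(m := H m) = ?f" by (auto simp: fun_eq_iff)
    ultimately show ?thesis unfolding X_def Y_def using row[OF that, of ?f] by simp
  qed
  have YS: "Y (Suc m) r = Q * Y m r + (1 - Q) * Y m m" if "m < r" "r < N" for m r
  proof -
    let ?f = "\<lambda>r. if r < m then B r else H r"
    have mN: "m < N" using that by simp
    have "(\<lambda>r. if r < Suc m then B r else H r)(r := W r) = (?f(r := W r))(m := B m)"
      using that by (auto simp: fun_eq_iff less_Suc_eq)
    then have 1: "Y (Suc m) r = Q * dt N (?f(r := W r, m := H m)) + (1 - Q) * dt N (?f(r := W r, m := W m))"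
      unfolding Y_def by (simp only: row[OF mN])
    have 2: "?f(r := W r, m := H m) = ?f(r := W r)" using that by (auto simp: fun_eq_iff)
    let ?g = "?f(m := W m)"
    have "?f(r := W r, m := W m) = ?g(r := \<lambda>i. H r i + (\<Sum>s\<in>{m..<r}. x ^ (r - s) * ?g s i))"
    proof
      fix s
      have "W r = (\<lambda>i. H r i + (\<Sum>s\<in>{m..<r}. x ^ (r - s) * ?g s i))"
        unfolding W[OF that(1), abs_def] by (intro ext arg_cong2[where f="(+)"] sum.cong) auto
      then show "(?f(r := W r, m := W m)) s = (?g(r := \<lambda>i. H r i + (\<Sum>s\<in>{m..<r}. x ^ (r - s) * ?g s i))) s"
        using that by auto
    qed
    then have "dt N (?f(r := W r, m := W m)) = dt N (?g(r := \<lambda>i. H r i + (\<Sum>s\<in>{m..<r}. x ^ (r - s) * ?g s i)))"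
      by (rule arg_cong)
    also have "\<dots> = dt N (?g(r := H r))"
      by (rule dt_row_sum_others) (use that in auto)
    also have "?g(r := H r) = ?f(m := W m)" using that by (auto simp: fun_eq_iff)
    finally have 3: "dt N (?f(r := W r, m := W m)) = dt N (?f(m := W m))" .
    show ?thesis unfolding 1 2 3 by (simp only: Y_def)
  qed
  \<comment> \<open>Both sequences obey z -> Q z + (1 - Q) \<open>Y m m\<close>, so their difference
    is multiplied by Q at each step.\<close>
  have D: "Y m r - X m = Q ^ m * (Y 0 r - X 0)" if "m \<le> r" "r < N" for m r
    using that(1)
  proof (induction m)
    case (Suc m)
    have y: "Y (Suc m) r = Q * Y m r + (1 - Q) * Y m m" by (rule YS) (use Suc that in auto)
    have x: "X (Suc m) = Q * X m + (1 - Q) * Y m m" by (rule XS) (use Suc that in auto)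
    have "Y (Suc m) r - X (Suc m) = Q * (Y m r - X m)" unfolding x y by (simp add: algebra_simps)
    then show ?case using Suc by simp
  qed simp
  have "X m = X 0 + (1 - Q) * (\<Sum>r<m. Q ^ r * (Y 0 r - X 0))" if "m \<le> N" for m
    using that
  proof (induction m)
    case (Suc m)
    have "X (Suc m) = X m + (1 - Q) * (Y m m - X m)" using XS[of m] Suc.prems by (simp add: algebra_simps)
    also have "Y m m - X m = Q ^ m * (Y 0 m - X 0)" by (rule D) (use Suc in auto)
    also have "X m = X 0 + (1 - Q) * (\<Sum>r<m. Q ^ r * (Y 0 r - X 0))" using Suc by simp
    finally show ?case by (simp only: sum.lessThan_Suc distrib_left add.assoc)
  qed simp
  from this[of N] have "X N = X 0 + (1 - Q) * (\<Sum>r<N. Q ^ r * (Y 0 r - X 0))" by simp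
  moreover have "X N = dt N B" unfolding X_def by (rule dt_cong) simp
  ultimately show ?thesis by (simp add: X_def Y_def)
qed

text \<open>The scalar by which the operator multiplies the Jacobi-Trudi term of p. At p = id and a
  partition it is the eigenvalue \<open>ev\<close>.\<close>

definition ce :: "'a::field_char_0 \<Rightarrow> 'a \<Rightarrow> nat \<Rightarrow> (nat \<Rightarrow> int) \<Rightarrow> (nat \<Rightarrow> nat) \<Rightarrow> 'a" where
  "ce q t N \<alpha> p = 1 + (1 - q) * (\<Sum>i<N. q ^ p i * (t ^ nat (\<alpha> i - int i + int (p i)) - 1))"

text \<open>The operator multiplies each Jacobi-Trudi term by a scalar. By \<open>trans_q_hi\<close>
  and \<open>dt_mixed_rows\<close> the translated determinant is a combination of determinants with
  one row of translated entries, and the constant term turns such an entry into t^m h_m.\<close>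

lemma EE_sN:
  "EE q t (sN N \<alpha>) = (\<Sum>p | p permutes {..<N}.
     of_int (sign p) * (Co (ce q t N \<alpha> p) * (\<Prod>i<N. hi (\<alpha> i - int i + int (p i)))))"
proof -
  let ?e = "\<lambda>r i. \<alpha> i - int i + int r"
  let ?g = "\<lambda>j. pi1 t (gneg j) :: 'a sym"
  let ?H = "\<lambda>r i. [:hi (?e r i) :: 'a sym:]"
  let ?W = "\<lambda>r i. tau (hi (?e r i) :: 'a sym)"
  let ?B = "\<lambda>r i. transl (\<lambda>k. 1 - q ^ k) (hi (?e r i) :: 'a sym)"
  let ?h = "\<lambda>r i. hi (?e r i) :: 'a sym"
  let ?T = "\<lambda>r i. Co (t ^ nat (?e r i)) * hi (?e r i) :: 'a sym"
  have g0: "?g 0 = 1" by simp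
  \<comment> \<open>After transposition, consecutive rows differ by a unit shift of the index, which
    is the relation between W rows required by \<open>dt_mixed_rows\<close>.\<close>
  have "sN N \<alpha> = dt N ?h" unfolding sN_def by (rule dt_transpose[symmetric])
  then have "transl (\<lambda>k. 1 - q ^ k) (sN N \<alpha>) = dt N ?B" by (simp add: dt_hom[OF rhom_transl])
  also have "\<dots> = dt N ?H + (1 - [:Co q:]) * (\<Sum>r<N. [:Co q:] ^ r * (dt N (?H(r := ?W r)) - dt N ?H))"
  proof (rule dt_mixed_rows[where x="monom 1 1"])
    show "?B r i = [:Co q:] * ?H r i + (1 - [:Co q:]) * ?W r i" for r i
      unfolding trans_q_hi by (simp add: Co_diff one_pCons)
    show "?W r i = ?H r i + (\<Sum>s\<in>{m..<r}. monom 1 1 ^ (r - s) * (if s = m then ?W m i else ?H s i))" if "m < r" for m r i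
    proof -
      have "?W r i = (\<Sum>k<r - m. monom (hi (?e r i - int k)) k) + monom 1 (r - m) * ?W m i"
        by (rule tau_hi_step) (use that in auto)
      also have "(\<Sum>k<r - m. monom (hi (?e r i - int k)) k :: 'a sym poly) =
          ?H r i + (\<Sum>k\<in>{1..<r - m}. monom (hi (?e r i - int k)) k)"
      proof -
        have "{..<r - m} = insert 0 {1..<r - m}" using that by auto
        then show ?thesis by (simp add: monom_0)
      qed
      also have "(\<Sum>k\<in>{1..<r - m}. monom (hi (?e r i - int k)) k :: 'a sym poly)
         = (\<Sum>s\<in>{Suc m..<r}. monom 1 1 ^ (r - s) * ?H s i)"
        by (rule sum.reindex_bij_witness[of _ "\<lambda>s. r - s" "\<lambda>k. r - k"])
           (use that in \<open>auto simp: monom_power smult_monom of_nat_diff algebra_simps\<close>)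
      also have "?H r i + (\<Sum>s\<in>{Suc m..<r}. monom 1 1 ^ (r - s) * ?H s i) + monom 1 (r - m) * ?W m i
        = ?H r i + (\<Sum>s\<in>{m..<r}. monom 1 1 ^ (r - s) * (if s = m then ?W m i else ?H s i))"
      proof -
        have "{m..<r} = insert m {Suc m..<r}" using that by auto
        then show ?thesis by (simp add: monom_power add.commute)
      qed
      finally show ?thesis .
    qed
  qed
  finally have tr0: "transl (\<lambda>k. 1 - q ^ k) (sN N \<alpha>) =
    dt N ?H + (1 - [:Co q:]) * (\<Sum>r<N. [:Co q:] ^ r * (dt N (?H(r := ?W r)) - dt N ?H))" .
  have Hd: "dt N ?H = [:dt N ?h:]" by (rule dt_hom[symmetric]) (simp add: rhom_def one_pCons)
  have tr: "transl (\<lambda>k. 1 - q ^ k) (sN N \<alpha>) =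
    [:dt N ?h:] + smult (Co (1 - q)) (\<Sum>r<N. smult (Co (q ^ r)) (dt N (?H(r := ?W r)) - [:dt N ?h:]))"
  proof -
    have q1: "[:Co q:] ^ r = [:Co (q ^ r) :: 'a sym:]" for r by (induction r) (auto simp: Co_mult one_pCons)
    have q2: "1 - [:Co q:] = [:Co (1 - q) :: 'a sym:]" by (simp add: Co_diff one_pCons)
    show ?thesis unfolding tr0 Hd q1 q2 by simp
  qed
  have LW: "LL ?g (dt N (?H(r := ?W r))) = dt N (?h(r := ?T r))" if r: "r < N" for r
  proof -
    have pr: "(\<Prod>s<N. (f(r := u)) s (p s)) = (\<Prod>s\<in>{..<N} - {r}. f s (p s)) * u (p r)"
      for f :: "nat \<Rightarrow> nat \<Rightarrow> 'x::comm_ring_1" and u p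
      using r by (subst prod.remove[of _ r]) (auto simp: mult.commute)
    have c: "of_int z * ((\<Prod>s\<in>A. ?H s (p s)) * P) = smult (of_int z * (\<Prod>s\<in>A. ?h s (p s))) P" for z A p P
    proof -
      have "(\<Prod>s\<in>A. ?H s (p s)) = [:\<Prod>s\<in>A. ?h s (p s):]"
        by (induction A rule: infinite_finite_induct) (auto simp: one_pCons)
      then show ?thesis by (simp add: of_int_poly mult.commute)
    qed
    show ?thesis unfolding dt_def pr c LL_sum LL_smult LL_tau_hi
      by (simp add: ac_simps)
  qed
  have lin: "LL ?g (P - R) = LL ?g P - LL ?g R" for P R
    using LL_add[of ?g "P - R" R] by simp
  have "EE q t (sN N \<alpha>) = dt N ?h + Co (1 - q) * (\<Sum>r<N. Co (q ^ r) * (dt N (?h(r := ?T r)) - dt N ?h))"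
    unfolding EE_def tr by (simp add: LL_add LL_smult LL_sum lin LL_pCons0[of ?g, OF g0] LW)
  also have "\<dots> = (\<Sum>p | p permutes {..<N}. of_int (sign p) *
      (Co (1 + (1 - q) * (\<Sum>r<N. q ^ r * (t ^ nat (?e r (p r)) - 1))) * (\<Prod>r<N. ?h r (p r))))"
  proof -
    have "dt N (?h(r := ?T r)) - dt N ?h = (\<Sum>p | p permutes {..<N}. of_int (sign p) *
      (Co (t ^ nat (?e r (p r)) - 1) * (\<Prod>r<N. ?h r (p r))))" if r: "r < N" for r
    proof -
      have "(\<Prod>s<N. (?h(r := ?T r)) s (p s)) = Co (t ^ nat (?e r (p r))) * (\<Prod>s<N. ?h s (p s))" for p
        using r by (subst (1 2) prod.remove[of _ r]) (auto simp: ac_simps)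
      then show ?thesis unfolding dt_def by (simp add: sum_subtractf Co_diff algebra_simps)
    qed
    then have "dt N ?h + Co (1 - q) * (\<Sum>r<N. Co (q ^ r) * (dt N (?h(r := ?T r)) - dt N ?h))
      = dt N ?h + Co (1 - q) * (\<Sum>r<N. Co (q ^ r) * (\<Sum>p | p permutes {..<N}. of_int (sign p) *
      (Co (t ^ nat (?e r (p r)) - 1) * (\<Prod>r<N. ?h r (p r)))))" by simp
    also have "\<dots> = dt N ?h + (\<Sum>p | p permutes {..<N}. \<Sum>r<N. Co (1 - q) * (Co (q ^ r) * (of_int (sign p) *
      (Co (t ^ nat (?e r (p r)) - 1) * (\<Prod>r<N. ?h r (p r))))))"
      by (subst sum.swap) (simp add: sum_distrib_left)
    also have "\<dots> = (\<Sum>p | p permutes {..<N}. of_int (sign p) *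
      (Co (1 + (1 - q) * (\<Sum>r<N. q ^ r * (t ^ nat (?e r (p r)) - 1))) * (\<Prod>r<N. ?h r (p r))))"
      unfolding dt_def sum.distrib[symmetric]
      by (intro sum.cong refl)
         (simp add: Co_add Co_mult Co_sum sum_distrib_left sum_distrib_right distrib_left distrib_right ac_simps)
    finally show ?thesis .
  qed
  also have "\<dots> = (\<Sum>p | p permutes {..<N}. of_int (sign (inv p)) *
      (Co (1 + (1 - q) * (\<Sum>r<N. q ^ r * (t ^ nat (?e r (inv p r)) - 1))) * (\<Prod>r<N. ?h r (inv p r))))"
    by (rule sum_permutations_inverse)
  also have "\<dots> = (\<Sum>p | p permutes {..<N}.
     of_int (sign p) * (Co (ce q t N \<alpha> p) * (\<Prod>i<N. hi (\<alpha> i - int i + int (p i)))))"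
  proof (rule sum.cong[OF refl])
    fix p assume "p \<in> {p. p permutes {..<N}}"
    then have p: "p permutes {..<N}" by simp
    have "sign (inv p) = sign p" using permutation_permutes p by (intro sign_inverse) auto
    moreover have "(\<Sum>r<N. q ^ r * (t ^ nat (?e r (inv p r)) - 1)) = (\<Sum>i<N. q ^ p i * (t ^ nat (?e (p i) i) - 1))"
      using sum.permute[OF p, of "\<lambda>r. q ^ r * (t ^ nat (?e r (inv p r)) - 1)"] permutes_inverses(2)[OF p]
      by (simp add: comp_def)
    moreover have "(\<Prod>r<N. ?h r (inv p r)) = (\<Prod>i<N. ?h (p i) i)"
      using prod.permute[OF p, of "\<lambda>r. ?h r (inv p r)"] permutes_inverses(2)[OF p] by (simp add: comp_def)
    ultimately show "of_int (sign (inv p)) *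
      (Co (1 + (1 - q) * (\<Sum>r<N. q ^ r * (t ^ nat (?e r (inv p r)) - 1))) * (\<Prod>r<N. ?h r (inv p r)))
      = of_int (sign p) * (Co (ce q t N \<alpha> p) * (\<Prod>i<N. hi (\<alpha> i - int i + int (p i))))"
      by (simp add: ce_def)
  qed
  finally show ?thesis .
qed

subsection \<open>Eigenvalues and triangularity\<close>

text \<open>The eigenvalue 1 - (1-q)(1-t) B with B the sum of all cell weights, including the cell
  (1,1). Conjugating l exchanges the roles of q and t.\<close>

definition ev :: "'a::field_char_0 \<Rightarrow> 'a \<Rightarrow> nat list \<Rightarrow> 'a" where
  "ev q t l = 1 - (1 - q) * (1 - t) * (\<Sum>(i, j)\<in>cells l. q ^ i * t ^ j)"

lemma ev_rows: "length l \<le> N \<Longrightarrow> ev q t l = 1 + (1 - q) * (\<Sum>i<N. q ^ i * (t ^ nth0 l i - 1))"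
proof -
  assume N: "length l \<le> N"
  have g: "(1 - t) * (\<Sum>j<a. t ^ j) = - (t ^ a - 1)" for a
    using power_diff_1_eq[of t a] by (simp add: algebra_simps)
  have "(1 - t) * (\<Sum>(i, j)\<in>cells l. q ^ i * t ^ j) = (\<Sum>i<length l. q ^ i * ((1 - t) * (\<Sum>j<l ! i. t ^ j)))"
    unfolding cells_Sigma by (subst sum.Sigma[symmetric]) (auto simp: sum_distrib_left ac_simps)
  also have "\<dots> = - (\<Sum>i<length l. q ^ i * (t ^ nth0 l i - 1))"
    unfolding g sum_negf[symmetric] by (rule sum.cong) (auto simp: nth0_def algebra_simps)
  also have "(\<Sum>i<length l. q ^ i * (t ^ nth0 l i - 1)) = (\<Sum>i<N. q ^ i * (t ^ nth0 l i - 1))"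
    by (rule sum.mono_neutral_left) (use N in \<open>auto simp: nth0_def\<close>)
  finally show ?thesis unfolding ev_def by (simp add: mult.assoc)
qed

lemma ev_conj: "partition l \<Longrightarrow> ev t q (conj l) = ev q t l"
  unfolding ev_def by (simp add: cells_conj sum.reindex case_prod_unfold ac_simps)

text \<open>Scaling the terms of a Jacobi-Trudi expansion keeps its triangularity, and the diagonal
  entry is the scalar attached to the identity permutation.\<close>

lemma ip_EE_sch:
  assumes l: "partition l" and m: "partition m"
  shows "ip (EE q t (sch l)) (sch m) \<noteq> 0 \<Longrightarrow> dom_le l m"
    and "ip (EE q t (sch l)) (sch l) = ev q t l"
proof -
  let ?N = "length l"
  let ?\<alpha> = "\<lambda>i. int (nth0 l i)"
  let ?h = "\<lambda>p. \<Prod>i<?N. hi (?\<alpha> i - int i + int (p i)) :: 'a sym"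
  have e: "ip (EE q t (sch l)) (sch m) = (\<Sum>p | p permutes {..<?N}. of_int (sign p) * (ce q t ?N ?\<alpha> p * ip (sch m) (?h p)))" for m
    unfolding sch_def[of l] EE_sN ip_sum_left ip_of_int_left ip_Co_left by (simp add: ip_commute)
  show "dom_le l m" if "ip (EE q t (sch l)) (sch m) \<noteq> 0"
  proof -
    have "(\<Sum>p | p permutes {..<?N}. of_int (sign p) * (ce q t ?N ?\<alpha> p * ip (sch m) (?h p))) \<noteq> 0"
      using that e by simp
    then obtain p where "p \<in> {p. p permutes {..<?N}}" "of_int (sign p) * (ce q t ?N ?\<alpha> p * ip (sch m) (?h p)) \<noteq> 0"
      by (rule sum.not_neutral_contains_not_neutral)
    then show ?thesis by (intro ip_prod_hi_nonzero(1)[OF l _ order_refl m, of p, where 'a='a]) auto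
  qed
  have "ip (EE q t (sch l)) (sch l) = (\<Sum>p\<in>{id}. of_int (sign p) * (ce q t ?N ?\<alpha> p * ip (sch l) (?h p)))"
    unfolding e
  proof (rule sum.mono_neutral_right[OF finite_perms])
    show "\<forall>p\<in>{p. p permutes {..<?N}} - {id}. of_int (sign p) * (ce q t ?N ?\<alpha> p * ip (sch l) (?h p)) = 0"
    proof
      fix p assume p: "p \<in> {p. p permutes {..<?N}} - {id}"
      then have "ip (sch l) (?h p) = 0" using ip_prod_hi_nonzero(2)[OF l _ order_refl l, of p, where 'a='a] by auto
      then show "of_int (sign p) * (ce q t ?N ?\<alpha> p * ip (sch l) (?h p)) = 0" by simp
    qed
  qed (auto simp: id_permutes)
  also have "\<dots> = ev q t l"
    using ip_sch_hmu_self[OF l, where 'a='a]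
    by (simp add: sign_id hmu_nth0[OF order_refl] ce_def ev_rows[OF order_refl])
  finally show "ip (EE q t (sch l)) (sch l) = ev q t l" .
qed

section \<open>Existence and uniqueness of Macdonald polynomials from two triangularities\<close>

section \<open>Macdonald polynomials as eigenvectors\<close>

lemma parseval: "homog n F \<Longrightarrow> ip F G = (\<Sum>l\<in>partitions n. ip F (sch l) * ip G (sch l))"
proof -
  assume F: "homog n F"
  have "ip F G = ip (mk n (sc n F)) G" by (simp add: mk_sc[OF F])
  also have "\<dots> = (\<Sum>l\<in>partitions n. ip F (sch l) * ip G (sch l))"
    unfolding mk_def ip_sum_left
    by (rule sum.cong) (auto simp: ip_Co_left sc_def ip_commute[of "sch _" G])
  finally show ?thesis .
qed

lemma homog_expand: "homog n F \<Longrightarrow> F = (\<Sum>l\<in>partitions n. Co (ip F (sch l)) * sch l)"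
proof -
  assume F: "homog n F"
  have "F = mk n (sc n F)" by (simp add: mk_sc[OF F])
  also have "\<dots> = (\<Sum>l\<in>partitions n. Co (ip F (sch l)) * sch l)"
    unfolding mk_def by (rule sum.cong) (auto simp: sc_def)
  finally show ?thesis .
qed

lemma diag_cong_homog:
  assumes F: "homog n F" and cd: "\<And>k. k \<ge> 1 \<Longrightarrow> c k = d k"
  shows "diag c F = diag d F"
proof (rule poly_mapping_eqI)
  fix m
  show "lookup (diag c F) m = lookup (diag d F) m"
  proof (cases "lookup F m = 0")
    case False
    then have "0 \<notin># m" using F by (auto simp: homog_def)
    then have "(\<Prod>k\<in>#m. c k) = (\<Prod>k\<in>#m. d k)"
      by (intro arg_cong[where f=prod_mset] image_mset_cong cd) (metis not_gr0 less_eq_Suc_le One_nat_def)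
    then show ?thesis by (simp add: lookup_diag)
  qed (simp add: lookup_diag)
qed

lemma diag_power: "homog n F \<Longrightarrow> diag (\<lambda>k. c ^ k) F = Co (c ^ n) * F"
proof (rule poly_mapping_eqI)
  fix m assume F: "homog n F"
  have "(\<Prod>k\<in>#m. c ^ k) = c ^ sum_mset m" by (induction m) (auto simp: power_add)
  then show "lookup (diag (\<lambda>k. c ^ k) F) m = lookup (Co (c ^ n) * F) m"
    using F by (cases "lookup F m = 0") (auto simp: lookup_diag homog_def)
qed

lemma pi1_0: "homog n F \<Longrightarrow> pi1 0 F = F"
  using diag_cong_homog[of n F "\<lambda>k. 1 - 0 ^ k" "\<lambda>_. 1"] by (simp add: diag_one_id)

text \<open>Rests on 1 - q^(-k) = (-1/q)^k (-(-1)^k)(1 - q^k): replacing q by 1/q applies omega up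
  to a scalar. Hence a support condition above \<open>conj mu\<close> for X(1-q) becomes one below
  mu for X(1-1/q).\<close>

lemma pi1_inverse:
  assumes F: "homog n F" and q: "q \<noteq> 0"
  shows "pi1 (1 / q) F = Co ((- 1 / q) ^ n) * Om (pi1 q F)"
proof -
  have "Co ((- 1 / q) ^ n) * Om (pi1 q F) = diag (\<lambda>k. (- 1 / q) ^ k) (Om (pi1 q F))"
    by (rule diag_power[symmetric]) (intro homog_diag F)
  also have "\<dots> = diag (\<lambda>k. (- 1 / q) ^ k * (om k * (1 - q ^ k))) F"
    by (simp add: diag_diag)
  also have "\<dots> = pi1 (1 / q) F"
  proof (rule diag_cong_homog[OF F])
    fix k :: nat
    have "(- 1 / q) ^ k * om k = - (((- 1 / q) * (- 1)) ^ k)" unfolding power_mult_distrib by simp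
    then have "(- 1 / q) ^ k * om k = - ((1 / q) ^ k)" by simp
    then have "(- 1 / q) ^ k * (om k * (1 - q ^ k)) = - ((1 / q) ^ k) * (1 - q ^ k)"
      by (simp add: mult.assoc[symmetric])
    also have "\<dots> = 1 - (1 / q) ^ k" using q by (simp add: right_diff_distrib power_divide)
    finally show "(- 1 / q) ^ k * (om k * (1 - q ^ k)) = 1 - (1 / q) ^ k" .
  qed
  finally show ?thesis by simp
qed

lemma pi1_inj:
  assumes u: "\<And>k. k \<ge> 1 \<Longrightarrow> u ^ k \<noteq> 1" and F: "homog n F" and z: "pi1 u F = 0"
  shows "F = 0"
proof (rule poly_mapping_eqI)
  fix m
  show "lookup F m = lookup 0 m"
  proof (rule ccontr)
    assume nz: "lookup F m \<noteq> lookup 0 m"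
    then have "0 \<notin># m" using F by (auto simp: homog_def)
    then have "(\<Prod>k\<in>#m. 1 - u ^ k) \<noteq> 0"
      using u by (induction m) (auto simp: Suc_le_eq)
    moreover have "lookup (pi1 u F) m = 0" using z by simp
    ultimately show False using nz by (simp add: lookup_diag)
  qed
qed

lemma pi1_surj:
  assumes u: "\<And>k. k \<ge> 1 \<Longrightarrow> u ^ k \<noteq> 1" and F: "homog n F"
  shows "\<exists>H. homog n H \<and> pi1 u H = F"
proof (intro exI conjI)
  show "homog n (diag (\<lambda>k. 1 / (1 - u ^ k)) F)" by (rule homog_diag[OF F])
  have "pi1 u (diag (\<lambda>k. 1 / (1 - u ^ k)) F) = diag (\<lambda>_. 1) F"
    unfolding diag_diag by (rule diag_cong_homog[OF F]) (use u in auto)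
  then show "pi1 u (diag (\<lambda>k. 1 / (1 - u ^ k)) F) = F" by (simp add: diag_one_id)
qed

definition above :: "nat list \<Rightarrow> 'a::field_char_0 sym \<Rightarrow> bool" where
  "above mu G \<longleftrightarrow> (\<forall>l\<in>partitions (sum_list mu). ip G (sch l) \<noteq> 0 \<longrightarrow> dom_le mu l)"

text \<open>Used with a = 1/q: the symmetric form <F[X(1-t)], G[X(1-1/q)]> takes the value 0 on a
  homogeneous pair (F, F) only for F = 0.\<close>

definition anisotropic :: "'a::field_char_0 \<Rightarrow> 'a \<Rightarrow> bool" where
  "anisotropic a t \<longleftrightarrow> (\<forall>n F. homog n F \<longrightarrow> ip (pi1 t F) (pi1 a F) = 0 \<longrightarrow> F = 0)"

lemma ip_pi1_inverse_sch:
  assumes F: "homog n F" and q: "q \<noteq> 0" and l: "partition l"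
  shows "ip (pi1 (1 / q) F) (sch l) = (- 1 / q) ^ n * ip (pi1 q F) (sch (conj l))"
  unfolding pi1_inverse[OF F q] ip_Co_left ip_diag[of om] Om_sch[OF l] ..

text \<open>One factor is supported on l above mu, the other, by \<open>pi1_inverse\<close>, on l
  below nu. Only l between mu and nu can contribute to the pairing.\<close>

lemma above_orthogonal:
  assumes mu: "partition mu" and nu: "partition nu" and q: "q \<noteq> 0"
    and F: "homog (sum_list mu) F" "above mu (pi1 t F)"
    and G: "homog (sum_list mu) G" "above (conj nu) (pi1 q G)" "sum_list nu = sum_list mu"
  shows "ip (pi1 t F) (pi1 (1 / q) G) \<noteq> 0 \<Longrightarrow> dom_le mu nu"
    and "mu = nu \<Longrightarrow> ip (pi1 t F) (pi1 (1 / q) G) = ip (pi1 t F) (sch mu) * ip (pi1 (1 / q) G) (sch mu)"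
proof -
  have key: "dom_le mu l \<and> dom_le l nu"
    if l: "l \<in> partitions (sum_list mu)" and nz: "ip (pi1 t F) (sch l) * ip (pi1 (1 / q) G) (sch l) \<noteq> 0" for l
  proof
    have lp: "partition l" using l by (simp add: partitions_iff)
    show "dom_le mu l" using F(2) l nz by (auto simp: above_def)
    have "ip (pi1 q G) (sch (conj l)) \<noteq> 0" using nz by (auto simp: ip_pi1_inverse_sch[OF G(1) q lp])
    then have "dom_le (conj nu) (conj l)"
      using G(2,3) conj_partitions[OF l] by (auto simp: above_def sum_list_conj[OF nu])
    then have "dom_le (conj (conj l)) (conj (conj nu))" by (rule dom_le_conj[OF partition_conj[OF nu] partition_conj[OF lp]])
    then show "dom_le l nu" by (simp add: conj_conj lp nu)
  qed
  have e: "ip (pi1 t F) (pi1 (1 / q) G)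
    = (\<Sum>l\<in>partitions (sum_list mu). ip (pi1 t F) (sch l) * ip (pi1 (1 / q) G) (sch l))"
    by (rule parseval[OF homog_diag[OF F(1)]])
  show "dom_le mu nu" if "ip (pi1 t F) (pi1 (1 / q) G) \<noteq> 0"
  proof -
    have "(\<Sum>l\<in>partitions (sum_list mu). ip (pi1 t F) (sch l) * ip (pi1 (1 / q) G) (sch l)) \<noteq> 0"
      using that e by simp
    then obtain l where "l \<in> partitions (sum_list mu)" "ip (pi1 t F) (sch l) * ip (pi1 (1 / q) G) (sch l) \<noteq> 0"
      by (rule sum.not_neutral_contains_not_neutral)
    then show ?thesis using key dom_le_trans by blast
  qed
  show "ip (pi1 t F) (pi1 (1 / q) G) = ip (pi1 t F) (sch mu) * ip (pi1 (1 / q) G) (sch mu)" if "mu = nu"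
  proof -
    have "(\<Sum>l\<in>partitions (sum_list mu). ip (pi1 t F) (sch l) * ip (pi1 (1 / q) G) (sch l))
      = (\<Sum>l\<in>{mu}. ip (pi1 t F) (sch l) * ip (pi1 (1 / q) G) (sch l))"
    proof (rule sum.mono_neutral_right)
      show "\<forall>l\<in>partitions (sum_list mu) - {mu}. ip (pi1 t F) (sch l) * ip (pi1 (1 / q) G) (sch l) = 0"
      proof (rule ballI, rule ccontr)
        fix l assume l: "l \<in> partitions (sum_list mu) - {mu}"
          and "ip (pi1 t F) (sch l) * ip (pi1 (1 / q) G) (sch l) \<noteq> 0"
        then have "dom_le mu l" "dom_le l mu" using key[of l] that by auto
        then show False using dom_le_antisym[OF mu, of l] l by (auto simp: partitions_iff)
      qed
    qed (use mu in \<open>auto simp: partitions_iff finite_partitions\<close>)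
    then show ?thesis using e by simp
  qed
qed

text \<open>Pairing F with itself leaves only the term at mu. If the leading coefficient vanishes, F
  is isotropic and therefore zero.\<close>

lemma macdonald_unique:
  assumes mu: "partition mu" and q: "q \<noteq> 0" and an: "anisotropic (1 / q) t"
    and F: "homog (sum_list mu) F" "above mu (pi1 t F)" "above (conj mu) (pi1 q F)"
    and z: "ip (pi1 t F) (sch mu) = 0"
  shows "F = 0"
  using above_orthogonal(2)[OF mu mu q F(1,2,1,3) refl refl] z an F(1) by (auto simp: anisotropic_def)

definition ev_inj :: "'a::field_char_0 \<Rightarrow> 'a \<Rightarrow> bool" where
  "ev_inj q t \<longleftrightarrow> (\<forall>n. inj_on (ev q t) (partitions n))"

lemma ev_inj_commute: "ev_inj q t \<Longrightarrow> ev_inj t q"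
  unfolding ev_inj_def
proof (intro allI inj_onI)
  fix n a b assume i: "\<forall>n. inj_on (ev q t) (partitions n)"
    and ab: "a \<in> partitions n" "b \<in> partitions n" "ev t q a = ev t q b"
  then have "ev q t (conj a) = ev q t (conj b)" by (simp add: ev_conj partitions_iff)
  then have "conj a = conj b" using i ab conj_partitions by (meson inj_onD)
  then show "a = b" using ab by (metis conj_conj partitions_iff)
qed

lemma ip_EE:
  assumes "homog n G"
  shows "ip (EE q t G) H = (\<Sum>l\<in>partitions n. ip G (sch l) * ip (EE q t (sch l)) H)"
proof -
  have "ip (EE q t G) H = ip (EE q t (\<Sum>l\<in>partitions n. Co (ip G (sch l)) * sch l)) H"
    by (rule arg_cong[OF homog_expand[OF assms], of "\<lambda>X. ip (EE q t X) H"])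
  then show ?thesis by (simp add: EE_sum EE_Co ip_sum_left ip_Co_left)
qed

definition dom_less :: "nat \<Rightarrow> (nat list \<times> nat list) set" where
  "dom_less n = {(a, b). a \<in> partitions n \<and> b \<in> partitions n \<and> dom_le a b \<and> a \<noteq> b}"

lemma wf_dom_less: "wf (dom_less n)"
proof (rule finite_acyclic_wf)
  show "finite (dom_less n)"
    by (rule finite_subset[of _ "partitions n \<times> partitions n"]) (auto simp: dom_less_def finite_partitions)
  have "Relation.trans (dom_less n)"
    using dom_le_trans dom_le_antisym unfolding Relation.trans_def dom_less_def partitions_iff by blast
  then show "acyclic (dom_less n)"
    by (auto simp: acyclic_def trancl_id dom_less_def)
qed

text \<open>At a minimal element of its support an eigenvector reads off the diagonal entry.\<close>

lemma eigenvector_support: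
  assumes inj: "ev_inj q t" and G: "homog n G" and e: "EE q t G = Co (ev q t mu) * G" and mu: "mu \<in> partitions n"
    and Q: "\<And>l k. Q l \<Longrightarrow> dom_le l k \<Longrightarrow> Q k" "Q mu \<or> ip G (sch mu) = 0"
    and k: "k \<in> partitions n" "ip G (sch k) \<noteq> 0"
  shows "Q k"
proof (rule ccontr)
  assume "\<not> Q k"
  then have "k \<in> {k \<in> partitions n. ip G (sch k) \<noteq> 0 \<and> \<not> Q k}" using k by simp
  then obtain m where m: "m \<in> {k \<in> partitions n. ip G (sch k) \<noteq> 0 \<and> \<not> Q k}"
    and min: "\<And>l. (l, m) \<in> dom_less n \<Longrightarrow> l \<notin> {k \<in> partitions n. ip G (sch k) \<noteq> 0 \<and> \<not> Q k}"
    by (rule wfE_min[OF wf_dom_less[of n]]) blast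
  have mp: "partition m" using m by (simp add: partitions_iff)
  have "ev q t mu * ip G (sch m) = ip (EE q t G) (sch m)" by (simp add: e ip_Co_left)
  also have "\<dots> = (\<Sum>l\<in>partitions n. ip G (sch l) * ip (EE q t (sch l)) (sch m))" by (rule ip_EE[OF G])
  also have "\<dots> = (\<Sum>l\<in>{m}. ip G (sch l) * ip (EE q t (sch l)) (sch m))"
  proof (rule sum.mono_neutral_right[OF finite_partitions])
    show "{m} \<subseteq> partitions n" using m by simp
    show "\<forall>l\<in>partitions n - {m}. ip G (sch l) * ip (EE q t (sch l)) (sch m) = 0"
    proof (rule ballI, rule ccontr)
      fix l assume l: "l \<in> partitions n - {m}" and nz: "ip G (sch l) * ip (EE q t (sch l)) (sch m) \<noteq> 0"
      have "dom_le l m" by (rule ip_EE_sch(1)[of l m q t]) (use l mp nz in \<open>auto simp: partitions_iff\<close>)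
      then have "(l, m) \<in> dom_less n" using l m by (auto simp: dom_less_def)
      then have "Q l" using min[of l] l nz by auto
      then show False using Q(1)[of l m] \<open>dom_le l m\<close> m by simp
    qed
  qed
  also have "\<dots> = ip G (sch m) * ev q t m" by (simp add: ip_EE_sch(2)[OF mp mp])
  finally have "ev q t mu = ev q t m" using m by simp
  then have "mu = m" using inj mu m by (auto simp: ev_inj_def dest: inj_onD)
  then show False using Q(2) m by auto
qed

lemma eigenvector_above:
  assumes "ev_inj q t" "homog (sum_list mu) G" "EE q t G = Co (ev q t mu) * G" "partition mu"
  shows "above mu G"
  unfolding above_def
proof (intro ballI impI)
  fix l assume l: "l \<in> partitions (sum_list mu)" "ip G (sch l) \<noteq> 0"
  have m: "mu \<in> partitions (sum_list mu)" by (simp add: partitions_iff assms(4))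
  show "dom_le mu l"
    by (rule eigenvector_support[OF assms(1-3) m _ _ l, where Q="dom_le mu"])
       (erule (1) dom_le_trans, simp)
qed

lemma eigenvector_zero:
  assumes "ev_inj q t" "homog n G" "EE q t G = Co (ev q t mu) * G" "mu \<in> partitions n" "ip G (sch mu) = 0"
  shows "G = 0"
proof (rule ip_sch_complete[OF assms(2)], rule ccontr)
  fix l assume "l \<in> partitions n" "ip G (sch l) \<noteq> 0"
  then show False using eigenvector_support[OF assms(1-4), of "\<lambda>_. False" l] assms(5) by simp
qed

text \<open>The triangular eigenvector system is solved by recursion along dominance; distinct
  eigenvalues make every division legitimate.\<close>

lemma eigenvector_exists:
  assumes inj: "ev_inj q t" and mu: "mu \<in> partitions n"
  shows "\<exists>J. homog n J \<and> EE q t J = Co (ev q t mu) * J \<and> ip J (sch mu) = (1 :: 'a::field_char_0)"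
proof -
  let ?a = "\<lambda>l k. ip (EE q t (sch l)) (sch k)"
  let ?H = "\<lambda>f k. if k = mu then 1 else if k \<in> partitions n \<and> dom_le mu k then
     (\<Sum>l\<in>{l. (l, k) \<in> dom_less n}. f l * ?a l k) / (ev q t mu - ev q t k) else 0"
  define f where "f = wfrec (dom_less n) ?H"
  have mup: "partition mu" using mu by (simp add: partitions_iff)
  have f: "f k = ?H f k" for k
  proof -
    have "f k = ?H (cut f (dom_less n) k) k" unfolding f_def by (rule wfrec[OF wf_dom_less])
    also have "\<dots> = ?H f k"
      by (intro if_cong refl arg_cong2[where f="(/)"] sum.cong) (auto simp: cut_apply)
    finally show ?thesis .
  qed
  define J where "J = mk n f"
  have J: "homog n J" unfolding J_def by (rule homog_mk)
  have c: "ip J (sch k) = f k" if "k \<in> partitions n" for k unfolding J_def by (rule ip_mk_sch[OF that])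
  have "EE q t J - Co (ev q t mu) * J = 0"
  proof (rule ip_sch_complete[of n])
    show "homog n (EE q t J - Co (ev q t mu) * J)" by (intro homog_diff homog_EE homog_Co J)
    fix k assume k: "k \<in> partitions n"
    then have kp: "partition k" by (simp add: partitions_iff)
    let ?L = "{l. (l, k) \<in> dom_less n}"
    have L: "?L \<subseteq> partitions n" by (auto simp: dom_less_def)
    have "ip (EE q t J) (sch k) = (\<Sum>l\<in>partitions n. f l * ?a l k)"
      unfolding ip_EE[OF J] by (rule sum.cong) (auto simp: c)
    also have "\<dots> = (\<Sum>l\<in>insert k ?L. f l * ?a l k)"
    proof (rule sum.mono_neutral_right[OF finite_partitions])
      show "\<forall>l\<in>partitions n - insert k ?L. f l * ?a l k = 0"
      proof
        fix l assume l: "l \<in> partitions n - insert k ?L"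
        then have "\<not> dom_le l k" using k by (auto simp: dom_less_def)
        then have "?a l k = 0" using ip_EE_sch(1)[of l k q t] l kp by (auto simp: partitions_iff)
        then show "f l * ?a l k = 0" by simp
      qed
    qed (use L k in auto)
    also have "\<dots> = f k * ev q t k + (\<Sum>l\<in>?L. f l * ?a l k)"
      using finite_subset[OF L finite_partitions] by (subst sum.insert) (auto simp: dom_less_def ip_EE_sch(2)[OF kp kp])
    also have "\<dots> = ev q t mu * f k"
    proof (cases "dom_le mu k")
      case False
      have "f l * ?a l k = 0" if "l \<in> ?L" for l
      proof (rule ccontr)
        assume nz: "f l * ?a l k \<noteq> 0"
        have "f l \<noteq> 0" using nz by simp
        then have "dom_le mu l" using f[of l] by (auto split: if_splits)
        moreover have "dom_le l k" using that by (simp add: dom_less_def)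
        ultimately show False using False dom_le_trans by blast
      qed
      then have "(\<Sum>l\<in>?L. f l * ?a l k) = 0" by (intro sum.neutral) auto
      moreover have "f k = 0" using f[of k] False by (auto split: if_splits)
      ultimately show ?thesis by simp
    next
      case True
      show ?thesis
      proof (cases "k = mu")
        case True
        have "f l = 0" if "l \<in> ?L" for l
          using f[of l] that True dom_le_antisym[of mu l] mup by (auto simp: dom_less_def partitions_iff split: if_splits)
        then show ?thesis using True by simp
      next
        case False
        then have "ev q t mu \<noteq> ev q t k" using inj mu k by (auto simp: ev_inj_def dest: inj_onD)
        then show ?thesis using f[of k] False True k by (simp add: field_simps)
      qed
    qed
    finally show "ip (EE q t J - Co (ev q t mu) * J) (sch k) = 0" by (simp add: ip_diff_left ip_Co_left c[OF k])
  qed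
  moreover have "ip J (sch mu) = 1" using c[OF mu] f[of mu] by simp
  ultimately show ?thesis using J by auto
qed

text \<open>The eigenvector with coefficient 1 at s_mu. When the eigenvalues are distinct,
  \<open>JJ_eqI\<close> shows that the choice is unique.\<close>

definition JJ :: "'a::field_char_0 \<Rightarrow> 'a \<Rightarrow> nat list \<Rightarrow> 'a sym" where
  "JJ q t mu = (SOME J. homog (sum_list mu) J \<and> EE q t J = Co (ev q t mu) * J \<and> ip J (sch mu) = 1)"

lemma JJ_props:
  assumes "ev_inj q t" "partition mu"
  shows "homog (sum_list mu) (JJ q t mu)" "EE q t (JJ q t mu) = Co (ev q t mu) * JJ q t mu" "ip (JJ q t mu) (sch mu) = 1"
proof -
  have "\<exists>J. homog (sum_list mu) J \<and> EE q t J = Co (ev q t mu) * J \<and> ip J (sch mu) = 1"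
    by (rule eigenvector_exists[OF assms(1)]) (simp add: partitions_iff assms)
  from someI_ex[OF this, folded JJ_def]
  show "homog (sum_list mu) (JJ q t mu)" "EE q t (JJ q t mu) = Co (ev q t mu) * JJ q t mu" "ip (JJ q t mu) (sch mu) = 1"
    by auto
qed

lemma JJ_eqI:
  assumes "ev_inj q t" "partition mu" "homog (sum_list mu) G" "EE q t G = Co (ev q t mu) * G" "ip G (sch mu) = 1"
  shows "G = JJ q t mu"
proof -
  note J = JJ_props[OF assms(1,2)]
  have "EE q t (G - JJ q t mu) = EE q t (G + Co (- 1) * JJ q t mu)" by (simp add: Co_uminus)
  also have "\<dots> = Co (ev q t mu) * (G - JJ q t mu)"
    unfolding EE_add EE_Co J(2) assms(4) by (simp add: Co_uminus algebra_simps)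
  finally have e: "EE q t (G - JJ q t mu) = Co (ev q t mu) * (G - JJ q t mu)" .
  have "G - JJ q t mu = 0"
  proof (rule eigenvector_zero[OF assms(1) _ e])
    show "homog (sum_list mu) (G - JJ q t mu)" by (intro homog_diff assms(3) J(1))
    show "mu \<in> partitions (sum_list mu)" by (simp add: partitions_iff assms(2))
    show "ip (G - JJ q t mu) (sch mu) = 0" by (simp only: ip_diff_left J(3) assms(5)) simp
  qed
  then show ?thesis by simp
qed

text \<open>The eigenvector of \<open>EE q t\<close> is pulled back through X(1-t) to an eigenvector
  of \<open>DD\<close> and pushed forward through X(1-q) to one of \<open>EE t q\<close>. Its
  eigenvalue is the one attached to \<open>conj mu\<close>, whence the second triangularity.\<close>

lemma macdonald_exists:
  assumes inj: "ev_inj q t" and t: "\<And>k. k \<ge> 1 \<Longrightarrow> t ^ k \<noteq> 1" and mu: "partition mu"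
  shows "\<exists>H. homog (sum_list mu) H \<and> pi1 t H = JJ q t mu \<and> above mu (pi1 t H) \<and> above (conj mu) (pi1 q H)"
proof -
  note J = JJ_props[OF inj mu]
  obtain H where H: "homog (sum_list mu) H" "pi1 t H = JJ q t mu"
    using pi1_surj[OF t J(1)] by blast
  have a: "above mu (pi1 t H)" unfolding H(2) by (rule eigenvector_above[OF inj J(1,2) mu])
  have hD: "homog (sum_list mu) (DD q t H)"
    unfolding DD_def LL_def
  proof (rule homog_sum)
    fix j
    have g: "homog j (gneg j)" unfolding gneg_def by (intro homog_diag homog_hh)
    show "homog (sum_list mu) (gneg j * coeff (transl (\<lambda>k. (1 - q ^ k) * (1 - t ^ k)) H) j)"
    proof (cases "j \<le> sum_list mu")
      case True
      then show ?thesis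
        using homog_mult[OF g, of "sum_list mu - j" "coeff (transl (\<lambda>k. (1 - q ^ k) * (1 - t ^ k)) H) j"]
          homog_coeff_transl[OF H(1), of j] by simp
    next
      case False
      then show ?thesis using homog_coeff_transl[OF H(1), of j] by simp
    qed
  qed
  have "pi1 t (DD q t H - Co (ev q t mu) * H) = pi1 t (DD q t H) - Co (ev q t mu) * pi1 t H"
    by (simp only: rhom_diff[OF rhom_diag] diag_mult diag_Co)
  also have "\<dots> = 0" unfolding pi1_DD H(2) J(2) by simp
  finally have z: "pi1 t (DD q t H - Co (ev q t mu) * H) = 0" .
  have "DD q t H - Co (ev q t mu) * H = 0"
    by (rule pi1_inj[OF t homog_diff[OF hD homog_Co[OF H(1)]] z])
  then have D: "DD q t H = Co (ev q t mu) * H" by simp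
  have "EE t q (pi1 q H) = pi1 q (DD q t H)" by (rule pi1_DD'[symmetric])
  also have "\<dots> = Co (ev t q (conj mu)) * pi1 q H" unfolding D diag_mult diag_Co ev_conj[OF mu] ..
  finally have e: "EE t q (pi1 q H) = Co (ev t q (conj mu)) * pi1 q H" .
  have "above (conj mu) (pi1 q H)"
  proof (rule eigenvector_above[OF ev_inj_commute[OF inj] _ e partition_conj[OF mu]])
    show "homog (sum_list (conj mu)) (pi1 q H)" unfolding sum_list_conj[OF mu] by (intro homog_diag H(1))
  qed
  with H a show ?thesis by blast
qed

section \<open>The operator e_k^perp on Macdonald eigenvectors\<close>

subsection \<open>Removing the first column\<close>

text \<open>This is e_k^perp, the adjoint of multiplication by e_k.\<close>

definition ek :: "nat \<Rightarrow> 'a::field_char_0 sym \<Rightarrow> 'a sym" where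
  "ek k F = coeff (tau' F) k"

lemma ek_add: "ek k (F + G) = ek k F + ek k G"
  and ek_Co: "ek k (Co c * F) = Co c * ek k F"
  by (simp_all add: ek_def rhom_add[OF rhom_transl] rhom_mult[OF rhom_transl])

lemma ek_sum: "ek k (sum f A) = (\<Sum>a\<in>A. ek k (f a))"
  by (simp add: ek_def rhom_sum[OF rhom_transl] coeff_sum)

lemma ek_of_int: "ek k (of_int c * F) = of_int c * ek k F"
  using ek_Co[of k "of_int c" F] by (simp add: Co_of_int)

lemma coeff_prod_linear:
  "coeff (\<Prod>i<N. [:a i:] + monom (b i) 1) N = (\<Prod>i<N. b i :: 'r::comm_ring_1)"
proof -
  have "coeff (\<Prod>i<N. [:a i:] + monom (b i) 1) N = (\<Prod>i<N. b i) \<and> (\<forall>j>N. coeff (\<Prod>i<N. [:a i:] + monom (b i) 1) j = 0)"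
  proof (induction N)
    case (Suc N)
    let ?P = "\<Prod>i<N. [:a i:] + monom (b i) 1"
    have "coeff (?P * ([:a N:] + monom (b N) 1)) j = a N * coeff ?P j + (if 1 \<le> j then b N * coeff ?P (j - 1) else 0)" for j
      by (subst mult.commute) (simp add: distrib_right coeff_monom_mult)
    then show ?case using Suc by (auto simp: mult.commute)
  qed (simp add: one_pCons coeff_pCons split: nat.splits)
  then show ?thesis by simp
qed

text \<open>Each of the N factors is linear in x, so the coefficient of x^N lowers every index by
  one. In an N-row determinant this strips a full first column.\<close>

lemma ek_prod_hi: "ek N (\<Prod>i<N. hi (\<beta> i)) = (\<Prod>i<N. hi (\<beta> i - 1))"
  unfolding ek_def rhom_prod[OF rhom_transl] tau'_hi by (rule coeff_prod_linear)

lemma ek_sN: "ek N (sN N \<alpha>) = sN N (\<lambda>i. \<alpha> i - 1)"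
  unfolding sN_def dt_def ek_sum ek_of_int ek_prod_hi
  by (intro sum.cong refl arg_cong2[where f="(*)"] prod.cong) (auto simp: algebra_simps)

lemma ce_alt:
  assumes "p permutes {..<N}"
  shows "ce q t N \<alpha> p = q ^ N + (1 - q) * (\<Sum>i<N. q ^ p i * t ^ nat (\<alpha> i - int i + int (p i)))"
proof -
  have "(\<Sum>i<N. q ^ p i) = (\<Sum>i<N. q ^ i)" using sum.permute[OF assms, of "\<lambda>i. q ^ i"] by (simp add: comp_def)
  moreover have "(1 - q) * (\<Sum>i<N. q ^ i) = 1 - q ^ N" using power_diff_1_eq[of q N] by (simp add: algebra_simps)
  ultimately show ?thesis
    by (simp add: ce_def sum_subtractf right_diff_distrib)
qed

text \<open>In the form \<open>ce_alt\<close> the scalar of a term is q^N plus a combination of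
  powers t^m of its indices m. Lowering all indices by one divides the second part by t and leaves
  q^N unchanged.\<close>

lemma ek_EE_sN:
  "ek N (EE q t (sN N \<alpha>)) - Co (q ^ N) * ek N (sN N \<alpha>)
     = Co t * (EE q t (ek N (sN N \<alpha>)) - Co (q ^ N) * ek N (sN N \<alpha>))"
proof -
  let ?\<beta> = "\<lambda>p i. \<alpha> i - int i + int (p i)"
  let ?P = "\<lambda>p. \<Prod>i<N. hi (?\<beta> p i - 1) :: 'a sym"
  let ?s = "\<lambda>p. (1 - q) * (\<Sum>i<N. q ^ p i * t ^ nat (?\<beta> p i))"
  let ?s' = "\<lambda>p. (1 - q) * (\<Sum>i<N. q ^ p i * t ^ nat (?\<beta> p i - 1))"
  have sh: "\<alpha> i - 1 - int i + int (p i) = ?\<beta> p i - 1" for i and p :: "nat \<Rightarrow> nat" by simp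
  have 0: "ek N (sN N \<alpha>) = (\<Sum>p | p permutes {..<N}. of_int (sign p) * ?P p)"
    unfolding sN_def dt_def ek_sum ek_of_int ek_prod_hi ..
  have 1: "ek N (EE q t (sN N \<alpha>)) = (\<Sum>p | p permutes {..<N}. of_int (sign p) * (Co (q ^ N + ?s p) * ?P p))"
    unfolding EE_sN ek_sum ek_of_int ek_Co ek_prod_hi by (rule sum.cong) (auto simp: ce_alt)
  have 2: "EE q t (ek N (sN N \<alpha>)) = (\<Sum>p | p permutes {..<N}. of_int (sign p) * (Co (q ^ N + ?s' p) * ?P p))"
    unfolding ek_sN EE_sN sh by (rule sum.cong) (auto simp: ce_alt algebra_simps)
  have st: "Co (?s p) * ?P p = Co t * (Co (?s' p) * ?P p)" for p
  \<comment> \<open>If some index is at most 0, the lowered product already vanishes; otherwise the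
    truncation by \<open>nat\<close> is harmless and one factor t splits off.\<close>
  proof (cases "\<exists>i<N. ?\<beta> p i < 1")
    case True
    then obtain i where i: "i < N" "?\<beta> p i < 1" by blast
    then have "hi (?\<beta> p i - 1) = (0 :: 'a sym)" by (intro hi_neg) simp
    then have "?P p = 0" using i by (intro prod_zero bexI[of _ i]) auto
    then show ?thesis by simp
  next
    case False
    have e: "?s p = t * ?s' p"
    proof -
      have "t ^ nat (?\<beta> p i) = t * t ^ nat (?\<beta> p i - 1)" if "i < N" for i
      proof -
        have "nat x = Suc (nat (x - 1))" if "x \<ge> 1" for x :: int using that by linarith
        moreover have "?\<beta> p i \<ge> 1" using False that by (meson not_less)
        ultimately have "nat (?\<beta> p i) = Suc (nat (?\<beta> p i - 1))" by blast
        then show ?thesis by simp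
      qed
      then have "(\<Sum>i<N. q ^ p i * t ^ nat (?\<beta> p i)) = (\<Sum>i<N. t * (q ^ p i * t ^ nat (?\<beta> p i - 1)))"
        by (intro sum.cong) auto
      then show ?thesis by (simp add: sum_distrib_left mult.left_commute)
    qed
    show ?thesis unfolding e by (simp only: Co_mult mult.assoc)
  qed
  have "ek N (EE q t (sN N \<alpha>)) - Co (q ^ N) * ek N (sN N \<alpha>) = (\<Sum>p | p permutes {..<N}. of_int (sign p) * (Co (?s p) * ?P p))"
    unfolding 0 1 by (simp add: Co_add distrib_right distrib_left sum.distrib sum_distrib_left mult.left_commute)
  also have "\<dots> = Co t * (\<Sum>p | p permutes {..<N}. of_int (sign p) * (Co (?s' p) * ?P p))"
    unfolding st by (simp add: sum_distrib_left mult.left_commute)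
  also have "(\<Sum>p | p permutes {..<N}. of_int (sign p) * (Co (?s' p) * ?P p)) = EE q t (ek N (sN N \<alpha>)) - Co (q ^ N) * ek N (sN N \<alpha>)"
    unfolding 2 unfolding 0 by (simp add: Co_add distrib_right distrib_left sum.distrib sum_distrib_left mult.left_commute)
  finally show ?thesis .
qed

definition short :: "nat \<Rightarrow> nat \<Rightarrow> 'a::field_char_0 sym \<Rightarrow> bool" where
  "short n k F \<longleftrightarrow> homog n F \<and> (\<forall>l\<in>partitions n. ip F (sch l) \<noteq> 0 \<longrightarrow> length l \<le> k)"

lemma short_expand:
  assumes "short n k F" shows "F = (\<Sum>l\<in>{l\<in>partitions n. length l \<le> k}. Co (ip F (sch l)) * sch l)"
proof -
  have "F = (\<Sum>l\<in>partitions n. Co (ip F (sch l)) * sch l)" using assms by (intro homog_expand) (simp add: short_def)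
  also have "\<dots> = (\<Sum>l\<in>{l\<in>partitions n. length l \<le> k}. Co (ip F (sch l)) * sch l)"
    by (rule sum.mono_neutral_right) (use assms in \<open>auto simp: short_def finite_partitions\<close>)
  finally show ?thesis .
qed

lemma ek_EE:
  assumes "short n k F"
  shows "ek k (EE q t F) - Co (q ^ k) * ek k F = Co t * (EE q t (ek k F) - Co (q ^ k) * ek k F)"
proof -
  let ?L = "{l\<in>partitions n. length l \<le> k}"
  define c where "c l = ip F (sch l)" for l
  have Fe: "F = (\<Sum>l\<in>?L. Co (c l) * sch l)" unfolding c_def by (rule short_expand[OF assms])
  have "ek k (EE q t F) - Co (q ^ k) * ek k F
     = (\<Sum>l\<in>?L. Co (c l) * (ek k (EE q t (sch l)) - Co (q ^ k) * ek k (sch l)))"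
    unfolding Fe
    by (simp add: EE_sum EE_Co ek_sum ek_Co sum_subtractf sum_distrib_left right_diff_distrib mult.left_commute)
  also have "\<dots> = (\<Sum>l\<in>?L. Co (c l) * (Co t * (EE q t (ek k (sch l)) - Co (q ^ k) * ek k (sch l))))"
  proof (rule sum.cong[OF refl])
    fix l assume "l \<in> ?L"
    then have "sch l = (sN k (\<lambda>i. int (nth0 l i)) :: 'a sym)" by (intro sch_sN) simp
    then show "Co (c l) * (ek k (EE q t (sch l)) - Co (q ^ k) * ek k (sch l)) =
      Co (c l) * (Co t * (EE q t (ek k (sch l)) - Co (q ^ k) * ek k (sch l)))"
      by (simp only: ek_EE_sN)
  qed
  also have "\<dots> = Co t * (EE q t (ek k F) - Co (q ^ k) * ek k F)"
    unfolding Fe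
    by (simp add: EE_sum EE_Co ek_sum ek_Co sum_subtractf sum_distrib_left right_diff_distrib mult.left_commute)
  finally show ?thesis .
qed

definition addcol :: "nat \<Rightarrow> nat list \<Rightarrow> nat list" where
  "addcol k l = map (\<lambda>i. Suc (nth0 l i)) [0..<k]"

lemma length_addcol [simp]: "length (addcol k l) = k" by (simp add: addcol_def)

lemma nth0_addcol: "nth0 (addcol k l) i = (if i < k then Suc (nth0 l i) else 0)"
  by (simp add: addcol_def nth0_def)

lemma partition_addcol: "partition l \<Longrightarrow> partition (addcol k l)"
  unfolding partition_def[of "addcol k l"]
  by (auto simp: addcol_def sorted_wrt_map sorted_wrt_iff_nth_less intro!: partition_nth0_mono)

lemma sum_addcol: "length l \<le> k \<Longrightarrow> sum_list (addcol k l) = sum_list l + k"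
  using sum_nth0[of "addcol k l" k] sum_nth0[of l k] by (simp add: nth0_addcol sum_Suc)

lemma addcol_inj:
  assumes "partition l" "partition m" "length l \<le> k" "length m \<le> k" "addcol k l = addcol k m"
  shows "l = m"
proof (rule nth0_eqI[OF assms(1,2)])
  fix i
  show "nth0 l i = nth0 m i"
  proof (cases "i < k")
    case True
    then show ?thesis using arg_cong[OF assms(5), of "\<lambda>x. nth0 x i"] by (simp add: nth0_addcol)
  next
    case False
    then show ?thesis using assms(3,4) by (simp add: nth0_def)
  qed
qed

lemma ex_addcol:
  assumes l: "partition l" and k: "length l = k"
  shows "\<exists>m. partition m \<and> length m \<le> k \<and> l = addcol k m"
proof -
  let ?a = "\<lambda>i. nth0 l i - 1"
  have "?a j \<le> ?a i" if "i \<le> j" for i j using partition_nth0_mono[OF l that] by simp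
  note lp = list_of_props[of k ?a, OF this]
  have "l = addcol k (list_of k ?a)"
  proof (rule nth0_eqI[OF l partition_addcol[OF lp(1)]])
    fix i show "nth0 l i = nth0 (addcol k (list_of k ?a)) i"
      using partition_nth0_pos[OF l, of i] k lp(3)[of i] by (auto simp: nth0_addcol)
  qed
  with lp(1,2) show ?thesis by blast
qed

lemma ek_sch:
  assumes l: "partition l"
  shows "length l \<le> k \<Longrightarrow> ek k (sch (addcol k l)) = (sch l :: 'a::field_char_0 sym)"
    and "length l < k \<Longrightarrow> ek k (sch l) = (0 :: 'a sym)"
proof -
  assume k: "length l \<le> k"
  have "ek k (sch (addcol k l) :: 'a sym) = sN k (\<lambda>i. int (nth0 (addcol k l) i) - 1)"
    by (subst sch_sN[of _ k]) (simp_all add: ek_sN)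
  also have "\<dots> = sN k (\<lambda>i. int (nth0 l i))" by (rule sN_cong) (simp add: nth0_addcol)
  also have "\<dots> = sch l" by (rule sch_sN[OF k, symmetric])
  finally show "ek k (sch (addcol k l)) = (sch l :: 'a sym)" .
next
  assume k: "length l < k"
  have "ek k (sch l :: 'a sym) = sN k (\<lambda>i. int (nth0 l i) - 1)"
    using k by (subst sch_sN[of _ k]) (simp_all add: ek_sN)
  also have "\<dots> = 0" using k by (intro sN_neg_last) (auto simp: nth0_def)
  finally show "ek k (sch l) = (0 :: 'a sym)" .
qed

text \<open>With at most k rows, every Schur function is a k-row determinant: a first column of
  height k is stripped off, and fewer than k rows give zero.\<close>

lemma ip_ek:
  assumes F: "short n k F" and m: "partition m" "sum_list m + k = n"
  shows "ip (ek k F) (sch m) = (if length m \<le> k then ip F (sch (addcol k m)) else 0)"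
proof -
  let ?L = "{l\<in>partitions n. length l \<le> k}"
  have "ip (ek k F) (sch m) = (\<Sum>l\<in>?L. ip F (sch l) * ip (ek k (sch l)) (sch m))"
    by (subst (1) short_expand[OF F]) (simp add: ek_sum ek_Co ip_sum_left ip_Co_left)
  also have "\<dots> = (\<Sum>l\<in>?L. if l = addcol k m \<and> length m \<le> k then ip F (sch l) else 0)"
  proof (rule sum.cong[OF refl])
    fix l assume l: "l \<in> ?L"
    then have lp: "partition l" by (simp add: partitions_iff)
    show "ip F (sch l) * ip (ek k (sch l)) (sch m) = (if l = addcol k m \<and> length m \<le> k then ip F (sch l) else 0)"
    proof (cases "length l = k")
      case True
      then obtain u where u: "partition u" "length u \<le> k" "l = addcol k u" using ex_addcol[OF lp] by blast
      have "l = addcol k m \<and> length m \<le> k \<longleftrightarrow> u = m" using addcol_inj[OF u(1) m(1) u(2)] u by auto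
      then show ?thesis using ek_sch(1)[OF u(1,2), where 'a='a] by (simp add: u(3) ip_sch_sch u(1) m(1))
    next
      case False
      then have "length l < k" using l by simp
      then show ?thesis using False ek_sch(2)[OF lp, of k, where 'a='a] by auto
    qed
  qed
  also have "\<dots> = (if length m \<le> k then ip F (sch (addcol k m)) else 0)"
  proof (cases "length m \<le> k")
    case True
    have "addcol k m \<in> ?L" using True m by (simp add: partitions_iff partition_addcol sum_addcol)
    then show ?thesis using True by (simp add: finite_partitions)
  qed simp
  finally show ?thesis .
qed

lemma homog_ek: "homog n F \<Longrightarrow> k \<le> n \<Longrightarrow> homog (n - k) (ek k F)"
  using homog_coeff_transl[of n F k] by (simp add: ek_def)

lemma above_short:
  assumes "homog (sum_list mu) F" "above mu F" shows "short (sum_list mu) (length mu) F"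
  using assms dom_le_length by (auto simp: short_def above_def partitions_iff)

text \<open>By \<open>ek_EE\<close> the image is an eigenvector, with the eigenvalue minus q^k
  divided by t. Removing a column of height k changes \<open>ev\<close> in exactly this way, and
  \<open>ip_ek\<close> keeps the leading coefficient equal to 1.\<close>

lemma ek_JJ:
  assumes inj: "ev_inj q t" and t: "t \<noteq> 0" and nu: "partition nu" "length nu \<le> k"
  shows "ek k (JJ q t (addcol k nu)) = JJ q t nu"
proof (rule JJ_eqI[OF inj nu(1)])
  let ?mu = "addcol k nu"
  have mu: "partition ?mu" "sum_list ?mu = sum_list nu + k" using nu by (auto simp: partition_addcol sum_addcol)
  note J = JJ_props[OF inj mu(1)]
  have sh: "short (sum_list ?mu) k (JJ q t ?mu)"
    using above_short[OF J(1) eigenvector_above[OF inj J(1,2) mu(1)]] by simp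
  show "homog (sum_list nu) (ek k (JJ q t ?mu))" using homog_ek[OF J(1), of k] mu(2) by simp
  show "ip (ek k (JJ q t ?mu)) (sch nu) = 1" using ip_ek[OF sh nu(1)] mu(2) nu(2) J(3) by simp
  let ?G = "ek k (JJ q t ?mu)"
  have ev1: "ev q t ?mu = q ^ k + (1 - q) * (\<Sum>i<k. q ^ i * t ^ nth0 ?mu i)"
    and ev2: "ev q t nu = q ^ k + (1 - q) * (\<Sum>i<k. q ^ i * t ^ nth0 nu i)"
    using ce_alt[OF id_permutes, of q t k "\<lambda>i. int (nth0 ?mu i)"] ce_alt[OF id_permutes, of q t k "\<lambda>i. int (nth0 nu i)"]
      nu(2) by (simp_all add: ce_def ev_rows[of _ k])
  have s: "(\<Sum>i<k. q ^ i * t ^ nth0 ?mu i) = t * (\<Sum>i<k. q ^ i * t ^ nth0 nu i)"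
    unfolding sum_distrib_left by (rule sum.cong) (auto simp: nth0_addcol)
  have d: "ev q t ?mu - q ^ k = t * (ev q t nu - q ^ k)" unfolding ev1 ev2 s by (simp add: ac_simps)
  have "Co t * (Co (ev q t nu - q ^ k) * ?G) = ek k (EE q t (JJ q t ?mu)) - Co (q ^ k) * ?G"
    unfolding J(2) ek_Co mult.assoc[symmetric] Co_mult[symmetric] d[symmetric] by (simp add: Co_diff left_diff_distrib)
  also have "\<dots> = Co t * (EE q t ?G - Co (q ^ k) * ?G)" by (rule ek_EE[OF sh])
  finally have "Co (1 / t) * (Co t * (Co (ev q t nu - q ^ k) * ?G)) = Co (1 / t) * (Co t * (EE q t ?G - Co (q ^ k) * ?G))"
    by simp
  then have "Co (ev q t nu - q ^ k) * ?G = EE q t ?G - Co (q ^ k) * ?G"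
    using t unfolding mult.assoc[symmetric] Co_mult[symmetric] by simp
  then show "EE q t ?G = Co (ev q t nu) * ?G" by (simp add: Co_diff left_diff_distrib)
qed

section \<open>Values at zero of rational functions, extended to symmetric functions\<close>

section \<open>Specialization\<close>

text \<open>The relation "regular at 0 with value v". It carries regularity and value together, so
  both propagate through sums, products and quotients. It is used for t = 0 and also for q =
  0.\<close>

definition spr :: "'r::linordered_idom poly fract \<Rightarrow> 'r fract \<Rightarrow> bool" where
  "spr x v \<longleftrightarrow> (\<exists>a b. x = Fract a b \<and> coeff b 0 \<noteq> 0 \<and> v = Fract (coeff a 0) (coeff b 0))"

lemma sprI: "coeff b 0 \<noteq> 0 \<Longrightarrow> spr (Fract a b) (Fract (coeff a 0) (coeff b 0))"
  by (auto simp: spr_def)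

lemma spr_unique: "spr x v \<Longrightarrow> spr x w \<Longrightarrow> v = w"
proof -
  assume "spr x v" "spr x w"
  then obtain a b c d where x: "x = Fract a b" "x = Fract c d" and nz: "coeff b 0 \<noteq> 0" "coeff d 0 \<noteq> 0"
    and v: "v = Fract (coeff a 0) (coeff b 0)" "w = Fract (coeff c 0) (coeff d 0)"
    unfolding spr_def by blast
  have "b \<noteq> 0" "d \<noteq> 0" using nz by auto
  then have "a * d = c * b" using x eq_fract(1)[of b d a c] by simp
  then have "coeff (a * d) 0 = coeff (c * b) 0" by simp
  then show ?thesis using nz by (simp add: v eq_fract coeff_mult_0)
qed

lemma spr_const: "spr (Fract [:c:] 1) (Fract c 1)"
  using sprI[of 1 "[:c:]"] by simp

lemma spr_0 [simp]: "spr 0 0" and spr_1 [simp]: "spr 1 1"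
  using spr_const[of 0] spr_const[of 1] by (simp_all add: Zero_fract_def One_fract_def one_pCons)

lemma spr_add: "spr x v \<Longrightarrow> spr y w \<Longrightarrow> spr (x + y) (v + w)"
  and spr_mult: "spr x v \<Longrightarrow> spr y w \<Longrightarrow> spr (x * y) (v * w)"
proof -
  assume "spr x v" "spr y w"
  then obtain a b c d where x: "x = Fract a b" "y = Fract c d" and nz: "coeff b 0 \<noteq> 0" "coeff d 0 \<noteq> 0"
    and v: "v = Fract (coeff a 0) (coeff b 0)" "w = Fract (coeff c 0) (coeff d 0)"
    unfolding spr_def by blast
  have b: "b \<noteq> 0" "d \<noteq> 0" using nz by auto
  have n: "coeff (b * d) 0 \<noteq> 0" using nz by (simp add: coeff_mult_0)
  show "spr (x + y) (v + w)" using sprI[OF n, of "a * d + c * b"] b nz by (simp add: x v coeff_mult_0)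
  show "spr (x * y) (v * w)" using sprI[OF n, of "a * c"] by (simp add: x v coeff_mult_0)
qed

lemma spr_uminus: "spr x v \<Longrightarrow> spr (- x) (- v)"
proof -
  assume "spr x v"
  moreover have "spr (- 1) (- 1 :: 'a fract)"
    using spr_const[of "- 1 :: 'a"] by (simp add: One_fract_def one_pCons)
  ultimately show ?thesis using spr_mult[of "- 1" "- 1" x v] by simp
qed

lemma spr_diff: "spr x v \<Longrightarrow> spr y w \<Longrightarrow> spr (x - y) (v - w)"
  using spr_add[of x v "- y" "- w"] spr_uminus by auto

lemma spr_inverse: "spr x v \<Longrightarrow> v \<noteq> 0 \<Longrightarrow> spr (inverse x) (inverse v)"
proof -
  assume "spr x v" "v \<noteq> 0"
  then obtain a b where x: "x = Fract a b" and nz: "coeff b 0 \<noteq> 0" and v: "v = Fract (coeff a 0) (coeff b 0)"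
    unfolding spr_def by blast
  have "coeff a 0 \<noteq> 0" using \<open>v \<noteq> 0\<close> nz by (auto simp: v Zero_fract_def eq_fract)
  then show ?thesis using sprI[of a b] by (simp add: x v)
qed

lemma spr_divide: "spr x v \<Longrightarrow> spr y w \<Longrightarrow> w \<noteq> 0 \<Longrightarrow> spr (x / y) (v / w)"
  unfolding divide_inverse by (intro spr_mult spr_inverse)

lemma spr_sum: "(\<And>i. i \<in> A \<Longrightarrow> spr (f i) (g i)) \<Longrightarrow> spr (sum f A) (sum g A)"
  by (induction A rule: infinite_finite_induct) (auto intro: spr_add)

lemma spr_prod: "(\<And>i. i \<in> A \<Longrightarrow> spr (f i) (g i)) \<Longrightarrow> spr (prod f A) (prod g A)"
  by (induction A rule: infinite_finite_induct) (auto intro: spr_mult)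

lemma spr_power: "spr x v \<Longrightarrow> spr (x ^ n) (v ^ n)"
  by (induction n) (auto intro: spr_mult)

lemma spr_of_nat: "spr (of_nat n) (of_nat n)"
  by (induction n) (auto intro: spr_add)

lemma spr_of_int: "spr (of_int n) (of_int n)"
  by (cases n rule: int_diff_cases) (auto intro: spr_diff spr_of_nat)

lemma spec0_eq: "spr x v \<Longrightarrow> spec0 x = v"
  unfolding spec0_def spr_def[symmetric] by (rule the_equality) (auto dest: spr_unique)

lemma common_denominator:
  "finite I \<Longrightarrow> \<exists>c. c \<noteq> 0 \<and> (\<forall>i\<in>I. \<exists>a. c * x i = Fract a (1 :: 'r::idom))"
proof (induction I rule: finite_induct)
  case empty then show ?case by (intro exI[of _ 1]) auto
next
  case (insert j I)
  then obtain c where c: "c \<noteq> 0" "\<forall>i\<in>I. \<exists>a. c * x i = Fract a 1" by blast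
  obtain a b where ab: "c * x j = Fract a b" "b \<noteq> 0" by (cases "c * x j") auto
  have b: "Fract b 1 \<noteq> 0" using ab by (simp add: Zero_fract_def eq_fract)
  have "\<exists>a. Fract b 1 * c * x i = Fract a 1" if i: "i \<in> insert j I" for i
  proof (cases "i = j")
    case True
    have "Fract b 1 * c * x j = Fract b 1 * Fract a b" using ab by (simp add: mult.assoc)
    also have "\<dots> = Fract a 1" using ab(2) by (simp add: eq_fract)
    finally show ?thesis using True by blast
  next
    case False
    then obtain a where "c * x i = Fract a 1" using c i by auto
    then have "Fract b 1 * c * x i = Fract (b * a) 1" by (simp add: mult.assoc)
    then show ?thesis by blast
  qed
  then show ?case using b c(1) by (intro exI[of _ "Fract b 1 * c"]) auto
qed

text \<open>Clearing denominators and dividing by the largest common power of the polynomial variable.\<close>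

lemma spr_primitive:
  fixes x :: "'i \<Rightarrow> 'r::linordered_idom poly fract"
  assumes fin: "finite I" and nz: "i0 \<in> I" "x i0 \<noteq> 0"
  shows "\<exists>c y. c \<noteq> 0 \<and> (\<forall>i\<in>I. spr (c * x i) (y i)) \<and> (\<exists>i\<in>I. y i \<noteq> 0)"
proof -
  obtain c where c: "c \<noteq> 0" "\<forall>i\<in>I. \<exists>a. c * x i = Fract a 1" using common_denominator[OF fin] by blast
  then obtain a where a: "\<And>i. i \<in> I \<Longrightarrow> c * x i = Fract (a i) 1" by metis
  have "a i0 \<noteq> 0" using a[OF nz(1)] c(1) nz(2) by (auto simp: Zero_fract_def[symmetric])
  then have ex: "\<exists>m. \<exists>i\<in>I. coeff (a i) m \<noteq> 0" using nz(1) by (metis coeff_0 poly_eqI)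
  define m where "m = (LEAST m. \<exists>i\<in>I. coeff (a i) m \<noteq> 0)"
  have m: "\<exists>i\<in>I. coeff (a i) m \<noteq> 0" unfolding m_def by (rule LeastI_ex[OF ex])
  have lt: "coeff (a i) j = 0" if "i \<in> I" "j < m" for i j
    using not_less_Least[of j "\<lambda>m. \<exists>i\<in>I. coeff (a i) m \<noteq> 0"] that by (auto simp: m_def)
  have sh: "a i = monom 1 m * poly_shift m (a i)" if "i \<in> I" for i
    by (rule poly_eqI) (use lt[OF that] in \<open>auto simp: coeff_monom_mult coeff_poly_shift\<close>)
  have mz: "Fract (monom 1 m) 1 \<noteq> (0 :: 'r poly fract)"
    by (simp add: Zero_fract_def eq_fract)
  let ?c = "c / Fract (monom 1 m) 1"
  have "spr (?c * x i) (Fract (coeff (a i) m) 1)" if i: "i \<in> I" for i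
  proof -
    have "Fract (a i) 1 = Fract (monom 1 m) 1 * Fract (poly_shift m (a i)) 1"
      by (subst sh[OF i]) simp
    moreover have "?c * x i = Fract (a i) 1 / Fract (monom 1 m) 1"
      by (simp only: times_divide_eq_left a[OF i])
    ultimately have "?c * x i = Fract (monom 1 m) 1 * Fract (poly_shift m (a i)) 1 / Fract (monom 1 m) 1"
      by (simp only:)
    also have "\<dots> = Fract (poly_shift m (a i)) 1"
      by (rule nonzero_mult_div_cancel_left[OF mz])
    finally have "?c * x i = Fract (poly_shift m (a i)) 1" .
    then show ?thesis using sprI[of 1 "poly_shift m (a i)"] by (simp add: coeff_poly_shift)
  qed
  moreover have "\<exists>i\<in>I. Fract (coeff (a i) m) 1 \<noteq> (0 :: 'r fract)" using m by (auto simp: Zero_fract_def eq_fract)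
  ultimately show ?thesis using c(1) mz by (intro exI[of _ ?c] exI[of _ "\<lambda>i. Fract (coeff (a i) m) 1"]) auto
qed

definition sprS :: "'r::linordered_idom poly fract sym \<Rightarrow> 'r fract sym \<Rightarrow> bool" where
  "sprS F G \<longleftrightarrow> (\<forall>m. spr (lookup F m) (lookup G m))"

lemma sprS_keys: "sprS F G \<Longrightarrow> keys G \<subseteq> keys F"
  unfolding sprS_def by (metis in_keys_iff spr_0 spr_unique subsetI)

lemma sprS_add: "sprS F F' \<Longrightarrow> sprS G G' \<Longrightarrow> sprS (F + G) (F' + G')"
  by (simp add: sprS_def lookup_add spr_add)

lemma sprS_0 [simp]: "sprS 0 0" by (simp add: sprS_def)

lemma sprS_sum: "(\<And>i. i \<in> A \<Longrightarrow> sprS (f i) (g i)) \<Longrightarrow> sprS (sum f A) (sum g A)"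
  by (induction A rule: infinite_finite_induct) (auto intro: sprS_add)

lemma sprS_single: "spr c d \<Longrightarrow> sprS (Poly_Mapping.single m c) (Poly_Mapping.single m d)"
  by (auto simp: sprS_def lookup_single when_def)

lemma sprS_Co: "spr c d \<Longrightarrow> sprS (Co c) (Co d)" unfolding Co_def by (rule sprS_single)

lemma sprS_1 [simp]: "sprS 1 1" using sprS_Co[of 1 1] by simp

lemma sprS_pp: "sprS (pp k) (pp k)" unfolding pp_def by (intro sprS_single) simp

lemma sprS_mult:
  assumes F: "sprS F F'" and G: "sprS G G'" shows "sprS (F * G) (F' * G')"
proof -
  have e: "H = (\<Sum>m\<in>K. Poly_Mapping.single m (lookup H m))" if "keys H \<subseteq> K" "finite K" for H :: "'x::comm_ring_1 sym" and K
  proof -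
    have "(\<Sum>m\<in>keys H. Poly_Mapping.single m (lookup H m)) = (\<Sum>m\<in>K. Poly_Mapping.single m (lookup H m))"
      by (rule sum.mono_neutral_left) (use that in \<open>auto simp: in_keys_iff\<close>)
    then show ?thesis using sym_sum_single[of H] by (rule trans[rotated])
  qed
  have p: "A * B = (\<Sum>m\<in>K. \<Sum>u\<in>L. Poly_Mapping.single (m + u) (lookup A m * lookup B u))"
    if "keys A \<subseteq> K" "finite K" "keys B \<subseteq> L" "finite L" for A B :: "'x::comm_ring_1 sym" and K L
  proof -
    have "A * B = (\<Sum>m\<in>K. Poly_Mapping.single m (lookup A m)) * (\<Sum>u\<in>L. Poly_Mapping.single u (lookup B u))"
      by (rule arg_cong2[OF e[OF that(1,2)] e[OF that(3,4)]])
    then show ?thesis by (simp add: sum_product mult_single)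
  qed
  have "F * G = (\<Sum>m\<in>keys F. \<Sum>u\<in>keys G. Poly_Mapping.single (m + u) (lookup F m * lookup G u))"
    by (rule p) auto
  moreover have "F' * G' = (\<Sum>m\<in>keys F. \<Sum>u\<in>keys G. Poly_Mapping.single (m + u) (lookup F' m * lookup G' u))"
    by (rule p[OF sprS_keys[OF F] finite_keys sprS_keys[OF G] finite_keys])
  moreover have "sprS (\<Sum>m\<in>keys F. \<Sum>u\<in>keys G. Poly_Mapping.single (m + u) (lookup F m * lookup G u))
     (\<Sum>m\<in>keys F. \<Sum>u\<in>keys G. Poly_Mapping.single (m + u) (lookup F' m * lookup G' u))"
    using F G by (intro sprS_sum sprS_single spr_mult) (auto simp: sprS_def)
  ultimately show ?thesis by simp
qed

lemma sprS_prod: "(\<And>i. i \<in> A \<Longrightarrow> sprS (f i) (g i)) \<Longrightarrow> sprS (prod f A) (prod g A)"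
  by (induction A rule: infinite_finite_induct) (auto intro: sprS_mult)

lemma sprS_hh: "sprS (hh n :: 'r::linordered_idom poly fract sym) (hh n)"
proof (induction n rule: less_induct)
  case (less n)
  show ?case
  proof (cases "n = 0")
    case False
    have "sprS (Co (1 / of_nat n) :: 'r poly fract sym) (Co (1 / of_nat n))"
      by (intro sprS_Co spr_divide spr_of_nat spr_1) (use False in auto)
    moreover have "sprS (\<Sum>k<n. pp (Suc k) * hh (n - Suc k) :: 'r poly fract sym) (\<Sum>k<n. pp (Suc k) * hh (n - Suc k))"
      by (intro sprS_sum sprS_mult sprS_pp less) (use False in auto)
    ultimately have "sprS (Co (1 / of_nat n) * (\<Sum>k<n. pp (Suc k) * hh (n - Suc k)) :: 'r poly fract sym)
       (Co (1 / of_nat n) * (\<Sum>k<n. pp (Suc k) * hh (n - Suc k)))"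
      by (rule sprS_mult)
    then show ?thesis using False by (simp add: hh.simps[of n])
  qed simp
qed

lemma sprS_sch: "sprS (sch l) (sch l)"
proof -
  have "sprS (of_int k) (of_int k)" for k
    using sprS_Co[OF spr_of_int[of k]] by (simp add: Co_of_int)
  moreover have "sprS (hi m) (hi m)" for m by (simp add: hi_def sprS_hh)
  ultimately show ?thesis unfolding sch_def sN_def dt_def by (intro sprS_sum sprS_mult sprS_prod)
qed

lemma spr_zz: "spr (zz m) (zz m)"
proof -
  have "spr (fact n) (fact n)" for n using spr_of_nat[of "fact n"] by (simp only: of_nat_fact)
  then show ?thesis unfolding zz_def by (intro spr_prod spr_mult spr_power spr_of_nat)
qed

lemma spr_ip: "sprS F F' \<Longrightarrow> sprS G G' \<Longrightarrow> spr (ip F G) (ip F' G')"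
proof -
  assume F: "sprS F F'" and G: "sprS G G'"
  have "ip F' G' = (\<Sum>m\<in>keys F. zz m * lookup F' m * lookup G' m)"
    by (rule ip_superset) (auto intro: sprS_keys[OF F, THEN subsetD])
  then show ?thesis unfolding ip_def[of F]
    using F G by (auto simp: sprS_def intro!: spr_sum spr_mult spr_zz)
qed

lemma sprS_diag: "(\<And>k. spr (c k) (d k)) \<Longrightarrow> sprS F F' \<Longrightarrow> sprS (diag c F) (diag d F')"
proof -
  assume c: "\<And>k. spr (c k) (d k)" and F: "sprS F F'"
  have "spr (\<Prod>k\<in>#m. c k) (\<Prod>k\<in>#m. d k)" for m
    by (induction m) (auto intro: spr_mult c)
  then show ?thesis using F by (auto simp: sprS_def lookup_diag intro: spr_mult)
qed

lemma sprS_pi1: "spr u v \<Longrightarrow> sprS F F' \<Longrightarrow> sprS (pi1 u F) (pi1 v F')"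
  by (intro sprS_diag spr_diff spr_power spr_1)

lemma sprS_mk: "(\<And>l. l \<in> partitions n \<Longrightarrow> spr (f l) (g l)) \<Longrightarrow> sprS (mk n f) (mk n g)"
  unfolding mk_def by (intro sprS_sum sprS_mult sprS_Co sprS_sch)

text \<open>A nonzero element rescaled to be primitive at the prime t (or q) has a nonzero
  reduction; the Schur coefficients serve as coordinates.\<close>

lemma sprS_primitive:
  assumes F: "homog n F" "F \<noteq> 0"
  shows "\<exists>c G. c \<noteq> 0 \<and> sprS (Co c * F) G \<and> homog n G \<and> G \<noteq> 0"
proof -
  have "\<exists>l\<in>partitions n. ip F (sch l) \<noteq> 0" using ip_sch_complete[OF F(1)] F(2) by blast
  then obtain l0 where l0: "l0 \<in> partitions n" "ip F (sch l0) \<noteq> 0" by blast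
  obtain c y where c: "c \<noteq> 0" and y: "\<forall>l\<in>partitions n. spr (c * ip F (sch l)) (y l)" and ynz: "\<exists>l\<in>partitions n. y l \<noteq> 0"
    using spr_primitive[OF finite_partitions l0(1), of "\<lambda>l. ip F (sch l)", OF l0(2)] by blast
  have "Co c * F = mk n (sc n (Co c * F))" by (rule mk_sc[symmetric, OF homog_Co[OF F(1)]])
  also have "\<dots> = mk n (\<lambda>l. c * ip F (sch l))" unfolding mk_def by (rule sum.cong) (auto simp: sc_def ip_Co_left)
  finally have "sprS (Co c * F) (mk n y)" using y by (auto intro: sprS_mk)
  moreover have "mk n y \<noteq> 0"
  proof
    assume "mk n y = 0"
    then have "y l = 0" if "l \<in> partitions n" for l using ip_mk_sch[OF that, of y] by simp
    then show False using ynz by auto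
  qed
  ultimately show ?thesis using c homog_mk by blast
qed

section \<open>The Macdonald form has no isotropic vectors\<close>

section \<open>Anisotropy\<close>

text \<open>The form is diagonal in the power sums, with weights z_m times products of 1 - t^k and 1
  - a^k, all positive in an ordered field when a and t lie in [0,1).\<close>

lemma anisotropic_ordered:
  fixes a t :: "'a::linordered_field"
  assumes a: "0 \<le> a" "a < 1" and t: "0 \<le> t" "t < 1"
  shows "anisotropic a t"
  unfolding anisotropic_def
proof (intro allI impI)
  fix n and F :: "'a sym"
  assume F: "homog n F" and z: "ip (pi1 t F) (pi1 a F) = 0"
  have pos: "(\<Prod>k\<in>#m. 1 - u ^ k) > 0" if "0 \<notin># m" "0 \<le> u" "u < 1" for m and u :: 'a
    using that(1)
  proof (induction m)
    case (add k m)
    then have "u ^ k < 1" using that by (intro power_less_one_iff[THEN iffD2]) auto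
    then show ?case using add by simp
  qed simp
  have zp: "zz m > (0 :: 'a)" if "0 \<notin># m" for m
    unfolding zz_def using that by (intro prod_pos) (auto intro!: mult_pos_pos zero_less_power Nat.gr0I)
  have sub: "keys (pi1 t F) \<subseteq> keys F" by (auto simp: in_keys_iff lookup_diag)
  have s: "(\<Sum>m\<in>keys F. zz m * lookup (pi1 t F) m * lookup (pi1 a F) m) = 0"
    using z ip_superset[OF finite_keys sub, of "pi1 a F"] by simp
  have nn: "zz m * lookup (pi1 t F) m * lookup (pi1 a F) m \<ge> 0"
    and p: "lookup F m \<noteq> 0 \<Longrightarrow> zz m * lookup (pi1 t F) m * lookup (pi1 a F) m > 0" for m
  proof -
    define P where "P = zz m * (\<Prod>k\<in>#m. 1 - t ^ k) * (\<Prod>k\<in>#m. 1 - a ^ k)"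
    have e: "zz m * lookup (pi1 t F) m * lookup (pi1 a F) m = P * (lookup F m)\<^sup>2"
      by (simp add: P_def lookup_diag power2_eq_square ac_simps)
    have P: "P > 0" if "lookup F m \<noteq> 0"
    proof -
      have "0 \<notin># m" using F that by (auto simp: homog_def)
      then show ?thesis unfolding P_def using zp pos[OF _ t] pos[OF _ a] by (intro mult_pos_pos) auto
    qed
    show "zz m * lookup (pi1 t F) m * lookup (pi1 a F) m \<ge> 0"
    proof (cases "lookup F m = 0")
      case False
      then show ?thesis unfolding e using P by (intro mult_nonneg_nonneg) auto
    qed (simp add: e)
    show "zz m * lookup (pi1 t F) m * lookup (pi1 a F) m > 0" if "lookup F m \<noteq> 0"
      unfolding e using P[OF that] that by (intro mult_pos_pos) auto
  qed
  show "F = 0"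
  proof (rule poly_mapping_eqI, rule ccontr)
    fix m assume "lookup F m \<noteq> lookup 0 m"
    then have nz: "lookup F m \<noteq> 0" by simp
    have "zz m * lookup (pi1 t F) m * lookup (pi1 a F) m = 0"
      using s nz by (subst (asm) sum_nonneg_eq_0_iff) (use nn in \<open>auto simp: in_keys_iff\<close>)
    then show False using p[OF nz] by linarith
  qed
qed

text \<open>A nonzero isotropic vector, made primitive, would reduce to a nonzero isotropic vector
  of the specialized form.\<close>

lemma anisotropic_spr:
  assumes "anisotropic a' t'" "spr a a'" "spr t t'" shows "anisotropic a t"
  unfolding anisotropic_def
proof (intro allI impI, rule ccontr)
  fix n F assume F: "homog n F" and z: "ip (pi1 t F) (pi1 a F) = 0" and nz: "F \<noteq> 0"
  obtain c G where c: "c \<noteq> 0" "sprS (Co c * F) G" and G: "homog n G" "G \<noteq> 0"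
    using sprS_primitive[OF F nz] by blast
  have "ip (pi1 t (Co c * F)) (pi1 a (Co c * F)) = 0"
    by (simp add: diag_mult ip_Co_left ip_Co_right z)
  moreover have "spr (ip (pi1 t (Co c * F)) (pi1 a (Co c * F))) (ip (pi1 t' G) (pi1 a' G))"
    by (intro spr_ip sprS_pi1 assms c)
  ultimately have "ip (pi1 t' G) (pi1 a' G) = 0" using spr_unique[OF spr_0] by simp
  then show False using assms(1) G by (auto simp: anisotropic_def)
qed

section \<open>Macdonald polynomials at t = 0\<close>

section \<open>Hall--Littlewood functions as specializations\<close>

lemma above_spr:
  assumes "above mu F" "sprS F G" shows "above mu G"
  unfolding above_def
proof (intro ballI impI)
  fix l assume l: "l \<in> partitions (sum_list mu)" and nz: "ip G (sch l) \<noteq> 0"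
  have "spr (ip F (sch l)) (ip G (sch l))" by (intro spr_ip assms sprS_sch)
  then have "ip F (sch l) \<noteq> 0" using nz spr_unique[OF spr_0, of "ip G (sch l)"] by metis
  then show "dom_le mu l" using assms(1) l by (simp add: above_def)
qed

text \<open>The conditions on a Macdonald polynomial at t = 0, where X(1-t) becomes X, with leading
  coefficient 1. Parameter 1/q gives Q'_mu.\<close>

definition HLprop :: "'a::field_char_0 \<Rightarrow> nat list \<Rightarrow> 'a sym \<Rightarrow> bool" where
  "HLprop q mu R \<longleftrightarrow> homog (sum_list mu) R \<and> above mu R \<and> above (conj mu) (pi1 q R) \<and> ip R (sch mu) = 1"

definition HL :: "'a::field_char_0 \<Rightarrow> nat list \<Rightarrow> 'a sym" where
  "HL q mu = (THE R. HLprop q mu R)"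

lemma above_diff: "above mu F \<Longrightarrow> above mu G \<Longrightarrow> above mu (F - G)"
  unfolding above_def ip_diff_left by (metis diff_0_right)

lemma HLprop_unique:
  assumes mu: "partition mu" and q: "q \<noteq> 0" "anisotropic (1 / q) 0" and R: "HLprop q mu R" "HLprop q mu S"
  shows "R = S"
proof -
  have h: "homog (sum_list mu) (R - S)" using R by (auto simp: HLprop_def intro: homog_diff)
  have "R - S = 0"
  proof (rule macdonald_unique[OF mu q h])
    show "above mu (pi1 0 (R - S))" unfolding pi1_0[OF h] using R by (auto simp: HLprop_def intro: above_diff)
    show "above (conj mu) (pi1 q (R - S))"
      unfolding rhom_diff[OF rhom_diag] using R by (auto simp: HLprop_def intro: above_diff)
    show "ip (pi1 0 (R - S)) (sch mu) = 0" unfolding pi1_0[OF h] using R by (simp add: HLprop_def ip_diff_left)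
  qed
  then show ?thesis by simp
qed

lemma HL_eqI:
  "partition mu \<Longrightarrow> q \<noteq> 0 \<Longrightarrow> anisotropic (1 / q) 0 \<Longrightarrow> HLprop q mu R \<Longrightarrow> HL q mu = R"
  unfolding HL_def by (rule the_equality) (auto intro: HLprop_unique)

text \<open>Some rescaling of H has a nonzero limit G, which inherits both triangularities.
  Uniqueness at t = 0 gives G a nonzero leading coefficient, so the scale factor itself has a
  nonzero limit, and H and \<open>JJ q t mu\<close> specialize without rescaling.\<close>

lemma macdonald_specialize:
  assumes inj: "ev_inj q t" and t: "\<And>k. k \<ge> 1 \<Longrightarrow> t ^ k \<noteq> 1" and mu: "partition mu"
    and q: "spr q q'" "q' \<noteq> 0" "anisotropic (1 / q') 0" and t0: "spr t 0"
  shows "\<exists>H. homog (sum_list mu) H \<and> pi1 t H = JJ q t mu \<and> above mu (pi1 t H) \<and> above (conj mu) (pi1 q H) \<and>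
     sprS H (HL q' mu) \<and> sprS (JJ q t mu) (HL q' mu) \<and> HLprop q' mu (HL q' mu)"
proof -
  let ?n = "sum_list mu"
  obtain H where H: "homog ?n H" "pi1 t H = JJ q t mu" "above mu (pi1 t H)" "above (conj mu) (pi1 q H)"
    using macdonald_exists[OF inj t mu] by blast
  note J = JJ_props[OF inj mu]
  have "H \<noteq> 0" using H(2) J(3) by auto
  then obtain c G where c: "c \<noteq> 0" "sprS (Co c * H) G" and G: "homog ?n G" "G \<noteq> 0"
    using sprS_primitive[OF H(1)] by blast
  have ab: "above mu (Co c * pi1 t H)" "above (conj mu) (Co c * pi1 q H)"
    using H(3,4) by (auto simp: above_def ip_Co_left)
  have s1: "sprS (Co c * pi1 t H) (pi1 0 G)" using sprS_pi1[OF t0 c(2)] by (simp add: diag_mult)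
  have s2: "sprS (Co c * pi1 q H) (pi1 q' G)" using sprS_pi1[OF q(1) c(2)] by (simp add: diag_mult)
  note a1 = above_spr[OF ab(1) s1] and a2 = above_spr[OF ab(2) s2]
  define g where "g = ip G (sch mu)"
  have g: "g \<noteq> 0"
  proof
    assume "g = 0"
    then have "ip (pi1 0 G) (sch mu) = 0" by (simp add: pi1_0[OF G(1)] g_def)
    then have "G = 0" by (rule macdonald_unique[OF mu q(2,3) G(1) a1 a2])
    then show False using G(2) by simp
  qed
  have "spr (ip (Co c * pi1 t H) (sch mu)) (ip (pi1 0 G) (sch mu))" by (intro spr_ip s1 sprS_sch)
  \<comment> \<open>\<open>JJ q t mu\<close> has leading coefficient 1, so that of the rescaled
    element is c itself.\<close>
  then have cg: "spr c g" by (simp add: ip_Co_left H(2) J(3) pi1_0[OF G(1)] g_def)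
  have ic: "spr (inverse c) (inverse g)" by (rule spr_inverse[OF cg g])
  define R where "R = Co (inverse g) * G"
  have "sprS (Co (inverse c) * (Co c * H)) R" unfolding R_def by (intro sprS_mult sprS_Co ic c(2))
  then have sH: "sprS H R" using c(1) by (simp add: mult.assoc[symmetric] Co_mult[symmetric])
  have hR: "homog ?n R" unfolding R_def by (intro homog_Co G)
  have sJ: "sprS (JJ q t mu) R" using sprS_pi1[OF t0 sH] by (simp add: H(2) pi1_0[OF hR])
  have "above mu R" "above (conj mu) (pi1 q' R)"
    using a1 a2 by (auto simp: R_def above_def ip_Co_left diag_mult pi1_0[OF G(1)])
  moreover have "ip R (sch mu) = 1" using g by (simp add: R_def ip_Co_left g_def)
  ultimately have "HLprop q' mu R" using hR by (simp add: HLprop_def)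
  then have "HLprop q' mu R" "HL q' mu = R" using HL_eqI[OF mu q(2,3)] by auto
  then show ?thesis using H sH sJ by blast
qed

text \<open>Column removal is proved for generic t, where eigenvalues separate partitions, and then
  carried to the limit coefficient by coefficient.\<close>

lemma ek_HL:
  assumes inj: "ev_inj q t" and t: "\<And>k. k \<ge> 1 \<Longrightarrow> t ^ k \<noteq> 1" "t \<noteq> 0" and nu: "partition nu" "length nu \<le> k"
    and q: "spr q q'" "q' \<noteq> 0" "anisotropic (1 / q') 0" and t0: "spr t 0"
  shows "ek k (HL q' (addcol k nu)) = HL q' nu"
proof -
  let ?mu = "addcol k nu" and ?n = "sum_list nu"
  have mu: "partition ?mu" "sum_list ?mu = ?n + k" using nu by (auto simp: partition_addcol sum_addcol)
  have Jm: "sprS (JJ q t ?mu) (HL q' ?mu)" "HLprop q' ?mu (HL q' ?mu)"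
    using macdonald_specialize[OF inj t(1) mu(1) q t0] by blast+
  have Jn: "sprS (JJ q t nu) (HL q' nu)" "HLprop q' nu (HL q' nu)"
    using macdonald_specialize[OF inj t(1) nu(1) q t0] by blast+
  have sh: "short (?n + k) k (HL q' ?mu)"
    using above_short[of ?mu "HL q' ?mu"] Jm(2) mu(2) by (simp add: HLprop_def)
  have shJ: "short (?n + k) k (JJ q t ?mu)"
    using above_short[of ?mu "JJ q t ?mu"] JJ_props[OF inj mu(1)] eigenvector_above[OF inj _ _ mu(1)] mu(2) by simp
  have "ek k (HL q' ?mu) - HL q' nu = 0"
  proof (rule ip_sch_complete[of ?n])
    show "homog ?n (ek k (HL q' ?mu) - HL q' nu)"
      using homog_ek[of "?n + k" "HL q' ?mu" k] sh Jn(2) by (auto simp: short_def HLprop_def intro: homog_diff)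
    fix l assume "l \<in> partitions ?n"
    then have l: "partition l" "sum_list l + k = ?n + k" by (auto simp: partitions_iff)
    have "spr (ip (ek k (JJ q t ?mu)) (sch l)) (ip (ek k (HL q' ?mu)) (sch l))"
      unfolding ip_ek[OF sh l] ip_ek[OF shJ l] using spr_ip[OF Jm(1) sprS_sch] by simp
    moreover have "spr (ip (ek k (JJ q t ?mu)) (sch l)) (ip (HL q' nu) (sch l))"
      unfolding ek_JJ[OF inj t(2) nu] by (rule spr_ip[OF Jn(1) sprS_sch])
    ultimately show "ip (ek k (HL q' ?mu) - HL q' nu) (sch l) = 0"
      by (simp add: ip_diff_left spr_unique)
  qed
  then show ?thesis by simp
qed

section \<open>The concrete parameters q, 1/q, t and the order on rational functions of q\<close>

section \<open>The parameters\<close>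

lemma qF_tF_Fract: "qF ^ a * tF ^ b = Fract (monom (monom 1 a) b) 1"
proof -
  have "Fract p 1 ^ n = Fract (p ^ n) 1" for p :: "rat poly poly" and n
    by (induction n) (auto simp: One_fract_def)
  then show ?thesis by (simp add: qF_def tF_def monom_altdef poly_const_pow)
qed

lemma qF_tF_nonzero: "qF \<noteq> 0" "tF \<noteq> 0"
  by (simp_all add: qF_def tF_def Zero_fract_def eq_fract)

lemma tF_power: "k \<ge> 1 \<Longrightarrow> tF ^ k \<noteq> 1"
proof
  assume k: "k \<ge> 1" and "tF ^ k = 1"
  then have "Fract (monom (monom 1 0) k) 1 = (Fract 1 1 :: qt)"
    using qF_tF_Fract[of 0 k] by (simp add: One_fract_def)
  then have "monom (monom 1 0) k = (1 :: rat poly poly)" by (simp add: eq_fract)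
  then have "coeff (monom (monom 1 0) k) 0 = (coeff 1 0 :: rat poly)" by (rule arg_cong)
  then show False using k by simp
qed

lemma qF_neq_1: "qF \<noteq> 1"
proof
  assume "qF = 1"
  then have "[:[:0, 1:]:] = (1 :: rat poly poly)" by (simp add: qF_def One_fract_def eq_fract)
  then show False by (simp add: one_pCons)
qed

lemma qt_independent:
  assumes e: "inj_on e {..<N::nat}" and eq: "(\<Sum>i<N. qF ^ e i * tF ^ l i) = (\<Sum>i<N. qF ^ e i * tF ^ m i)" and i: "i < N"
  shows "l i = m i"
proof -
  have S: "(\<Sum>i<N. qF ^ e i * tF ^ l i) = Fract (\<Sum>i<N. monom (monom 1 (e i)) (l i)) 1" for l and N :: nat
    by (induction N) (auto simp: qF_tF_Fract Zero_fract_def)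
  have "(\<Sum>i<N. monom (monom 1 (e i)) (l i)) = (\<Sum>i<N. monom (monom (1::rat) (e i)) (m i))"
    using eq by (simp add: S eq_fract)
  then have c: "coeff (coeff (\<Sum>i<N. monom (monom (1::rat) (e i)) (l i)) (l i)) (e i)
     = coeff (coeff (\<Sum>i<N. monom (monom (1::rat) (e i)) (m i)) (l i)) (e i)" by simp
  have ce: "coeff (coeff (\<Sum>j<N. monom (monom (1::rat) (e j)) (u j)) (l i)) (e i) = (if u i = l i then 1 else 0)" for u
  proof -
    have "coeff (coeff (\<Sum>j<N. monom (monom (1::rat) (e j)) (u j)) (l i)) (e i)
       = (\<Sum>j<N. if j = i then (if u i = l i then 1 else 0) else 0)"
      unfolding coeff_sum by (rule sum.cong) (use e i in \<open>auto dest: inj_onD\<close>)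
    then show ?thesis using i by simp
  qed
  show ?thesis using c unfolding ce by (auto split: if_splits)
qed

lemma ev_inj_rows:
  assumes q: "q \<noteq> 1" and ind: "\<And>N l m i. (\<Sum>i<N. q ^ i * t ^ l i) = (\<Sum>i<N. q ^ i * t ^ m i) \<Longrightarrow> i < N \<Longrightarrow> l i = (m i :: nat)"
  shows "ev_inj q t"
  unfolding ev_inj_def
proof (intro allI inj_onI)
  fix n a b assume a: "a \<in> partitions n" and b: "b \<in> partitions n" and eq: "ev q t a = ev q t b"
  define N where "N = max (length a) (length b)"
  have N: "length a \<le> N" "length b \<le> N" by (auto simp: N_def)
  have "(1 - q) * (\<Sum>i<N. q ^ i * (t ^ nth0 a i - 1)) = (1 - q) * (\<Sum>i<N. q ^ i * (t ^ nth0 b i - 1))"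
    using eq by (simp add: ev_rows[OF N(1)] ev_rows[OF N(2)])
  then have "(\<Sum>i<N. q ^ i * (t ^ nth0 a i - 1)) = (\<Sum>i<N. q ^ i * (t ^ nth0 b i - 1))" using q by simp
  then have "(\<Sum>i<N. q ^ i * t ^ nth0 a i) = (\<Sum>i<N. q ^ i * t ^ nth0 b i)"
    by (simp add: right_diff_distrib sum_subtractf)
  then have "nth0 a i = nth0 b i" if "i < N" for i using ind that by blast
  moreover have "nth0 a i = nth0 b i" if "\<not> i < N" for i using that N by (simp add: nth0_def)
  ultimately show "a = b" using a b by (intro nth0_eqI) (auto simp: partitions_iff)
qed

lemma ev_inj_qF: "ev_inj qF tF"
  by (rule ev_inj_rows[OF qF_neq_1]) (rule qt_independent[of "\<lambda>i. i"], auto)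

lemma ev_inj_qF_inverse: "ev_inj (1 / qF) tF"
proof (rule ev_inj_rows)
  show "1 / qF \<noteq> 1" using qF_neq_1 qF_tF_nonzero by (simp add: field_simps)
  fix N i and l m :: "nat \<Rightarrow> nat"
  assume eq: "(\<Sum>i<N. (1 / qF) ^ i * tF ^ l i) = (\<Sum>i<N. (1 / qF) ^ i * tF ^ m i)" and i: "i < N"
  \<comment> \<open>Multiplication by q^N turns the negative exponents into the distinct positive
    exponents N - i.\<close>
  have "(\<Sum>i<N. qF ^ (N - i) * tF ^ u i) = qF ^ N * (\<Sum>i<N. (1 / qF) ^ i * tF ^ u i)" for u
    unfolding sum_distrib_left
    by (rule sum.cong) (auto simp: power_diff qF_tF_nonzero power_divide)
  then have "(\<Sum>i<N. qF ^ (N - i) * tF ^ l i) = (\<Sum>i<N. qF ^ (N - i) * tF ^ m i)" using eq by simp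
  moreover have "inj_on (\<lambda>i. N - i) {..<N}" by (auto simp: inj_on_def)
  ultimately show "l i = m i" using i by (intro qt_independent[of "\<lambda>i. N - i" N]) auto
qed

lemma spr_qF: "spr qF qG" and spr_tF: "spr tF 0" and spr_qG: "spr qG 0"
  using sprI[of 1 "[:[:0, 1:]:] :: rat poly poly"] sprI[of 1 "[:0, 1:] :: rat poly poly"] sprI[of 1 "[:0, 1:] :: rat poly"]
  by (simp_all add: qF_def tF_def qG_def Zero_fract_def)

lemma qG_nonzero: "qG \<noteq> 0" by (simp add: qG_def Zero_fract_def eq_fract)

text \<open>Polynomials are ordered by the sign of the leading coefficient, so q is infinitely large
  and 1/q is a positive infinitesimal.\<close>

lemma qG_gt_1: "qG > 1"
proof -
  have "(0::rat poly) < [:0, 1:] - 1" by (simp add: less_poly_def pos_poly_def one_pCons)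
  then have "(1::rat poly) < [:0, 1:]" by simp
  then show ?thesis by (simp add: qG_def One_fract_def)
qed

text \<open>Positivity applies directly to 1/q. As q itself lies outside [0,1), the form with a = q
  is first specialized to q = 0.\<close>

lemma anisotropic_qG: "anisotropic qG 0" "anisotropic (1 / qG) 0"
proof -
  have "anisotropic (0 :: rat fract) 0" by (rule anisotropic_ordered) auto
  then show "anisotropic qG 0" using spr_qG spr_0 by (rule anisotropic_spr)
  show "anisotropic (1 / qG) 0" using qG_gt_1 by (intro anisotropic_ordered) auto
qed

text \<open>The two Hall--Littlewood parameters together with the parameters they specialize.\<close>

definition parameter :: "qq \<Rightarrow> qt \<Rightarrow> bool" where
  "parameter q' q \<longleftrightarrow> q' = qG \<and> q = qF \<or> q' = 1 / qG \<and> q = 1 / qF"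

lemma parameter_props:
  assumes "parameter q' q"
  shows "spr q q'" "q' \<noteq> 0" "q \<noteq> 0" "anisotropic (1 / q') 0" "anisotropic (1 / q) tF" "ev_inj q tF"
proof -
  have i: "spr (1 / qF) (1 / qG)" by (rule spr_divide[OF spr_1 spr_qF qG_nonzero])
  show "spr q q'" "q' \<noteq> 0" "q \<noteq> 0" "anisotropic (1 / q') 0" "ev_inj q tF"
    using assms i spr_qF qG_nonzero qF_tF_nonzero anisotropic_qG ev_inj_qF ev_inj_qF_inverse
    by (auto simp: parameter_def)
  show "anisotropic (1 / q) tF"
    using assms anisotropic_spr[OF anisotropic_qG(1) spr_qF spr_tF] anisotropic_spr[OF anisotropic_qG(2) i spr_tF]
    by (auto simp: parameter_def)
qed

lemma qG_power: "k \<ge> 1 \<Longrightarrow> qG ^ k \<noteq> 1"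
  using power_gt1_lemma[OF qG_gt_1] one_less_power[OF qG_gt_1, of k] by auto

section \<open>Expansion in an orthogonal basis of Macdonald type\<close>

section \<open>Orthogonal bases\<close>

text \<open>Abstracts what generic Macdonald polynomials (\<open>HM\<close>) and Hall-Littlewood
  functions (t = 0) share, so that orthogonal expansion is available for both.\<close>

locale mac_basis =
  fixes q t :: "'a::field_char_0" and R :: "nat list \<Rightarrow> 'a sym"
  assumes q0: "q \<noteq> 0" and aniso: "anisotropic (1 / q) t" and roots: "\<And>k. k \<ge> 1 \<Longrightarrow> (1 / q) ^ k \<noteq> 1"
    and R_homog: "\<And>mu. partition mu \<Longrightarrow> homog (sum_list mu) (R mu)"
    and R_above: "\<And>mu. partition mu \<Longrightarrow> above mu (pi1 t (R mu))"
    and R_above': "\<And>mu. partition mu \<Longrightarrow> above (conj mu) (pi1 q (R mu))"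
    and R_monic: "\<And>mu. partition mu \<Longrightarrow> ip (pi1 t (R mu)) (sch mu) = 1"
begin

definition fm :: "'a sym \<Rightarrow> 'a sym \<Rightarrow> 'a" where "fm F G = ip (pi1 t F) (pi1 (1 / q) G)"

lemma fm_commute: "fm F G = fm G F"
  unfolding fm_def ip_diag diag_diag by (subst ip_commute, subst ip_diag, simp add: mult.commute ip_diag)

text \<open>A nonzero pairing forces mu below nu; by symmetry of the form it also forces nu below
  mu.\<close>

lemma fm_orthogonal:
  assumes "partition mu" "partition nu" "sum_list mu = sum_list nu" "mu \<noteq> nu"
  shows "fm (R mu) (R nu) = 0"
proof (rule ccontr)
  assume nz: "fm (R mu) (R nu) \<noteq> 0"
  have 1: "dom_le a b" if "partition a" "partition b" "sum_list a = sum_list b" "fm (R a) (R b) \<noteq> 0" for a b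
  proof (rule above_orthogonal(1)[OF that(1,2) q0 R_homog[OF that(1)] R_above[OF that(1)] _ R_above'[OF that(2)] that(3)[symmetric]])
    show "homog (sum_list a) (R b)" using R_homog[OF that(2)] unfolding that(3) .
    show "ip (pi1 t (R a)) (pi1 (1 / q) (R b)) \<noteq> 0" using that(4) unfolding fm_def .
  qed
  have "dom_le mu nu" by (rule 1[OF assms(1,2,3) nz])
  moreover have "dom_le nu mu"
    by (rule 1[OF assms(2,1) assms(3)[symmetric]]) (use nz in \<open>subst fm_commute\<close>)
  ultimately show False using dom_le_antisym assms by blast
qed

lemma R_nonzero: "partition mu \<Longrightarrow> R mu \<noteq> 0"
  using R_monic[of mu] by auto

lemma fm_self: "partition mu \<Longrightarrow> fm (R mu) (R mu) \<noteq> 0"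
  using aniso R_homog R_nonzero unfolding anisotropic_def fm_def by blast

lemma fm_add: "fm (F + G) H = fm F H + fm G H" and fm_Co: "fm (Co c * F) H = c * fm F H"
  and fm_diff: "fm (F - G) H = fm F H - fm G H"
  by (simp_all add: fm_def diag_add ip_add_left diag_mult ip_Co_left rhom_diff[OF rhom_diag] ip_diff_left)

lemma fm_sum: "fm (sum f A) H = (\<Sum>a\<in>A. fm (f a) H)"
  by (simp add: fm_def rhom_sum[OF rhom_diag] ip_sum_left)

lemma fm_sum_R:
  assumes "mu \<in> partitions n"
  shows "fm (\<Sum>nu\<in>partitions n. Co (c nu) * R nu) (R mu) = c mu * fm (R mu) (R mu)"
proof -
  have "fm (\<Sum>nu\<in>partitions n. Co (c nu) * R nu) (R mu)
    = (\<Sum>nu\<in>partitions n. if nu = mu then c mu * fm (R mu) (R mu) else 0)"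
    unfolding fm_sum fm_Co
    by (rule sum.cong) (use assms in \<open>auto simp: partitions_iff fm_orthogonal\<close>)
  then show ?thesis using assms by (simp add: finite_partitions)
qed

lemma ip_R_complete:
  assumes F: "homog n F" and z: "\<And>mu. mu \<in> partitions n \<Longrightarrow> ip F (pi1 t (R mu)) = 0"
  shows "F = 0"
proof (rule ip_sch_complete[OF F])
  fix l assume "l \<in> partitions n"
  then show "ip F (sch l) = 0"
  proof (induction "card {k \<in> partitions n. dom_le l k}" arbitrary: l rule: less_induct)
    case less
    have l: "partition l" "sum_list l = n" using less.prems by (auto simp: partitions_iff)
    have hz: "ip (pi1 t (R l)) (sch k) * ip F (sch k) = 0" if k: "k \<in> partitions n - {l}" for k
    proof (cases "ip (pi1 t (R l)) (sch k) = 0")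
      case False
      then have lk: "dom_le l k" using R_above[OF l(1)] k l(2) by (auto simp: above_def)
      have kp: "partition k" using k by (simp add: partitions_iff)
      have "{k' \<in> partitions n. dom_le k k'} \<subset> {k' \<in> partitions n. dom_le l k'}"
      proof (rule psubsetI)
        show "{k' \<in> partitions n. dom_le k k'} \<subseteq> {k' \<in> partitions n. dom_le l k'}"
          using dom_le_trans[OF lk] by auto
        have "l \<in> {k' \<in> partitions n. dom_le l k'}" "l \<notin> {k' \<in> partitions n. dom_le k k'}"
          using less.prems dom_le_antisym[OF kp l(1) _ lk] k by auto
        then show "{k' \<in> partitions n. dom_le k k'} \<noteq> {k' \<in> partitions n. dom_le l k'}" by blast
      qed
      then have "card {k' \<in> partitions n. dom_le k k'} < card {k' \<in> partitions n. dom_le l k'}"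
        by (intro psubset_card_mono) (auto simp: finite_partitions)
      then show ?thesis using less.hyps[of k] k by simp
    qed simp
    have "0 = ip (pi1 t (R l)) F" using z[OF less.prems] by (simp add: ip_commute)
    also have "\<dots> = (\<Sum>k\<in>partitions n. ip (pi1 t (R l)) (sch k) * ip F (sch k))"
      using R_homog[OF l(1)] l(2) by (intro parseval homog_diag) simp
    also have "\<dots> = (\<Sum>k\<in>{l}. ip (pi1 t (R l)) (sch k) * ip F (sch k))"
      by (rule sum.mono_neutral_right[OF finite_partitions]) (use less.prems hz in auto)
    also have "\<dots> = ip F (sch l)" by (simp add: R_monic[OF l(1)])
    finally show ?case by simp
  qed
qed

lemma fm_complete:
  assumes F: "homog n F" and z: "\<And>mu. mu \<in> partitions n \<Longrightarrow> fm F (R mu) = 0"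
  shows "F = 0"
proof (rule pi1_inj[OF roots F])
  show "pi1 (1 / q) F = 0"
  proof (rule ip_R_complete[OF homog_diag[OF F]])
    fix mu assume "mu \<in> partitions n"
    then have "fm (R mu) F = 0" using z fm_commute[of "R mu" F] by simp
    then show "ip (pi1 (1 / q) F) (pi1 t (R mu)) = 0" by (simp add: fm_def ip_commute)
  qed
qed

lemma R_expand:
  assumes F: "homog n F"
  shows "F = (\<Sum>mu\<in>partitions n. Co (fm F (R mu) / fm (R mu) (R mu)) * R mu)" (is "F = ?S")
proof -
  have "F - ?S = 0"
  proof (rule fm_complete[of n])
    show "homog n (F - ?S)"
      by (intro homog_diff F homog_sum homog_Co) (use R_homog in \<open>auto simp: partitions_iff\<close>)
    fix mu assume mu: "mu \<in> partitions n"
    then show "fm (F - ?S) (R mu) = 0"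
      unfolding fm_diff fm_sum_R[OF mu] using fm_self by (simp add: partitions_iff)
  qed
  then show ?thesis by simp
qed

lemma R_coeff_unique:
  assumes "(\<Sum>nu\<in>partitions n. Co (c nu) * R nu) = (\<Sum>nu\<in>partitions n. Co (d nu) * R nu)" "mu \<in> partitions n"
  shows "c mu = d mu"
proof -
  have "c mu * fm (R mu) (R mu) = d mu * fm (R mu) (R mu)"
    using arg_cong[OF assms(1), of "\<lambda>F. fm F (R mu)"] unfolding fm_sum_R[OF assms(2)] .
  moreover have "fm (R mu) (R mu) \<noteq> 0" using fm_self assms(2) by (simp add: partitions_iff)
  ultimately show ?thesis by (rule mult_right_cancel[THEN iffD1, rotated])
qed

end

section \<open>Expansion of h_n[X(1-u)/(1-q)] in a Hall-Littlewood basis\<close>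

section \<open>The Hall--Littlewood basis\<close>

lemma above_EE:
  assumes mu: "partition mu" and G: "homog (sum_list mu) G" "above mu G" shows "above mu (EE q t G)"
  unfolding above_def
proof (intro ballI impI)
  fix m assume m: "m \<in> partitions (sum_list mu)" and nz: "ip (EE q t G) (sch m) \<noteq> 0"
  then have "(\<Sum>l\<in>partitions (sum_list mu). ip G (sch l) * ip (EE q t (sch l)) (sch m)) \<noteq> 0"
    by (simp add: ip_EE[OF G(1)])
  then obtain l where l: "l \<in> partitions (sum_list mu)" "ip G (sch l) * ip (EE q t (sch l)) (sch m) \<noteq> 0"
    by (rule sum.not_neutral_contains_not_neutral)
  then have "dom_le mu l" using G(2) by (auto simp: above_def)
  moreover have "dom_le l m" using ip_EE_sch(1)[of l m q t] l m by (auto simp: partitions_iff)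
  ultimately show "dom_le mu m" by (rule dom_le_trans)
qed

lemma ip_EE_self:
  assumes mu: "partition mu" and G: "homog (sum_list mu) G" "above mu G"
  shows "ip (EE q t G) (sch mu) = ip G (sch mu) * ev q t mu"
proof -
  have "ip (EE q t G) (sch mu) = (\<Sum>l\<in>partitions (sum_list mu). ip G (sch l) * ip (EE q t (sch l)) (sch mu))"
    by (rule ip_EE[OF G(1)])
  also have "\<dots> = (\<Sum>l\<in>{mu}. ip G (sch l) * ip (EE q t (sch l)) (sch mu))"
  proof (rule sum.mono_neutral_right[OF finite_partitions])
    show "\<forall>l\<in>partitions (sum_list mu) - {mu}. ip G (sch l) * ip (EE q t (sch l)) (sch mu) = 0"
    proof (rule ballI, rule ccontr)
      fix l assume l: "l \<in> partitions (sum_list mu) - {mu}" and nz: "ip G (sch l) * ip (EE q t (sch l)) (sch mu) \<noteq> 0"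
      have lp: "partition l" using l by (simp add: partitions_iff)
      have "dom_le mu l" using G(2) l nz by (auto simp: above_def)
      moreover have "dom_le l mu" using ip_EE_sch(1)[OF lp mu] nz by auto
      ultimately show False using dom_le_antisym[OF mu lp] l by simp
    qed
  qed (use mu in \<open>auto simp: partitions_iff\<close>)
  finally show ?thesis by (simp add: ip_EE_sch(2)[OF mu mu])
qed

text \<open>At t = 0 the eigenvalues only see the number of parts. They no longer separate
  partitions, which is why Hall-Littlewood functions are built as limits rather than isolated as
  eigenvectors.\<close>

lemma ev_0: "partition mu \<Longrightarrow> ev q 0 mu = q ^ length mu"
proof -
  assume mu: "partition mu"
  have "q ^ i * (0 ^ nth0 mu i - 1) = - (q ^ i)" if "i < length mu" for i
    using partition_nth0_pos[OF mu, of i] that by (simp add: power_0_left)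
  then have "(\<Sum>i<length mu. q ^ i * (0 ^ nth0 mu i - 1)) = - (\<Sum>i<length mu. q ^ i)"
    by (simp add: sum_negf)
  then have "ev q 0 mu = 1 - (1 - q) * (\<Sum>i<length mu. q ^ i)" unfolding ev_rows[OF order_refl] by simp
  also have "(1 - q) * (\<Sum>i<length mu. q ^ i) = 1 - q ^ length mu"
    unfolding one_diff_power_eq ..
  finally show ?thesis by simp
qed

lemma newt_cong: "newt a A \<Longrightarrow> (\<And>k. k \<ge> 1 \<Longrightarrow> a k = b k) \<Longrightarrow> newt b A"
  unfolding newt_def by (metis (no_types, lifting) atLeastAtMost_iff sum.cong)

lemma evl_diag: "evl z (diag c F) = evl (\<lambda>k. z k * c k) F" for F :: "'a::comm_ring_1 sym"
  by (rule rhom_ext[OF rhom_comp[OF rhom_evl rhom_diag] rhom_evl])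
     (auto simp: rhom_mult[OF rhom_evl] mult.commute)

lemma evl_cong_homog:
  assumes F: "homog n F" and cd: "\<And>k. k \<ge> 1 \<Longrightarrow> z k = w k" shows "evl z F = evl w (F :: 'a::field_char_0 sym)"
proof -
  have "evl z F = evl (\<lambda>_. 1) (diag z F)" "evl w F = evl (\<lambda>_. 1) (diag w F)" by (simp_all add: evl_diag)
  then show ?thesis using diag_cong_homog[OF F cd] by simp
qed

lemma evl_scale: "homog n F \<Longrightarrow> evl (\<lambda>k. c ^ k * z k) F = c ^ n * evl z F" for F :: "'a::field_char_0 sym"
proof -
  assume F: "homog n F"
  have "evl (\<lambda>k. c ^ k * z k) F = evl z (diag (\<lambda>k. c ^ k) F)" by (simp add: evl_diag mult.commute)
  also have "\<dots> = c ^ n * evl z F" by (simp add: diag_power[OF F] rhom_mult[OF rhom_evl])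
  finally show ?thesis .
qed

text \<open>\<open>AA q n u\<close> is \<open>h\<^sub>n[X (1-u)/(1-q)]\<close>.\<close>

definition AA :: "'a::field_char_0 \<Rightarrow> nat \<Rightarrow> 'a \<Rightarrow> 'a sym" where
  "AA q n u = diag (\<lambda>k. (1 - u ^ k) / (1 - q ^ k)) (hh n)"

lemma homog_AA: "homog n (AA q n u)"
  unfolding AA_def by (intro homog_diag homog_hh)

lemma newt_AA: "newt (\<lambda>k. Co ((1 - u ^ k) / (1 - q ^ k)) * pp k) (\<lambda>n. AA q n u)"
  using newt_hom[OF rhom_diag newt_hh, of "\<lambda>k. (1 - u ^ k) / (1 - q ^ k)"] by (simp add: AA_def)

lemma ip_AA: "homog n F \<Longrightarrow> ip (AA q n u) F = evl (\<lambda>k. (1 - u ^ k) / (1 - q ^ k)) F"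
  unfolding AA_def by (rule ip_hh_diag)

lemma AA_0 [simp]: "AA q 0 u = 1" by (simp add: AA_def)

lemma transl_AA:
  assumes W: "newt (\<lambda>k. monom (Co (a k * ((1 - u ^ k) / (1 - q ^ k)))) k) W"
  shows "transl a (AA q n u) = (\<Sum>j\<le>n. [:AA q (n - j) u:] * W j)"
proof -
  have 1: "newt (\<lambda>k. [:Co ((1 - u ^ k) / (1 - q ^ k)) * pp k:] + monom (Co (a k * ((1 - u ^ k) / (1 - q ^ k)))) k)
     (\<lambda>n. \<Sum>j\<le>n. [:AA q j u:] * W (n - j))"
    by (rule newt_mult[OF newt_hom[OF _ newt_AA] W]) (simp add: rhom_def one_pCons)
  have 2: "newt (\<lambda>k. transl a (Co ((1 - u ^ k) / (1 - q ^ k)) * pp k)) (\<lambda>n. transl a (AA q n u))"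
    by (rule newt_hom[OF rhom_transl newt_AA])
  have "transl a (AA q n u) = (\<Sum>j\<le>n. [:AA q j u:] * W (n - j))"
    by (rule newt_unique_poly[OF 2 1])
       (simp add: rhom_mult[OF rhom_transl] transl_pp smult_add_right smult_monom Co_mult[symmetric] mult.commute)
  also have "\<dots> = (\<Sum>j\<le>n. [:AA q (n - j) u:] * W j)"
    by (rule sum.reindex_bij_witness[of _ "\<lambda>j. n - j" "\<lambda>j. n - j"]) auto
  finally show ?thesis .
qed

text \<open>Translating by (1-q)x multiplies the generating series by (1-ux)/(1-x) = u +
  (1-u)/(1-x). The constant term then adds -1 to the factor (1-u)/(1-q), which becomes
  q(1-u/q)/(1-q), so u is replaced by u/q at the cost of q^n.\<close>

lemma EE_AA:
  assumes q: "q \<noteq> 0" "\<And>k. k \<ge> 1 \<Longrightarrow> q ^ k \<noteq> 1"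
  shows "EE q 0 (AA q n u) = Co u * AA q n u + Co ((1 - u) * q ^ n) * AA q n (u / q)"
proof -
  let ?x = "monom 1 1 :: 'a sym poly"
  define W where "W j = (if j = 0 then 1 else monom (Co (1 - u)) j)" for j
  have xk: "?x ^ k = monom 1 k" "monom (Co u) 1 ^ k = monom (Co (u ^ k)) k" for k
  proof -
    have "Co u ^ k = Co (u ^ k)" by (induction k) (auto simp: Co_mult)
    then show "?x ^ k = monom 1 k" "monom (Co u) 1 ^ k = monom (Co (u ^ k)) k" by (simp_all add: monom_power)
  qed
  have "newt (\<lambda>k. ?x ^ k + - (monom (Co u) 1 ^ k))
     (\<lambda>n. \<Sum>j\<le>n. ?x ^ j * (if n - j = 0 then 1 else if n - j = 1 then - monom (Co u) 1 else 0))"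
    by (rule newt_mult[OF newt_geometric newt_linear])
  moreover have "(\<lambda>n. \<Sum>j\<le>n. ?x ^ j * (if n - j = 0 then 1 else if n - j = 1 then - monom (Co u) 1 else 0)) = W"
  proof
    fix n
    show "(\<Sum>j\<le>n. ?x ^ j * (if n - j = 0 then 1 else if n - j = 1 then - monom (Co u) 1 else 0)) = W n"
    proof (cases n)
      case (Suc m)
      have "(\<Sum>j\<le>n. ?x ^ j * (if n - j = 0 then 1 else if n - j = 1 then - monom (Co u) 1 else 0))
        = (\<Sum>j\<in>{m, Suc m}. ?x ^ j * (if n - j = 0 then 1 else if n - j = 1 then - monom (Co u) 1 else 0))"
        by (rule sum.mono_neutral_right) (auto simp: Suc)
      also have "\<dots> = monom 1 m * - monom (Co u) 1 + monom 1 (Suc m)" unfolding xk by (simp add: Suc)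
      also have "\<dots> = W n" by (simp add: Suc W_def mult_monom Co_diff diff_monom[symmetric])
      finally show ?thesis .
    qed (simp add: W_def)
  qed
  ultimately have nW: "newt (\<lambda>k. ?x ^ k + - (monom (Co u) 1 ^ k)) W" by simp
  have W: "newt (\<lambda>k. monom (Co ((1 - q ^ k) * ((1 - u ^ k) / (1 - q ^ k)))) k) W"
    by (rule newt_cong[OF nW]) (unfold xk, use q in \<open>simp add: Co_diff diff_monom[symmetric]\<close>)
  have g: "pi1 0 (gneg j) = (gneg j :: 'a sym)" for j
    by (rule pi1_0[of j]) (unfold gneg_def, intro homog_diag homog_hh)
  have "EE q 0 (AA q n u) = (\<Sum>j\<le>n. (if j = 0 then 1 else Co (1 - u)) * (gneg j * AA q (n - j) u))"
    unfolding EE_def transl_AA[OF W] LL_sum g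
  proof (rule sum.cong)
    fix j
    show "LL gneg ([:AA q (n - j) u:] * W j) = (if j = 0 then 1 else Co (1 - u)) * (gneg j * AA q (n - j) u)"
      by (cases "j = 0") (simp_all add: W_def LL_monom smult_monom LL_pCons0 mult.left_commute mult.commute)
  qed simp
  also have "\<dots> = (\<Sum>j\<le>n. Co (1 - u) * (gneg j * AA q (n - j) u) + (if j = 0 then Co u * AA q n u else 0))"
    by (rule sum.cong) (auto simp: Co_diff left_diff_distrib)
  also have "\<dots> = Co (1 - u) * (\<Sum>j\<le>n. gneg j * AA q (n - j) u) + Co u * AA q n u"
    by (simp add: sum.distrib sum_distrib_left)
  also have "(\<Sum>j\<le>n. gneg j * AA q (n - j) u) = Co q ^ n * AA q n (u / q)"
  proof (rule newt_unique_sym[OF newt_mult[OF newt_gneg newt_AA] newt_scale[OF newt_AA]])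
    fix k :: nat assume k: "k \<ge> 1"
    have "(1 - u ^ k) / (1 - q ^ k) - 1 = q ^ k * ((1 - (u / q) ^ k) / (1 - q ^ k))"
      using q(1) q(2)[OF k] by (simp add: divide_simps power_divide)
    moreover have "Co q ^ k = Co (q ^ k)" by (induction k) (auto simp: Co_mult)
    ultimately have "Co ((1 - u ^ k) / (1 - q ^ k) - 1) = Co q ^ k * Co ((1 - (u / q) ^ k) / (1 - q ^ k))"
      by (metis Co_mult)
    moreover have "- pp k + Co ((1 - u ^ k) / (1 - q ^ k)) * pp k = Co ((1 - u ^ k) / (1 - q ^ k) - 1) * pp k"
      by (simp add: Co_diff left_diff_distrib)
    ultimately show "- pp k + Co ((1 - u ^ k) / (1 - q ^ k)) * pp k = Co q ^ k * (Co ((1 - (u / q) ^ k) / (1 - q ^ k)) * pp k)"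
      by (simp only: mult.assoc)
  qed
  also have "Co q ^ n = Co (q ^ n)" by (induction n) (auto simp: Co_mult)
  finally show ?thesis by (simp add: Co_mult mult.assoc)
qed

text \<open>E_j is e_j(1, q, ..., q^(N-1)), built by adjoining one variable at a time; the last
  nonzero one is the product of all variables.\<close>

lemma finite_geometric_e:
  fixes q :: "'a::field_char_0"
  assumes q: "\<And>k. k \<ge> 1 \<Longrightarrow> q ^ k \<noteq> 1"
  shows "\<exists>E. newt (\<lambda>k. om k * ((1 - (q ^ N) ^ k) / (1 - q ^ k))) E \<and> E N = q ^ (N choose 2) \<and> (\<forall>j>N. E j = 0)"
proof (induction N)
  case 0
  have "newt (\<lambda>k. om k * ((1 - (q ^ 0) ^ k) / (1 - q ^ k))) (\<lambda>n. if n = 0 then 1 else 0)"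
    by (simp add: newt_def)
  then show ?case by (intro exI[of _ "\<lambda>n. if n = 0 then 1 else 0"]) (auto simp: numeral_2_eq_2)
next
  case (Suc N)
  then obtain E where E: "newt (\<lambda>k. om k * ((1 - (q ^ N) ^ k) / (1 - q ^ k))) E" "E N = q ^ (N choose 2)" "\<forall>j>N. E j = 0"
    by blast
  let ?L = "\<lambda>n. if n = 0 then 1 else if n = 1 then - (- (q ^ N)) else (0 :: 'a)"
  let ?E = "\<lambda>n. \<Sum>j\<le>n. E j * ?L (n - j)"
  have "newt (\<lambda>k. om k * ((1 - (q ^ N) ^ k) / (1 - q ^ k)) + - ((- (q ^ N)) ^ k)) ?E"
    by (rule newt_mult[OF E(1) newt_linear])
  then have 1: "newt (\<lambda>k. om k * ((1 - (q ^ Suc N) ^ k) / (1 - q ^ k))) ?E"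
  proof (rule newt_cong)
    fix k :: nat assume k: "k \<ge> 1"
    have "(- (q ^ N)) ^ k = (- 1) ^ k * (q ^ N) ^ k" by (subst power_mult_distrib[symmetric]) simp
    moreover have "(1 - X) / (1 - q ^ k) + X = (1 - q ^ k * X) / (1 - q ^ k)" for X
      using q[OF k] by (simp add: field_simps)
    moreover have "(q ^ Suc N) ^ k = q ^ k * (q ^ N) ^ k" by (simp only: power_Suc power_mult_distrib)
    ultimately have "(1 - (q ^ Suc N) ^ k) / (1 - q ^ k) = (1 - (q ^ N) ^ k) / (1 - q ^ k) + (q ^ N) ^ k"
      "- ((- (q ^ N)) ^ k) = om k * (q ^ N) ^ k" by simp_all
    then show "om k * ((1 - (q ^ N) ^ k) / (1 - q ^ k)) + - ((- (q ^ N)) ^ k) = om k * ((1 - (q ^ Suc N) ^ k) / (1 - q ^ k))"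
      by (simp only: distrib_left)
  qed
  have e: "?E (Suc m) = E m * q ^ N + E (Suc m)" for m
  proof -
    have "?E (Suc m) = (\<Sum>j\<in>{m, Suc m}. E j * ?L (Suc m - j))"
      by (rule sum.mono_neutral_right) auto
    then show ?thesis by simp
  qed
  have "?E (Suc N) = q ^ (Suc N choose 2)"
    unfolding e using E(2,3) by (simp add: numeral_2_eq_2 power_add)
  moreover have "\<forall>j>Suc N. ?E j = 0"
  proof (intro allI impI)
    fix j assume "j > Suc N"
    then obtain m where "j = Suc m" "m > N" by (cases j) auto
    then show "?E j = 0" using E(3) by (simp only: e) simp
  qed
  ultimately show ?case using 1 by (intro exI[of _ ?E] conjI)
qed

text \<open>At u = q^k the pairing involves the alphabet 1, q, ..., q^(k-1), whose e_k is the single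
  monomial q^(k choose 2).\<close>

lemma ek_AA:
  assumes q: "\<And>k. k \<ge> 1 \<Longrightarrow> q ^ k \<noteq> 1"
  shows "ek k (AA q (k + n) (q ^ k)) = Co (q ^ (k choose 2)) * AA q n (q ^ k)"
proof -
  obtain E where E: "newt (\<lambda>j. om j * ((1 - (q ^ k) ^ j) / (1 - q ^ j))) E" "E k = q ^ (k choose 2)"
    using finite_geometric_e[of q k] q by blast
  have h: "rhom (\<lambda>c. [:Co c:] :: 'a sym poly)" by (rule rhom_pCons_Co)
  have Cp: "[:Co c:] * monom 1 j = (monom (Co c) j :: 'a sym poly)" for c j by (simp add: smult_monom)
  have "newt (\<lambda>j. monom 1 1 ^ j * [:Co (om j * ((1 - (q ^ k) ^ j) / (1 - q ^ j))):]) (\<lambda>n. monom 1 1 ^ n * [:Co (E n):])"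
    by (rule newt_scale[OF newt_hom[OF h E(1)]])
  then have W: "newt (\<lambda>j. monom (Co (om j * ((1 - (q ^ k) ^ j) / (1 - q ^ j)))) j) (\<lambda>n. monom (Co (E n)) n)"
    by (simp add: monom_power mult.commute[of "monom _ _"] smult_monom)
  have "ek k (AA q (k + n) (q ^ k)) = (\<Sum>j\<le>k + n. if j = k then AA q (k + n - j) (q ^ k) * Co (E j) else 0)"
    unfolding ek_def transl_AA[OF W] coeff_sum by (rule sum.cong) auto
  then show ?thesis by (simp add: E(2) mult.commute)
qed

lemma AA_inverse:
  assumes q: "q \<noteq> 0" and u: "u \<noteq> 0"
  shows "AA (1 / q) n u = Co ((q * u) ^ n) * AA q n (1 / u)"
proof -
  have "Co ((q * u) ^ n) * AA q n (1 / u) = diag (\<lambda>k. (q * u) ^ k) (AA q n (1 / u))"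
    by (rule diag_power[OF homog_AA, symmetric])
  also have "\<dots> = diag (\<lambda>k. (q * u) ^ k * ((1 - (1 / u) ^ k) / (1 - q ^ k))) (hh n)"
    unfolding AA_def diag_diag ..
  also have "\<dots> = AA (1 / q) n u"
    unfolding AA_def
  proof (rule diag_cong_homog[OF homog_hh])
    fix k :: nat
    have "(q * u) ^ k * (1 - (1 / u) ^ k) * (1 - (1 / q) ^ k) = (1 - u ^ k) * (1 - q ^ k)"
      using q u by (simp add: power_divide power_mult_distrib field_simps)
    moreover have "1 - (1 / q) ^ k = 0 \<longleftrightarrow> 1 - q ^ k = 0" using q by (auto simp: power_divide field_simps)
    ultimately show "(q * u) ^ k * ((1 - (1 / u) ^ k) / (1 - q ^ k)) = (1 - u ^ k) / (1 - (1 / q) ^ k)"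
      by (cases "1 - q ^ k = 0") (simp_all add: nonzero_eq_divide_eq nonzero_divide_eq_eq)
  qed
  finally show ?thesis by simp
qed

text \<open>From 1 - u^k = -u^k (1 - u^(-k)): omega inverts u up to a scalar and keeps q. This lets
  omega be compared with the passage from q to 1/q in \<open>Om_expansion\<close>.\<close>

lemma Om_AA: "u \<noteq> 0 \<Longrightarrow> Om (AA q n u) = Co ((- u) ^ n) * AA q n (1 / u)"
proof -
  assume u: "u \<noteq> 0"
  have "Co ((- u) ^ n) * AA q n (1 / u) = diag (\<lambda>k. (- u) ^ k) (AA q n (1 / u))"
    by (rule diag_power[OF homog_AA, symmetric])
  also have "\<dots> = diag (\<lambda>k. (- u) ^ k * ((1 - (1 / u) ^ k) / (1 - q ^ k))) (hh n)"
    unfolding AA_def diag_diag ..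
  also have "\<dots> = Om (AA q n u)"
    unfolding AA_def diag_diag
  proof (rule diag_cong_homog[OF homog_hh])
    fix k :: nat
    have "(- u) ^ k = (- 1) ^ k * u ^ k" by (subst power_mult_distrib[symmetric]) simp
    moreover have "u ^ k * (1 - (1 / u) ^ k) = - (1 - u ^ k)" using u by (simp add: power_divide algebra_simps)
    ultimately have "(- u) ^ k * (1 - (1 / u) ^ k) = om k * (1 - u ^ k)" by (simp add: mult.assoc right_diff_distrib)
    then show "(- u) ^ k * ((1 - (1 / u) ^ k) / (1 - q ^ k)) = om k * ((1 - u ^ k) / (1 - q ^ k))"
      by (metis times_divide_eq_right)
  qed
  finally show ?thesis by simp
qed

lemma partition_length_le: "partition l \<Longrightarrow> length l \<le> sum_list l"
proof -
  assume "partition l"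
  then have "0 \<notin> set l" by (simp add: partition_def)
  then show ?thesis by (induction l) (auto simp: Suc_le_eq)
qed

lemma power_inj:
  fixes q :: "'a::field_char_0"
  assumes q: "q \<noteq> 0" "\<And>k. k \<ge> 1 \<Longrightarrow> q ^ k \<noteq> 1"
  shows "q ^ i = q ^ j \<longleftrightarrow> i = j"
proof -
  have "i = j" if "i \<le> j" "q ^ i = q ^ j" for i j
  proof (rule ccontr)
    assume "i \<noteq> j"
    have "q ^ j = q ^ i * q ^ (j - i)" using that(1) by (simp flip: power_add)
    then have "q ^ (j - i) = 1" using that(2) q(1) by simp
    then show False using q(2)[of "j - i"] \<open>i \<noteq> j\<close> that(1) by simp
  qed
  then show ?thesis by (metis nle_le)
qed

lemma infinite_powers:
  fixes q :: "'a::field_char_0"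
  assumes q: "q \<noteq> 0" "\<And>k. k \<ge> 1 \<Longrightarrow> q ^ k \<noteq> 1"
  shows "infinite (range (\<lambda>k::nat. q ^ k))"
  by (rule range_inj_infinite) (auto intro: injI simp: power_inj[OF q])

lemma poly_eqI_infinite:
  fixes p r :: "'a::field_char_0 poly"
  assumes "infinite S" "\<And>x. x \<in> S \<Longrightarrow> poly p x = poly r x"
  shows "p = r"
proof (rule ccontr)
  assume "p \<noteq> r"
  then have "finite {x. poly (p - r) x = 0}" by (intro poly_roots_finite) simp
  moreover have "S \<subseteq> {x. poly (p - r) x = 0}" using assms(2) by auto
  ultimately show False using assms(1) finite_subset by blast
qed

lemma evl_polynomial:
  fixes F :: "'a::field_char_0 sym"
  assumes "\<And>k. \<exists>p. \<forall>u. z u k = poly p u"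
  shows "\<exists>P. \<forall>u. evl (z u) F = poly P u"
proof (induction F rule: sym_induct)
  case (const c)
  have "\<forall>u. evl (z u) (Co c) = poly [:c:] u" by simp
  then show ?case by blast
next
  case c: (pp k F)
  obtain P where "\<forall>u. evl (z u) F = poly P u" using c by blast
  moreover obtain p where "\<forall>u. z u k = poly p u" using assms by blast
  ultimately have "\<forall>u. evl (z u) (Submission.pp k * F) = poly (p * P) u" by (simp add: rhom_mult[OF rhom_evl])
  then show ?case by blast
next
  case (add F G)
  obtain P Q where "\<forall>u. evl (z u) F = poly P u" "\<forall>u. evl (z u) G = poly Q u" using add by blast
  then have "\<forall>u. evl (z u) (F + G) = poly (P + Q) u" by (simp add: rhom_add[OF rhom_evl])
  then show ?case by blast
qed

text \<open>For l at most n this is u^n (1/u;q)_l, written so that it is visibly a polynomial in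
  u.\<close>

definition psi :: "'a::field_char_0 \<Rightarrow> nat \<Rightarrow> nat \<Rightarrow> 'a \<Rightarrow> 'a" where
  "psi q n l u = u ^ (n - l) * (\<Prod>i<l. u - q ^ i)"

lemma psi_polynomial: "\<exists>P. \<forall>u. psi q n l u = poly P u"
  by (rule exI[of _ "monom 1 (n - l) * (\<Prod>i<l. [:- (q ^ i), 1:])"]) (simp add: psi_def poly_monom poly_prod)

lemma psi_inverse:
  assumes v: "v \<noteq> 0" and len: "l \<le> n" shows "v ^ n * psi q n l (1 / v) = (\<Prod>i<l. 1 - q ^ i * v)"
proof -
  have "v ^ n * psi q n l (1 / v) = v ^ l * (\<Prod>i<l. 1 / v - q ^ i)"
    using v len power_add[of v "n - l" l] by (simp add: psi_def power_divide)
  also have "\<dots> = (\<Prod>i<l. v * (1 / v - q ^ i))" by (simp add: prod.distrib)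
  also have "\<dots> = (\<Prod>i<l. 1 - q ^ i * v)" by (rule prod.cong) (use v in \<open>auto simp: right_diff_distrib mult.commute\<close>)
  finally show ?thesis .
qed

lemma psi_functional_equation:
  assumes "q \<noteq> 0" "l \<le> n"
  shows "q ^ l * psi q n l u = u * psi q n l u + (1 - u) * q ^ n * psi q n l (u / q)"
proof -
  have "q ^ n * psi q n l (u / q) = u ^ (n - l) * (q ^ l * (\<Prod>i<l. u / q - q ^ i))"
    using assms power_add[of q "n - l" l] by (simp add: psi_def power_divide)
  also have "q ^ l * (\<Prod>i<l. u / q - q ^ i) = (\<Prod>i<l. u - q ^ Suc i)"
    using assms prod.distrib[of "\<lambda>_. q" "\<lambda>i. u / q - q ^ i" "{..<l}"] by (simp add: right_diff_distrib)
  finally have "(1 - u) * q ^ n * psi q n l (u / q) = - (u ^ (n - l) * ((u - q ^ 0) * (\<Prod>i<l. u - q ^ Suc i)))"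
    by (simp add: algebra_simps)
  also have "(u - q ^ 0) * (\<Prod>i<l. u - q ^ Suc i) = (\<Prod>i<l. u - q ^ i) * (u - q ^ l)"
    using prod.lessThan_Suc_shift[of "\<lambda>i. u - q ^ i" l] prod.lessThan_Suc[of "\<lambda>i. u - q ^ i" l] by (simp add: mult.commute)
  finally show ?thesis by (simp add: psi_def algebra_simps)
qed

text \<open>Subtract the multiple of \<open>psi\<close> that matches p at q^l. The equation then
  carries a zero from u/q to u, since the factor q^l - u vanishes only at u = q^l, where the
  difference is zero by choice. At u = 1 the last term drops out and starts the induction;
  infinitely many zeros finish it.\<close>

lemma functional_equation_unique:
  fixes q :: "'a::field_char_0"
  assumes q: "q \<noteq> 0" "\<And>k. k \<ge> 1 \<Longrightarrow> q ^ k \<noteq> 1" and l: "l \<le> n"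
    and p: "\<And>u. q ^ l * poly p u = u * poly p u + (1 - u) * q ^ n * poly p (u / q)"
  shows "\<exists>c. \<forall>u. poly p u = c * psi q n l u"
proof -
  obtain P where P: "\<And>u. psi q n l u = poly P u" using psi_polynomial by blast
  have nz: "poly P (q ^ l) \<noteq> 0"
    unfolding P[symmetric] psi_def using power_inj[OF q] q(1) by (auto simp: eq_diff_eq)
  define c where "c = poly p (q ^ l) / poly P (q ^ l)"
  let ?f = "p - smult c P"
  have f: "q ^ l * poly ?f u = u * poly ?f u + (1 - u) * q ^ n * poly ?f (u / q)" for u
    using p[of u] psi_functional_equation[OF q(1) l, of u] unfolding P
    by (simp add: algebra_simps) (metis (no_types, lifting) distrib_left mult.left_commute)
  have fl: "poly ?f (q ^ l) = 0" using nz by (simp add: c_def)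
  have "poly ?f (q ^ N) = 0" for N
  proof (induction N)
    case 0
    show ?case
    proof (cases "l = 0")
      case False
      have "(q ^ l - 1) * poly ?f 1 = 0" using f[of 1] by (simp only: left_diff_distrib) simp
      then show ?thesis using q(2)[of l] False by auto
    qed (use fl in simp)
  next
    case (Suc N)
    show ?case
    proof (cases "Suc N = l")
      case False
      have "poly ?f (q ^ Suc N / q) = 0" using Suc q(1) by simp
      then have "(q ^ l - q ^ Suc N) * poly ?f (q ^ Suc N) = 0"
        using f[of "q ^ Suc N"] by (simp only: left_diff_distrib) simp
      moreover have "q ^ l - q ^ Suc N \<noteq> 0" using power_inj[OF q, of l "Suc N"] False by simp
      ultimately show ?thesis by (metis mult_eq_0_iff)
    qed (use fl in simp)
  qed
  then have "?f = 0" by (intro poly_eqI_infinite[OF infinite_powers[OF q]]) auto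
  then have "poly p u = c * psi q n l u" for u by (simp add: P flip: poly_smult)
  then show ?thesis by blast
qed

text \<open>Instantiated at q and at 1/q. Besides the triangular characterization it records the
  column rule, from which the expansion constants are computed.\<close>

locale hl_basis =
  fixes q :: "'a::field_char_0" and R :: "nat list \<Rightarrow> 'a sym"
  assumes q_nonzero: "q \<noteq> 0" and q_roots: "\<And>k. k \<ge> 1 \<Longrightarrow> q ^ k \<noteq> 1" and q_aniso: "anisotropic (1 / q) 0"
    and R_HL: "\<And>mu. partition mu \<Longrightarrow> HLprop q mu (R mu)"
    and R_column: "\<And>k nu. partition nu \<Longrightarrow> length nu \<le> k \<Longrightarrow> ek k (R (addcol k nu)) = R nu"
begin

lemma inverse_roots: "k \<ge> 1 \<Longrightarrow> (1 / q) ^ k \<noteq> 1"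
  using q_roots[of k] q_nonzero by (auto simp: power_divide)

lemma R0: "partition mu \<Longrightarrow> pi1 0 (R mu) = R mu"
  using R_HL[of mu] pi1_0 by (auto simp: HLprop_def)

sublocale mac_basis q 0 R
  using R_HL q_nonzero q_aniso inverse_roots by unfold_locales (auto simp: HLprop_def R0)

text \<open>The difference of both sides satisfies both triangularities and has leading coefficient
  0, so \<open>macdonald_unique\<close> kills it. For the second triangularity, \<open>DD\<close>
  moves the operator across X(1-q), where it becomes the triangular \<open>EE 0 q\<close>.\<close>

lemma EE_R:
  assumes mu: "partition mu" shows "EE q 0 (R mu) = Co (q ^ length mu) * R mu"
proof -
  let ?n = "sum_list mu" and ?F = "EE q 0 (R mu) - Co (q ^ length mu) * R mu"
  have R: "homog ?n (R mu)" "above mu (R mu)" "above (conj mu) (pi1 q (R mu))" "ip (R mu) (sch mu) = 1"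
    using R_HL[OF mu] by (auto simp: HLprop_def)
  have h: "homog ?n ?F" by (intro homog_diff homog_EE homog_Co R)
  have aC: "above l (Co c * G)" if "above l G" for l c and G :: "'a sym"
    using that by (auto simp: above_def ip_Co_left)
  have "?F = 0"
  proof (rule macdonald_unique[OF mu q_nonzero q_aniso h])
    show "above mu (pi1 0 ?F)" unfolding pi1_0[OF h] by (intro above_diff above_EE mu R aC)
    have "pi1 q (EE q 0 (R mu)) = pi1 q (pi1 0 (DD q 0 (R mu)))" by (simp only: pi1_DD R0[OF mu])
    also have "\<dots> = pi1 0 (pi1 q (DD q 0 (R mu)))" by (simp only: diag_diag mult.commute)
    also have "\<dots> = pi1 0 (EE 0 q (pi1 q (R mu)))" by (simp only: pi1_DD')
    also have "\<dots> = EE 0 q (pi1 q (R mu))" by (rule pi1_0[OF homog_EE[OF homog_diag[OF R(1)]]])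
    finally have e: "pi1 q ?F = EE 0 q (pi1 q (R mu)) - Co (q ^ length mu) * pi1 q (R mu)"
      by (simp add: rhom_diff[OF rhom_diag] diag_mult)
    have "homog (sum_list (conj mu)) (pi1 q (R mu))" using homog_diag[OF R(1)] by (simp add: sum_list_conj[OF mu])
    then show "above (conj mu) (pi1 q ?F)"
      unfolding e by (intro above_diff aC above_EE partition_conj[OF mu] R(3))
    show "ip (pi1 0 ?F) (sch mu) = 0"
      unfolding pi1_0[OF h] ip_diff_left ip_Co_left ip_EE_self[OF mu R(1,2)] R(4) ev_0[OF mu] by simp
  qed
  then show ?thesis by simp
qed

definition rr :: "nat list \<Rightarrow> 'a \<Rightarrow> 'a" where
  "rr mu u = fm (AA q (sum_list mu) u) (R mu) / fm (R mu) (R mu)"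

lemma AA_rr: "AA q n u = (\<Sum>mu\<in>partitions n. Co (rr mu u) * R mu)"
proof -
  have "AA q n u = (\<Sum>mu\<in>partitions n. Co (fm (AA q n u) (R mu) / fm (R mu) (R mu)) * R mu)"
    by (rule R_expand[OF homog_AA])
  also have "\<dots> = (\<Sum>mu\<in>partitions n. Co (rr mu u) * R mu)"
    by (rule sum.cong) (auto simp: rr_def partitions_iff)
  finally show ?thesis .
qed

text \<open>The operator is diagonal in the basis and acts on \<open>AA\<close> by
  \<open>EE_AA\<close>; comparing coefficients of one basis element gives the equation.\<close>

lemma rr_functional_equation:
  assumes mu: "partition mu"
  shows "q ^ length mu * rr mu u = u * rr mu u + (1 - u) * q ^ sum_list mu * rr mu (u / q)"
proof -
  let ?n = "sum_list mu"
  have "(\<Sum>nu\<in>partitions ?n. Co (q ^ length nu * rr nu u) * R nu) = EE q 0 (AA q ?n u)"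
    unfolding AA_rr[of ?n u] EE_sum EE_Co
    by (rule sum.cong) (auto simp: EE_R partitions_iff Co_mult mult_ac)
  also have "\<dots> = Co u * AA q ?n u + Co ((1 - u) * q ^ ?n) * AA q ?n (u / q)"
    by (rule EE_AA[OF q_nonzero q_roots])
  also have "\<dots> = (\<Sum>nu\<in>partitions ?n. Co (u * rr nu u + (1 - u) * q ^ ?n * rr nu (u / q)) * R nu)"
    unfolding AA_rr sum_distrib_left sum.distrib[symmetric]
    by (rule sum.cong) (auto simp: Co_add Co_mult distrib_right mult.assoc)
  finally show ?thesis by (rule R_coeff_unique) (use mu in \<open>simp add: partitions_iff\<close>)
qed

lemma fm_AA:
  assumes mu: "partition mu"
  shows "fm (AA q (sum_list mu) u) (R mu) = evl (\<lambda>k. (1 - u ^ k) / (1 - q ^ k) * (1 - (1 / q) ^ k)) (R mu)"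
proof -
  have R: "homog (sum_list mu) (R mu)" using R_HL[OF mu] by (auto simp: HLprop_def)
  have "fm (AA q (sum_list mu) u) (R mu) = ip (AA q (sum_list mu) u) (pi1 (1 / q) (R mu))"
    unfolding fm_def pi1_0[OF homog_AA] ..
  then show ?thesis by (simp add: ip_AA[OF homog_diag[OF R]] evl_diag)
qed

lemma rr_psi:
  assumes mu: "partition mu"
  shows "\<exists>c. \<forall>u. rr mu u = c * psi q (sum_list mu) (length mu) u"
proof -
  have "\<exists>P. \<forall>u. evl (\<lambda>k. (1 - u ^ k) / (1 - q ^ k) * (1 - (1 / q) ^ k)) (R mu) = poly P u"
  proof (rule evl_polynomial)
    fix k
    have "\<forall>u. (1 - u ^ k) / (1 - q ^ k) * (1 - (1 / q) ^ k)
      = poly (smult ((1 - (1 / q) ^ k) / (1 - q ^ k)) (1 - monom 1 k)) u"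
      by (simp add: poly_monom)
    then show "\<exists>p. \<forall>u. (1 - u ^ k) / (1 - q ^ k) * (1 - (1 / q) ^ k) = poly p u" by blast
  qed
  then obtain P where P: "\<And>u. evl (\<lambda>k. (1 - u ^ k) / (1 - q ^ k) * (1 - (1 / q) ^ k)) (R mu) = poly P u" by blast
  let ?p = "smult (1 / fm (R mu) (R mu)) P"
  have p: "rr mu u = poly ?p u" for u unfolding rr_def fm_AA[OF mu] P by simp
  have len: "length mu \<le> sum_list mu" using partition_length_le[OF mu] .
  show ?thesis unfolding p
    by (rule functional_equation_unique[OF q_nonzero q_roots len], assumption) (unfold p[symmetric], rule rr_functional_equation[OF mu])
qed

definition CC :: "nat list \<Rightarrow> 'a" where
  "CC mu = (SOME c. \<forall>u. rr mu u = c * psi q (sum_list mu) (length mu) u)"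

lemma rr_CC: "partition mu \<Longrightarrow> rr mu u = CC mu * psi q (sum_list mu) (length mu) u"
  using someI_ex[OF rr_psi[of mu]] unfolding CC_def by blast

lemma AA_expansion: "AA q n u = (\<Sum>mu\<in>partitions n. Co (CC mu * psi q n (length mu) u) * R mu)"
  unfolding AA_rr by (rule sum.cong) (auto simp: rr_CC partitions_iff)

lemma ek_R_short:
  assumes mu: "partition mu" "length mu < k" shows "ek k (R mu) = 0"
proof -
  have R: "homog (sum_list mu) (R mu)" "above mu (R mu)" using R_HL[OF mu(1)] by (auto simp: HLprop_def)
  have "ek k (R mu) = (\<Sum>l\<in>partitions (sum_list mu). Co (ip (R mu) (sch l)) * ek k (sch l))"
    by (subst homog_expand[OF R(1)]) (simp add: ek_sum ek_Co)
  also have "\<dots> = 0"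
  proof (rule sum.neutral, intro ballI)
    fix l assume l: "l \<in> partitions (sum_list mu)"
    then have lp: "partition l" by (simp add: partitions_iff)
    show "Co (ip (R mu) (sch l)) * ek k (sch l) = 0"
    proof (cases "ip (R mu) (sch l) = 0")
      case False
      then have "dom_le mu l" using R(2) l by (auto simp: above_def)
      then have "length l < k" using dom_le_length[OF lp, of mu] mu by simp
      then show ?thesis using ek_sch(2)[OF lp, of k, where 'a='a] by simp
    qed simp
  qed
  finally show ?thesis .
qed

lemma psi_zero: "i < l \<Longrightarrow> psi q n l (q ^ i) = 0"
  unfolding psi_def by (auto intro!: prod_zero)

text \<open>Apply e_k^perp at u = q^k: the factor \<open>psi\<close> kills lengths above k, e_k^perp
  kills lengths below k, and the remaining mu lose their first column. Comparison with
  \<open>ek_AA\<close> relates the constants of mu and of its remainder.\<close>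

lemma CC_recursion:
  assumes nu: "partition nu" "length nu \<le> k"
  shows "CC (addcol k nu) * psi q (sum_list nu + k) k (q ^ k)
    = q ^ (k choose 2) * (CC nu * psi q (sum_list nu) (length nu) (q ^ k))"
proof -
  let ?n = "sum_list nu"
  define A where "A = {nu \<in> partitions ?n. length nu \<le> k}"
  have A: "finite A" "A \<subseteq> partitions ?n" by (auto simp: A_def finite_partitions)
  have Ap: "partition l" "length l \<le> k" "sum_list l = ?n" if "l \<in> A" for l
    using that by (auto simp: A_def partitions_iff)
  have inj: "inj_on (addcol k) A" by (rule inj_onI) (use addcol_inj Ap in blast)
  define t where "t mu = Co (CC mu * psi q (k + ?n) (length mu) (q ^ k)) * ek k (R mu)" for mu
  have "ek k (AA q (k + ?n) (q ^ k)) = (\<Sum>mu\<in>partitions (k + ?n). t mu)"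
    unfolding AA_expansion ek_sum ek_Co t_def ..
  also have "\<dots> = (\<Sum>mu\<in>addcol k ` A. t mu)"
  proof (rule sum.mono_neutral_right[OF finite_partitions])
    show "addcol k ` A \<subseteq> partitions (k + ?n)"
      using Ap by (auto simp: partitions_iff partition_addcol sum_addcol)
    show "\<forall>mu\<in>partitions (k + ?n) - addcol k ` A. t mu = 0"
    proof
      fix mu assume mu: "mu \<in> partitions (k + ?n) - addcol k ` A"
      then have mp: "partition mu" "sum_list mu = k + ?n" by (auto simp: partitions_iff)
      consider "length mu < k" | "length mu > k" | "length mu = k" by linarith
      then show "t mu = 0"
      proof cases
        case 3
        then obtain l where l: "partition l" "length l \<le> k" "mu = addcol k l" using ex_addcol[OF mp(1)] by blast
        then have "l \<in> A" using mp(2) by (simp add: A_def partitions_iff sum_addcol)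
        then show ?thesis using mu l by blast
      qed (simp_all add: t_def ek_R_short[OF mp(1)] psi_zero)
    qed
  qed
  also have "\<dots> = (\<Sum>l\<in>A. Co (CC (addcol k l) * psi q (k + ?n) k (q ^ k)) * R l)"
    unfolding sum.reindex[OF inj] by (rule sum.cong) (auto simp: t_def R_column Ap)
  also have "\<dots> = (\<Sum>l\<in>partitions ?n. Co (if length l \<le> k then CC (addcol k l) * psi q (k + ?n) k (q ^ k) else 0) * R l)"
    by (rule sum.mono_neutral_cong_left[OF finite_partitions A(2)]) (auto simp: A_def)
  finally have 1: "ek k (AA q (k + ?n) (q ^ k)) = \<dots>" .
  have "ek k (AA q (k + ?n) (q ^ k)) = Co (q ^ (k choose 2)) * AA q ?n (q ^ k)"
    by (rule ek_AA[OF q_roots])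
  also have "\<dots> = (\<Sum>l\<in>partitions ?n. Co (q ^ (k choose 2) * (CC l * psi q ?n (length l) (q ^ k))) * R l)"
    unfolding AA_expansion sum_distrib_left by (rule sum.cong) (auto simp: Co_mult mult_ac)
  finally have "(\<Sum>l\<in>partitions ?n. Co (if length l \<le> k then CC (addcol k l) * psi q (k + ?n) k (q ^ k) else 0) * R l)
    = (\<Sum>l\<in>partitions ?n. Co (q ^ (k choose 2) * (CC l * psi q ?n (length l) (q ^ k))) * R l)"
    unfolding 1 .
  from R_coeff_unique[OF this, of nu] show ?thesis using nu by (simp add: partitions_iff add.commute)
qed

lemma CC_Nil: "CC [] = 1"
proof -
  have "partitions 0 = {[]}" using sum_list_partition_eq_0 by (auto simp: partitions_iff)
  then have "AA q 0 1 = Co (CC []) * R []" by (subst AA_expansion) (simp add: psi_def)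
  then have "ip 1 (sch []) = ip (Co (CC []) * R []) (sch [])" by simp
  moreover have "ip (R []) (sch []) = 1" using R_HL[of "[]"] by (simp add: HLprop_def)
  ultimately show ?thesis using ip_sch_sch[of "[]" "[]", where 'a='a] by (simp add: ip_Co_left)
qed

lemma psi_nonzero: "l \<le> k \<Longrightarrow> psi q n l (q ^ k) \<noteq> 0"
  unfolding psi_def using power_inj[OF q_nonzero q_roots] q_nonzero by auto

lemma CC_nonzero: "partition mu \<Longrightarrow> CC mu \<noteq> 0"
proof (induction "sum_list mu" arbitrary: mu rule: less_induct)
  case less
  show ?case
  proof (cases "mu = []")
    case False
    obtain nu where nu: "partition nu" "length nu \<le> length mu" "mu = addcol (length mu) nu"
      using ex_addcol[OF less.prems refl] by blast
    have "sum_list nu < sum_list mu" using arg_cong[OF nu(3), of sum_list] nu(2) False by (simp add: sum_addcol)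
    then have "CC nu \<noteq> 0" using less.hyps nu(1) by blast
    then show ?thesis
      using CC_recursion[OF nu(1,2)] psi_nonzero[of "length nu" "length mu" "sum_list nu"] nu(2) q_nonzero
      unfolding nu(3)[symmetric] by auto
  qed (simp add: CC_Nil)
qed

text \<open>Needed to normalize the coefficient of s_(n) to 1. That coefficient is the value of R mu
  at p_k = 1, hence the value at v = 0 of the polynomial obtained from p_k = 1 - v^k; with u = 1/v
  the expansion constants identify this polynomial as a nonzero multiple of (v;q)_l.\<close>

lemma ip_R_row_nonzero:
  assumes mu: "partition mu" shows "ip (R mu) (hh (sum_list mu)) \<noteq> 0"
proof -
  let ?n = "sum_list mu" and ?l = "length mu"
  define N where "N = fm (R mu) (R mu)"
  have N: "N \<noteq> 0" unfolding N_def by (rule fm_self[OF mu])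
  have R: "homog ?n (R mu)" using R_HL[OF mu] by (auto simp: HLprop_def)
  have len: "?l \<le> ?n" by (rule partition_length_le[OF mu])
  have "\<exists>P. \<forall>v. evl (\<lambda>k. 1 - v ^ k) (R mu) = poly P v"
  proof (rule evl_polynomial)
    fix k have "\<forall>u. 1 - u ^ k = poly (1 - monom 1 k) (u :: 'a)" by (simp add: poly_monom)
    then show "\<exists>p. \<forall>u. 1 - u ^ k = poly p (u :: 'a)" by blast
  qed
  then obtain P where P: "\<And>v. evl (\<lambda>k. 1 - v ^ k) (R mu) = poly P v" by blast
  let ?S = "smult (q ^ ?n * N * CC mu) (\<Prod>i<?l. [:1, - (q ^ i):])"
  have "poly P v = poly ?S v" if v: "v \<noteq> 0" for v
  proof -
    have e: "(1 - (1 / v) ^ k) / (1 - q ^ k) * (1 - (1 / q) ^ k) = (1 / (v * q)) ^ k * (1 - v ^ k)" if k: "k \<ge> 1" for k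
    proof -
      have "(1 - (1 / v) ^ k) * v ^ k = - (1 - v ^ k)" "(1 - (1 / q) ^ k) * q ^ k = - (1 - q ^ k)"
        using v q_nonzero by (simp_all add: power_divide field_simps)
      then have e: "(1 - (1 / v) ^ k) = - (1 - v ^ k) / v ^ k" "(1 - (1 / q) ^ k) = - (1 - q ^ k) / q ^ k"
        using v q_nonzero by (simp_all add: nonzero_eq_divide_eq)
      have g: "(- a / x) / b * (- b / y) = 1 / (x * y) * a" if "b \<noteq> 0" for a b x y :: 'a
        using that by simp
      show ?thesis unfolding e power_divide[of 1 "v * q"] power_mult_distrib power_one
        by (rule g) (use q_roots[OF k] in simp)
    qed
    have "N * rr mu (1 / v) = fm (AA q ?n (1 / v)) (R mu)" using N by (simp add: rr_def N_def)
    also have "\<dots> = evl (\<lambda>k. (1 / (v * q)) ^ k * (1 - v ^ k)) (R mu)"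
      unfolding fm_AA[OF mu] by (rule evl_cong_homog[OF R e])
    also have "\<dots> = (1 / (v * q)) ^ ?n * poly P v" unfolding evl_scale[OF R] P ..
    finally have "poly P v = (v * q) ^ ?n * (N * (CC mu * psi q ?n ?l (1 / v)))"
      using v q_nonzero by (simp add: rr_CC[OF mu] power_divide field_simps)
    then show ?thesis using psi_inverse[OF v len, of q] by (simp add: power_mult_distrib poly_prod mult_ac)
  qed
  \<comment> \<open>The identity is known for v nonzero only; as polynomials both sides agree, so v
    = 0 may be substituted.\<close>
  then have "P = ?S" by (intro poly_eqI_infinite[of "- {0}"]) (auto simp: finite_compl infinite_UNIV_char_0)
  then have "evl (\<lambda>k. 1 - 0 ^ k) (R mu) = q ^ ?n * N * CC mu" by (simp add: P poly_prod)
  moreover have "evl (\<lambda>k. 1 - 0 ^ k) (R mu) = evl (\<lambda>_. 1) (R mu)"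
    by (rule evl_cong_homog[OF R]) (simp add: power_0_left)
  moreover have "ip (hh ?n) (R mu) = evl (\<lambda>_. 1) (R mu)"
    using ip_hh_diag[OF R, of "\<lambda>_. 1"] by (simp add: diag_one_id)
  ultimately show ?thesis using N CC_nonzero[OF mu] q_nonzero ip_commute[of "hh ?n" "R mu"] by simp
qed

end

section \<open>Connection coefficients between (v;x)_l and (v;1/x)_k\<close>

section \<open>A change of basis between $q$-shifted factorials\<close>

text \<open>The q-Pochhammer symbol (x;x)_m; the abbreviation \<open>shf x l v\<close> below is
  (v;x)_l.\<close>

definition poch :: "'a::field_char_0 \<Rightarrow> nat \<Rightarrow> 'a" where
  "poch x m = (\<Prod>i<m. 1 - x ^ Suc i)"

lemma poch_0 [simp]: "poch x 0 = 1" and poch_Suc: "poch x (Suc m) = poch x m * (1 - x ^ Suc m)"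
  by (simp_all add: poch_def)

lemma poch_nonzero: "(\<And>k. k \<ge> 1 \<Longrightarrow> x ^ k \<noteq> 1) \<Longrightarrow> poch x m \<noteq> 0"
  by (induction m) (auto simp: poch_Suc simp del: power_Suc)

lemma poch_complement: "l \<le> k \<Longrightarrow> (\<Prod>i<l. 1 - x ^ (k - i)) * poch x (k - l) = poch x k"
proof (induction l)
  case (Suc l)
  have e: "k - l = Suc (k - Suc l)" using Suc.prems by simp
  have "poch x (k - l) = poch x (k - Suc l) * (1 - x ^ (k - l))" unfolding e by (simp add: poch_Suc)
  then show ?case using Suc by (simp add: mult_ac)
qed simp

abbreviation shf :: "'a::field_char_0 \<Rightarrow> nat \<Rightarrow> 'a \<Rightarrow> 'a" where
  "shf x l v \<equiv> \<Prod>i<l. 1 - x ^ i * v"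

lemma shf_complement:
  assumes x: "x \<noteq> 0" and j: "j \<le> m" shows "shf (1 / x) j (x ^ m) * poch x (m - j) = poch x m"
proof -
  have "shf (1 / x) j (x ^ m) = (\<Prod>i<j. 1 - x ^ (m - i))"
  proof (rule prod.cong[OF refl])
    fix i assume "i \<in> {..<j}"
    then have "x ^ m = x ^ i * x ^ (m - i)" using j by (simp flip: power_add)
    then show "1 - (1 / x) ^ i * x ^ m = 1 - x ^ (m - i)" using x by (simp add: power_divide)
  qed
  then show ?thesis using poch_complement[OF j] by simp
qed

lemma shf_zero: "x \<noteq> 0 \<Longrightarrow> m < j \<Longrightarrow> shf (1 / x) j (x ^ m) = 0"
  by (rule prod_zero) (auto intro!: bexI[of _ m] simp: power_divide)

text \<open>The coefficient of (v;1/x)_k in (v;x)_l. For l at least 1 both factorials with positive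
  index vanish at v = 1, which is why the coefficient at k = 0 is 0.\<close>

definition conn :: "'a::field_char_0 \<Rightarrow> nat \<Rightarrow> nat \<Rightarrow> 'a" where
  "conn x l k = (if k = 0 \<or> l < k then 0
     else x ^ (k * (k - 1)) * (poch x l * poch x (l - 1) / (poch x k * poch x (k - 1) * poch x (l - k))))"

lemma conn_step:
  assumes x: "x \<noteq> 0" "\<And>k. k \<ge> 1 \<Longrightarrow> x ^ k \<noteq> 1" and l: "l \<ge> 1"
  shows "conn x (Suc l) (Suc k) = x ^ (l + k) * conn x l k + (1 - x ^ (l + Suc k)) * conn x l (Suc k)"
proof (cases "l < k")
  case True
  then show ?thesis by (simp add: conn_def)
next
  case False
  obtain m where m: "l = Suc m" using l by (cases l) auto
  obtain d where d: "l = k + d" using False le_Suc_ex by (metis not_less)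
  note nz = poch_nonzero[OF x(2)]
  define c where "c = poch x l * poch x (l - 1) / (poch x (Suc k) * poch x k * poch x d)"
  have 1: "conn x (Suc l) (Suc k) = x ^ (k * Suc k) * c * ((1 - x ^ Suc l) * (1 - x ^ l))"
  proof -
    have p: "poch x l = poch x (l - 1) * (1 - x ^ l)" using m by (simp add: poch_Suc)
    have "Suc l - Suc k = d" using d by simp
    then have "conn x (Suc l) (Suc k) = x ^ (k * Suc k) * (poch x (Suc l) * poch x l / (poch x (Suc k) * poch x k * poch x d))"
      using False by (simp add: conn_def mult.commute)
    also have "poch x (Suc l) * poch x l = poch x l * poch x (l - 1) * ((1 - x ^ Suc l) * (1 - x ^ l))"
      by (simp add: poch_Suc p mult_ac)
    finally show ?thesis by (simp add: c_def)
  qed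
  have 2: "(1 - x ^ (l + Suc k)) * conn x l (Suc k) = x ^ (k * Suc k) * c * ((1 - x ^ (l + Suc k)) * (1 - x ^ d))"
  proof (cases d)
    case 0
    then show ?thesis by (simp add: conn_def d)
  next
    case (Suc e)
    then have "poch x d = poch x e * (1 - x ^ d)" by (simp add: poch_Suc)
    moreover have "1 - x ^ d \<noteq> 0" using x(2)[of d] Suc by simp
    ultimately show ?thesis using nz Suc by (simp add: conn_def d c_def divide_simps)
  qed
  have 3: "x ^ (l + k) * conn x l k = x ^ (k * Suc k) * c * (x ^ d * (1 - x ^ Suc k) * (1 - x ^ k))"
  proof (cases k)
    case 0
    then show ?thesis by (simp add: conn_def)
  next
    case (Suc j)
    have p: "poch x (Suc k) = poch x k * (1 - x ^ Suc k)" "poch x k = poch x j * (1 - x ^ k)"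
      using Suc by (simp_all add: poch_Suc)
    have n: "1 - x ^ Suc k \<noteq> 0" "1 - x ^ k \<noteq> 0" using x(2)[of "Suc k"] x(2)[of k] Suc by simp_all
    have e: "x ^ (l + k) * x ^ (k * (k - 1)) = x ^ (k * Suc k) * x ^ d"
      unfolding power_add[symmetric] d Suc by (rule arg_cong[of _ _ "\<lambda>n. x ^ n"]) (simp add: algebra_simps)
    have c: "c * ((1 - x ^ Suc k) * (1 - x ^ k)) = poch x l * poch x (l - 1) / (poch x k * poch x j * poch x d)"
      unfolding c_def p(1) using n nz[of k] nz[of j] nz[of d] by (simp add: divide_simps) (simp add: p(2) mult_ac)
    have "x ^ (l + k) * conn x l k = (x ^ (l + k) * x ^ (k * (k - 1))) * (poch x l * poch x (l - 1) / (poch x k * poch x j * poch x d))"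
      using d Suc by (simp add: conn_def)
    also have "\<dots> = x ^ (k * Suc k) * c * (x ^ d * (1 - x ^ Suc k) * (1 - x ^ k))"
      unfolding e c[symmetric] by (simp only: mult_ac)
    finally show ?thesis .
  qed
  \<comment> \<open>With l = k + d the three terms share the factor x^(k(k+1)) c; what is left is
    this polynomial identity.\<close>
  have "(1 - x ^ Suc l) * (1 - x ^ l) = x ^ d * (1 - x ^ Suc k) * (1 - x ^ k) + (1 - x ^ (l + Suc k)) * (1 - x ^ d)"
    unfolding d by (simp add: algebra_simps power_add)
  then show ?thesis unfolding 1 2 3 by (simp add: distrib_left)
qed

text \<open>Induction on l through 1 - x^l v = (1 - x^(l+k)) + x^(l+k) (1 - x^(-k) v): the first
  summand keeps k, the second raises it by one, and \<open>conn_step\<close> is the resulting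
  recurrence.\<close>

lemma shf_expand:
  assumes x: "x \<noteq> 0" "\<And>k. k \<ge> 1 \<Longrightarrow> x ^ k \<noteq> 1" and l: "l \<ge> 1"
  shows "shf x l v = (\<Sum>k\<le>l. conn x l k * shf (1 / x) k v)"
  using l
proof (induction l rule: nat_induct_at_least)
  case base
  show ?case using x(2)[of 1] by (simp add: conn_def poch_Suc)
next
  case (Suc l)
  have s: "(1 - x ^ l * v) * shf (1 / x) k v = (1 - x ^ (l + k)) * shf (1 / x) k v + x ^ (l + k) * shf (1 / x) (Suc k) v" for k
    using x(1) by (simp add: power_divide field_simps power_add)
  have "shf x (Suc l) v = (\<Sum>k\<le>l. conn x l k * ((1 - x ^ l * v) * shf (1 / x) k v))"
    unfolding prod.lessThan_Suc Suc.IH sum_distrib_right by (intro sum.cong refl) (simp only: mult_ac)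
  also have "\<dots> = (\<Sum>k\<le>l. (1 - x ^ (l + k)) * conn x l k * shf (1 / x) k v) + (\<Sum>k\<le>l. x ^ (l + k) * conn x l k * shf (1 / x) (Suc k) v)"
    unfolding s by (simp add: sum.distrib distrib_left mult_ac)
  also have "(\<Sum>k\<le>l. (1 - x ^ (l + k)) * conn x l k * shf (1 / x) k v) = (\<Sum>k\<le>Suc l. (1 - x ^ (l + k)) * conn x l k * shf (1 / x) k v)"
    by (simp add: conn_def)
  also have "\<dots> = (\<Sum>k\<le>l. (1 - x ^ (l + Suc k)) * conn x l (Suc k) * shf (1 / x) (Suc k) v)"
    unfolding sum.atMost_Suc_shift by (simp add: conn_def)
  also have "\<dots> + (\<Sum>k\<le>l. x ^ (l + k) * conn x l k * shf (1 / x) (Suc k) v) = (\<Sum>k\<le>l. conn x (Suc l) (Suc k) * shf (1 / x) (Suc k) v)"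
    unfolding sum.distrib[symmetric]
  proof (rule sum.cong[OF refl])
    fix k
    have c: "conn x (Suc l) (Suc k) = x ^ (l + k) * conn x l k + (1 - x ^ (l + Suc k)) * conn x l (Suc k)"
      using x Suc.hyps by (rule conn_step)
    show "(1 - x ^ (l + Suc k)) * conn x l (Suc k) * shf (1 / x) (Suc k) v + x ^ (l + k) * conn x l k * shf (1 / x) (Suc k) v
      = conn x (Suc l) (Suc k) * shf (1 / x) (Suc k) v"
      unfolding c distrib_right by (rule add.commute)
  qed
  also have "\<dots> = (\<Sum>k\<le>Suc l. conn x (Suc l) k * shf (1 / x) k v)"
    unfolding sum.atMost_Suc_shift by (simp add: conn_def)
  finally show ?case .
qed

text \<open>At v = x^k all (v;1/x)_j with j > k vanish, so the (v;1/x)_k are independent and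
  coefficients can be compared. The condition \<open>X 0 = 0\<close> is there because
  \<open>conn x 0 k\<close> is 0 while (v;x)_0 is 1.\<close>

lemma shf_basis_change:
  assumes x: "x \<noteq> 0" "\<And>k. k \<ge> 1 \<Longrightarrow> x ^ k \<noteq> 1"
    and X: "X 0 = 0" and eq: "\<And>v. v \<noteq> 0 \<Longrightarrow> (\<Sum>l\<le>n. shf x l v * X l) = (\<Sum>k\<le>n. shf (1 / x) k v * Y k)"
    and k: "k \<le> n"
  shows "Y k = (\<Sum>l\<le>n. conn x l k * X l)"
proof -
  define Z where "Z k = (\<Sum>l\<le>n. conn x l k * X l) - Y k" for k
  have z: "(\<Sum>k\<le>n. shf (1 / x) k v * Z k) = 0" if v: "v \<noteq> 0" for v
  proof -
    have "(\<Sum>l\<le>n. shf x l v * X l) = (\<Sum>l\<le>n. \<Sum>k\<le>n. conn x l k * shf (1 / x) k v * X l)"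
    proof (rule sum.cong[OF refl])
      fix l assume l: "l \<in> {..n}"
      show "shf x l v * X l = (\<Sum>k\<le>n. conn x l k * shf (1 / x) k v * X l)"
      proof (cases "l = 0")
        case False
        have "shf x l v = (\<Sum>k\<le>l. conn x l k * shf (1 / x) k v)" using shf_expand[OF x] False by simp
        also have "\<dots> = (\<Sum>k\<le>n. conn x l k * shf (1 / x) k v)"
          by (rule sum.mono_neutral_left) (use l in \<open>auto simp: conn_def\<close>)
        finally show ?thesis by (simp add: sum_distrib_right)
      qed (simp add: X)
    qed
    also have "\<dots> = (\<Sum>k\<le>n. \<Sum>l\<le>n. conn x l k * shf (1 / x) k v * X l)" by (rule sum.swap)
    also have "\<dots> = (\<Sum>k\<le>n. shf (1 / x) k v * (\<Sum>l\<le>n. conn x l k * X l))"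
      unfolding sum_distrib_left by (intro sum.cong refl) (simp only: mult_ac)
    finally show ?thesis using eq[OF v] by (simp add: Z_def right_diff_distrib sum_subtractf)
  qed
  have "k \<le> n \<Longrightarrow> Z k = 0" for k
  proof (induction k rule: less_induct)
    case (less k)
    have "0 = (\<Sum>j\<le>n. shf (1 / x) j (x ^ k) * Z j)" using z[of "x ^ k"] x(1) by simp
    also have "\<dots> = (\<Sum>j\<in>{k}. shf (1 / x) j (x ^ k) * Z j)"
    proof (rule sum.mono_neutral_right)
      show "\<forall>j\<in>{..n} - {k}. shf (1 / x) j (x ^ k) * Z j = 0"
      proof
        fix j assume "j \<in> {..n} - {k}"
        then consider "j < k" | "k < j" by fastforce
        then show "shf (1 / x) j (x ^ k) * Z j = 0"
          by cases (use less shf_zero[OF x(1)] in auto)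
      qed
    qed (use less.prems in auto)
    also have "\<dots> = shf (1 / x) k (x ^ k) * Z k" by simp
    finally have "shf (1 / x) k (x ^ k) * Z k = 0" ..
    moreover have "shf (1 / x) k (x ^ k) = poch x k" using shf_complement[OF x(1) order_refl, of k] by simp
    moreover have "poch x k \<noteq> 0" using x(2) by (rule poch_nonzero)
    ultimately show ?case by (metis mult_eq_0_iff)
  qed
  then show ?thesis using k by (simp add: Z_def)
qed

section \<open>Explicit coefficients at parameter 1/q, and the effect of omega\<close>

section \<open>Coefficients in the dual basis\<close>

lemma psi_power:
  assumes x: "x \<noteq> 0" and l: "l \<le> k" "l \<le> m"
  shows "psi (1 / x) m l ((1 / x) ^ k) * poch x (k - l) * x ^ (k * m) = poch x k"
proof -
  have "(1 / x) ^ k - (1 / x) ^ i = (1 / x) ^ k * (1 - x ^ (k - i))" if "i < l" for i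
  proof -
    have "(1 / x) ^ k * x ^ (k - i) = (1 / x) ^ i * ((1 / x) ^ (k - i) * x ^ (k - i))"
      using that l(1) by (simp flip: power_add mult.assoc)
    then show ?thesis using x by (simp add: right_diff_distrib power_divide)
  qed
  then have "(\<Prod>i<l. (1 / x) ^ k - (1 / x) ^ i) = ((1 / x) ^ k) ^ l * (\<Prod>i<l. 1 - x ^ (k - i))"
    by (simp add: prod.distrib)
  then have "psi (1 / x) m l ((1 / x) ^ k) = ((1 / x) ^ k) ^ m * (\<Prod>i<l. 1 - x ^ (k - i))"
    using l(2) by (simp add: psi_def mult.assoc[symmetric] power_add[symmetric])
  moreover have "((1 / x) ^ k) ^ m * x ^ (k * m) = 1" using x by (simp add: power_divide power_mult)
  ultimately have "psi (1 / x) m l ((1 / x) ^ k) * poch x (k - l) * x ^ (k * m) = (\<Prod>i<l. 1 - x ^ (k - i)) * poch x (k - l)"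
    by (simp add: mult_ac)
  then show ?thesis by (simp only: poch_complement[OF l(1)])
qed

lemma addcol_append: "length l \<le> k \<Longrightarrow> addcol k l = map Suc l @ replicate (k - length l) 1"
  by (rule nth_equalityI) (auto simp: addcol_def nth0_def nth_append)

lemma sum_lessThan_choose: "(\<Sum>i<k. i) = k choose 2"
  by (induction k) (auto simp: numeral_2_eq_2)

lemma bstat_addcol: "length l \<le> k \<Longrightarrow> bstat (addcol k l) = (k choose 2) + bstat l"
proof -
  assume k: "length l \<le> k"
  have "bstat (addcol k l) = (\<Sum>i<k. i + i * nth0 l i)"
    unfolding bstat_def length_addcol by (rule sum.cong) (auto simp: addcol_def)
  also have "\<dots> = (k choose 2) + (\<Sum>i<k. i * nth0 l i)" by (simp add: sum.distrib sum_lessThan_choose)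
  also have "(\<Sum>i<k. i * nth0 l i) = (\<Sum>i<length l. i * nth0 l i)"
    by (rule sum.mono_neutral_right) (use k in \<open>auto simp: nth0_def\<close>)
  also have "\<dots> = bstat l" unfolding bstat_def by (rule sum.cong) (auto simp: nth0_def)
  finally show ?thesis .
qed

definition mfact :: "nat list \<Rightarrow> qq" where
  "mfact l = (\<Prod>i\<in>set l. qfact (count_list l i))"

lemma qfact_0 [simp]: "qfact 0 = 1" by (simp add: qfact_def)

lemma mfact_superset: "finite S \<Longrightarrow> set l \<subseteq> S \<Longrightarrow> mfact l = (\<Prod>i\<in>S. qfact (count_list l i))"
  unfolding mfact_def by (rule prod.mono_neutral_left) (auto simp: count_notin)

lemma count_list_map_inj: "inj f \<Longrightarrow> count_list (map f l) (f i) = count_list l i"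
  by (induction l) (auto simp: inj_eq)

lemma mfact_addcol:
  assumes l: "partition l" "length l \<le> k" shows "mfact (addcol k l) = qfact (k - length l) * mfact l"
proof -
  have 0: "0 \<notin> set l" using l(1) by (simp add: partition_def)
  have r: "count_list (replicate m (1::nat)) (Suc i) = (if i = 0 then m else 0)" for m i by (induction m) auto
  have c: "count_list (addcol k l) (Suc i) = count_list l i + (if i = 0 then k - length l else 0)" for i
    unfolding addcol_append[OF l(2)] count_list_append r using count_list_map_inj[of Suc l i] by simp
  have "mfact (addcol k l) = (\<Prod>i\<in>Suc ` insert 0 (set l). qfact (count_list (addcol k l) i))"
    by (rule mfact_superset) (auto simp: addcol_append[OF l(2)])
  also have "\<dots> = (\<Prod>i\<in>insert 0 (set l). qfact (count_list (addcol k l) (Suc i)))"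
    by (subst prod.reindex) auto
  also have "\<dots> = qfact (k - length l) * (\<Prod>i\<in>set l. qfact (count_list l i))"
    using 0 unfolding c by (subst prod.insert) (auto simp: count_notin intro!: prod.cong)
  finally show ?thesis by (simp add: mfact_def)
qed

lemma poch_qfact: "poch qG m = (1 - qG) ^ m * qfact m"
proof (induction m)
  case (Suc m)
  have a: "qfact (Suc m) = qfact m * qint (Suc m)" by (simp add: qfact_def)
  have b: "1 - qG ^ Suc m = (1 - qG) * qint (Suc m)" unfolding qint_def by (rule one_diff_power_eq)
  show ?case unfolding poch_Suc Suc.IH a b by (simp only: power_Suc mult_ac)
qed simp

lemma qfact_nonzero: "qfact m \<noteq> 0"
  using poch_nonzero[OF qG_power, of m] by (auto simp: poch_qfact)

lemma mfact_nonzero: "mfact l \<noteq> 0"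
  by (simp add: mfact_def qfact_nonzero)

lemma hl_basis_parameter: "parameter q' q \<Longrightarrow> (\<And>k. k \<ge> 1 \<Longrightarrow> q' ^ k \<noteq> 1) \<Longrightarrow> hl_basis q' (HL q')"
proof -
  assume P: "parameter q' q" and r: "\<And>k. k \<ge> 1 \<Longrightarrow> q' ^ k \<noteq> 1"
  show ?thesis
  proof
    show "q' \<noteq> 0" "anisotropic (1 / q') 0" by (rule parameter_props(2,4)[OF P])+
    show "q' ^ k \<noteq> 1" if "k \<ge> 1" for k using that by (rule r)
    show "HLprop q' mu (HL q' mu)" if "partition mu" for mu
      using macdonald_specialize[OF parameter_props(6)[OF P] tF_power that parameter_props(1,2,4)[OF P] spr_tF] by blast
    show "ek k (HL q' (addcol k nu)) = HL q' nu" if "partition nu" "length nu \<le> k" for k nu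
      by (rule ek_HL[OF parameter_props(6)[OF P] tF_power qF_tF_nonzero(2) that parameter_props(1,2,4)[OF P] spr_tF])
  qed
qed

interpretation HLq: hl_basis qG "HL qG"
  by (rule hl_basis_parameter[of _ qF]) (auto simp: parameter_def qG_power)

interpretation HLp: hl_basis "1 / qG" "HL (1 / qG)"
  by (rule hl_basis_parameter[of _ "1 / qF"]) (use qG_power qG_nonzero in \<open>auto simp: parameter_def power_divide\<close>)

lemma choose_square: "k * k = (k choose 2) + (Suc k choose 2)"
  by (induction k) (auto simp: numeral_2_eq_2)

text \<open>Column by column, with k = \<open>length mu\<close> and l the length after removal,
  \<open>CC_recursion\<close> reduces to CC mu (q;q)_(k-l) = q^((k+1) choose 2) CC nu. The exponents
  add up to |mu| + b(mu), and the factors (q;q)_(k-l) to the multiplicity factorials, since k - l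
  parts equal to 1 disappear.\<close>

lemma CC_dual:
  assumes "partition mu"
  shows "HLp.CC mu * ((1 - qG) ^ length mu * mfact mu) = qG ^ (sum_list mu + bstat mu)"
  using assms
proof (induction "sum_list mu" arbitrary: mu rule: less_induct)
  case less
  show ?case
  proof (cases "mu = []")
    case False
    let ?k = "length mu" and ?x = qG
    obtain nu where nu: "partition nu" "length nu \<le> ?k" "mu = addcol ?k nu"
      using ex_addcol[OF less.prems refl] by blast
    define n l where "n = sum_list nu" and "l = length nu"
    have s: "sum_list mu = n + ?k" "bstat mu = (?k choose 2) + bstat nu" "mfact mu = qfact (?k - l) * mfact nu"
      using sum_addcol[OF nu(2)] bstat_addcol[OF nu(2)] mfact_addcol[OF nu(1,2)] by (simp_all flip: nu(3) add: n_def l_def)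
    have ln: "l \<le> ?k" "l \<le> n" using nu partition_length_le by (auto simp: n_def l_def)
    have IH: "HLp.CC nu * ((1 - qG) ^ l * mfact nu) = qG ^ (n + bstat nu)"
      unfolding n_def l_def by (rule less.hyps) (use s(1) False nu in \<open>auto simp: n_def\<close>)
    have x: "?x \<noteq> 0" by (rule qG_nonzero)
    have rec: "HLp.CC mu * psi (1 / ?x) (n + ?k) ?k ((1 / ?x) ^ ?k)
      = (1 / ?x) ^ (?k choose 2) * (HLp.CC nu * psi (1 / ?x) n l ((1 / ?x) ^ ?k))"
      using HLp.CC_recursion[OF nu(1,2)] by (simp only: nu(3)[symmetric] n_def l_def)
    have p1: "psi (1 / ?x) (n + ?k) ?k ((1 / ?x) ^ ?k) * ?x ^ (?k * (n + ?k)) = poch ?x ?k"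
      using psi_power[OF x, of ?k ?k "n + ?k"] by simp
    have p2: "psi (1 / ?x) n l ((1 / ?x) ^ ?k) * poch ?x (?k - l) * ?x ^ (?k * n) = poch ?x ?k"
      using psi_power[OF x ln] .
    have e: "?x ^ (?k * (n + ?k)) = ?x ^ (?k choose 2) * ?x ^ (Suc ?k choose 2) * ?x ^ (?k * n)"
      unfolding distrib_left choose_square by (simp only: power_add mult_ac)
    have "(HLp.CC mu * poch ?x (?k - l)) * poch ?x ?k
       = HLp.CC mu * psi (1 / ?x) (n + ?k) ?k ((1 / ?x) ^ ?k) * poch ?x (?k - l) * ?x ^ (?k * (n + ?k))"
      by (simp only: p1[symmetric] mult_ac)
    also have "\<dots> = ((1 / ?x) ^ (?k choose 2) * ?x ^ (?k choose 2)) * ?x ^ (Suc ?k choose 2) * HLp.CC nu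
       * (psi (1 / ?x) n l ((1 / ?x) ^ ?k) * poch ?x (?k - l) * ?x ^ (?k * n))"
      unfolding rec e by (simp only: mult_ac)
    also have "\<dots> = (?x ^ (Suc ?k choose 2) * HLp.CC nu) * poch ?x ?k"
      unfolding p2 using x by (simp add: power_divide)
    finally have r: "HLp.CC mu * poch ?x (?k - l) = ?x ^ (Suc ?k choose 2) * HLp.CC nu"
      using poch_nonzero[OF qG_power, of ?k] by simp
    have "(1 - qG) ^ ?k = (1 - qG) ^ (?k - l) * (1 - qG) ^ l" using ln(1) by (simp flip: power_add)
    then have "HLp.CC mu * ((1 - qG) ^ ?k * mfact mu) = HLp.CC mu * poch ?x (?k - l) * ((1 - qG) ^ l * mfact nu)"
      by (simp add: s(3) poch_qfact mult_ac)
    also have "\<dots> = ?x ^ (Suc ?k choose 2) * ?x ^ (n + bstat nu)"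
      unfolding r mult.assoc IH ..
    also have "\<dots> = ?x ^ (sum_list mu + bstat mu)"
      unfolding s power_add[symmetric] by (rule arg_cong[of _ _ "\<lambda>n. ?x ^ n"]) (simp add: numeral_2_eq_2)
    finally show ?thesis .
  qed (simp add: HLp.CC_Nil mfact_def bstat_def)
qed

definition aa :: "nat list \<Rightarrow> qq" where
  "aa mu = qG ^ bstat mu / ((1 - qG) ^ length mu * mfact mu)"

lemma CC_aa: "partition mu \<Longrightarrow> HLp.CC mu = qG ^ sum_list mu * aa mu"
  using CC_dual[of mu] mfact_nonzero[of mu] qG_power[of 1] by (simp add: aa_def power_add nonzero_eq_divide_eq)

text \<open>The expansion for parameter 1/q at u = 1/v, moved back to base q by
  \<open>AA_inverse\<close>; there \<open>psi\<close> turns into (v;1/q)_l and the powers of q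
  cancel.\<close>

lemma AA_dual:
  assumes v: "v \<noteq> 0"
  shows "AA qG n v = (\<Sum>mu\<in>partitions n. Co (aa mu * shf (1 / qG) (length mu) v) * HL (1 / qG) mu)"
proof -
  let ?x = qG
  have x: "?x \<noteq> 0" by (rule qG_nonzero)
  have "Co ((1 / ?x) ^ n) * (Co (v ^ n) * AA (1 / ?x) n (1 / v)) = Co ((1 / ?x) ^ n * v ^ n * (?x * (1 / v)) ^ n) * AA ?x n v"
    using AA_inverse[OF x, of "1 / v" n] v by (simp add: Co_mult mult_ac)
  also have "(1 / ?x) ^ n * v ^ n * (?x * (1 / v)) ^ n = 1" using v x by (simp flip: power_mult_distrib)
  finally have "AA ?x n v = Co ((1 / ?x) ^ n * v ^ n) * AA (1 / ?x) n (1 / v)" by (simp add: Co_mult mult_ac)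
  also have "\<dots> = (\<Sum>mu\<in>partitions n. Co (aa mu * shf (1 / ?x) (length mu) v) * HL (1 / ?x) mu)"
    unfolding HLp.AA_expansion sum_distrib_left
  proof (rule sum.cong[OF refl])
    fix mu assume "mu \<in> partitions n"
    then have mu: "partition mu" "sum_list mu = n" by (auto simp: partitions_iff)
    have len: "length mu \<le> n" using partition_length_le[OF mu(1)] mu(2) by simp
    have "(1 / ?x) ^ n * v ^ n * (HLp.CC mu * psi (1 / ?x) n (length mu) (1 / v))
      = ((1 / ?x) ^ n * ?x ^ n) * aa mu * (v ^ n * psi (1 / ?x) n (length mu) (1 / v))"
      unfolding CC_aa[OF mu(1)] mu(2) by (simp only: mult_ac)
    also have "\<dots> = aa mu * shf (1 / ?x) (length mu) v"
      unfolding psi_inverse[OF v len] using x by (simp add: power_divide)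
    finally show "Co ((1 / ?x) ^ n * v ^ n) * (Co (HLp.CC mu * psi (1 / ?x) n (length mu) (1 / v)) * HL (1 / ?x) mu)
      = Co (aa mu * shf (1 / ?x) (length mu) v) * HL (1 / ?x) mu" by (simp only: Co_mult[symmetric] mult.assoc[symmetric])
  qed
  finally show ?thesis .
qed

text \<open>Omega sends h_n[X(1-1/v)/(1-q)] to a multiple of h_n[X(1-v)/(1-q)]. The first is
  expanded at parameter q, the second at parameter 1/q.\<close>

lemma Om_expansion:
  assumes v: "v \<noteq> 0"
  shows "(\<Sum>mu\<in>partitions n. Co (HLq.CC mu * shf qG (length mu) v) * Om (HL qG mu))
    = Co ((- 1) ^ n) * (\<Sum>mu\<in>partitions n. Co (aa mu * shf (1 / qG) (length mu) v) * HL (1 / qG) mu)"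
proof -
  have "Co (v ^ n) * Om (AA qG n (1 / v)) = Co (v ^ n * (- (1 / v)) ^ n) * AA qG n v"
    using Om_AA[of "1 / v" qG n] v by (simp add: Co_mult mult.assoc)
  also have "v ^ n * (- (1 / v)) ^ n = (- 1) ^ n" using v by (simp flip: power_mult_distrib)
  finally have 1: "Co (v ^ n) * Om (AA qG n (1 / v)) = Co ((- 1) ^ n) * AA qG n v" .
  have "Co (v ^ n) * Om (AA qG n (1 / v)) = (\<Sum>mu\<in>partitions n. Co (HLq.CC mu * shf qG (length mu) v) * Om (HL qG mu))"
    unfolding HLq.AA_expansion rhom_sum[OF rhom_diag] diag_mult sum_distrib_left diag_Co
  proof (rule sum.cong[OF refl])
    fix mu assume "mu \<in> partitions n"
    then have "length mu \<le> n" using partition_length_le[of mu] by (auto simp: partitions_iff)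
    from psi_inverse[OF v this, of qG]
    have "v ^ n * (HLq.CC mu * psi qG n (length mu) (1 / v)) = HLq.CC mu * shf qG (length mu) v"
      by (subst mult.left_commute) simp
    then show "Co (v ^ n) * (Co (HLq.CC mu * psi qG n (length mu) (1 / v)) * Om (HL qG mu))
      = Co (HLq.CC mu * shf qG (length mu) v) * Om (HL qG mu)" by (simp only: Co_mult[symmetric] mult.assoc[symmetric])
  qed
  then show ?thesis unfolding 1 AA_dual[OF v] by simp
qed

lemma sch_row: "n \<ge> 1 \<Longrightarrow> sch [n] = hh n"
proof -
  have "{p. p permutes {..<Suc 0}} = {id}" by (simp add: lessThan_Suc permutes_sing)
  then show ?thesis by (simp add: sch_def sN_def dt_def sign_id hi_def nth0_def)
qed

lemma conj_row: "n \<ge> 1 \<Longrightarrow> conj [n] = replicate n 1"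
  by (auto simp: conj_def map_replicate_const intro!: nth_equalityI)

lemma sch_column: "n \<ge> 1 \<Longrightarrow> sch (replicate n 1) = Om (hh n :: 'a::field_char_0 sym)"
  using Om_sch[of "[n]", where 'a='a] by (simp add: sch_row conj_row partition_def)

text \<open>At u = 1/q the plethystic factor (1-1/q)/(1-q) is -1/q, and h_n[-X/q] is e_n up to the
  scalar (-1/q)^n.\<close>

lemma e_expansion:
  "Om (hh n) = (\<Sum>mu\<in>partitions n. Co ((- 1) ^ n * HLq.CC mu * poch qG (length mu)) * HL qG mu)"
proof -
  let ?x = qG
  have x: "?x \<noteq> 0" by (rule qG_nonzero)
  have "Co ((- ?x) ^ n) * AA ?x n (1 / ?x) = diag (\<lambda>k. (- ?x) ^ k) (AA ?x n (1 / ?x))"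
    by (rule diag_power[OF homog_AA, symmetric])
  also have "\<dots> = Om (hh n)"
    unfolding AA_def diag_diag
  proof (rule diag_cong_homog[OF homog_hh])
    fix k :: nat assume k: "k \<ge> 1"
    have a: "(- ?x) ^ k = (- 1) ^ k * ?x ^ k" by (subst power_mult_distrib[symmetric]) simp
    have b: "?x ^ k * ((1 - (1 / ?x) ^ k) / (1 - ?x ^ k)) = - 1"
      using x qG_power[OF k] by (simp add: power_divide field_simps)
    show "(- ?x) ^ k * ((1 - (1 / ?x) ^ k) / (1 - ?x ^ k)) = om k" unfolding a mult.assoc b by simp
  qed
  finally have "Om (hh n) = Co ((- ?x) ^ n) * AA ?x n (1 / ?x)" ..
  also have "\<dots> = (\<Sum>mu\<in>partitions n. Co ((- 1) ^ n * HLq.CC mu * poch ?x (length mu)) * HL ?x mu)"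
    unfolding HLq.AA_expansion sum_distrib_left
  proof (rule sum.cong[OF refl])
    fix mu assume "mu \<in> partitions n"
    then have l: "length mu \<le> n" using partition_length_le[of mu] by (auto simp: partitions_iff)
    have "?x ^ n * psi ?x n (length mu) (1 / ?x) = poch ?x (length mu)"
      unfolding psi_inverse[OF x l] poch_def by (simp add: mult.commute)
    moreover have "(- ?x) ^ n = (- 1) ^ n * ?x ^ n" by (subst power_mult_distrib[symmetric]) simp
    ultimately have "(- ?x) ^ n * (HLq.CC mu * psi ?x n (length mu) (1 / ?x)) = (- 1) ^ n * HLq.CC mu * poch ?x (length mu)"
      by (simp add: mult_ac)
    then show "Co ((- ?x) ^ n) * (Co (HLq.CC mu * psi ?x n (length mu) (1 / ?x)) * HL ?x mu)
      = Co ((- 1) ^ n * HLq.CC mu * poch ?x (length mu)) * HL ?x mu"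
      by (simp only: Co_mult[symmetric] mult.assoc[symmetric])
  qed
  finally show ?thesis .
qed

section \<open>Identification of Q'_mu and of the modified Macdonald polynomials\<close>

lemma dom_le_partitions: "partition mu \<Longrightarrow> l \<in> partitions (sum_list mu) \<Longrightarrow> dom_le (conj l) mu \<longleftrightarrow> dom_le (conj mu) l"
proof -
  assume mu: "partition mu" and "l \<in> partitions (sum_list mu)"
  then have l: "partition l" by (simp add: partitions_iff)
  show ?thesis
  proof
    assume "dom_le (conj l) mu"
    from dom_le_conj[OF partition_conj[OF l] mu this] show "dom_le (conj mu) l" unfolding conj_conj[OF l] .
  next
    assume "dom_le (conj mu) l"
    from dom_le_conj[OF partition_conj[OF mu] l this] show "dom_le (conj l) mu" unfolding conj_conj[OF mu] .
  qed
qed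

text \<open>The condition that Q'_mu[X(1-q)] lies below mu becomes, by \<open>pi1_inverse\<close>,
  the condition that Q'_mu[X(1-1/q)] lies above \<open>conj mu\<close>. So Q'_mu is the
  Hall-Littlewood function at parameter 1/q.\<close>

lemma Qp_conditions:
  assumes mu: "partition mu"
  shows "(supp_on (sum_list mu) h \<and> (\<forall>lam. h lam \<noteq> 0 \<longrightarrow> dom_le mu lam) \<and> h mu = 1 \<and>
      (\<forall>lam. pleth (sum_list mu) qG h lam \<noteq> 0 \<longrightarrow> dom_le lam mu))
    \<longleftrightarrow> supp_on (sum_list mu) h \<and> HLprop (1 / qG) mu (mk (sum_list mu) h)"
proof (cases "supp_on (sum_list mu) h")
  case s: True
  let ?n = "sum_list mu" and ?F = "mk (sum_list mu) h"
  have m: "mu \<in> partitions ?n" using mu by (simp add: partitions_iff)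
  have 1: "(\<forall>lam. h lam \<noteq> 0 \<longrightarrow> dom_le mu lam) \<longleftrightarrow> above mu ?F"
    unfolding above_def using s by (auto simp: ip_mk_sch supp_on_def)
  have 2: "h mu = ip ?F (sch mu)" by (rule ip_mk_sch[OF m, symmetric])
  have "(\<forall>lam. pleth ?n qG h lam \<noteq> 0 \<longrightarrow> dom_le lam mu) \<longleftrightarrow> (\<forall>l\<in>partitions ?n. ip (pi1 qG ?F) (sch l) \<noteq> 0 \<longrightarrow> dom_le l mu)"
    unfolding pleth_eq by (auto simp: sc_def)
  also have "\<dots> \<longleftrightarrow> (\<forall>l\<in>partitions ?n. ip (pi1 qG ?F) (sch (conj l)) \<noteq> 0 \<longrightarrow> dom_le (conj l) mu)"
    (is "(\<forall>l\<in>_. ?P l) \<longleftrightarrow> (\<forall>l\<in>_. ?P (conj l))")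
  proof (intro iffI ballI)
    fix l assume "\<forall>l\<in>partitions ?n. ?P l" "l \<in> partitions ?n"
    then show "?P (conj l)" using conj_partitions by blast
  next
    fix l assume a: "\<forall>l\<in>partitions ?n. ?P (conj l)" and l: "l \<in> partitions ?n"
    have "?P (conj (conj l))" using a conj_partitions[OF l] by (rule bspec)
    then show "?P l" using conj_conj[of l] l by (simp only: partitions_iff)
  qed
  also have "\<dots> \<longleftrightarrow> above (conj mu) (pi1 (1 / qG) ?F)"
    unfolding above_def sum_list_conj[OF mu]
    by (intro ball_cong refl)
       (simp add: ip_pi1_inverse_sch[OF homog_mk qG_nonzero] partitions_iff qG_nonzero dom_le_partitions[OF mu])
  finally show ?thesis using 1 2 s homog_mk[of ?n h] by (auto simp: HLprop_def)
qed simp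

lemma Qp_HL:
  assumes mu: "partition mu" shows "Qp mu = sc (sum_list mu) (HL (1 / qG) mu)"
  unfolding Qp_def Qp_conditions[OF mu]
proof (rule the_equality)
  have H: "HLprop (1 / qG) mu (HL (1 / qG) mu)" by (rule HLp.R_HL[OF mu])
  then show "supp_on (sum_list mu) (sc (sum_list mu) (HL (1 / qG) mu)) \<and>
      HLprop (1 / qG) mu (mk (sum_list mu) (sc (sum_list mu) (HL (1 / qG) mu)))"
    by (simp add: supp_on_sc mk_sc HLprop_def)
  fix h assume h: "supp_on (sum_list mu) h \<and> HLprop (1 / qG) mu (mk (sum_list mu) h)"
  then have "mk (sum_list mu) h = HL (1 / qG) mu"
    using HLprop_unique[OF mu HLp.q_nonzero HLp.q_aniso _ H] by blast
  then show "h = sc (sum_list mu) (HL (1 / qG) mu)" using sc_mk[of "sum_list mu" h] h by simp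
qed

text \<open>The Macdonald polynomial scaled so that H[X(1-t)] has coefficient 1 at s_mu; this
  scaling specializes well at t = 0. The one in the statement differs by the factor
  \<open>hrow mu\<close>.\<close>

definition HM :: "nat list \<Rightarrow> qt sym" where
  "HM mu = (SOME H. homog (sum_list mu) H \<and> pi1 tF H = JJ qF tF mu \<and> above mu (pi1 tF H) \<and> above (conj mu) (pi1 qF H) \<and>
     sprS H (HL qG mu))"

lemma parameter_qF: "parameter qG qF" by (simp add: parameter_def)

lemma HM_props:
  assumes mu: "partition mu"
  shows "homog (sum_list mu) (HM mu)" "pi1 tF (HM mu) = JJ qF tF mu" "above mu (pi1 tF (HM mu))"
    "above (conj mu) (pi1 qF (HM mu))" "sprS (HM mu) (HL qG mu)"
proof -
  have "\<exists>H. homog (sum_list mu) H \<and> pi1 tF H = JJ qF tF mu \<and> above mu (pi1 tF H) \<and> above (conj mu) (pi1 qF H) \<and>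
     sprS H (HL qG mu)"
    using macdonald_specialize[OF parameter_props(6)[OF parameter_qF] tF_power mu parameter_props(1,2,4)[OF parameter_qF] spr_tF]
    by blast
  from someI_ex[OF this, folded HM_def]
  show "homog (sum_list mu) (HM mu)" "pi1 tF (HM mu) = JJ qF tF mu" "above mu (pi1 tF (HM mu))"
    "above (conj mu) (pi1 qF (HM mu))" "sprS (HM mu) (HL qG mu)" by blast+
qed

lemma qF_inverse_power: "k \<ge> 1 \<Longrightarrow> (1 / qF) ^ k \<noteq> 1"
proof
  assume k: "k \<ge> 1" and "(1 / qF) ^ k = 1"
  then have "qF ^ k = 1" using qF_tF_nonzero by (simp add: power_divide)
  then have "qG ^ k = 1" using spr_power[OF spr_qF, of k] spr_unique[OF spr_1] by metis
  then show False using qG_power[OF k] by simp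
qed

interpretation HM: mac_basis qF tF HM
proof
  show "qF \<noteq> 0" by (rule qF_tF_nonzero)
  show "anisotropic (1 / qF) tF" by (rule parameter_props(5)[OF parameter_qF])
  show "(1 / qF) ^ k \<noteq> 1" if "k \<ge> 1" for k using that by (rule qF_inverse_power)
  show "ip (pi1 tF (HM mu)) (sch mu) = 1" if "partition mu" for mu
    unfolding HM_props(2)[OF that] by (rule JJ_props(3)[OF ev_inj_qF that])
qed (rule HM_props; assumption)+

definition hrow :: "nat list \<Rightarrow> qt" where "hrow mu = ip (HM mu) (hh (sum_list mu))"

text \<open>Its value at t = 0 is nonzero by \<open>HLq.ip_R_row_nonzero\<close>.\<close>

lemma hrow_nonzero: "partition mu \<Longrightarrow> hrow mu \<noteq> 0"
  using spr_ip[OF HM_props(5) sprS_hh, of mu "sum_list mu"] HLq.ip_R_row_nonzero[of mu] spr_unique[OF spr_0]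
  unfolding hrow_def by metis

text \<open>Any candidate minus the multiple of \<open>HM mu\<close> with the same leading
  coefficient vanishes by \<open>macdonald_unique\<close>; the coefficient of s_(n) then fixes the
  multiple.\<close>

lemma Ht_HM:
  assumes mu: "partition mu" and n: "sum_list mu \<ge> 1"
  shows "Ht mu = sc (sum_list mu) (Co (1 / hrow mu) * HM mu)" (is "_ = sc ?n ?F")
  unfolding Ht_def
proof (rule the_equality)
  note H = HM_props[OF mu]
  have "[m] \<in> partitions m" if "m \<ge> 1" for m using that by (simp add: partitions_iff partition_def)
  note nm = this[OF n]
  have F: "homog ?n ?F" by (intro homog_Co H)
  have P: "pi1 u ?F = Co (1 / hrow mu) * pi1 u (HM mu)" for u by (simp add: diag_mult)
  show "supp_on ?n (sc ?n ?F) \<and>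
      (\<forall>lam. pleth ?n qF (sc ?n ?F) lam \<noteq> 0 \<longrightarrow> dom_le (conj mu) lam) \<and>
      (\<forall>lam. pleth ?n tF (sc ?n ?F) lam \<noteq> 0 \<longrightarrow> dom_le mu lam) \<and> sc ?n ?F [?n] = 1"
    unfolding pleth_eq mk_sc[OF F] P
    using H(3,4) hrow_nonzero[OF mu] nm n sum_list_conj[OF mu]
    by (auto simp: supp_on_sc sc_def ip_Co_left above_def sch_row hrow_def)
  fix h assume h: "supp_on ?n h \<and>
      (\<forall>lam. pleth ?n qF h lam \<noteq> 0 \<longrightarrow> dom_le (conj mu) lam) \<and>
      (\<forall>lam. pleth ?n tF h lam \<noteq> 0 \<longrightarrow> dom_le mu lam) \<and> h [?n] = 1"
  define G where "G = mk ?n h"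
  have G: "homog ?n G" "sc ?n G = h" using h by (simp_all add: G_def homog_mk sc_mk)
  have "sc ?n (pi1 u G) l \<noteq> 0" if "l \<in> partitions ?n" "ip (pi1 u G) (sch l) \<noteq> 0" for u l
    using that by (simp add: sc_def)
  then have ab: "above mu (pi1 tF G)" "above (conj mu) (pi1 qF G)"
    using h unfolding above_def sum_list_conj[OF mu] pleth_eq G_def[symmetric] by blast+
  have row: "ip G (hh ?n) = 1" using h fun_cong[OF G(2), of "[?n]"] nm n by (simp add: sc_def sch_row)
  define a where "a = ip (pi1 tF G) (sch mu)"
  have aC: "above l (F - Co c * F')" if "above l F" "above l F'" for l c and F F' :: "qt sym"
    using that unfolding above_def ip_diff_left ip_Co_left by fastforce
  have P': "pi1 u (G - Co a * HM mu) = pi1 u G - Co a * pi1 u (HM mu)" for u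
    by (simp add: rhom_diff[OF rhom_diag] diag_mult)
  have "G - Co a * HM mu = 0"
  proof (rule macdonald_unique[OF mu HM.q0 HM.aniso])
    show "homog ?n (G - Co a * HM mu)" by (intro homog_diff homog_Co G H)
    show "above mu (pi1 tF (G - Co a * HM mu))" "above (conj mu) (pi1 qF (G - Co a * HM mu))"
      unfolding P' by (intro aC ab H)+
    show "ip (pi1 tF (G - Co a * HM mu)) (sch mu) = 0"
      unfolding P' ip_diff_left ip_Co_left HM.R_monic[OF mu] by (simp add: a_def)
  qed
  then have Ga: "G = Co a * HM mu" by simp
  then have "a * hrow mu = 1" using row by (simp add: ip_Co_left hrow_def)
  then have "a = 1 / hrow mu" using hrow_nonzero[OF mu] by (simp add: nonzero_eq_divide_eq)
  then show "h = sc ?n ?F" using G(2) Ga by simp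
qed

lemma sc_sum: "sc n (sum f A) l = (\<Sum>a\<in>A. sc n (f a) l)" and sc_Co: "sc n (Co c * F) l = c * sc n F l"
  by (simp_all add: sc_def ip_sum_left ip_Co_left)

definition ecoeff :: "nat list \<Rightarrow> qt" where
  "ecoeff mu = HM.fm (Om (hh (sum_list mu))) (HM mu) / HM.fm (HM mu) (HM mu)"

text \<open>An eigenvector may be rescaled without changing its eigenvalue, so the factors
  \<open>hrow mu\<close> cancel between coefficient and basis vector.\<close>

lemma delta'_HM:
  assumes n: "n \<ge> 1"
  shows "delta' nu n (e_sf n) = sc n (\<Sum>mu\<in>partitions n. Co (ecoeff mu * schur_eval nu (wts mu)) * HM mu)"
proof -
  have pn: "partition mu" "sum_list mu = n" if "mu \<in> partitions n" for mu using that by (auto simp: partitions_iff)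
  have Ht: "Ht mu l = 1 / hrow mu * sc n (HM mu) l" if "mu \<in> partitions n" for mu l
    using Ht_HM[of mu] pn[OF that] n by (simp add: sc_Co)
  have col: "replicate n 1 \<in> partitions n" by (simp add: partitions_iff partition_def sum_list_replicate sorted_wrt_iff_nth_less)
  have e: "e_sf n = sc n (Om (hh n :: qt sym))"
  proof
    fix l show "e_sf n l = sc n (Om (hh n :: qt sym)) l"
    proof (cases "l \<in> partitions n")
      case True
      have "sc n (Om (hh n :: qt sym)) l = ip (sch (replicate n 1)) (sch l)"
        unfolding sch_column[OF n] sc_def using True by (rule if_P)
      then show ?thesis
        unfolding ip_sch_sch[OF pn(1)[OF col] pn(1)[OF True]] by (simp add: e_sf_def eq_commute[of l])
    next
      case False
      then show ?thesis using col by (auto simp: sc_def e_sf_def)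
    qed
  qed
  have hom: "homog n (Om (hh n :: qt sym))" by (intro homog_diag homog_hh)
  have hs: "homog n (\<Sum>mu\<in>partitions n. Co (d mu) * HM mu)" for d
  proof (intro homog_sum homog_Co)
    fix mu assume mu: "mu \<in> partitions n"
    show "homog n (HM mu)" using HM_props(1)[OF pn(1)[OF mu]] unfolding pn(2)[OF mu] .
  qed
  have "Om (hh n) = (\<Sum>mu\<in>partitions n. Co (HM.fm (Om (hh n)) (HM mu) / HM.fm (HM mu) (HM mu)) * HM mu)"
    by (rule HM.R_expand[OF hom])
  also have "\<dots> = (\<Sum>mu\<in>partitions n. Co (ecoeff mu) * HM mu)"
    by (rule sum.cong) (simp_all add: ecoeff_def pn)
  finally have ex: "Om (hh n) = (\<Sum>mu\<in>partitions n. Co (ecoeff mu) * HM mu)" .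
  have S: "(\<Sum>mu\<in>partitions n. c mu * Ht mu l) = sc n (\<Sum>mu\<in>partitions n. Co (c mu / hrow mu) * HM mu) l" for c l
    unfolding sc_sum sc_Co by (rule sum.cong) (simp_all add: Ht)
  define c where "c mu = (if mu \<in> partitions n then ecoeff mu * hrow mu else 0)" for mu
  have cd: "c mu / hrow mu = ecoeff mu" if "mu \<in> partitions n" for mu
    using that hrow_nonzero pn by (simp add: c_def)
  have "(THE c. supp_on n c \<and> e_sf n = (\<lambda>lam. \<Sum>mu \<in> partitions n. c mu * Ht mu lam)) = c"
  proof (rule the_equality)
    have "(\<Sum>mu\<in>partitions n. Co (c mu / hrow mu) * HM mu) = Om (hh n)" unfolding ex by (rule sum.cong) (simp_all add: cd)
    then show "supp_on n c \<and> e_sf n = (\<lambda>lam. \<Sum>mu \<in> partitions n. c mu * Ht mu lam)"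
      unfolding S e by (simp add: supp_on_def c_def)
  next
    fix c' assume c': "supp_on n c' \<and> e_sf n = (\<lambda>lam. \<Sum>mu \<in> partitions n. c' mu * Ht mu lam)"
    have "sc n (Om (hh n)) = sc n (\<Sum>mu\<in>partitions n. Co (c' mu / hrow mu) * HM mu)"
      using conjunct2[OF c'] unfolding S e .
    then have "Om (hh n) = (\<Sum>mu\<in>partitions n. Co (c' mu / hrow mu) * HM mu)" by (rule sc_inj[OF hom hs])
    then have eq: "(\<Sum>mu\<in>partitions n. Co (c' mu / hrow mu) * HM mu) = (\<Sum>mu\<in>partitions n. Co (ecoeff mu) * HM mu)"
      unfolding ex[symmetric] by (rule sym)
    show "c' = c"
    proof
      fix mu show "c' mu = c mu"
      proof (cases "mu \<in> partitions n")
        case True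
        from HM.R_coeff_unique[OF eq True] show ?thesis
          using True hrow_nonzero[OF pn(1)[OF True]] by (simp add: c_def nonzero_divide_eq_eq)
      qed (use c' in \<open>auto simp: supp_on_def c_def\<close>)
    qed
  qed
  then have "delta' nu n (e_sf n) = (\<lambda>l. \<Sum>mu\<in>partitions n. (c mu * schur_eval nu (wts mu)) * Ht mu l)"
    unfolding delta'_def by simp
  also have "\<dots> = sc n (\<Sum>mu\<in>partitions n. Co (c mu * schur_eval nu (wts mu) / hrow mu) * HM mu)"
    unfolding S ..
  also have "(\<Sum>mu\<in>partitions n. Co (c mu * schur_eval nu (wts mu) / hrow mu) * HM mu)
    = (\<Sum>mu\<in>partitions n. Co (ecoeff mu * schur_eval nu (wts mu)) * HM mu)"
  proof (rule sum.cong[OF refl])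
    fix mu assume "mu \<in> partitions n"
    from cd[OF this] have "c mu * schur_eval nu (wts mu) / hrow mu = ecoeff mu * schur_eval nu (wts mu)"
      by (metis times_divide_eq_left)
    then show "Co (c mu * schur_eval nu (wts mu) / hrow mu) * HM mu = Co (ecoeff mu * schur_eval nu (wts mu)) * HM mu"
      by (rule arg_cong)
  qed
  finally show ?thesis .
qed

section \<open>Coefficients and eigenvalues at t = 0\<close>

text \<open>The coefficient of e_n is a quotient of values of the form, and each value has a limit.
  The limiting norm is nonzero by anisotropy, so the quotient tends to the coefficient in
  \<open>e_expansion\<close>.\<close>

lemma spr_ecoeff:
  assumes mu: "partition mu"
  shows "spr (ecoeff mu) ((- 1) ^ sum_list mu * HLq.CC mu * poch qG (length mu))"
proof -
  let ?n = "sum_list mu"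
  have i: "spr (1 / qF) (1 / qG)" by (rule spr_divide[OF spr_1 spr_qF qG_nonzero])
  have f: "spr (HM.fm F G) (HLq.fm F' G')" if "sprS F F'" "sprS G G'" for F F' G G'
    unfolding HM.fm_def HLq.fm_def by (intro spr_ip sprS_pi1 that spr_tF i)
  have o: "sprS (Om (hh ?n)) (Om (hh ?n))"
    by (intro sprS_diag sprS_hh) (use spr_of_int[of "om _"] in simp)
  note H = HM_props(5)[OF mu]
  have hom: "homog ?n (Om (hh ?n :: qq sym))" by (intro homog_diag homog_hh)
  have m: "mu \<in> partitions ?n" using mu by (simp add: partitions_iff)
  have "HLq.fm (Om (hh ?n)) (HL qG mu) = ((- 1) ^ ?n * HLq.CC mu * poch qG (length mu)) * HLq.fm (HL qG mu) (HL qG mu)"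
    unfolding e_expansion by (rule HLq.fm_sum_R[OF m])
  then have e: "HLq.fm (Om (hh ?n)) (HL qG mu) / HLq.fm (HL qG mu) (HL qG mu) = (- 1) ^ ?n * HLq.CC mu * poch qG (length mu)"
    using HLq.fm_self[OF mu] by simp
  show ?thesis unfolding ecoeff_def e[symmetric] by (intro spr_divide f o H HLq.fm_self mu)
qed

lemma spr_evl: "(\<And>k. spr (z k) (w k)) \<Longrightarrow> sprS F G \<Longrightarrow> homog n F \<Longrightarrow> homog n G \<Longrightarrow> spr (evl z F) (evl w G)"
  unfolding ip_hh_diag[symmetric] by (intro spr_ip sprS_diag sprS_hh)

lemma spr_psv: "list_all2 spr zs ws \<Longrightarrow> spr (psv zs k) (psv ws k)"
proof -
  assume "list_all2 spr zs ws"
  then have "spr (\<Sum>z\<leftarrow>zs. z ^ k) (\<Sum>z\<leftarrow>ws. z ^ k)"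
    by (induction rule: list_all2_induct) (auto intro: spr_add spr_power)
  then show ?thesis by (simp add: psv_def)
qed

text \<open>At t = 0 only first-column cells keep a nonzero weight; without the corner these are q,
  ..., q^(l-1), whose power sums are q^k (1 - q^(k(l-1)))/(1 - q^k). Evaluation of s_nu there is a
  pairing with \<open>AA\<close>.\<close>

lemma spr_schur_wts:
  assumes mu: "partition mu" "mu \<noteq> []" and nu: "partition nu"
  shows "spr (schur_eval nu (wts mu)) (qG ^ sum_list nu * ip (AA qG (sum_list nu) (qG ^ (length mu - 1))) (sch nu))"
proof -
  let ?l = "length mu" and ?x = qG
  \<comment> \<open>The weights with t replaced by 0: here 0^0 = 1 keeps column 0, and row 0, which
    starts at column 1, contributes only zeros.\<close>
  define ws where "ws = concat (map (\<lambda>i. map (\<lambda>j. ?x ^ i * 0 ^ j) (if i = 0 then [1..<mu ! i] else [0..<mu ! i])) [0..<?l])"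
  have c: "list_all2 spr (concat (map f is)) (concat (map g is))" if "\<And>i. i \<in> set is \<Longrightarrow> list_all2 spr (f i) (g i)"
    for f g and "is" :: "nat list"
    using that by (induction "is") (auto intro: list_all2_appendI)
  have "list_all2 spr (wts mu) ws"
    unfolding wts_def ws_def
    by (rule c) (auto simp: list_all2_map1 list_all2_map2 intro!: list.rel_refl_strong spr_mult spr_power spr_qF spr_tF)
  note spr_psv[OF this]
  then have 1: "spr (schur_eval nu (wts mu)) (evl (psv ws) (sch nu))"
    unfolding schur_eval_sch[OF nu] by (rule spr_evl[OF _ sprS_sch homog_sch homog_sch])
  have p: "psv ws k = ?x ^ k * ((1 - (?x ^ (?l - 1)) ^ k) / (1 - ?x ^ k))" if k: "k \<ge> 1" for k
  proof -
    have in0: "(\<Sum>j\<leftarrow>[0..<a]. (c * 0 ^ j) ^ k) = (if a = 0 then 0 else c ^ k)" for a and c :: qq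
    proof (induction a)
      case (Suc a) then show ?case using k by (cases a) (auto simp: power_mult_distrib power_0_left)
    qed simp
    have in1: "(\<Sum>j\<leftarrow>[1..<a]. (c * 0 ^ j) ^ k) = 0" for a and c :: qq
    proof -
      have "map (\<lambda>j. (c * 0 ^ j) ^ k) [1..<a] = map (\<lambda>_. 0) [1..<a]"
        by (rule map_cong[OF refl]) (use k in \<open>auto simp: power_0_left\<close>)
      then show ?thesis by (simp only: sum_list_0)
    qed
    have cc: "(\<Sum>z\<leftarrow>concat (map f is). z ^ k) = (\<Sum>i\<leftarrow>is. \<Sum>z\<leftarrow>f i. z ^ k)" for f :: "nat \<Rightarrow> qq list" and "is"
      by (induction "is") auto
    have "psv ws k = (\<Sum>z\<leftarrow>ws. z ^ k)" using k by (simp add: psv_def)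
    also have "\<dots> = (\<Sum>i\<leftarrow>[0..<?l]. if i = 0 then 0 else (?x ^ i) ^ k)"
      unfolding ws_def cc
    proof (rule arg_cong[of _ _ sum_list], rule map_cong[OF refl])
      fix i assume "i \<in> set [0..<?l]"
      then have "mu ! i \<in> set mu" by simp
      then have m: "mu ! i \<noteq> 0" using mu(1) unfolding partition_def by metis
      show "(\<Sum>z\<leftarrow>map (\<lambda>j. ?x ^ i * 0 ^ j) (if i = 0 then [1..<mu ! i] else [0..<mu ! i]). z ^ k) = (if i = 0 then 0 else (?x ^ i) ^ k)"
      proof (cases "i = 0")
        case True
        then show ?thesis using in1[of 1 "mu ! 0"] by (simp add: o_def)
      next
        case False
        then show ?thesis using in0[of "?x ^ i" "mu ! i"] m by (simp add: o_def)
      qed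
    qed
    also have "\<dots> = (\<Sum>i<?l. if i = 0 then 0 else (?x ^ i) ^ k)"
      by (simp add: interv_sum_list_conv_sum_set_nat atLeast0LessThan)
    also have "\<dots> = (\<Sum>i<?l - 1. (?x ^ Suc i) ^ k)"
    proof -
      obtain m where m: "?l = Suc m" using mu(2) by (cases ?l) auto
      show ?thesis unfolding m sum.lessThan_Suc_shift by simp
    qed
    also have "\<dots> = ?x ^ k * (\<Sum>i<?l - 1. (?x ^ k) ^ i)"
      unfolding sum_distrib_left
    proof (rule sum.cong[OF refl])
      fix i show "(?x ^ Suc i) ^ k = ?x ^ k * (?x ^ k) ^ i"
        unfolding power_mult[symmetric] power_add[symmetric] by (rule arg_cong[of _ _ "\<lambda>m. ?x ^ m"]) simp
    qed
    also have "(\<Sum>i<?l - 1. (?x ^ k) ^ i) = (1 - (?x ^ (?l - 1)) ^ k) / (1 - ?x ^ k)"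
    proof -
      have a: "(?x ^ (?l - 1)) ^ k = (?x ^ k) ^ (?l - 1)" by (simp only: power_mult[symmetric] mult.commute)
      have b: "1 - ?x ^ k \<noteq> 0" using qG_power[OF k] by simp
      show ?thesis unfolding a one_diff_power_eq[of "?x ^ k" "?l - 1"] by (rule nonzero_mult_div_cancel_left[OF b, symmetric])
    qed
    finally show ?thesis .
  qed
  have hs: "homog (sum_list nu) (sch nu :: qq sym)" using homog_sch nu by auto
  have "evl (psv ws) (sch nu) = evl (\<lambda>k. ?x ^ k * ((1 - (?x ^ (?l - 1)) ^ k) / (1 - ?x ^ k))) (sch nu)"
    by (rule evl_cong_homog[OF hs p])
  also have "\<dots> = ?x ^ sum_list nu * ip (AA ?x (sum_list nu) (?x ^ (?l - 1))) (sch nu)"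
    unfolding evl_scale[OF hs] ip_AA[OF hs] ..
  finally show ?thesis using 1 by simp
qed

section \<open>Grouping by length and comparison of the two sides\<close>

lemma sum_group_length:
  fixes g :: "nat list \<Rightarrow> 'a::comm_ring_1"
  shows "(\<Sum>mu\<in>partitions n. f (length mu) * g mu) = (\<Sum>l\<le>n. f l * (\<Sum>mu\<in>{mu \<in> partitions n. length mu = l}. g mu))"
proof -
  have "(\<Sum>mu\<in>partitions n. f (length mu) * g mu)
    = (\<Sum>l\<in>{..n}. \<Sum>mu\<in>{mu. mu \<in> partitions n \<and> length mu = l}. f (length mu) * g mu)"
    by (rule sum.group[symmetric]) (use partition_length_le in \<open>fastforce simp: finite_partitions partitions_iff\<close>)+
  also have "\<dots> = (\<Sum>l\<le>n. f l * (\<Sum>mu\<in>{mu \<in> partitions n. length mu = l}. g mu))"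
    unfolding sum_distrib_left by (intro sum.cong refl) auto
  finally show ?thesis .
qed

lemma bstat_bbar: "partition mu \<Longrightarrow> bbar mu + (length mu choose 2) = bstat mu"
proof -
  assume mu: "partition mu"
  have "i * (mu ! i - 1) + i = i * mu ! i" if "i < length mu" for i
  proof -
    have "mu ! i \<noteq> 0" using mu nth_mem[OF that] unfolding partition_def by metis
    then show ?thesis by (cases "mu ! i") auto
  qed
  then show ?thesis unfolding bbar_def bstat_def sum_lessThan_choose[symmetric] sum.distrib[symmetric]
    by (intro sum.cong) auto
qed

text \<open>The part of length k in the expansion at 1/q, read off at s_lam. It serves both for the
  inner sum over mu and, with |nu| and nu, for P_{nu,j}; \<open>omega_sum\<close> is its counterpart
  for omega of the functions at q.\<close>

definition dual_sum :: "nat \<Rightarrow> nat \<Rightarrow> nat list \<Rightarrow> qq" where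
  "dual_sum n k lam = (\<Sum>mu\<in>{mu \<in> partitions n. length mu = k}. aa mu * ip (HL (1 / qG) mu) (sch lam))"

definition omega_sum :: "nat \<Rightarrow> nat \<Rightarrow> nat list \<Rightarrow> qq" where
  "omega_sum n l lam = (\<Sum>mu\<in>{mu \<in> partitions n. length mu = l}. HLq.CC mu * ip (Om (HL qG mu)) (sch lam))"

lemma Qp_sc: "mu \<in> partitions n \<Longrightarrow> Qp mu = sc n (HL (1 / qG) mu)"
  using Qp_HL[of mu] by (auto simp: partitions_iff)

lemma multinom_aa: "length mu = k \<Longrightarrow> qG ^ bstat mu * qmultinom k mu = poch qG k * aa mu"
  using qG_power[of 1] by (simp add: qmultinom_def mfact_def[symmetric] aa_def poch_qfact)

lemma multinom_sum:
  assumes lam: "lam \<in> partitions n"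
  shows "(\<Sum>mu\<in>{mu \<in> partitions n. length mu = k}. qG ^ bstat mu * qmultinom k mu * Qp mu lam) = poch qG k * dual_sum n k lam"
  unfolding dual_sum_def sum_distrib_left
proof (rule sum.cong[OF refl])
  fix mu assume "mu \<in> {mu \<in> partitions n. length mu = k}"
  then show "qG ^ bstat mu * qmultinom k mu * Qp mu lam = poch qG k * (aa mu * ip (HL (1 / qG) mu) (sch lam))"
    using Qp_sc[of mu n] multinom_aa[of mu k] lam by (simp add: sc_def mult.assoc)
qed

lemma Pnu_dual_sum:
  assumes nu: "partition nu"
  shows "Pnu nu j = qG powi (int (sum_list nu) - int ((j + 1) choose 2)) * (poch qG j * dual_sum (sum_list nu) j nu)"
proof -
  have "nu \<in> partitions (sum_list nu)" using nu by (simp add: partitions_iff)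
  from multinom_sum[OF this, of j] show ?thesis unfolding Pnu_def KF_def by simp
qed

lemma bbar_sum:
  assumes lam: "lam \<in> partitions n"
  shows "qG ^ (k choose 2) * (\<Sum>mu\<in>{mu \<in> partitions n. length mu = k}. qG ^ bbar mu * qmultinom k mu * Qp mu lam)
    = poch qG k * dual_sum n k lam"
  unfolding multinom_sum[OF lam, symmetric] sum_distrib_left
proof (rule sum.cong[OF refl])
  fix mu assume "mu \<in> {mu \<in> partitions n. length mu = k}"
  then have "bstat mu = (k choose 2) + bbar mu" using bstat_bbar[of mu] by (simp add: partitions_iff)
  then show "qG ^ (k choose 2) * (qG ^ bbar mu * qmultinom k mu * Qp mu lam) = qG ^ bstat mu * qmultinom k mu * Qp mu lam"
    by (simp add: power_add)
qed

lemma dual_sum_zero: "n < k \<Longrightarrow> dual_sum n k lam = 0"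
  unfolding dual_sum_def by (rule sum.neutral) (use partition_length_le in \<open>fastforce simp: partitions_iff\<close>)

text \<open>Q'_rho involves only s_nu with nu above rho, and such nu have at most
  \<open>length rho\<close> parts. This explains the lower summation limit in the theorem.\<close>

lemma dual_sum_short:
  assumes nu: "partition nu" and j: "j < length nu" shows "dual_sum (sum_list nu) j nu = 0"
  unfolding dual_sum_def
proof (rule sum.neutral, rule ballI)
  fix rho assume r: "rho \<in> {mu \<in> partitions (sum_list nu). length mu = j}"
  then have rp: "partition rho" "sum_list rho = sum_list nu" "length rho = j" by (auto simp: partitions_iff)
  have "\<not> dom_le rho nu" using dom_le_length[OF nu, of rho] rp j by auto
  moreover have "nu \<in> partitions (sum_list rho)" using nu rp by (simp add: partitions_iff)
  ultimately have "ip (HL (1 / qG) rho) (sch nu) = 0"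
    using HLp.R_HL[OF rp(1)] unfolding HLprop_def above_def by blast
  then show "aa rho * ip (HL (1 / qG) rho) (sch nu) = 0" by simp
qed

lemma omega_sum_0: "n \<ge> 1 \<Longrightarrow> omega_sum n 0 lam = 0"
  unfolding omega_sum_def by (rule sum.neutral) (auto simp: partitions_iff)

text \<open>Both expansions in \<open>Om_expansion\<close>, read off at s_lam and grouped by length,
  agree for all nonzero v; \<open>shf_basis_change\<close> then solves for the sums at 1/q.\<close>

lemma dual_sum_omega_sum:
  assumes n: "n \<ge> 1"
  shows "dual_sum n k lam = (- 1) ^ n * (\<Sum>l\<le>n. conn qG l k * omega_sum n l lam)"
proof (cases "k \<le> n")
  case True
  have "(- 1) ^ n * dual_sum n k lam = (\<Sum>l\<le>n. conn qG l k * omega_sum n l lam)"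
  proof (rule shf_basis_change[where X = "\<lambda>l. omega_sum n l lam" and Y = "\<lambda>k. (- 1) ^ n * dual_sum n k lam",
        OF qG_nonzero qG_power omega_sum_0[OF n] _ True])
    fix v :: qq assume v: "v \<noteq> 0"
    have "(\<Sum>l\<le>n. shf qG l v * omega_sum n l lam)
      = (\<Sum>mu\<in>partitions n. shf qG (length mu) v * (HLq.CC mu * ip (Om (HL qG mu)) (sch lam)))"
      unfolding omega_sum_def by (rule sum_group_length[symmetric])
    also have "\<dots> = ip (\<Sum>mu\<in>partitions n. Co (HLq.CC mu * shf qG (length mu) v) * Om (HL qG mu)) (sch lam)"
      unfolding ip_sum_left ip_Co_left by (intro sum.cong refl) (simp only: mult_ac)
    also have "\<dots> = (- 1) ^ n * (\<Sum>mu\<in>partitions n. shf (1 / qG) (length mu) v * (aa mu * ip (HL (1 / qG) mu) (sch lam)))"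
      unfolding Om_expansion[OF v] ip_Co_left ip_sum_left
      by (intro arg_cong[of _ _ "\<lambda>s. (- 1) ^ n * s"] sum.cong refl) (simp only: mult_ac)
    also have "\<dots> = (- 1) ^ n * (\<Sum>k\<le>n. shf (1 / qG) k v * dual_sum n k lam)"
      unfolding dual_sum_def by (subst sum_group_length) (rule refl)
    also have "\<dots> = (\<Sum>k\<le>n. shf (1 / qG) k v * ((- 1) ^ n * dual_sum n k lam))"
      unfolding sum_distrib_left by (intro sum.cong refl) (simp only: mult_ac)
    finally show "(\<Sum>l\<le>n. shf qG l v * omega_sum n l lam) = (\<Sum>k\<le>n. shf (1 / qG) k v * ((- 1) ^ n * dual_sum n k lam))" .
  qed
  moreover have "(- 1) ^ n * ((- 1) ^ n * dual_sum n k lam) = dual_sum n k lam"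
    by (simp flip: mult.assoc power_mult_distrib)
  ultimately show ?thesis by metis
next
  case False
  then have "(\<Sum>l\<le>n. conn qG l k * omega_sum n l lam) = 0" by (intro sum.neutral) (simp add: conn_def)
  then show ?thesis using False dual_sum_zero[of n k lam] by simp
qed

text \<open>The identity that matches the two sides: up to factors (q;q)_m and a power of q, the
  connection coefficient from l to j+1 is the factor (q^(l-1);1/q)_j by which length l enters the
  eigenvalue.\<close>

lemma conn_shf:
  assumes x: "x \<noteq> 0" "\<And>k. k \<ge> 1 \<Longrightarrow> x ^ k \<noteq> 1" and l: "l \<ge> 1"
  shows "poch x j * poch x (Suc j) * conn x l (Suc j) = x ^ (Suc j * j) * (poch x l * shf (1 / x) j (x ^ (l - 1)))"
proof (cases "Suc j \<le> l")
  case True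
  have s: "shf (1 / x) j (x ^ (l - 1)) * poch x (l - 1 - j) = poch x (l - 1)"
    by (rule shf_complement[OF x(1)]) (use True in simp)
  have "poch x m \<noteq> 0" for m using x(2) by (rule poch_nonzero)
  then show ?thesis using True unfolding s[symmetric] conn_def by simp
next
  case False
  then have "shf (1 / x) j (x ^ (l - 1)) = 0" using l by (intro shf_zero x) simp
  then show ?thesis using False by (simp add: conn_def)
qed

text \<open>Everything is taken to t = 0 termwise: the coefficient of e_n, the eigenvalue (expanded
  by \<open>AA_dual\<close> at v = q^(l-1) and paired with s_nu), and the basis vector. Grouping by
  l and exchanging the sums isolates j.\<close>

lemma spec_delta':
  assumes nu: "partition nu" and n: "n \<ge> 1" and lam: "lam \<in> partitions n"
  shows "spec0 (omega (delta' nu n (e_sf n)) lam)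
    = (- 1) ^ n * qG ^ sum_list nu * (\<Sum>j\<le>sum_list nu. dual_sum (sum_list nu) j nu *
        (\<Sum>l\<le>n. poch qG l * shf (1 / qG) j (qG ^ (l - 1)) * omega_sum n l lam))"
proof (rule spec0_eq)
  let ?N = "sum_list nu" and ?x = qG
  let ?S = "\<lambda>l. \<Sum>j\<le>?N. shf (1 / ?x) j (?x ^ (l - 1)) * dual_sum ?N j nu"
  have pn: "partition mu" "sum_list mu = n" "mu \<noteq> []" if "mu \<in> partitions n" for mu
    using that n by (auto simp: partitions_iff)
  have S: "ip (AA ?x ?N (?x ^ (l - 1))) (sch nu) = ?S l" for l
  proof -
    have "?x ^ (l - 1) \<noteq> 0" using qG_nonzero by simp
    note A = AA_dual[OF this]
    have "ip (AA ?x ?N (?x ^ (l - 1))) (sch nu)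
      = (\<Sum>mu\<in>partitions ?N. shf (1 / ?x) (length mu) (?x ^ (l - 1)) * (aa mu * ip (HL (1 / ?x) mu) (sch nu)))"
      unfolding A ip_sum_left ip_Co_left by (intro sum.cong refl) (simp only: mult_ac)
    also have "\<dots> = ?S l" unfolding dual_sum_def by (rule sum_group_length)
    finally show ?thesis .
  qed
  have h: "homog n (\<Sum>mu\<in>partitions n. Co (d mu) * HM mu)" for d
  proof (intro homog_sum homog_Co)
    fix mu assume mu: "mu \<in> partitions n"
    show "homog n (HM mu)" using HM_props(1)[OF pn(1)[OF mu]] unfolding pn(2)[OF mu] .
  qed
  have L: "omega (delta' nu n (e_sf n)) lam
    = (\<Sum>mu\<in>partitions n. ecoeff mu * schur_eval nu (wts mu) * ip (Om (HM mu)) (sch lam))"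
    unfolding delta'_HM[OF n] omega_sc[OF h] using lam
    by (simp add: sc_def rhom_sum[OF rhom_diag] diag_mult ip_sum_left ip_Co_left)
  have "spr (omega (delta' nu n (e_sf n)) lam)
    (\<Sum>mu\<in>partitions n. (- 1) ^ n * HLq.CC mu * poch ?x (length mu) * (?x ^ ?N * ?S (length mu)) * ip (Om (HL ?x mu)) (sch lam))"
    unfolding L
  proof (rule spr_sum)
    fix mu assume mu: "mu \<in> partitions n"
    have o: "sprS (Om (HM mu)) (Om (HL ?x mu))"
      by (intro sprS_diag HM_props(5) pn(1)[OF mu]) (use spr_of_int[of "om _"] in simp)
    show "spr (ecoeff mu * schur_eval nu (wts mu) * ip (Om (HM mu)) (sch lam))
      ((- 1) ^ n * HLq.CC mu * poch ?x (length mu) * (?x ^ ?N * ?S (length mu)) * ip (Om (HL ?x mu)) (sch lam))"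
      using spr_ecoeff[OF pn(1)[OF mu]] spr_schur_wts[OF pn(1)[OF mu] pn(3)[OF mu] nu] unfolding pn(2)[OF mu] S
      by (intro spr_mult spr_ip o sprS_sch)
  qed
  also have "(\<Sum>mu\<in>partitions n. (- 1) ^ n * HLq.CC mu * poch ?x (length mu) * (?x ^ ?N * ?S (length mu)) * ip (Om (HL ?x mu)) (sch lam))
    = (- 1) ^ n * ?x ^ ?N * (\<Sum>mu\<in>partitions n. (poch ?x (length mu) * ?S (length mu)) * (HLq.CC mu * ip (Om (HL ?x mu)) (sch lam)))"
    unfolding sum_distrib_left[of "(- 1) ^ n * ?x ^ ?N"] by (intro sum.cong refl) (simp only: mult_ac)
  also have "(\<Sum>mu\<in>partitions n. (poch ?x (length mu) * ?S (length mu)) * (HLq.CC mu * ip (Om (HL ?x mu)) (sch lam)))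
    = (\<Sum>l\<le>n. (poch ?x l * ?S l) * omega_sum n l lam)"
    unfolding omega_sum_def by (rule sum_group_length)
  also have "\<dots> = (\<Sum>l\<le>n. \<Sum>j\<le>?N. dual_sum ?N j nu * (poch ?x l * shf (1 / ?x) j (?x ^ (l - 1)) * omega_sum n l lam))"
    unfolding sum_distrib_left sum_distrib_right by (intro sum.cong refl) (simp only: mult_ac)
  also have "\<dots> = (\<Sum>j\<le>?N. dual_sum ?N j nu * (\<Sum>l\<le>n. poch ?x l * shf (1 / ?x) j (?x ^ (l - 1)) * omega_sum n l lam))"
    unfolding sum_distrib_left by (rule sum.swap)
  finally show "spr (omega (delta' nu n (e_sf n)) lam)
    ((- 1) ^ n * ?x ^ ?N * (\<Sum>j\<le>?N. dual_sum ?N j nu * (\<Sum>l\<le>n. poch ?x l * shf (1 / ?x) j (?x ^ (l - 1)) * omega_sum n l lam)))" .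
qed

lemma double_choose: "(Suc j choose 2) + (Suc j choose 2) = Suc j * j"
  by (induction j) (auto simp: numeral_2_eq_2)

text \<open>The equality holds for each j on its own: \<open>dual_sum_omega_sum\<close> rewrites the
  inner sum over mu through \<open>omega_sum\<close>, and \<open>conn_shf\<close> turns the
  coefficients into those of \<open>spec_delta'\<close>.\<close>

lemma summand_identity:
  assumes nu: "partition nu" and n: "n \<ge> 1" and lam: "lam \<in> partitions n"
  shows "Pnu nu j * (\<Sum>mu\<in>{mu \<in> partitions n. length mu = Suc j}. qG ^ bbar mu * qmultinom (Suc j) mu * Qp mu lam)
    = (- 1) ^ n * qG ^ sum_list nu * (dual_sum (sum_list nu) j nu *
        (\<Sum>l\<le>n. poch qG l * shf (1 / qG) j (qG ^ (l - 1)) * omega_sum n l lam))"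
proof -
  let ?x = qG and ?c = "Suc j choose 2" and ?N = "sum_list nu"
  let ?I = "\<Sum>mu\<in>{mu \<in> partitions n. length mu = Suc j}. ?x ^ bbar mu * qmultinom (Suc j) mu * Qp mu lam"
  have x: "?x \<noteq> 0" by (rule qG_nonzero)
  have P: "Pnu nu j * ?x ^ ?c = ?x ^ ?N * (poch ?x j * dual_sum ?N j nu)"
    unfolding Pnu_dual_sum[OF nu] power_int_diff[OF disjI1[OF x]] using x by simp
  \<comment> \<open>P_{nu,j} and the passage from b(mu) to its reduced form each cost q^((j+1)
    choose 2). Multiplying by q^(j(j+1)) clears both negative powers at once.\<close>
  have "Pnu nu j * ?I * ?x ^ (Suc j * j) = (Pnu nu j * ?x ^ ?c) * (?x ^ ?c * ?I)"
    unfolding double_choose[symmetric] power_add by (simp only: mult_ac)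
  also have "\<dots> = ?x ^ ?N * dual_sum ?N j nu * (poch ?x j * poch ?x (Suc j) * dual_sum n (Suc j) lam)"
    unfolding P bbar_sum[OF lam] by (simp only: mult_ac)
  also have "poch ?x j * poch ?x (Suc j) * dual_sum n (Suc j) lam
    = (- 1) ^ n * (\<Sum>l\<le>n. (poch ?x j * poch ?x (Suc j) * conn ?x l (Suc j)) * omega_sum n l lam)"
    unfolding dual_sum_omega_sum[OF n, of "Suc j"] sum_distrib_left by (intro sum.cong refl) (simp only: mult_ac)
  also have "(\<Sum>l\<le>n. (poch ?x j * poch ?x (Suc j) * conn ?x l (Suc j)) * omega_sum n l lam)
    = (\<Sum>l\<le>n. (?x ^ (Suc j * j) * (poch ?x l * shf (1 / ?x) j (?x ^ (l - 1)))) * omega_sum n l lam)"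
  proof (rule sum.cong[OF refl])
    fix l
    show "(poch ?x j * poch ?x (Suc j) * conn ?x l (Suc j)) * omega_sum n l lam
      = (?x ^ (Suc j * j) * (poch ?x l * shf (1 / ?x) j (?x ^ (l - 1)))) * omega_sum n l lam"
    proof (cases "l = 0")
      case True
      then show ?thesis using omega_sum_0[OF n] by simp
    next
      case False
      have "l \<ge> 1" using False by simp
      from conn_shf[OF x qG_power this, of j] show ?thesis by (simp only:)
    qed
  qed
  also have "\<dots> = ?x ^ (Suc j * j) * (\<Sum>l\<le>n. poch ?x l * shf (1 / ?x) j (?x ^ (l - 1)) * omega_sum n l lam)"
    unfolding sum_distrib_left by (intro sum.cong refl) (simp only: mult_ac)
  also have "?x ^ ?N * dual_sum ?N j nu * ((- 1) ^ n * (?x ^ (Suc j * j) * (\<Sum>l\<le>n. poch ?x l * shf (1 / ?x) j (?x ^ (l - 1)) * omega_sum n l lam)))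
    = ((- 1) ^ n * ?x ^ ?N * (dual_sum ?N j nu * (\<Sum>l\<le>n. poch ?x l * shf (1 / ?x) j (?x ^ (l - 1)) * omega_sum n l lam))) * ?x ^ (Suc j * j)"
    by (simp only: mult_ac)
  finally show ?thesis by (rule mult_right_cancel[THEN iffD1, rotated]) (use x in simp)
qed

theorem theorem1p2:
  fixes nu :: "nat list" and n :: nat
  assumes "partition nu" and "n \<ge> 1"
  shows "(\<lambda>lam. spec0 (omega (delta' nu n (e_sf n)) lam)) =
    (\<lambda>lam. \<Sum>k \<in> {length nu + 1 .. sum_list nu + 1}.
        Pnu nu (k - 1) *
        (\<Sum>mu \<in> {mu \<in> partitions n. length mu = k}.
            qG ^ bbar mu * qmultinom k mu * Qp mu lam))"
proof
  fix lam
  let ?I = "\<lambda>k. \<Sum>mu \<in> {mu \<in> partitions n. length mu = k}. qG ^ bbar mu * qmultinom k mu * Qp mu lam"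
  show "spec0 (omega (delta' nu n (e_sf n)) lam) = (\<Sum>k \<in> {length nu + 1 .. sum_list nu + 1}. Pnu nu (k - 1) * ?I k)"
  proof (cases "lam \<in> partitions n")
    case True
    have "(\<Sum>k \<in> {length nu + 1 .. sum_list nu + 1}. Pnu nu (k - 1) * ?I k) = (\<Sum>j \<in> {length nu .. sum_list nu}. Pnu nu j * ?I (Suc j))"
      by (rule sum.reindex_bij_witness[of _ Suc "\<lambda>k. k - 1"]) auto
    \<comment> \<open>The range may be extended down to j = 0, since P_{nu,j} vanishes for j below
      the length of nu.\<close>
    also have "\<dots> = (\<Sum>j\<le>sum_list nu. Pnu nu j * ?I (Suc j))"
    proof (rule sum.mono_neutral_left)
      show "\<forall>j\<in>{..sum_list nu} - {length nu..sum_list nu}. Pnu nu j * ?I (Suc j) = 0"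
        using dual_sum_short[OF assms(1)] by (auto simp: Pnu_dual_sum[OF assms(1)])
    qed auto
    also have "\<dots> = spec0 (omega (delta' nu n (e_sf n)) lam)"
      unfolding summand_identity[OF assms True] spec_delta'[OF assms True] by (rule sum_distrib_left[symmetric])
    finally show ?thesis ..
  next
    case False
    \<comment> \<open>Outside the partitions of n both sides are 0 because every coefficient
      function involved is supported there.\<close>
    have "conj lam \<notin> partitions n" if "partition lam" using that False by (simp add: partitions_iff sum_list_conj)
    then have "omega (delta' nu n (e_sf n)) lam = 0"
      unfolding delta'_HM[OF assms(2)] by (simp add: omega_def sc_def)
    moreover have "?I k = 0" for k
      by (rule sum.neutral) (use False Qp_sc in \<open>auto simp: sc_def\<close>)
    ultimately show ?thesis by (simp add: spec0_eq[OF spr_0])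
  qed
qed

end
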